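(* Let $b\in L^\infty(Q)$ and assume that for some constant $K>0$, $$|b(x,t)|\leq K\sqrt{a(x)}\quad\text{and}\quad |a_x(x)|\leq K\sqrt{a(x)}\qquad\text{for } (x,t)\in Q.$$ There exists a constant $\lambda_0>0$ such that for each $\lambda>\lambda_0$ there are constants $s_0(\lambda)>0$ and $C>0$ such that, with $\varphi(t)=e^{\lambda t}$, $$\begin{aligned} & \int_{Q} \frac{1}{s\varphi}\left(a(x)| (am)_{xx}|^2+a(x)| m_{t}|^2 \right)e^{2s\varphi}\,dx\, dt+\int_{Q} \lambda | (am)_{x}|^2 e^{2s\varphi}\, dx\, dt+\int_{Q} s\lambda^2 \varphi\, a(x)| m|^2 e^{2s\varphi}\, dx\,dt\\ &\leq C \int_{Q}a(x)| G|^2 e^{2s\varphi}\,dx\,dt +Cs\lambda \left(\varphi(T)\| m(\cdot,T)\|_{a}^2+\| (am)_{x}(\cdot,T)\|_{L^2(0,1)}^2\right)e^{2s\varphi(T)}\\ &\quad +C\left( s\lambda\| m(\cdot,0)\|_{a}^2 +\| (am)_{x}(\cdot,0)\|_{L^2(0,1)}^2\right)e^{2s} \end{aligned}$$ for all $s\geq s_0(\lambda)$ and all $m\in H^1(0,T;L^2_a(0,1))\cap L^2(0,T;H_{2,a}(0,1))$ satisfying $$m_t(x,t)-(a(x)m(x,t))_{xx}+b(x,t)m_x(x,t)=G(x,t)\ \text{ in }Q,\qquad am=0\ \text{ on }\Sigma.$$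
   Context: Let $T>0$, $Q=(0,1)\times(0,T)$, $\Sigma=\{0,1\}\times(0,T)$. The coefficient $a$ satisfies $a\in C([0,1])\cap C^1(0,1)$, $a(x)>0$ for $x\in(0,1)$ and $a(0)=a(1)=0$. All functions are real-valued. The constants $\lambda_0,s_0(\lambda),C$ do not depend on $m$ or $G$, and $C$ does not depend on $s$. Weighted spaces: $L^2_a(0,1)=\{u \text{ measurable}: \|u\|_a<\infty\}$ with $\|u\|_a^2=\int_0^1 a u^2\,dx$; $H_{1,a}(0,1)=\{u\in L^2_a(0,1): \int_0^1|(au)_x|^2dx<\infty,\ (au)(0)=(au)(1)=0\}$ with $\|u\|_{1,a}^2=\|u\|_a^2+\int_0^1|(au)_x|^2dx$; $H_{2,a}(0,1)=\{u\in H_{1,a}(0,1): (au)_{xx}\in L^2_a(0,1)\}$ with $\|u\|_{2,a}^2=\|u\|_{1,a}^2+\int_0^1 a|(au)_{xx}|^2dx$. *)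

theory Defs
  imports "HOL-Analysis.Analysis"
begin

text \<open>
  Elements of the function spaces are represented by functions, equality being equality almost
  everywhere for Lebesgue measure. Only the values in the open sets (0,1), (0,T), or Q matter.
\<close>

definition Q :: "real \<Rightarrow> (real \<times> real) set"
  where "Q T = {0<..<1} \<times> {0<..<T}"

definition Linfty :: "('a::euclidean_space) set \<Rightarrow> ('a \<Rightarrow> real) set"
  where "Linfty S = {f \<in> borel_measurable (lebesgue_on S).
                      \<exists>B. AE z in lebesgue_on S. \<bar>f z\<bar> \<le> B}"

subsection \<open>Weak derivatives on (0,1)\<close>

definition test_function :: "real \<Rightarrow> real \<Rightarrow> (real \<Rightarrow> real) \<Rightarrow> bool"
  where "test_function c d \<phi> \<longleftrightarrow>
           (\<forall>n. (deriv ^^ n) \<phi> differentiable_on UNIV) \<and>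
           (\<exists>K. compact K \<and> K \<subseteq> {c<..<d} \<and> (\<forall>x. x \<notin> K \<longrightarrow> \<phi> x = 0))"

definition locally_integrable :: "(real \<Rightarrow> real) \<Rightarrow> bool"
  where "locally_integrable f \<longleftrightarrow>
           (\<forall>K. compact K \<and> K \<subseteq> {0<..<1} \<longrightarrow> integrable (lebesgue_on K) f)"

definition has_weak_deriv :: "(real \<Rightarrow> real) \<Rightarrow> (real \<Rightarrow> real) \<Rightarrow> bool"
  where "has_weak_deriv f g \<longleftrightarrow>
           locally_integrable f \<and> locally_integrable g \<and>
           (\<forall>\<phi>. test_function 0 1 \<phi> \<longrightarrow>
              (LINT x|lebesgue_on {0<..<1}. f x * deriv \<phi> x) =
              - (LINT x|lebesgue_on {0<..<1}. g x * \<phi> x))"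

definition weakly_differentiable :: "(real \<Rightarrow> real) \<Rightarrow> bool"
  where "weakly_differentiable f \<longleftrightarrow> (\<exists>g. has_weak_deriv f g)"

text \<open>An arbitrary version of the weak derivative, which is unique almost everywhere.\<close>

definition wderiv :: "(real \<Rightarrow> real) \<Rightarrow> real \<Rightarrow> real"
  where "wderiv f = (SOME g. has_weak_deriv f g)"

text \<open>The boundary condition f(0) = f(1) = 0, for the continuous representative of f.\<close>

definition zero_at_ends :: "(real \<Rightarrow> real) \<Rightarrow> bool"
  where "zero_at_ends f \<longleftrightarrow>
           (\<exists>g. continuous_on {0..1} g \<and> (AE x in lebesgue_on {0<..<1}. f x = g x) \<and>
                g 0 = 0 \<and> g 1 = 0)"

subsection \<open>Weighted spaces on (0,1)\<close>

definition L2a :: "(real \<Rightarrow> real) \<Rightarrow> (real \<Rightarrow> real) set"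
  where "L2a a = {u \<in> borel_measurable (lebesgue_on {0<..<1}).
                   integrable (lebesgue_on {0<..<1}) (\<lambda>x. a x * (u x)\<^sup>2)}"

definition norm_a :: "(real \<Rightarrow> real) \<Rightarrow> (real \<Rightarrow> real) \<Rightarrow> real"
  where "norm_a a u = sqrt (LINT x|lebesgue_on {0<..<1}. a x * (u x)\<^sup>2)"

definition norm_L2 :: "(real \<Rightarrow> real) \<Rightarrow> real"
  where "norm_L2 u = sqrt (LINT x|lebesgue_on {0<..<1}. (u x)\<^sup>2)"

definition H1a :: "(real \<Rightarrow> real) \<Rightarrow> (real \<Rightarrow> real) set"
  where "H1a a = {u \<in> L2a a.
                   weakly_differentiable (\<lambda>x. a x * u x) \<and>
                   integrable (lebesgue_on {0<..<1}) (\<lambda>x. (wderiv (\<lambda>y. a y * u y) x)\<^sup>2) \<and>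
                   zero_at_ends (\<lambda>x. a x * u x)}"

definition norm_1a :: "(real \<Rightarrow> real) \<Rightarrow> (real \<Rightarrow> real) \<Rightarrow> real"
  where "norm_1a a u = sqrt ((norm_a a u)\<^sup>2 + (norm_L2 (wderiv (\<lambda>x. a x * u x)))\<^sup>2)"

definition H2a :: "(real \<Rightarrow> real) \<Rightarrow> (real \<Rightarrow> real) set"
  where "H2a a = {u \<in> H1a a.
                   weakly_differentiable (wderiv (\<lambda>x. a x * u x)) \<and>
                   wderiv (wderiv (\<lambda>x. a x * u x)) \<in> L2a a}"

definition norm_2a :: "(real \<Rightarrow> real) \<Rightarrow> (real \<Rightarrow> real) \<Rightarrow> real"
  where "norm_2a a u =
           sqrt ((norm_1a a u)\<^sup>2 + (norm_a a (wderiv (wderiv (\<lambda>x. a x * u x))))\<^sup>2)"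

subsection \<open>Bochner spaces over (0,T)\<close>

text \<open>Strong measurability with respect to a (semi)norm N on a space X of functions on (0,1):
  almost everywhere limit of simple functions.\<close>

definition strongly_measurable ::
  "real \<Rightarrow> (real \<Rightarrow> real) set \<Rightarrow> ((real \<Rightarrow> real) \<Rightarrow> real) \<Rightarrow> (real \<Rightarrow> real \<Rightarrow> real) \<Rightarrow> bool"
  where "strongly_measurable T X N u \<longleftrightarrow>
           (\<exists>s :: nat \<Rightarrow> real \<Rightarrow> real \<Rightarrow> real.
              (\<forall>n. finite (s n ` {0<..<T}) \<and> s n ` {0<..<T} \<subseteq> X \<and>
                   (\<forall>v. {t \<in> {0<..<T}. s n t = v} \<in> sets lebesgue)) \<and>
              (AE t in lebesgue_on {0<..<T}. (\<lambda>n. N (\<lambda>x. s n t x - u t x)) \<longlonglongrightarrow> 0))"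

text \<open>L2(0,T;X). A Bochner class is represented by a function u(x,t) that is jointly measurable
  on Q; for the spaces X used below every class has such a representative.\<close>

definition L2_time ::
  "real \<Rightarrow> (real \<Rightarrow> real) set \<Rightarrow> ((real \<Rightarrow> real) \<Rightarrow> real) \<Rightarrow> (real \<times> real \<Rightarrow> real) set"
  where "L2_time T X N = {u \<in> borel_measurable (lebesgue_on (Q T)).
           (AE t in lebesgue_on {0<..<T}. (\<lambda>x. u (x, t)) \<in> X) \<and>
           strongly_measurable T X N (\<lambda>t x. u (x, t)) \<and>
           integrable (lebesgue_on {0<..<T}) (\<lambda>t. (N (\<lambda>x. u (x, t)))\<^sup>2)}"

text \<open>The L2a-valued distributional derivative in time. The Bochner integrals in the identity
  are evaluated pointwise in x, as is legitimate for jointly measurable u and v.\<close>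

definition has_time_deriv ::
  "(real \<Rightarrow> real) \<Rightarrow> real \<Rightarrow> (real \<times> real \<Rightarrow> real) \<Rightarrow> (real \<times> real \<Rightarrow> real) \<Rightarrow> bool"
  where "has_time_deriv a T u v \<longleftrightarrow>
           u \<in> L2_time T (L2a a) (norm_a a) \<and> v \<in> L2_time T (L2a a) (norm_a a) \<and>
           (\<forall>\<phi>. test_function 0 T \<phi> \<longrightarrow>
              (AE x in lebesgue_on {0<..<1}.
                 (LINT t|lebesgue_on {0<..<T}. deriv \<phi> t * u (x, t)) =
                 - (LINT t|lebesgue_on {0<..<T}. \<phi> t * v (x, t))))"

definition H1_time_L2a :: "(real \<Rightarrow> real) \<Rightarrow> real \<Rightarrow> (real \<times> real \<Rightarrow> real) set"
  where "H1_time_L2a a T = {u. \<exists>v. has_time_deriv a T u v}"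

text \<open>f_x = g on Q, with g a jointly measurable version.\<close>

definition has_space_deriv :: "real \<Rightarrow> (real \<times> real \<Rightarrow> real) \<Rightarrow> (real \<times> real \<Rightarrow> real) \<Rightarrow> bool"
  where "has_space_deriv T f g \<longleftrightarrow>
           g \<in> borel_measurable (lebesgue_on (Q T)) \<and>
           (AE t in lebesgue_on {0<..<T}. has_weak_deriv (\<lambda>x. f (x, t)) (\<lambda>x. g (x, t)))"

text \<open>v = u(.,t0), read off from the representative of u in C([0,T];L2a). It exists and is unique
  up to almost everywhere equality for u in H1(0,T;L2a).\<close>

definition has_time_trace ::
  "(real \<Rightarrow> real) \<Rightarrow> real \<Rightarrow> (real \<times> real \<Rightarrow> real) \<Rightarrow> real \<Rightarrow> (real \<Rightarrow> real) \<Rightarrow> bool"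
  where "has_time_trace a T u t0 v \<longleftrightarrow>
           (\<exists>U :: real \<Rightarrow> real \<Rightarrow> real.
              (\<forall>t\<in>{0..T}. U t \<in> L2a a) \<and>
              (\<forall>t\<in>{0..T}. ((\<lambda>r. norm_a a (\<lambda>x. U r x - U t x)) \<longlongrightarrow> 0) (at t within {0..T})) \<and>
              (AE t in lebesgue_on {0<..<T}. AE x in lebesgue_on {0<..<1}. u (x, t) = U t x) \<and>
              t0 \<in> {0..T} \<and> v = U t0)"

end

theory Submission
  imports Defs
begin

text \<open>
  With P = s \<lambda> \<phi> and \<theta> = exp (2 s \<phi>), set A = (am)_xx and expand, in the weighted L2 space,
  the square of m_t - A = (m_t + P m) - (P m + A) with weight \<theta>. Integrating the cross terms by
  parts in time leaves \<lambda> P a m^2 with a good sign, up to boundary terms; testing the equation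
  with \<lambda> m then controls \<lambda> |(am)_x|^2. The first order term is absorbed for large \<lambda>,
  because a m_x = (am)_x - a_x m and |a_x| \<le> K sqrt a.

  The regularity of m only just justifies this. Almost every x carries an absolutely continuous
  m(x,.), which gives the identities for the norm of m. For D(t) = \<integral> |(am)_x|^2 one has
  D(t+h) - D(t) = - \<integral> a (m(t+h) - m(t)) (A(t+h) + A(t)), and continuity of translations in L2
  shows that D is absolutely continuous with D' = - 2 \<integral> a A m_t. Choosing r \<rightarrow> 0 with
  r \<integral> a |A(r)|^2 \<rightarrow> 0 makes (am)_x(r) a Cauchy family, so a m(0) is weakly differentiable
  and D(0) is the squared norm of its derivative. At time T only D \<ge> 0 is needed.
\<close>

subsection \<open>Primitives of integrable functions\<close>

text \<open>The weight is dictated by exact cancellation. As \<open>\<theta>\<close> has derivative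
  2 P \<theta>, integrating the cross term of m_t and P m in time produces the P^2 m^2 that the
  cross term of P m with itself takes away, and the terms P |(am)_x|^2 coming from (m_t, A) and from
  (P m, A) cancel as well. What survives is the derivative of P alone, and P' = \<lambda> P makes it
  positive.

  The obstacle is low regularity together with degeneracy. (am)_x(.,t) may be unbounded at x = 0 and
  x = 1, so boundary products are small only along sequences, and the identity for m_t has an
  exceptional null set of x for each test function. Everything is therefore moved to Borel functions
  that vanish outside \<open>Q T\<close>, on which Fubini and translations act over the whole plane,
  and derivatives in either variable become statements \<open>primitive_on S F f\<close>: on each
  compact interval inside S, F is absolutely continuous with density f. For open S, f need not be
  integrable up to the ends, which is the situation of (am)_xx.\<close>

definition primitive_on :: "real set \<Rightarrow> (real \<Rightarrow> real) \<Rightarrow> (real \<Rightarrow> real) \<Rightarrow> bool"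
  where "primitive_on S F f \<longleftrightarrow> (\<forall>x y. x \<le> y \<longrightarrow> {x..y} \<subseteq> S \<longrightarrow>
           set_integrable lborel {x..y} f \<and> F y - F x = (LINT z:{x..y}|lborel. f z))"

lemma primitive_onD:
  assumes "primitive_on S F f" "x \<le> y" "{x..y} \<subseteq> S"
  shows "set_integrable lborel {x..y} f" "F y - F x = (LINT z:{x..y}|lborel. f z)"
  using assms unfolding primitive_on_def by auto

lemma primitive_on_subset: "primitive_on S F f \<Longrightarrow> R \<subseteq> S \<Longrightarrow> primitive_on R F f"
  unfolding primitive_on_def by (meson order_trans)

lemma primitive_on_integral:
  assumes "set_integrable lborel {c..d} f"
  shows "primitive_on {c..d} (\<lambda>x. k + (LINT z:{c..x}|lborel. f z)) f"
  unfolding primitive_on_def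
proof (intro allI impI conjI)
  fix x y :: real assume xy: "x \<le> y" "{x..y} \<subseteq> {c..d}"
  then have cd: "c \<le> x" "y \<le> d" by auto
  show "set_integrable lborel {x..y} f"
    using assms by (rule set_integrable_subset) (use cd in auto)
  have i1: "set_integrable lborel {c..x} f" and i2: "set_integrable lborel {x..y} f"
    by (rule set_integrable_subset[OF assms]; use cd xy in auto)+
  have "(LINT z:{c..x} \<union> {x..y}|lborel. f z) = (LINT z:{c..x}|lborel. f z) + (LINT z:{x..y}|lborel. f z)"
  proof (rule set_integral_Un_AE)
    have "AE z in lborel. z \<noteq> x" by (rule AE_lborel_singleton)
    then show "AE z in lborel. \<not> (z \<in> {c..x} \<and> z \<in> {x..y})" by eventually_elim auto
  qed (use i1 i2 in auto)
  moreover have "{c..x} \<union> {x..y} = {c..y}" using cd xy by auto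
  ultimately show "k + (LINT z:{c..y}|lborel. f z) - (k + (LINT z:{c..x}|lborel. f z)) = (LINT z:{x..y}|lborel. f z)"
    by simp
qed

lemma primitive_on_continuous_Icc:
  assumes "primitive_on {c..d} F f"
  shows "continuous_on {c..d} F"
proof (cases "c \<le> d")
  case True
  have "set_integrable lborel {c..d} f" using primitive_onD[OF assms True] by auto
  then have L: "set_integrable lebesgue {c..d} f"
    by (simp add: set_integrable_def integrable_completion)
  then have "continuous_on {c..d} (\<lambda>x. integral {c..x} f)"
    by (intro indefinite_integral_continuous_1 set_lebesgue_integral_eq_integral(1))
  then have "continuous_on {c..d} (\<lambda>x. F c + integral {c..x} f)"
    by (intro continuous_intros)
  moreover have "F x = F c + integral {c..x} f" if "x \<in> {c..d}" for x
  proof -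
    have i: "set_integrable lborel {c..x} f" "F x - F c = (LINT z:{c..x}|lborel. f z)"
      using primitive_onD[OF assms, of c x] that by auto
    have "(LINT z:{c..x}|lborel. f z) = integral {c..x} f"
      using i(1) by (rule set_borel_integral_eq_integral)
    then show ?thesis using i by simp
  qed
  ultimately show ?thesis by (metis (no_types, lifting) continuous_on_cong)
qed auto

lemma primitive_on_continuous_Ioo:
  assumes "primitive_on {c<..<d} F f"
  shows "continuous_on {c<..<d} F"
proof (rule continuous_at_imp_continuous_on, rule ballI)
  fix x assume x: "x \<in> {c<..<d}"
  then obtain e where e: "e > 0" "{x-e..x+e} \<subseteq> {c<..<d}"
    by (intro that[of "min (x-c) (d-x) / 2"]) (auto simp: min_def field_simps split: if_splits)
  have "continuous_on {x-e..x+e} F"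
    by (rule primitive_on_continuous_Icc, rule primitive_on_subset[OF assms e(2)])
  then have "continuous_on {x-e<..<x+e} F" by (rule continuous_on_subset) auto
  then show "isCont F x" using e by (simp add: continuous_on_eq_continuous_at)
qed

lemma primitive_on_AE_eq:
  assumes "primitive_on S F f" "AE x in lborel. x \<in> S \<longrightarrow> f x = g x" "g \<in> borel_measurable borel"
  shows "primitive_on S F g"
  unfolding primitive_on_def
proof (intro allI impI conjI)
  fix x y :: real assume xy: "x \<le> y" "{x..y} \<subseteq> S"
  note d = primitive_onD[OF assms(1) xy]
  have ae: "AE z in lborel. indicator {x..y} z *\<^sub>R f z = indicator {x..y} z *\<^sub>R g z"
    using assms(2) by eventually_elim (use xy in \<open>auto simp: indicator_def\<close>)
  have m: "(\<lambda>z. indicator {x..y} z *\<^sub>R g z) \<in> borel_measurable lborel" using assms(3) by measurable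
  show "set_integrable lborel {x..y} g"
    using d(1) unfolding set_integrable_def
    by (rule integrable_cong_AE_imp[OF _ m]) (use ae in \<open>eventually_elim, simp\<close>)
  show "F y - F x = (LINT z:{x..y}|lborel. g z)"
    unfolding d(2) set_lebesgue_integral_def
    by (rule integral_cong_AE) (use ae m d(1) in \<open>auto simp: set_integrable_def\<close>)
qed

lemma set_integrable_mult_continuous:
  fixes f F :: "real \<Rightarrow> real"
  assumes "set_integrable lborel {x..y} f" "continuous_on {x..y} F"
  shows "set_integrable lborel {x..y} (\<lambda>z. F z * f z)"
proof -
  have "compact (F ` {x..y})" using assms(2) by (intro compact_continuous_image) auto
  then obtain B where B: "\<And>z. z \<in> {x..y} \<Longrightarrow> \<bar>F z\<bar> \<le> B"
    by (fastforce dest!: compact_imp_bounded simp: bounded_iff)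
  have m: "(\<lambda>z. indicator {x..y} z * F z) \<in> borel_measurable lborel"
    using borel_measurable_continuous_on_indicator[of "{x..y}" F] assms(2) by auto
  have "integrable lborel (\<lambda>z. B * (indicator {x..y} z * f z))"
    using assms(1) by (simp add: set_integrable_def)
  then show ?thesis unfolding set_integrable_def
  proof (rule Bochner_Integration.integrable_bound)
    have "(\<lambda>z. (indicator {x..y} z * F z) * (indicator {x..y} z * f z)) \<in> borel_measurable lborel"
      using borel_measurable_times[OF m borel_measurable_integrable[OF assms(1)[unfolded set_integrable_def]]] by simp
    also have "(\<lambda>z. (indicator {x..y} z * F z) * (indicator {x..y} z * f z)) = (\<lambda>z. indicator {x..y} z *\<^sub>R (F z * f z))"
      by (auto simp: indicator_def)
    finally show "(\<lambda>z. indicator {x..y} z *\<^sub>R (F z * f z)) \<in> borel_measurable lborel" .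
  qed (auto simp: indicator_def abs_mult intro!: AE_I2 mult_right_mono order_trans[OF B abs_ge_self])
qed

text \<open>Fubini over the square, split along its null diagonal.\<close>

lemma integral_square_split:
  fixes f g :: "real \<Rightarrow> real"
  assumes f: "set_integrable lborel {x..y} f" and g: "set_integrable lborel {x..y} g"
  shows "(LINT z:{x..y}|lborel. f z) * (LINT z:{x..y}|lborel. g z) =
    (LINT z:{x..y}|lborel. (LINT u:{x..z}|lborel. f u) * g z) +
    (LINT z:{x..y}|lborel. (LINT u:{x..z}|lborel. g u) * f z)"
proof -
  define f' where "f' = (\<lambda>z. indicator {x..y} z * f z)"
  define g' where "g' = (\<lambda>z. indicator {x..y} z * g z)"
  have fi: "integrable lborel f'" and gi: "integrable lborel g'"
    using f g by (auto simp: f'_def g'_def set_integrable_def)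
  have [measurable]: "f' \<in> borel_measurable borel" "g' \<in> borel_measurable borel" using fi gi by auto
  define L where "L = {p::real\<times>real. fst p \<le> snd p}"
  have [measurable]: "L \<in> sets (borel \<Otimes>\<^sub>M borel)" unfolding L_def
    unfolding borel_prod by (intro borel_closed closed_Collect_le continuous_intros)
  have prodi: "integrable (lborel \<Otimes>\<^sub>M lborel) (\<lambda>p. f' (fst p) * g' (snd p))"
    by (rule lborel_pair.Fubini_integrable) (use fi gi in \<open>auto simp: abs_mult\<close>)
  have i1: "integrable (lborel \<Otimes>\<^sub>M lborel) (\<lambda>p. indicator L p * (f' (fst p) * g' (snd p)))"
    using prodi by (rule Bochner_Integration.integrable_bound) (auto simp: indicator_def)
  have i2: "integrable (lborel \<Otimes>\<^sub>M lborel) (\<lambda>p. indicator (-L) p * (f' (fst p) * g' (snd p)))"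
    using prodi by (rule Bochner_Integration.integrable_bound) (auto simp: indicator_def)
  have inner1: "(LINT u|lborel. indicator L (u, z) * (f' u * g' z)) = indicator {x..y} z * ((LINT u:{x..z}|lborel. f u) * g z)" for z
  proof -
    have "(LINT u|lborel. indicator L (u, z) * (f' u * g' z)) = (LINT u|lborel. (indicator {x..z} u * f u) * g' z)"
      by (rule Bochner_Integration.integral_cong) (auto simp: L_def f'_def g'_def indicator_def)
    also have "\<dots> = (LINT u|lborel. indicator {x..z} u * f u) * g' z" by (rule integral_mult_left_zero)
    finally show ?thesis by (auto simp: g'_def indicator_def set_lebesgue_integral_def)
  qed
  have inner2: "(LINT z|lborel. indicator (-L) (u, z) * (f' u * g' z)) = indicator {x..y} u * ((LINT z:{x..u}|lborel. g z) * f u)" for u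
  proof -
    have "(LINT z|lborel. indicator (-L) (u, z) * (f' u * g' z)) = (LINT z|lborel. (indicator {x..<u} z * g z) * f' u)"
      by (rule Bochner_Integration.integral_cong) (auto simp: L_def f'_def g'_def indicator_def)
    also have "\<dots> = (LINT z|lborel. indicator {x..<u} z * g z) * f' u" by (rule integral_mult_left_zero)
    also have "\<dots> = (LINT z:{x..u}|lborel. g z) * f' u"
    proof (cases "u \<in> {x..y}")
      case True
      have "AE z in lborel. z \<noteq> u" by (rule AE_lborel_singleton)
      then have ae: "AE z in lborel. indicator {x..<u} z * g' z = indicator {x..u} z * g' z"
        by eventually_elim (auto simp: indicator_def)
      have "(LINT z|lborel. indicator {x..<u} z * g' z) = (LINT z|lborel. indicator {x..u} z * g' z)"
        using ae by (intro integral_cong_AE) auto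
      moreover have "indicator {x..<u} z * g' z = indicator {x..<u} z * g z" "indicator {x..u} z * g' z = indicator {x..u} z * g z" for z
        using True by (auto simp: g'_def indicator_def)
      ultimately show ?thesis by (simp add: set_lebesgue_integral_def)
    qed (simp add: f'_def)
    finally show ?thesis by (simp add: f'_def mult_ac)
  qed
  have "(LINT z:{x..y}|lborel. f z) * (LINT z:{x..y}|lborel. g z) = (LINT u|lborel. f' u) * (LINT z|lborel. g' z)"
    by (simp add: f'_def g'_def set_lebesgue_integral_def)
  also have "\<dots> = (LINT p|(lborel \<Otimes>\<^sub>M lborel). f' (fst p) * g' (snd p))"
    using lborel_pair.integral_fst'[OF prodi] by simp
  also have "\<dots> = (LINT p|(lborel \<Otimes>\<^sub>M lborel). indicator L p * (f' (fst p) * g' (snd p)) + indicator (-L) p * (f' (fst p) * g' (snd p)))"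
    by (rule Bochner_Integration.integral_cong) (auto simp: indicator_def)
  also have "\<dots> = (LINT p|(lborel \<Otimes>\<^sub>M lborel). indicator L p * (f' (fst p) * g' (snd p))) + (LINT p|(lborel \<Otimes>\<^sub>M lborel). indicator (-L) p * (f' (fst p) * g' (snd p)))"
    using i1 i2 by (rule Bochner_Integration.integral_add)
  also have "(LINT p|(lborel \<Otimes>\<^sub>M lborel). indicator L p * (f' (fst p) * g' (snd p))) = (LINT z:{x..y}|lborel. (LINT u:{x..z}|lborel. f u) * g z)"
  proof -
    have e: "(\<lambda>p. indicator L p * (f' (fst p) * g' (snd p))) = (\<lambda>(u, z). indicator L (u, z) * (f' u * g' z))" by auto
    show ?thesis
      using lborel_pair.integral_snd[OF i1[unfolded e]] unfolding e by (simp add: inner1 set_lebesgue_integral_def)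
  qed
  also have "(LINT p|(lborel \<Otimes>\<^sub>M lborel). indicator (-L) p * (f' (fst p) * g' (snd p))) = (LINT z:{x..y}|lborel. (LINT u:{x..z}|lborel. g u) * f z)"
    using lborel_pair.integral_fst'[OF i2] by (simp add: inner2 set_lebesgue_integral_def)
  finally show ?thesis .
qed

text \<open>\<open>integral_square_split\<close> writes the product of the two increments as a sum
  of iterated integrals. Their inner integrals are \<open>F z - F x\<close> and
  \<open>G z - G x\<close>, and multiplying out leaves the product rule for absolutely continuous
  functions.\<close>

lemma primitive_on_mult:
  assumes F: "primitive_on S F f" and G: "primitive_on S G g"
  shows "primitive_on S (\<lambda>x. F x * G x) (\<lambda>x. F x * g x + G x * f x)"
  unfolding primitive_on_def
proof (intro allI impI)
  fix x y :: real assume xy: "x \<le> y" "{x..y} \<subseteq> S"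
  note f = primitive_onD[OF F xy] and g = primitive_onD[OF G xy]
  have cF: "continuous_on {x..y} F" and cG: "continuous_on {x..y} G"
    using primitive_on_subset[OF F xy(2)] primitive_on_subset[OF G xy(2)]
    by (auto intro: primitive_on_continuous_Icc)
  have iFg: "set_integrable lborel {x..y} (\<lambda>z. F z * g z)" and iGf: "set_integrable lborel {x..y} (\<lambda>z. G z * f z)"
    using cF cG f(1) g(1) by (auto intro: set_integrable_mult_continuous)
  have If: "(LINT u:{x..z}|lborel. f u) = F z - F x" and Ig: "(LINT u:{x..z}|lborel. g u) = G z - G x" if "z \<in> {x..y}" for z
  proof -
    have "x \<le> z" "{x..z} \<subseteq> S" using that xy(2) by auto
    then show "(LINT u:{x..z}|lborel. f u) = F z - F x" "(LINT u:{x..z}|lborel. g u) = G z - G x"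
      using primitive_onD(2)[OF F, of x z] primitive_onD(2)[OF G, of x z] by auto
  qed
  have "(F y - F x) * (G y - G x) =
     (LINT z:{x..y}|lborel. (LINT u:{x..z}|lborel. f u) * g z) +
     (LINT z:{x..y}|lborel. (LINT u:{x..z}|lborel. g u) * f z)"
    unfolding f(2) g(2) by (rule integral_square_split) fact+
  also have "(LINT z:{x..y}|lborel. (LINT u:{x..z}|lborel. f u) * g z) = (LINT z:{x..y}|lborel. F z * g z - F x * g z)"
    by (rule set_lebesgue_integral_cong) (auto simp: If algebra_simps)
  also have "\<dots> = (LINT z:{x..y}|lborel. F z * g z) - F x * (G y - G x)"
    using iFg g by (simp add: set_integral_diff)
  also have "(LINT z:{x..y}|lborel. (LINT u:{x..z}|lborel. g u) * f z) = (LINT z:{x..y}|lborel. G z * f z - G x * f z)"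
    by (rule set_lebesgue_integral_cong) (auto simp: Ig algebra_simps)
  also have "\<dots> = (LINT z:{x..y}|lborel. G z * f z) - G x * (F y - F x)"
    using iGf f by (simp add: set_integral_diff)
  finally show "set_integrable lborel {x..y} (\<lambda>x. F x * g x + G x * f x) \<and>
      F y * G y - F x * G x = (LINT z:{x..y}|lborel. F z * g z + G z * f z)"
    using iFg iGf by (auto simp: set_integral_add algebra_simps)
qed

lemma primitive_on_C1:
  fixes F f :: "real \<Rightarrow> real"
  assumes "\<And>x. x \<in> S \<Longrightarrow> (F has_real_derivative f x) (at x within S)" "continuous_on S f"
  shows "primitive_on S F f"
  unfolding primitive_on_def
proof (intro allI impI conjI)
  fix x y :: real assume xy: "x \<le> y" "{x..y} \<subseteq> S"
  have c: "continuous_on {x..y} f" using assms(2) xy(2) by (rule continuous_on_subset)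
  show i: "set_integrable lborel {x..y} f" using c by (rule borel_integrable_atLeastAtMost')
  have "(LINT z:{x..y}|lborel. f z) = F y - F x"
    unfolding set_lebesgue_integral_def using xy(1)
  proof (rule integral_FTC_atLeastAtMost)
    fix z assume "x \<le> z" "z \<le> y"
    then show "(F has_vector_derivative f z) (at z within {x..y})"
      using assms(1)[of z] xy(2) has_vector_derivative_within_subset[of F "f z" z S "{x..y}"]
      by (auto simp: has_real_derivative_iff_has_vector_derivative)
  qed (use c in auto)
  then show "F y - F x = (LINT z:{x..y}|lborel. f z)" by simp
qed

text \<open>The set of disagreement is open and has measure zero, hence is empty.\<close>

lemma AE_eq_continuous_Ioo:
  fixes f g :: "real \<Rightarrow> real"
  assumes "continuous_on {c<..<d} f" "continuous_on {c<..<d} g"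
    and ae: "AE x in lborel. x \<in> {c<..<d} \<longrightarrow> f x = g x"
  shows "\<forall>x\<in>{c<..<d}. f x = g x"
proof (rule ccontr)
  assume "\<not> ?thesis"
  then obtain x where x: "x \<in> {c<..<d}" "f x \<noteq> g x" by auto
  define U where "U = {c<..<d} \<inter> (\<lambda>x. f x - g x) -` (- {0})"
  have "open U" unfolding U_def
    by (rule continuous_open_preimage) (use assms in \<open>auto intro: continuous_intros\<close>)
  moreover have "x \<in> U" using x by (auto simp: U_def)
  moreover have "AE x in lborel. x \<notin> U" using ae by eventually_elim (auto simp: U_def)
  then have "emeasure lborel U = 0" using \<open>open U\<close>
    by (subst (asm) AE_iff_measurable[of U]) auto
  then have "negligible U" using \<open>open U\<close>
    by (simp add: negligible_iff_null_sets null_sets_def)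
  ultimately show False using open_not_negligible by blast
qed

text \<open>Chebyshev's inequality, with a slack that makes it hold even if the integral vanishes.\<close>

lemma exists_le_average:
  fixes f :: "real \<Rightarrow> real"
  assumes cd: "c < d" and f: "set_integrable lborel {c..d} f" and P: "AE x in lborel. x \<in> {c<..<d} \<longrightarrow> P x"
  shows "\<exists>x\<in>{c<..<d}. P x \<and> (d - c) * f x \<le> (LINT x:{c..d}|lborel. f x) + (d - c)"
proof (rule ccontr)
  let ?J = "LINT x:{c..d}|lborel. f x"
  assume n: "\<not> ?thesis"
  have "AE x in lborel. x \<in> {c<..<d}  \<longrightarrow> (?J + (d - c)) / (d - c) \<le> f x"
    using P by eventually_elim (use n cd in \<open>auto simp: field_simps not_le intro: less_imp_le\<close>)
  moreover have "AE z in lborel. z \<noteq> c" "AE z in lborel. z \<noteq> d" by (rule AE_lborel_singleton)+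
  ultimately have "AE x in lborel. x \<in> {c..d} \<longrightarrow> (?J + (d - c)) / (d - c) \<le> f x"
    by eventually_elim auto
  then have "(LINT x:{c..d}|lborel. (?J + (d - c)) / (d - c)) \<le> ?J"
    by (intro set_integral_mono_AE f) (auto intro!: borel_integrable_atLeastAtMost')
  moreover have "(LINT x:{c..d}|lborel. (?J + (d - c)) / (d - c)) = ?J + (d - c)"
    using cd by (simp add: set_lebesgue_integral_def)
  ultimately show False using cd by simp
qed

subsection \<open>Integration by parts with vanishing boundary values\<close>

lemma set_integral_singleton: "(LINT z:{c}|lborel. f z) = (0::real)" for c :: real
proof -
  have "AE z in lborel. z \<noteq> c" by (rule AE_lborel_singleton)
  then have "AE z in lborel. indicator {c} z *\<^sub>R f z = 0" by eventually_elim auto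
  then show ?thesis unfolding set_lebesgue_integral_def by (rule integral_eq_zero_AE)
qed

lemma set_integrable_L2_L1:
  fixes f :: "real \<Rightarrow> real"
  assumes "set_integrable lborel {c..d} (\<lambda>x. (f x)^2)" "f \<in> borel_measurable borel"
  shows "set_integrable lborel {c..d} f"
proof -
  have "integrable lborel (\<lambda>x. indicator {c..d} x *\<^sub>R (f x)^2 + indicator {c..d} x)"
    using assms(1) unfolding set_integrable_def
    by (intro Bochner_Integration.integrable_add integrable_real_indicator) (auto simp: emeasure_lborel_Icc_eq)
  then show ?thesis unfolding set_integrable_def
  proof (rule Bochner_Integration.integrable_bound)
    have "\<bar>y\<bar> \<le> y^2 + 1" for y :: real
      using zero_le_power2[of "\<bar>y\<bar> - 1"] by (simp add: power2_diff)
    then show "AE x in lborel. norm (indicator {c..d} x *\<^sub>R f x) \<le> norm (indicator {c..d} x *\<^sub>R (f x)^2 + indicator {c..d} x)"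
      by (auto simp: indicator_def)
  qed (use assms(2) in auto)
qed

text \<open>The discriminant argument: the integral of (f + t g)^2 is a nonnegative quadratic in t,
  evaluated at its minimum t = - b / c, or, if c = 0, a nonnegative affine function, which must be
  constant.\<close>

lemma integral_Cauchy_Schwarz:
  fixes f g :: "'a \<Rightarrow> real"
  assumes f: "integrable M (\<lambda>x. (f x)^2)" and g: "integrable M (\<lambda>x. (g x)^2)"
    and m: "f \<in> borel_measurable M" "g \<in> borel_measurable M"
  shows "integrable M (\<lambda>x. f x * g x)"
    and "(LINT x|M. f x * g x)^2 \<le> (LINT x|M. (f x)^2) * (LINT x|M. (g x)^2)"
proof -
  have s: "integrable M (\<lambda>x. (f x)^2 + (g x)^2)" using f g by (rule Bochner_Integration.integrable_add)
  have b: "\<bar>u * v\<bar> \<le> u^2 + v^2" for u v :: real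
  proof -
    have "2 * \<bar>u\<bar> * \<bar>v\<bar> \<le> \<bar>u\<bar>^2 + \<bar>v\<bar>^2" using sum_squares_bound[of "\<bar>u\<bar>" "\<bar>v\<bar>"] by simp
    then show ?thesis by (simp add: abs_mult) (use abs_ge_zero[of u] abs_ge_zero[of v] mult_nonneg_nonneg[of "\<bar>u\<bar>" "\<bar>v\<bar>"] in linarith)
  qed
  show i: "integrable M (\<lambda>x. f x * g x)"
    by (rule Bochner_Integration.integrable_bound[OF s]) (use m b in \<open>auto simp: abs_mult\<close>)
  define a b c where "a = (LINT x|M. (f x)^2)" and "b = (LINT x|M. f x * g x)" and "c = (LINT x|M. (g x)^2)"
  have q: "0 \<le> a + 2 * t * b + t^2 * c" for t
  proof -
    have "0 \<le> (LINT x|M. (f x + t * g x)^2)" by simp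
    also have "\<dots> = (LINT x|M. (f x)^2 + 2 * t * (f x * g x) + t^2 * (g x)^2)"
      by (rule Bochner_Integration.integral_cong) (auto simp: power2_eq_square algebra_simps)
    also have "\<dots> = a + 2 * t * b + t^2 * c"
      using f g i by (simp add: a_def b_def c_def)
    finally show ?thesis .
  qed
  have c0: "c \<ge> 0" "a \<ge> 0" by (auto simp: c_def a_def)
  have "b^2 \<le> a * c"
  proof (cases "c = 0")
    case True
    have "b = 0"
    proof (rule ccontr)
      assume "b \<noteq> 0"
      \<comment> \<open>At this t the affine function a + 2 t b takes the value -1.\<close>
      then show False using q[of "- (a + 1) / (2 * b)"] True by (simp add: field_simps)
    qed
    then show ?thesis using True by simp
  next
    case False
    then show ?thesis using q[of "- b / c"] c0 by (simp add: field_simps power2_eq_square)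
  qed
  then show "(LINT x|M. f x * g x)^2 \<le> (LINT x|M. (f x)^2) * (LINT x|M. (g x)^2)"
    by (simp add: a_def b_def c_def)
qed

lemma set_integral_sq_le:
  fixes f :: "real \<Rightarrow> real"
  assumes "set_integrable lborel {c..d} (\<lambda>x. (f x)^2)" "f \<in> borel_measurable borel" "c \<le> d"
  shows "(LINT x:{c..d}|lborel. f x)^2 \<le> (d - c) * (LINT x:{c..d}|lborel. (f x)^2)"
proof -
  have e: "(indicator {c..d} x * f x)^2 = indicator {c..d} x * (f x)^2" "(indicator {c..d} x)^2 = (indicator {c..d} x :: real)" for x
    by (auto simp: indicator_def)
  have "(LINT x|lborel. indicator {c..d} x * (indicator {c..d} x * f x))^2 \<le> (d - c) * (LINT x|lborel. indicator {c..d} x * (f x)^2)"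
    using integral_Cauchy_Schwarz(2)[of lborel "indicator {c..d}" "\<lambda>x. indicator {c..d} x * f x"] assms
    by (simp add: e set_integrable_def)
  moreover have "indicator {c..d} x * (indicator {c..d} x * f x) = indicator {c..d} x * f x" for x by (auto simp: indicator_def)
  ultimately show ?thesis by (simp add: set_lebesgue_integral_def)
qed

text \<open>Turns a statement about the left end of an interval into one about the right end. The
  outer minus sign keeps the density \<open>f (- x)\<close> free of a sign.\<close>

lemma primitive_on_reflect:
  assumes "primitive_on {c..d} F f"
  shows "primitive_on {-d..-c} (\<lambda>x. - F (- x)) (\<lambda>x. f (- x))"
  unfolding primitive_on_def
proof (intro allI impI)
  fix x y :: real assume xy: "x \<le> y" "{x..y} \<subseteq> {-d..-c}"
  then have *: "-y \<le> -x" "{-y..-x} \<subseteq> {c..d}" by auto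
  note p = primitive_onD[OF assms *]
  have e: "indicator {-y..-x} (- z) = (indicator {x..y} z :: real)" for z by (auto simp: indicator_def)
  have "integrable lborel (\<lambda>z. indicator {-y..-x} (- z) * f (- z))"
    using lborel_integrable_real_affine[OF p(1)[unfolded set_integrable_def], of "-1" 0] by simp
  moreover have "(LINT z|lborel. indicator {-y..-x} z * f z) = (LINT z|lborel. indicator {-y..-x} (- z) * f (- z))"
    using lborel_integral_real_affine[of "-1" "\<lambda>z. indicator {-y..-x} z * f z" 0] by simp
  ultimately show "set_integrable lborel {x..y} (\<lambda>x. f (- x)) \<and> - F (- y) - - F (- x) = (LINT z:{x..y}|lborel. f (- z))"
    using p(2) by (simp add: set_integrable_def set_lebesgue_integral_def e)
qed

text \<open>Here the boundary term P W is only known to be small along a sequence, which is where the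
  square integrability of P = W' enters: W^2 is o(x), and x P^2 gets small.\<close>

lemma boundary_term_small:
  fixes W P p q :: "real \<Rightarrow> real"
  assumes W: "primitive_on {c..d} W p" "W c = 0" and cd: "c < d"
    and p: "set_integrable lborel {c..d} (\<lambda>x. (p x)^2)" "p \<in> borel_measurable borel"
    and q: "set_integrable lborel {c..d} (\<lambda>x. (q x)^2)" 
    and P: "AE x in lborel. x \<in> {c<..<d} \<longrightarrow> P x = q x" and e: "e > 0"
  shows "\<exists>x\<in>{c<..<d}. x < c + e \<and> \<bar>W x * P x\<bar> \<le> e"
proof -
  let ?A = "LINT x:{c..d}|lborel. (p x)^2" and ?B = "LINT x:{c..d}|lborel. (q x)^2"
  have mono: "(LINT x:{a..b}|lborel. (f x)^2) \<le> (LINT x:{c..d}|lborel. (f x)^2)"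
    if "set_integrable lborel {c..d} (\<lambda>x. (f x)^2)" "c \<le> a" "b \<le> d" for f :: "real \<Rightarrow> real" and a b
    unfolding set_lebesgue_integral_def
    by (rule Bochner_Integration.integral_mono)
      (use that set_integrable_subset[OF that(1), of "{a..b}"] in \<open>auto simp: set_integrable_def indicator_def\<close>)
  have A0: "?A \<ge> 0" by (simp add: set_lebesgue_integral_def)
  have lim: "((\<lambda>x. LINT z:{c..x}|lborel. (q z)^2) \<longlongrightarrow> 0) (at c within {c..d})"
  proof -
    have "continuous_on {c..d} (\<lambda>x. 0 + (LINT z:{c..x}|lborel. (q z)^2))"
      by (rule primitive_on_continuous_Icc[OF primitive_on_integral[OF q]])
    then have "((\<lambda>x. 0 + (LINT z:{c..x}|lborel. (q z)^2)) \<longlongrightarrow> 0 + (LINT z:{c..c}|lborel. (q z)^2)) (at c within {c..d})"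
      unfolding continuous_on_def by (rule bspec) (use cd in auto)
    then show ?thesis by (simp add: set_integral_singleton)
  qed
  \<comment> \<open>Chosen so that the last estimate closes as (\<open>?A\<close> + 1) * 2 h = e^2,
    where W^2 \<le> (x - c) \<open>?A\<close> and (x - c) q^2 \<le> 2 h. The summand 1 covers the
    case \<open>?A\<close> = 0.\<close>
  define h where "h = e^2 / (2 * (?A + 1))"
  have h: "h > 0" using e A0 by (simp add: h_def)
  obtain \<delta> where \<delta>: "\<delta> > 0" "\<And>x. x \<in> {c..d} \<Longrightarrow> x \<noteq> c \<Longrightarrow> dist x c < \<delta> \<Longrightarrow> (LINT z:{c..x}|lborel. (q z)^2) < h / 2"
    using lim h unfolding tendsto_iff eventually_at
    by (metis (no_types, lifting) abs_less_iff diff_zero dist_real_def half_gt_zero)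
  \<comment> \<open>The point is sought in the window from c + \<eta>/2 to c + \<eta>. Its length is
    comparable to its distance from c, so a bound for the average of q^2 over it is a bound for (x -
    c) q^2 at some point.\<close>
  define \<eta> where "\<eta> = min (min (h / 2) (\<delta> / 2)) (min (e / 2) ((d - c) / 2))"
  have \<eta>: "\<eta> > 0" "\<eta> \<le> h / 2" "\<eta> \<le> \<delta> / 2" "\<eta> \<le> e / 2" "\<eta> \<le> (d - c) / 2" using h \<delta> e cd by (simp_all only: \<eta>_def min_less_iff_conj) (auto simp: min_le_iff_disj)
  have sq: "set_integrable lborel {c+\<eta>/2..c+\<eta>} (\<lambda>x. (q x)^2)"
    using q by (rule set_integrable_subset) (use \<eta> in auto)
  have "\<exists>x\<in>{c+\<eta>/2<..<c+\<eta>}. P x = q x \<and> (c + \<eta> - (c + \<eta>/2)) * (q x)^2 \<le> (LINT x:{c+\<eta>/2..c+\<eta>}|lborel. (q x)^2) + (c + \<eta> - (c+\<eta>/2))"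
    by (rule exists_le_average) (use \<eta> sq P in \<open>auto elim!: eventually_mono\<close>)
  then obtain x where x: "c+\<eta>/2 < x" "x < c+\<eta>" "P x = q x" and qx: "\<eta>/2 * (q x)^2 \<le> (LINT x:{c+\<eta>/2..c+\<eta>}|lborel. (q x)^2) + \<eta>/2" by auto
  have "(LINT x:{c+\<eta>/2..c+\<eta>}|lborel. (q x)^2) \<le> (LINT x:{c..c+\<eta>}|lborel. (q x)^2)"
    unfolding set_lebesgue_integral_def
    by (rule Bochner_Integration.integral_mono)
      (use sq \<eta> set_integrable_subset[OF q, of "{c..c+\<eta>}"] in \<open>auto simp: set_integrable_def indicator_def\<close>)
  also have "\<dots> < h / 2" using \<delta>(2)[of "c+\<eta>"] \<eta> \<delta> by (auto simp: dist_real_def)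
  finally have "\<eta> * (q x)^2 \<le> 2 * h" using qx \<eta> by linarith
  moreover have "(x - c) * (q x)^2 \<le> \<eta> * (q x)^2" using x by (intro mult_right_mono) auto
  ultimately have q2: "(x - c) * (q x)^2 \<le> 2 * h" by linarith
  have Wx: "W x = (LINT z:{c..x}|lborel. p z)" using primitive_onD(2)[OF W(1), of c x] x \<eta> W(2) by auto
  have "(W x)^2 \<le> (x - c) * (LINT z:{c..x}|lborel. (p z)^2)"
    unfolding Wx by (rule set_integral_sq_le) (use p x \<eta> set_integrable_subset[OF p(1), of "{c..x}"] in auto)
  also have "\<dots> \<le> (x - c) * ?A" by (intro mult_left_mono mono p) (use x \<eta> in auto)
  finally have "(W x)^2 * (P x)^2 \<le> (x - c) * ?A * (q x)^2" by (intro mult_mono) (use x \<eta> A0 in auto)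
  also have "\<dots> = ?A * ((x - c) * (q x)^2)" by simp
  also have "\<dots> \<le> (?A + 1) * (2 * h)" by (intro mult_mono q2) (use A0 x \<eta> in auto)
  also have "\<dots> = e^2" using A0 by (simp add: h_def field_simps)
  finally have "(W x * P x)^2 \<le> e^2" by (simp add: power_mult_distrib)
  then have "\<bar>W x * P x\<bar> \<le> e" using e by (metis abs_le_square_iff abs_of_pos)
  then show ?thesis using x \<eta> by (intro bexI[of _ x]) auto
qed

text \<open>W vanishes at both ends, but P lives only on the open interval and may be unbounded
  there. The product rule is applied on compact subintervals; since W A and p q are integrable up to
  the ends, the integral over such a subinterval converges, and \<open>boundary_term_small\<close>
  supplies end points at which W P is small.\<close>

lemma integral_by_parts_zero_boundary:
  fixes W P p q A :: "real \<Rightarrow> real"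
  assumes W: "primitive_on {0..1} W p" "W 0 = 0" "W 1 = 0"
    and p: "set_integrable lborel {0..1} (\<lambda>x. (p x)^2)" "p \<in> borel_measurable borel"
    and q: "set_integrable lborel {0..1} (\<lambda>x. (q x)^2)" "q \<in> borel_measurable borel"
    and P: "primitive_on {0<..<1} P A" "AE x in lborel. x \<in> {0<..<1} \<longrightarrow> P x = q x"
    and WA: "set_integrable lborel {0..1} (\<lambda>x. W x * A x)"
  shows "(LINT x:{0..1}|lborel. W x * A x) = - (LINT x:{0..1}|lborel. p x * q x)"
proof -
  have pq: "set_integrable lborel {0..1} (\<lambda>x. p x * q x)"
  proof -
    have e: "(indicator {0..1} x * f x)^2 = indicator {0..1} x * (f x)^2" for x and f :: "real \<Rightarrow> real"
      by (auto simp: indicator_def)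
    have "integrable lborel (\<lambda>x. (indicator {0..1} x * p x) * (indicator {0..1} x * q x))"
      by (rule integral_Cauchy_Schwarz) (use p q in \<open>auto simp: e set_integrable_def\<close>)
    moreover have "(indicator {0..1} x * p x) * (indicator {0..1} x * q x) = indicator {0..1} x * (p x * q x)" for x
      by (auto simp: indicator_def)
    ultimately show ?thesis by (simp add: set_integrable_def)
  qed
  define h where "h = (\<lambda>x. W x * A x + q x * p x)"
  have h: "set_integrable lborel {0..1} h" unfolding h_def
    using WA pq by (intro set_integral_add) (simp_all add: mult.commute)
  have HP: "primitive_on {0<..<1} (\<lambda>x. W x * P x) (\<lambda>x. W x * A x + P x * p x)"
    by (rule primitive_on_mult[OF primitive_on_subset[OF W(1)] P(1)]) auto
  have hm: "(\<lambda>x. indicator {0..1} x * h x) \<in> borel_measurable borel" using h by (simp add: set_integrable_def borel_measurable_integrable)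
  have "primitive_on {0<..<1} (\<lambda>x. W x * P x) (\<lambda>x. indicator {0..1} x * h x)"
    by (rule primitive_on_AE_eq[OF HP _ hm]) (use P(2) in \<open>eventually_elim, auto simp: h_def\<close>)
  then have H: "W y * P y - W x * P x = (LINT z:{x..y}|lborel. h z)" if "0 < x" "x \<le> y" "y < 1" for x y
    using primitive_onD(2)[of _ "\<lambda>x. W x * P x" _ x y] that
    by (fastforce simp: set_lebesgue_integral_def indicator_def intro!: Bochner_Integration.integral_cong)
  let ?I = "LINT z:{0..1}|lborel. h z"
  have G: "primitive_on {0..1} (\<lambda>x. 0 + (LINT z:{0..x}|lborel. h z)) h" by (rule primitive_on_integral[OF h])
  let ?G = "\<lambda>x. LINT z:{0..x}|lborel. h z"
  have Gc: "continuous_on {0..1} ?G" using primitive_on_continuous_Icc[OF G] by simp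
  have G0: "?G 0 = 0" by (simp add: set_integral_singleton)
  have "?I = 0"
  proof (rule ccontr)
    assume n: "?I \<noteq> 0"
    \<comment> \<open>Two errors from the continuity of \<open>?G\<close> and two boundary terms,
      each at most e, fall short of the 5 e that \<open>?I\<close> would have to be.\<close>
    define e where "e = \<bar>?I\<bar> / 5"
    have e: "e > 0" using n by (simp add: e_def)
    from Gc e obtain d0 where d0: "d0 > 0" "\<And>x. x \<in> {0..1} \<Longrightarrow> dist x 0 < d0 \<Longrightarrow> dist (?G x) (?G 0) < e"
      unfolding continuous_on_iff by (metis atLeastAtMost_iff order_refl zero_le_one)
    from Gc e obtain d1 where d1: "d1 > 0" "\<And>x. x \<in> {0..1} \<Longrightarrow> dist x 1 < d1 \<Longrightarrow> dist (?G x) (?G 1) < e"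
      unfolding continuous_on_iff by (metis atLeastAtMost_iff order_refl zero_le_one)
    define \<epsilon> where "\<epsilon> = min e (min (1/2) (min d0 d1))"
    have \<epsilon>: "\<epsilon> > 0" "\<epsilon> \<le> e" "\<epsilon> \<le> 1/2" "\<epsilon> \<le> d0" "\<epsilon> \<le> d1" using e d0 d1 by (auto simp: \<epsilon>_def)
    obtain x where x: "x \<in> {0<..<1}" "x < \<epsilon>" "\<bar>W x * P x\<bar> \<le> \<epsilon>"
      using boundary_term_small[OF W(1,2) _ p q(1) P(2) \<epsilon>(1)] by auto
    \<comment> \<open>The reflection x to - x carries the end 1 to the left end -1, where
      \<open>boundary_term_small\<close> applies again.\<close>
    have rW: "primitive_on {-1..0} (\<lambda>x. - W (- x)) (\<lambda>x. p (- x))"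
      using primitive_on_reflect[OF W(1)] by simp
    have ri: "set_integrable lborel {-1..0} (\<lambda>x. (f (- x))^2)" if "set_integrable lborel {0..1} (\<lambda>x. (f x)^2)" for f :: "real \<Rightarrow> real"
    proof -
      have "indicator {0..1} (- z) = (indicator {-1..0} z :: real)" for z :: real by (auto simp: indicator_def)
      then show ?thesis
        using lborel_integrable_real_affine[OF that[unfolded set_integrable_def], of "-1" 0]
        by (simp add: set_integrable_def)
    qed
    have rP: "AE x in lborel. x \<in> {-1<..<0} \<longrightarrow> P (- x) = q (- x)"
    proof -
      have "AE x in distr lborel borel uminus. x \<in> {0<..<1} \<longrightarrow> P x = q x"
        unfolding lborel_distr_uminus by (rule P(2))
      then have "AE x in lborel. - x \<in> {0<..<1} \<longrightarrow> P (- x) = q (- x)" by (rule AE_distrD[rotated]) auto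
      then show ?thesis by eventually_elim auto
    qed
    obtain y' where y': "y' \<in> {-1<..<0}" "y' < -1 + \<epsilon>" "\<bar>- W (- y') * P (- y')\<bar> \<le> \<epsilon>"
      using boundary_term_small[OF rW _ _ ri[OF p(1)] _ ri[OF q(1)] rP \<epsilon>(1)] W(3) p(2) by auto
    define y where "y = - y'"
    have y: "y \<in> {0<..<1}" "1 - \<epsilon> < y" "\<bar>W y * P y\<bar> \<le> \<epsilon>" using y' by (auto simp: y_def abs_mult)
    have xy: "x \<le> y" using x y \<epsilon> by auto
    have "?G y - ?G x = W y * P y - W x * P x"
      using H[of x y] primitive_onD(2)[OF G xy] x y xy by auto
    moreover have "\<bar>?G x\<bar> < e" using d0(2)[of x] x \<epsilon> G0 by (auto simp: dist_real_def)
    moreover have "\<bar>?G y - ?I\<bar> < e" using d1(2)[of y] y \<epsilon> by (auto simp: dist_real_def)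
    ultimately have "\<bar>?I\<bar> < 5 * e" using x(3) y(3) \<epsilon> by linarith
    then show False by (simp add: e_def)
  qed
  then show ?thesis using WA pq unfolding h_def
    by (subst (asm) set_integral_add) (simp_all add: mult.commute)
qed

subsection \<open>Bump functions and the du Bois-Reymond lemma\<close>

text \<open>Induction over Borel sets, starting from intervals. The step for complements requires
  the integral over the whole line to vanish, which is obtained first by exhaustion with the
  intervals from -n to n.\<close>

lemma AE_zero_of_interval_integrals:
  fixes f :: "real \<Rightarrow> real"
  assumes f: "integrable lborel f" and z: "\<And>x y. x \<le> y \<Longrightarrow> (LINT z:{x..y}|lborel. f z) = 0"
  shows "AE x in lborel. f x = 0"
proof (rule sigma_finite_measure.density_zero[OF lborel.sigma_finite_measure_axioms f])
  have U: "(LINT z|lborel. f z) = 0"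
  proof -
    have "(\<lambda>n. LINT z:{- real n..real n}|lborel. f z) \<longlonglongrightarrow> (LINT z:(\<Union>n. {- real n..real n})|lborel. f z)"
    proof (rule set_integral_cont_up)
      show "incseq (\<lambda>n. {- real n..real n})" by (auto simp: incseq_def)
      show "set_integrable lborel (\<Union>n. {- real n..real n}) f" unfolding set_integrable_def using f
        by (intro integrable_mult_indicator) auto
    qed auto
    moreover have "(\<Union>n. {- real n..real n}) = UNIV"
    proof -
      have "\<exists>n. - real n \<le> x \<and> x \<le> real n" for x :: real
        using real_arch_simple[of "\<bar>x\<bar>"] by (metis abs_le_iff minus_le_iff)
      then show ?thesis by auto
    qed
    moreover have "(LINT z:{- real n..real n}|lborel. f z) = 0" for n by (rule z) auto
    ultimately show ?thesis by (simp add: LIMSEQ_const_iff set_lebesgue_integral_def)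
  qed
  have si: "set_integrable lborel A f" if "A \<in> sets borel" for A
    unfolding set_integrable_def using f that by (intro integrable_mult_indicator) auto
  fix A :: "real set" assume "A \<in> sets lborel"
  then have "A \<in> sets borel" by simp
  then show "(LINT z:A|lborel. f z) = 0"
  proof (induction rule: borel_set_induct)
    case (compl A)
    then have m: "A \<in> sets borel" by simp
    have "(LINT z:A \<union> -A|lborel. f z) = (LINT z:A|lborel. f z) + (LINT z:-A|lborel. f z)"
      by (rule set_integral_Un) (use si m in auto)
    moreover have "A \<union> -A = UNIV" by auto
    ultimately show ?case using U compl by (simp add: set_lebesgue_integral_def)
  next
    case (union F)
    have "(LINT z:(\<Union>i. F i)|lborel. f z) = (\<Sum>i. (LINT z:F i|lborel. f z))"
      by (rule lebesgue_integral_countable_add) (use union si in \<open>auto simp: disjoint_family_on_def\<close>)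
    then show ?case using union by simp
  next
    case empty
    show ?case by (simp add: set_lebesgue_integral_def)
  next
    case (interval x y)
    then show ?case by (rule z)
  qed
qed

text \<open>Countably many compact intervals with rational ends cover the open interval. On each of
  them f is cut off to an integrable function on the line.\<close>

lemma AE_zero_of_interval_integrals_on:
  fixes f :: "real \<Rightarrow> real"
  assumes f: "\<And>x y. c < x \<Longrightarrow> x \<le> y \<Longrightarrow> y < d \<Longrightarrow> set_integrable lborel {x..y} f"
    and z: "\<And>x y. c < x \<Longrightarrow> x \<le> y \<Longrightarrow> y < d \<Longrightarrow> (LINT z:{x..y}|lborel. f z) = 0"
  shows "AE x in lborel. x \<in> {c<..<d} \<longrightarrow> f x = 0"
proof -
  have "AE x in lborel. x \<in> {l..r} \<longrightarrow> f x = 0" if lr: "c < l" "r < d" for l r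
  proof (cases "l \<le> r")
    case True
    have "AE x in lborel. indicator {l..r} x * f x = 0"
    proof (rule AE_zero_of_interval_integrals)
      show "integrable lborel (\<lambda>x. indicator {l..r} x * f x)" using f[of l r] lr True by (simp add: set_integrable_def)
      fix x y :: real
      have e: "indicator {x..y} z * (indicator {l..r} z * f z) = indicator {max x l..min y r} z * f z" for z
        by (auto simp: indicator_def)
      show "(LINT z:{x..y}|lborel. indicator {l..r} z * f z) = 0"
      proof (cases "max x l \<le> min y r")
        case True
        show ?thesis using z[of "max x l" "min y r"] True lr by (auto simp: e set_lebesgue_integral_def)
      next
        case False
        then have "{max x l..min y r} = {}" by auto
        then show ?thesis by (simp only: e set_lebesgue_integral_def real_scaleR_def) simp
      qed
    qed
    then show ?thesis by eventually_elim (auto simp: indicator_def)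
  qed auto
  then have "AE x in lborel. x \<in> {l..r} \<longrightarrow> f x = 0" if "(l, r) \<in> {(l,r). l \<in> \<rat> \<and> r \<in> \<rat> \<and> c < l \<and> r < d}" for l r
    using that by auto
  moreover have "countable {(l::real,r::real). l \<in> \<rat> \<and> r \<in> \<rat> \<and> c < l \<and> r < d}"
    by (rule countable_subset[of _ "\<rat> \<times> \<rat>"]) (auto simp: countable_rat)
  ultimately have "AE x in lborel. \<forall>p\<in>{(l,r). l \<in> \<rat> \<and> r \<in> \<rat> \<and> c < l \<and> r < d}. x \<in> {fst p..snd p} \<longrightarrow> f x = 0"
    by (subst AE_ball_countable) auto
  then show ?thesis
  proof eventually_elim
    case (elim x)
    show ?case
    proof
      assume "x \<in> {c<..<d}"
      then obtain l r where "l \<in> \<rat>" "r \<in> \<rat>" "c < l" "l < x" "x < r" "r < d"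
        using Rats_dense_in_real[of c x] Rats_dense_in_real[of x d] by auto
      then have "(l, r) \<in> {(l,r). l \<in> \<rat> \<and> r \<in> \<rat> \<and> c < l \<and> r < d}" "x \<in> {l..r}" by auto
      then show "f x = 0" using elim by (auto dest: bspec[of _ _ "(l, r)"])
    qed
  qed
qed

lemma exists_primitive_Ioo:
  fixes g :: "real \<Rightarrow> real"
  assumes g: "\<And>x y. c < x \<Longrightarrow> x \<le> y \<Longrightarrow> y < d \<Longrightarrow> set_integrable lborel {x..y} g" and m: "c < m" "m < d"
  shows "\<exists>F. primitive_on {c<..<d} F g"
proof -
  define F where "F x = (if m \<le> x then LINT z:{m..x}|lborel. g z else - (LINT z:{x..m}|lborel. g z))" for x
  have split: "(LINT w:{x..z}|lborel. g w) = (LINT w:{x..y}|lborel. g w) + (LINT w:{y..z}|lborel. g w)"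
    if "c < x" "x \<le> y" "y \<le> z" "z < d" for x y z
    using primitive_onD(2)[OF primitive_on_integral[OF g[of x z], of 0], of y z] that by auto
  have "primitive_on {c<..<d} F g"
    unfolding primitive_on_def
  proof (intro allI impI conjI)
    fix x y :: real assume xy: "x \<le> y" "{x..y} \<subseteq> {c<..<d}"
    then have cd: "c < x" "y < d" by auto
    show "set_integrable lborel {x..y} g" using g cd xy by auto
    show "F y - F x = (LINT z:{x..y}|lborel. g z)"
      using split[of m x y] split[of x y m] split[of x m y] xy cd m by (auto simp: F_def)
  qed
  then show ?thesis by blast
qed

section \<open>Smooth bump functions\<close>

definition smooth :: "(real \<Rightarrow> real) \<Rightarrow> bool"
  where "smooth f \<longleftrightarrow> (\<forall>n. (deriv ^^ n) f differentiable_on UNIV)"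

lemma smooth_deriv: "smooth f \<longleftrightarrow> f differentiable_on UNIV \<and> smooth (deriv f)"
  unfolding smooth_def
  by (metis (mono_tags, opaque_lifting) comp_apply funpow_0 funpow_Suc_right not0_implies_Suc)

lemma smooth_has_deriv: "smooth f \<Longrightarrow> (f has_real_derivative deriv f x) (at x)"
  using smooth_deriv[of f] by (auto simp: differentiable_on_def real_differentiable_def DERIV_deriv_iff_real_differentiable)

lemma smooth_continuous: "smooth f \<Longrightarrow> continuous_on S f"
  by (meson DERIV_continuous_on smooth_has_deriv has_field_derivative_at_within)

lemma smooth_diff_scale:
  assumes "smooth f" "smooth g"
  shows "smooth (\<lambda>x. f x - k * g x)"
proof -
  have "(deriv ^^ n) (\<lambda>x. f x - k * g x) = (\<lambda>x. (deriv ^^ n) f x - k * (deriv ^^ n) g x)" for n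
  proof (induction n)
    case (Suc n)
    have "((deriv ^^ n) h has_real_derivative (deriv ^^ Suc n) h x) (at x)" if "smooth h" for h x
      using that unfolding smooth_def
      by (auto simp: differentiable_on_def real_differentiable_def DERIV_deriv_iff_real_differentiable)
    from this[OF assms(1)] this[OF assms(2)] show ?case
      by (auto simp: Suc intro!: ext DERIV_imp_deriv derivative_eq_intros)
  qed simp
  then show ?thesis using assms unfolding smooth_def
    by (auto intro!: differentiable_on_diff differentiable_on_mult)
qed

text \<open>The derivatives of exp(-1/q), q = s (x - c) (d - x), all have the form r / q^k exp(-1/q)
  with a polynomial r.\<close>

definition bump_aux :: "real \<Rightarrow> real \<Rightarrow> real \<Rightarrow> real poly \<Rightarrow> nat \<Rightarrow> real \<Rightarrow> real"
  where "bump_aux s c d r k x = (if c < x \<and> x < d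
     then poly r x / (s * (x - c) * (d - x)) ^ k * exp (- 1 / (s * (x - c) * (d - x))) else 0)"

text \<open>The (n+1)-st power of u \<le> exp u with u = 1 / ((n+1) q). It shows that exp(-1/q)
  beats every power of q as q tends to 0.\<close>

lemma exp_minus_inverse_le:
  fixes q :: real
  assumes "q > 0"
  shows "exp (- 1 / q) \<le> real (Suc n) ^ Suc n * q ^ Suc n"
proof -
  have "1 / (real (Suc n) * q) \<le> exp (1 / (real (Suc n) * q))"
    using exp_ge_add_one_self[of "1 / (real (Suc n) * q)"] by linarith
  then have "(1 / (real (Suc n) * q)) ^ Suc n \<le> exp (1 / (real (Suc n) * q)) ^ Suc n"
    using assms by (intro power_mono) auto
  also have "\<dots> = exp (1 / q)"
    by (subst exp_of_nat_mult[symmetric]) simp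
  finally have "1 / (real (Suc n) * q) ^ Suc n \<le> exp (1 / q)" by (simp add: power_one_over)
  moreover have "(real (Suc n) * q) ^ Suc n > 0" using assms by simp
  ultimately have "1 \<le> exp (1 / q) * (real (Suc n) * q) ^ Suc n" by (simp add: pos_divide_le_eq)
  then have "exp (- 1 / q) * 1 \<le> exp (- 1 / q) * (exp (1 / q) * (real (Suc n) * q) ^ Suc n)"
    by (intro mult_left_mono) auto
  also have "\<dots> = (real (Suc n) * q) ^ Suc n" by (simp add: mult.assoc[symmetric] mult_exp_exp)
  finally show ?thesis by (simp only: mult_1_right power_mult_distrib)
qed

lemma DERIV_zero_of_quadratic_bound:
  fixes f :: "real \<Rightarrow> real"
  assumes "\<And>y. \<bar>f y\<bar> \<le> M * (y - x)^2"
  shows "(f has_real_derivative 0) (at x)"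
proof -
  have f0: "f x = 0" using assms[of x] by simp
  have "((\<lambda>y. (f y - f x) / (y - x)) \<longlongrightarrow> 0) (at x)"
  proof (rule Lim_null_comparison)
    show "\<forall>\<^sub>F y in at x. norm ((f y - f x) / (y - x)) \<le> M * \<bar>y - x\<bar>"
      unfolding eventually_at_filter
    proof (rule always_eventually, intro allI impI)
      fix y assume "y \<noteq> x"
      then show "norm ((f y - f x) / (y - x)) \<le> M * \<bar>y - x\<bar>"
        using assms[of y] f0 by (simp add: abs_divide divide_le_eq power2_eq_square mult.assoc)
    qed
    have "((\<lambda>y. M * \<bar>y - x\<bar>) \<longlongrightarrow> M * \<bar>x - x\<bar>) (at x)" by (intro tendsto_intros)
    then show "((\<lambda>y. M * \<bar>y - x\<bar>) \<longlongrightarrow> 0) (at x)" by simp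
  qed
  then show ?thesis by (simp add: has_field_derivative_iff)
qed

text \<open>Bounding the exponential by a multiple of q^(k+2) leaves q^2 after division by q^k, and
  q vanishes to first order at either end. A quadratic bound gives derivative 0 at the two points
  where the formula is glued to 0.\<close>

lemma bump_aux_quadratic:
  assumes s: "s > 0" and x: "x = c \<or> x = d" and cd: "c < d"
  shows "\<exists>M. \<forall>y. \<bar>bump_aux s c d r k y\<bar> \<le> M * (y - x)^2"
proof -
  have "compact (poly r ` {c..d})" by (intro compact_continuous_image continuous_intros) auto
  then obtain B where B: "\<And>y. c \<le> y \<Longrightarrow> y \<le> d \<Longrightarrow> \<bar>poly r y\<bar> \<le> B"
    by (fastforce dest!: compact_imp_bounded simp: bounded_iff)
  have B0: "B \<ge> 0" using B[of c] cd by linarith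
  define N where "N = real (Suc (Suc k)) ^ Suc (Suc k)"
  have N: "N \<ge> 0" by (simp add: N_def)
  show ?thesis
  proof (rule exI[of _ "B * N * (s * (d - c))^2"], rule allI)
    fix y
    show "\<bar>bump_aux s c d r k y\<bar> \<le> B * N * (s * (d - c))^2 * (y - x)^2"
    proof (cases "c < y \<and> y < d")
      case True
      define q where "q = s * (y - c) * (d - y)"
      have q: "q > 0" using True s by (simp add: q_def)
      have "\<bar>bump_aux s c d r k y\<bar> = \<bar>poly r y\<bar> / q ^ k * exp (- 1 / q)"
        using True q by (simp add: bump_aux_def q_def abs_mult)
      also have "\<dots> \<le> B / q ^ k * (N * q ^ Suc (Suc k))"
        unfolding N_def by (intro mult_mono divide_right_mono B exp_minus_inverse_le) (use True q B0 in auto)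
      also have "\<dots> = B * N * q^2" using q by (simp add: power2_eq_square)
      also have "q \<le> s * (d - c) * \<bar>y - x\<bar>"
      proof -
        have "(y - c) * (d - y) \<le> (d - c) * \<bar>y - x\<bar>"
          using x
        proof
          assume "x = c"
          then have "(y - c) * (d - y) = \<bar>y - x\<bar> * (d - y)" using True by simp
          also have "\<dots> \<le> \<bar>y - x\<bar> * (d - c)" using True by (intro mult_left_mono) auto
          finally show ?thesis by (simp add: mult.commute)
        next
          assume "x = d"
          then have "(y - c) * (d - y) = (y - c) * \<bar>y - x\<bar>" using True by simp
          also have "\<dots> \<le> (d - c) * \<bar>y - x\<bar>" using True by (intro mult_right_mono) auto
          finally show ?thesis .
        qed
        then show ?thesis using s by (simp add: q_def mult.assoc)
      qed
      then have "B * N * q^2 \<le> B * N * (s * (d - c) * \<bar>y - x\<bar>)^2"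
        using q N B0 by (intro mult_left_mono power_mono) auto
      finally show ?thesis by (simp add: power_mult_distrib mult_ac)
    qed (use B0 N in \<open>auto simp: bump_aux_def\<close>)
  qed
qed

text \<open>Quotient and chain rule over the common denominator q^(k+2): the derivative of -1/q
  contributes q'/q^2, so the new numerator is r' q^2 - k r q' q + r q'.\<close>

lemma bump_aux_deriv:
  assumes s: "s > 0" and cd: "c < d"
  shows "\<exists>r'. \<forall>x. (bump_aux s c d r k has_real_derivative bump_aux s c d r' (k + 2) x) (at x)"
proof -
  define q where "q = smult s ([:- c, 1:] * [:d, -1:])"
  have q: "poly q x = s * (x - c) * (d - x)" for x by (simp add: q_def algebra_simps)
  define r' where "r' = pderiv r * q^2 - of_nat k * (r * pderiv q * q) + r * pderiv q"
  have "(bump_aux s c d r k has_real_derivative bump_aux s c d r' (k + 2) x) (at x)" for x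
  proof -
    consider "c < x \<and> x < d" | "x = c \<or> x = d" | "x < c \<or> x > d" by fastforce
    then show ?thesis
    proof cases
      case 1
      then have q0: "poly q x > 0" using s by (simp add: q)
      have "((\<lambda>x. poly r x / poly q x ^ k * exp (- 1 / poly q x)) has_real_derivative bump_aux s c d r' (k + 2) x) (at x)"
      proof -
        have "((\<lambda>x. poly r x / poly q x ^ k * exp (- 1 / poly q x)) has_real_derivative
          ((poly (pderiv r) x * poly q x ^ k - poly r x * (of_nat k * (poly (pderiv q) x * poly q x ^ (k - Suc 0)))) / (poly q x ^ k * poly q x ^ k)
              * exp (- 1 / poly q x)
            + exp (- 1 / poly q x) * (poly (pderiv q) x / (poly q x * poly q x)) * (poly r x / poly q x ^ k))) (at x)"
          by (rule derivative_eq_intros poly_DERIV refl | use q0 in \<open>force\<close>)+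
        moreover have "(poly (pderiv r) x * poly q x ^ k - poly r x * (of_nat k * (poly (pderiv q) x * poly q x ^ (k - Suc 0)))) / (poly q x ^ k * poly q x ^ k)
              * exp (- 1 / poly q x)
            + exp (- 1 / poly q x) * (poly (pderiv q) x / (poly q x * poly q x)) * (poly r x / poly q x ^ k)
          = bump_aux s c d r' (k + 2) x"
        proof -
          \<comment> \<open>The later split on k is for the truncated \<open>k - Suc 0\<close>: at k
            = 0 the factor \<open>of_nat k\<close> removes that term.\<close>
          have *: "poly q x ^ k * poly r' x = (poly (pderiv r) x * poly q x ^ k - poly r x * (of_nat k * (poly (pderiv q) x * poly q x ^ (k - Suc 0)))) * poly q x ^2
             + poly (pderiv q) x * poly r x * poly q x ^ k"
            by (cases k) (simp_all add: r'_def algebra_simps power2_eq_square)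
          have "bump_aux s c d r' (k + 2) x = (poly q x ^ k * poly r' x) / (poly q x ^ k * poly q x ^ k * poly q x ^ 2) * exp (- 1 / poly q x)"
            using 1 q0 unfolding bump_aux_def q[symmetric] by (simp add: power_add power2_eq_square)
          also have "\<dots> = (poly (pderiv r) x * poly q x ^ k - poly r x * (of_nat k * (poly (pderiv q) x * poly q x ^ (k - Suc 0)))) / (poly q x ^ k * poly q x ^ k)
              * exp (- 1 / poly q x)
            + exp (- 1 / poly q x) * (poly (pderiv q) x / (poly q x * poly q x)) * (poly r x / poly q x ^ k)"
            unfolding * add_divide_distrib distrib_right using q0 by (simp add: power2_eq_square mult_ac)
          finally show ?thesis by simp
        qed
        ultimately show ?thesis by simp
      qed
      then show ?thesis
        by (rule has_field_derivative_transform_within_open[of _ _ _ "{c<..<d}"]) (use 1 in \<open>auto simp: bump_aux_def q\<close>)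
    next
      case 2
      then obtain M where "\<And>y. \<bar>bump_aux s c d r k y\<bar> \<le> M * (y - x)^2" using bump_aux_quadratic[OF s 2 cd, of r k] by auto
      then have "(bump_aux s c d r k has_real_derivative 0) (at x)" by (rule DERIV_zero_of_quadratic_bound)
      moreover have "bump_aux s c d r' (k + 2) x = 0" using 2 by (auto simp: bump_aux_def)
      ultimately show ?thesis by simp
    next
      case 3
      have "((\<lambda>_. 0) has_real_derivative 0) (at x)" by simp
      then have "(bump_aux s c d r k has_real_derivative 0) (at x)"
        by (rule has_field_derivative_transform_within_open[of _ _ _ "{..<c} \<union> {d<..}"]) (use 3 cd in \<open>auto simp: bump_aux_def\<close>)
      then show ?thesis using 3 by (auto simp: bump_aux_def)
    qed
  qed
  then show ?thesis by blast
qed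

text \<open>The factor \<open>Suc n\<close> flattens the bump: as n grows it tends pointwise to the
  indicator of the open interval, so that integrals against bumps tend to integrals over
  intervals.\<close>

definition bump :: "nat \<Rightarrow> real \<Rightarrow> real \<Rightarrow> real \<Rightarrow> real"
  where "bump n c d = bump_aux (real (Suc n)) c d 1 0"

lemma bump_eq: "bump n c d x = (if c < x \<and> x < d then exp (- 1 / (real (Suc n) * (x - c) * (d - x))) else 0)"
  by (simp add: bump_def bump_aux_def)

lemma smooth_bump:
  assumes cd: "c < d"
  shows "smooth (bump n c d)"
proof -
  let ?B = "bump_aux (real (Suc n)) c d"
  have "\<exists>r k. (deriv ^^ i) (bump n c d) = ?B r k" for i
  proof (induction i)
    case (Suc i)
    then obtain r k where rk: "(deriv ^^ i) (bump n c d) = ?B r k" by blast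
    obtain r' where "\<And>x. (?B r k has_real_derivative ?B r' (k + 2) x) (at x)"
      using bump_aux_deriv[OF _ cd, of "real (Suc n)" r k] by auto
    then have "deriv (?B r k) = ?B r' (k + 2)" by (auto intro: DERIV_imp_deriv)
    then show ?case using rk by auto
  qed (auto simp: bump_def)
  then show ?thesis unfolding smooth_def differentiable_on_def real_differentiable_def
    by (metis bump_aux_deriv[OF _ cd, of "real (Suc n)"] of_nat_0_less_iff zero_less_Suc has_field_derivative_at_within)
qed

lemma bump_bounds: "0 \<le> bump n c d x" "bump n c d x \<le> indicator {c..d} x"
proof -
  have "- 1 / (real (Suc n) * (x - c) * (d - x)) \<le> 0" if "c < x" "x < d" using that by simp
  then show "0 \<le> bump n c d x" "bump n c d x \<le> indicator {c..d} x" by (auto simp: bump_eq indicator_def)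
qed

lemma bump_tendsto: "(\<lambda>n. bump n c d x) \<longlonglongrightarrow> indicator {c<..<d} x"
proof (cases "c < x \<and> x < d")
  case True
  have "(\<lambda>n. exp ((- 1 / ((x - c) * (d - x))) * (1 / real (Suc n)))) \<longlonglongrightarrow> exp ((- 1 / ((x - c) * (d - x))) * 0)"
    by (intro tendsto_intros LIMSEQ_Suc[OF lim_const_over_n])
  moreover have "(- 1 / ((x - c) * (d - x))) * (1 / real (Suc n)) = - 1 / (real (Suc n) * (x - c) * (d - x))" for n
    by (simp add: mult_ac)
  ultimately show ?thesis using True by (simp only: bump_eq) simp
next
  case False
  then have "bump n c d x = 0" for n by (auto simp: bump_eq)
  then show ?thesis using False by auto
qed

lemma bump_integrable:
  assumes "c < d"
  shows "integrable lborel (bump n c d)"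
proof -
  have "continuous_on UNIV (bump n c d)" by (rule smooth_continuous[OF smooth_bump[OF assms]])
  then have m: "bump n c d \<in> borel_measurable borel" by (rule borel_measurable_continuous_onI)
  have "integrable lborel (indicator {c..d} :: real \<Rightarrow> real)" by (rule integrable_real_indicator) (auto simp: emeasure_lborel_Icc_eq)
  then show ?thesis
    by (rule Bochner_Integration.integrable_bound) (use m bump_bounds[of n c d] in auto)
qed

lemma bump_integral_tendsto:
  fixes w :: "real \<Rightarrow> real"
  assumes "c < d" "set_integrable lborel {c..d} w"
  shows "(\<lambda>n. LINT x|lborel. w x * bump n c d x) \<longlonglongrightarrow> (LINT x:{c..d}|lborel. w x)"
    and "integrable lborel (\<lambda>x. w x * bump n c d x)"
proof -
  have bm: "bump n c d \<in> borel_measurable borel" for n using bump_integrable[OF assms(1)] by auto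
  have wi: "integrable lborel (\<lambda>x. indicator {c..d} x * w x)" using assms(2) by (simp add: set_integrable_def)
  have e: "w x * bump n c d x = (indicator {c..d} x * w x) * bump n c d x" for x n
  proof (cases "x \<in> {c..d}")
    case False
    then have "bump n c d x = 0" by (auto simp: bump_eq)
    then show ?thesis by simp
  qed simp
  have m: "(\<lambda>x. w x * bump n c d x) \<in> borel_measurable lborel" for n
    unfolding e using borel_measurable_times[OF borel_measurable_integrable[OF wi], of "bump n c d"] bm by simp
  have b: "norm (w x * bump n c d x) \<le> \<bar>indicator {c..d} x * w x\<bar>" for x n
    using bump_bounds[of n c d x] by (auto simp: indicator_def abs_mult mult_left_le)
  show "integrable lborel (\<lambda>x. w x * bump n c d x)" for n
    by (rule Bochner_Integration.integrable_bound[OF wi m]) (use b in auto)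
  have "AE x in lborel. x \<noteq> c" "AE x in lborel. x \<noteq> d" by (rule AE_lborel_singleton)+
  then have ae: "AE x in lborel. (\<lambda>n. w x * bump n c d x) \<longlonglongrightarrow> indicator {c..d} x *\<^sub>R w x"
  proof eventually_elim
    case (elim x)
    have "(\<lambda>n. w x * bump n c d x) \<longlonglongrightarrow> w x * indicator {c<..<d} x" by (intro tendsto_intros bump_tendsto)
    moreover have "w x * indicator {c<..<d} x = indicator {c..d} x *\<^sub>R w x" using elim by (auto simp: indicator_def)
    ultimately show ?case by simp
  qed
  show "(\<lambda>n. LINT x|lborel. w x * bump n c d x) \<longlonglongrightarrow> (LINT x:{c..d}|lborel. w x)"
    unfolding set_lebesgue_integral_def
  proof (rule integral_dominated_convergence[where w="\<lambda>x. \<bar>indicator {c..d} x * w x\<bar>"])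
    show "(\<lambda>x. indicator {c..d} x *\<^sub>R w x) \<in> borel_measurable lborel"
      using borel_measurable_integrable[OF wi] by simp
    show "integrable lborel (\<lambda>x. \<bar>indicator {c..d} x * w x\<bar>)" using wi by (rule integrable_abs)
    show "AE x in lborel. norm (w x * bump n c d x) \<le> \<bar>indicator {c..d} x * w x\<bar>" for n
      by (rule AE_I2, rule b)
  qed (fact m ae)+
qed

text \<open>The factor makes the integral vanish, so that the primitive has compact support.\<close>

definition bump_diff :: "nat \<Rightarrow> real \<Rightarrow> real \<Rightarrow> real \<Rightarrow> real \<Rightarrow> real \<Rightarrow> real"
  where "bump_diff n c1 d1 c2 d2 x = bump n c1 d1 x
     - (LINT z|lborel. bump n c1 d1 z) / (LINT z|lborel. bump n c2 d2 z) * bump n c2 d2 x"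

lemma bump_integral_pos: "c < d \<Longrightarrow> (LINT z|lborel. bump n c d z) > 0"
proof -
  assume cd: "c < d"
  have "(LINT z|lborel. bump n c d z) \<noteq> 0"
  proof
    assume "(LINT z|lborel. bump n c d z) = 0"
    then have "AE z in lborel. bump n c d z = 0"
      using integral_nonneg_eq_0_iff_AE[OF bump_integrable[OF cd]] bump_bounds by auto
    then have "\<forall>z\<in>{c<..<d}. bump n c d z = 0"
      by (intro AE_eq_continuous_Ioo[where g="\<lambda>_. 0"] smooth_continuous[OF smooth_bump[OF cd]] continuous_on_const)
        (auto elim: eventually_mono)
    then show False using cd dense[OF cd] by (auto simp: bump_eq)
  qed
  moreover have "(LINT z|lborel. bump n c d z) \<ge> 0" by (simp add: bump_bounds)
  ultimately show ?thesis by simp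
qed

lemma test_function_bump_primitive:
  fixes n :: nat
  assumes I: "c < c1" "c1 < d1" "d1 < d" "c < c2" "c2 < d2" "d2 < d"
  defines "\<phi> \<equiv> \<lambda>x. LINT z:{c..x}|lborel. bump_diff n c1 d1 c2 d2 z"
  shows "test_function c d \<phi>" "deriv \<phi> = bump_diff n c1 d1 c2 d2"
proof -
  let ?f = "bump_diff n c1 d1 c2 d2"
  define l where "l = min c1 c2"
  define r where "r = max d1 d2"
  have lr: "c < l" "r < d" "l < r" using I by (auto simp: l_def r_def)
  have sm: "smooth ?f" unfolding bump_diff_def using smooth_bump I by (intro smooth_diff_scale) auto
  have cont: "continuous_on S ?f" for S by (rule smooth_continuous[OF sm])
  have f0: "?f x = 0" if "x \<notin> {l..r}" for x
    using that by (auto simp: bump_diff_def bump_eq l_def r_def)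
  have fi: "integrable lborel ?f" unfolding bump_diff_def
    using I by (intro Bochner_Integration.integrable_diff integrable_mult_right bump_integrable) auto
  have fz: "(LINT z|lborel. ?f z) = 0" unfolding bump_diff_def
    using I bump_integrable[of c1 d1 n] bump_integrable[of c2 d2 n] bump_integral_pos[of c2 d2 n]
    by (subst Bochner_Integration.integral_diff) auto
  have phi_I: "\<phi> x = integral {c..x} ?f" for x unfolding \<phi>_def
    by (rule set_borel_integral_eq_integral(2)) (rule borel_integrable_atLeastAtMost'[OF cont])
  have phi0: "\<phi> x = 0" if "x \<notin> {l..r}" for x
  proof (cases "x < l")
    case True
    then have "indicator {c..x} z *\<^sub>R ?f z = 0" for z using f0[of z] by (auto simp: indicator_def)
    then show ?thesis unfolding \<phi>_def set_lebesgue_integral_def by (simp only: Bochner_Integration.integral_zero)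
  next
    case False
    then have "indicator {c..x} z *\<^sub>R ?f z = ?f z" for z
      using f0[of z] that lr False by (cases "z \<in> {l..r}") auto
    then show ?thesis unfolding \<phi>_def set_lebesgue_integral_def by (simp only: fz)
  qed
  \<comment> \<open>To the left of l the primitive is locally 0. Otherwise c < x, so the derivative
    within the interval from c to x + 1 is a two-sided one.\<close>
  have der: "(\<phi> has_real_derivative ?f x) (at x)" for x
  proof (cases "x < l")
    case True
    have "((\<lambda>_. 0) has_real_derivative 0) (at x)" by simp
    then have "(\<phi> has_real_derivative 0) (at x)"
      by (rule has_field_derivative_transform_within_open[of _ _ _ "{..<l}"]) (use True phi0 in auto)
    then show ?thesis using f0[of x] True by simp
  next
    case False
    have "((\<lambda>u. integral {c..u} ?f) has_real_derivative ?f x) (at x within {c..x+1})"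
      by (rule integral_has_real_derivative) (use cont False lr in auto)
    then have "((\<lambda>u. integral {c..u} ?f) has_real_derivative ?f x) (at x within {c<..<x+1})"
      by (rule DERIV_subset) auto
    then have "((\<lambda>u. integral {c..u} ?f) has_real_derivative ?f x) (at x)"
      by (subst (asm) at_within_open) (use False lr in auto)
    moreover have "\<phi> = (\<lambda>u. integral {c..u} ?f)" using phi_I by (rule ext)
    ultimately show ?thesis by simp
  qed
  then show d: "deriv \<phi> = ?f" by (auto intro: DERIV_imp_deriv)
  have "smooth \<phi>" unfolding smooth_deriv[of \<phi>] d
    using der sm by (auto simp: differentiable_on_def real_differentiable_def)
  then show "test_function c d \<phi>" unfolding test_function_def smooth_def
    using phi0 lr by (intro conjI exI[of _ "{l..r}"]) auto
qed

text \<open>The end points are rational to make the family countable. The derivative of a member is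
  a combination of two bumps, so testing with it compares the integrals of a function over two
  intervals.\<close>

definition tests :: "real \<Rightarrow> real \<Rightarrow> (real \<Rightarrow> real) set"
  where "tests c d = (\<lambda>(n, c1, d1, c2, d2) x. LINT z:{c..x}|lborel. bump_diff n c1 d1 c2 d2 z) `
    {(n, c1, d1, c2, d2). {c1, d1, c2, d2} \<subseteq> \<rat> \<and> c < c1 \<and> c1 < d1 \<and> d1 < d \<and> c < c2 \<and> c2 < d2 \<and> d2 < d}"

lemma countable_tests: "countable (tests c d)"
  unfolding tests_def
proof (rule countable_image, rule countable_subset)
  show "countable ((UNIV :: nat set) \<times> (\<rat> :: real set) \<times> (\<rat> :: real set) \<times> (\<rat> :: real set) \<times> (\<rat> :: real set))"
    by (intro countable_SIGMA countable_rat) auto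
qed auto

lemma tests_test_function: "\<phi> \<in> tests c d \<Longrightarrow> test_function c d \<phi>"
  unfolding tests_def using test_function_bump_primitive(1) by auto

text \<open>The du Bois-Reymond lemma for a countable set of test functions: countability allows the
  exceptional null sets of the time derivative, one for each test function, to be united.\<close>

lemma AE_const_of_tests:
  fixes w :: "real \<Rightarrow> real"
  assumes cd: "c < d" and w: "\<And>x y. c < x \<Longrightarrow> x \<le> y \<Longrightarrow> y < d \<Longrightarrow> set_integrable lborel {x..y} w"
    and z: "\<And>\<phi>. \<phi> \<in> tests c d \<Longrightarrow> (LINT x|lborel. w x * deriv \<phi> x) = 0"
  shows "\<exists>k. AE x in lborel. x \<in> {c<..<d} \<longrightarrow> w x = k"
proof -
  \<comment> \<open>Letting n grow turns the bumps into indicators: w has the same average over any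
    two intervals with rational ends.\<close>
  have key: "(LINT x:{c1..d1}|lborel. w x) * (d2 - c2) = (d1 - c1) * (LINT x:{c2..d2}|lborel. w x)"
    if I: "c < c1" "c1 < d1" "d1 < d" "c < c2" "c2 < d2" "d2 < d" and rat: "{c1, d1, c2, d2} \<subseteq> \<rat>" for c1 d1 c2 d2
  proof -
    have w1: "set_integrable lborel {c1..d1} w" and w2: "set_integrable lborel {c2..d2} w" using w I by auto
    have eq: "(LINT x|lborel. w x * bump n c1 d1 x) * (LINT z|lborel. 1 * bump n c2 d2 z)
        = (LINT z|lborel. 1 * bump n c1 d1 z) * (LINT x|lborel. w x * bump n c2 d2 x)" for n
    proof -
      let ?\<kappa> = "(LINT z|lborel. bump n c1 d1 z) / (LINT z|lborel. bump n c2 d2 z)"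
      have "(\<lambda>x. LINT z:{c..x}|lborel. bump_diff n c1 d1 c2 d2 z) \<in> tests c d"
        unfolding tests_def using I rat by (intro image_eqI[of _ _ "(n, c1, d1, c2, d2)"]) auto
      from z[OF this] have "0 = (LINT x|lborel. w x * bump_diff n c1 d1 c2 d2 x)"
        by (simp add: test_function_bump_primitive(2)[OF I])
      also have "\<dots> = (LINT x|lborel. w x * bump n c1 d1 x - ?\<kappa> * (w x * bump n c2 d2 x))"
        by (rule Bochner_Integration.integral_cong) (auto simp: bump_diff_def algebra_simps)
      also have "\<dots> = (LINT x|lborel. w x * bump n c1 d1 x) - ?\<kappa> * (LINT x|lborel. w x * bump n c2 d2 x)"
        using bump_integral_tendsto(2)[OF I(2) w1] bump_integral_tendsto(2)[OF I(5) w2] by simp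
      finally show ?thesis using bump_integral_pos[OF I(5), of n] by (simp add: field_simps)
    qed
    have one: "set_integrable lborel {x..y} (\<lambda>_. 1::real)" for x y :: real by (rule borel_integrable_atLeastAtMost') auto
    have h1: "(\<lambda>n. (LINT x|lborel. w x * bump n c1 d1 x) * (LINT z|lborel. 1 * bump n c2 d2 z))
        \<longlonglongrightarrow> (LINT x:{c1..d1}|lborel. w x) * (LINT x:{c2..d2}|lborel. 1)"
      by (intro tendsto_mult bump_integral_tendsto I w1 one)
    have h2: "(\<lambda>n. (LINT z|lborel. 1 * bump n c1 d1 z) * (LINT x|lborel. w x * bump n c2 d2 x))
        \<longlonglongrightarrow> (LINT x:{c1..d1}|lborel. 1) * (LINT x:{c2..d2}|lborel. w x)"
      by (intro tendsto_mult bump_integral_tendsto I w2 one)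
    have len: "(LINT x:{x..y}|lborel. 1) = y - x" if "x < y" for x y :: real
      using that by (simp add: set_lebesgue_integral_def)
    show ?thesis using LIMSEQ_unique[OF h1[unfolded eq] h2] unfolding len[OF I(2)] len[OF I(5)] .
  qed
  obtain c2 where c2: "c2 \<in> \<rat>" "c < c2" "c2 < d" using Rats_dense_in_real[OF cd] by auto
  obtain d2 where d2: "d2 \<in> \<rat>" "c2 < d2" "d2 < d" using Rats_dense_in_real[OF c2(3)] by auto
  \<comment> \<open>The common average, read off from one reference interval; w - k then has
    integral 0 over all intervals with rational ends.\<close>
  define k where "k = (LINT x:{c2..d2}|lborel. w x) / (d2 - c2)"
  define w' where "w' = (\<lambda>x. w x - k)"
  have w'i: "set_integrable lborel {x..y} w'" if "c < x" "x \<le> y" "y < d" for x y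
  proof -
    have "set_integrable lborel {x..y} (\<lambda>_. k)" by (rule borel_integrable_atLeastAtMost') auto
    then show ?thesis unfolding w'_def by (rule set_integral_diff(1)[OF w[OF that]])
  qed
  have rat: "(LINT z:{x..y}|lborel. w' z) = 0" if xy: "c < x" "x < y" "y < d" "x \<in> \<rat>" "y \<in> \<rat>" for x y
  proof -
    have ki: "set_integrable lborel {x..y} (\<lambda>_. k)" by (rule borel_integrable_atLeastAtMost') auto
    have "(LINT z:{x..y}|lborel. w' z) = (LINT z:{x..y}|lborel. w z) - (LINT z:{x..y}|lborel. k)"
      unfolding w'_def using w[of x y] xy by (intro set_integral_diff(2) ki) auto
    also have "(LINT z:{x..y}|lborel. k) = (y - x) * k" using xy by (simp add: set_lebesgue_integral_def)
    also have "(LINT z:{x..y}|lborel. w z) = (y - x) * k"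
      using key[of x y c2 d2] xy c2 d2 by (simp add: k_def field_simps)
    finally show ?thesis by simp
  qed
  obtain F where F: "primitive_on {c<..<d} F w'" using exists_primitive_Ioo[OF w'i c2(2,3)] by blast
  have Fc: "continuous_on {c<..<d} F" by (rule primitive_on_continuous_Ioo[OF F])
  have Frat: "F x = F c2" if "x \<in> \<rat>" "x \<in> {c<..<d}" for x
  proof -
    consider "x < c2" | "x = c2" | "c2 < x" by fastforce
    then show ?thesis
      using rat[of x c2] rat[of c2 x] primitive_onD(2)[OF F, of x c2] primitive_onD(2)[OF F, of c2 x] that c2
      by cases fastforce+
  qed
  \<comment> \<open>\<open>Frat\<close> gives the value at rational points; continuity of F carries
    it to the others.\<close>
  have Fconst: "F x = F c2" if x: "x \<in> {c<..<d}" for x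
  proof (rule ccontr)
    assume n: "F x \<noteq> F c2"
    define U where "U = {c<..<d} \<inter> F -` (- {F c2})"
    have "open U" unfolding U_def by (rule continuous_open_preimage[OF Fc]) auto
    moreover have "x \<in> U" using x n by (auto simp: U_def)
    ultimately obtain e where "e > 0" "ball x e \<subseteq> U" by (meson openE)
    moreover obtain y where "y \<in> \<rat>" "x < y" "y < x + e" using Rats_dense_in_real[of x "x + e"] \<open>e > 0\<close> by auto
    ultimately have "y \<in> U" "y \<in> \<rat>" by (auto simp: dist_real_def subset_iff)
    then show False using Frat by (auto simp: U_def)
  qed
  have "AE x in lborel. x \<in> {c<..<d} \<longrightarrow> w' x = 0"
  proof (rule AE_zero_of_interval_integrals_on[OF w'i])
    fix x y assume xy: "c < x" "x \<le> y" "y < d"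
    then show "(LINT z:{x..y}|lborel. w' z) = 0"
      using primitive_onD(2)[OF F, of x y] Fconst[of x] Fconst[of y] by fastforce
  qed
  then show ?thesis by (intro exI[of _ k]) (auto simp: w'_def)
qed

section \<open>From test functions to primitives\<close>

lemma test_functionD:
  assumes "test_function c d \<phi>"
  shows "(\<phi> has_real_derivative deriv \<phi> x) (at x)" "continuous_on S \<phi>" "continuous_on S (deriv \<phi>)"
    and "c < d \<Longrightarrow> \<exists>l r. c < l \<and> l \<le> r \<and> r < d \<and> (\<forall>x. x \<notin> {l<..<r} \<longrightarrow> \<phi> x = 0 \<and> deriv \<phi> x = 0)"
proof -
  have sm: "smooth \<phi>" using assms by (auto simp: test_function_def smooth_def)
  then have sm': "smooth (deriv \<phi>)" using smooth_deriv by blast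
  show "(\<phi> has_real_derivative deriv \<phi> x) (at x)" "continuous_on S \<phi>" "continuous_on S (deriv \<phi>)" for x S
    using sm sm' by (auto intro: smooth_has_deriv smooth_continuous)
  show "\<exists>l r. c < l \<and> l \<le> r \<and> r < d \<and> (\<forall>x. x \<notin> {l<..<r} \<longrightarrow> \<phi> x = 0 \<and> deriv \<phi> x = 0)" if cd: "c < d"
  proof -
    obtain K where K: "compact K" "K \<subseteq> {c<..<d}" "\<And>x. x \<notin> K \<Longrightarrow> \<phi> x = 0"
      using assms by (auto simp: test_function_def)
    have d0: "deriv \<phi> x = 0" if "x \<notin> K" for x
    proof -
      have "((\<lambda>_. 0) has_real_derivative 0) (at x)" by simp
      then have "(\<phi> has_real_derivative 0) (at x)"
        by (rule has_field_derivative_transform_within_open[of _ _ _ "- K"])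
          (use that K in \<open>auto intro: compact_imp_closed\<close>)
      then show ?thesis by (rule DERIV_imp_deriv)
    qed
    show ?thesis
    proof (cases "K = {}")
      case True
      then show ?thesis using K d0 dense[OF cd] by auto
    next
      case False
      obtain l' where l': "l' \<in> K" "\<And>x. x \<in> K \<Longrightarrow> l' \<le> x" using compact_attains_inf[OF K(1) False] by auto
      obtain r' where r': "r' \<in> K" "\<And>x. x \<in> K \<Longrightarrow> x \<le> r'" using compact_attains_sup[OF K(1) False] by auto
      \<comment> \<open>l and r lie strictly outside the support, so that the function and its
        derivative vanish at l and r too; these serve as ends of integration later.\<close>
      obtain l where l: "c < l" "l < l'" using dense[of c l'] l' K by (meson greaterThanLessThan_iff subsetD)
      obtain r where r: "r < d" "r' < r" using dense[of r' d] r' K by (meson greaterThanLessThan_iff subsetD)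
      have "x \<notin> K" if "x \<notin> {l<..<r}" for x using that l r l'(2)[of x] r'(2)[of x] by auto
      moreover have "l \<le> r" using l r l' r' by fastforce
      ultimately show ?thesis using K d0 l r by (intro exI[of _ l] exI[of _ r]) auto
    qed
  qed
qed

lemma primitive_on_test_function:
  assumes F: "primitive_on {c<..<d} F g" and \<phi>: "test_function c d \<phi>" and cd: "c < d"
  shows "integrable lborel (\<lambda>x. F x * deriv \<phi> x)" "integrable lborel (\<lambda>x. g x * \<phi> x)"
    "(LINT x|lborel. F x * deriv \<phi> x) = - (LINT x|lborel. g x * \<phi> x)"
proof -
  obtain l r where lr: "c < l" "l \<le> r" "r < d" and out: "\<And>x. x \<notin> {l<..<r} \<Longrightarrow> \<phi> x = 0 \<and> deriv \<phi> x = 0"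
    using test_functionD(4)[OF \<phi> cd] by blast
  have sub: "{l..r} \<subseteq> {c<..<d}" using lr by auto
  have \<phi>p: "primitive_on {c<..<d} \<phi> (deriv \<phi>)"
    using test_functionD[OF \<phi>] by (intro primitive_on_C1) (auto intro: has_field_derivative_at_within)
  have i1: "set_integrable lborel {l..r} (\<lambda>x. F x * deriv \<phi> x)"
    using primitive_on_continuous_Icc[OF primitive_on_subset[OF F sub]] primitive_onD(1)[OF \<phi>p lr(2) sub]
    by (intro set_integrable_mult_continuous)
  have i2: "set_integrable lborel {l..r} (\<lambda>x. \<phi> x * g x)"
    using primitive_onD(1)[OF F lr(2) sub] test_functionD(2)[OF \<phi>]
    by (intro set_integrable_mult_continuous)
  have e: "(\<lambda>x. indicator {l..r} x *\<^sub>R (F x * deriv \<phi> x)) = (\<lambda>x. F x * deriv \<phi> x)"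
       "(\<lambda>x. indicator {l..r} x *\<^sub>R (\<phi> x * g x)) = (\<lambda>x. g x * \<phi> x)"
  proof -
    show "(\<lambda>x. indicator {l..r} x *\<^sub>R (F x * deriv \<phi> x)) = (\<lambda>x. F x * deriv \<phi> x)"
    proof
      show "indicator {l..r} x *\<^sub>R (F x * deriv \<phi> x) = F x * deriv \<phi> x" for x
        using out[of x] by (cases "x \<in> {l..r}") auto
    qed
    show "(\<lambda>x. indicator {l..r} x *\<^sub>R (\<phi> x * g x)) = (\<lambda>x. g x * \<phi> x)"
    proof
      show "indicator {l..r} x *\<^sub>R (\<phi> x * g x) = g x * \<phi> x" for x
        using out[of x] by (cases "x \<in> {l..r}") auto
    qed
  qed
  show "integrable lborel (\<lambda>x. F x * deriv \<phi> x)" "integrable lborel (\<lambda>x. g x * \<phi> x)"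
    using i1 i2 by (simp_all only: set_integrable_def e)
  have "\<phi> r = 0" "\<phi> l = 0" using out by auto
  then have h: "(LINT x:{l..r}|lborel. F x * deriv \<phi> x) + (LINT x:{l..r}|lborel. \<phi> x * g x) = 0"
    using primitive_onD(2)[OF primitive_on_mult[OF F \<phi>p] lr(2) sub] set_integral_add(2)[OF i1 i2] by simp
  have "(LINT x:{l..r}|lborel. F x * deriv \<phi> x) = (LINT x|lborel. F x * deriv \<phi> x)"
       "(LINT x:{l..r}|lborel. \<phi> x * g x) = (LINT x|lborel. g x * \<phi> x)"
    unfolding set_lebesgue_integral_def by (rule arg_cong[OF e(1)] arg_cong[OF e(2)])+
  with h show "(LINT x|lborel. F x * deriv \<phi> x) = - (LINT x|lborel. g x * \<phi> x)"
    by (metis eq_neg_iff_add_eq_0)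
qed

text \<open>Integrate g to some primitive F. By integration by parts f - F is annihilated by the
  derivatives of all members of \<open>tests\<close>, so it is almost everywhere constant, and the
  constant is added to F.\<close>

lemma primitive_of_tests:
  fixes f g :: "real \<Rightarrow> real"
  assumes cd: "c < d"
    and f: "\<And>x y. c < x \<Longrightarrow> x \<le> y \<Longrightarrow> y < d \<Longrightarrow> set_integrable lborel {x..y} f"
    and g: "\<And>x y. c < x \<Longrightarrow> x \<le> y \<Longrightarrow> y < d \<Longrightarrow> set_integrable lborel {x..y} g"
    and w: "\<And>\<phi>. \<phi> \<in> tests c d \<Longrightarrow> (LINT x|lborel. f x * deriv \<phi> x) = - (LINT x|lborel. g x * \<phi> x)"
  shows "\<exists>F. primitive_on {c<..<d} F g \<and> (AE x in lborel. x \<in> {c<..<d} \<longrightarrow> F x = f x)"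
proof -
  obtain m where m: "c < m" "m < d" using dense[OF cd] by auto
  obtain F where F: "primitive_on {c<..<d} F g" using exists_primitive_Ioo[OF g m] by blast
  have Fi: "set_integrable lborel {x..y} F" if "c < x" "x \<le> y" "y < d" for x y
    by (rule borel_integrable_atLeastAtMost', rule continuous_on_subset[OF primitive_on_continuous_Ioo[OF F]])
      (use that in auto)
  have "\<exists>k. AE x in lborel. x \<in> {c<..<d} \<longrightarrow> f x - F x = k"
  proof (rule AE_const_of_tests[OF cd])
    show "set_integrable lborel {x..y} (\<lambda>x. f x - F x)" if "c < x" "x \<le> y" "y < d" for x y
      using f[OF that] Fi[OF that] by (rule set_integral_diff)
    fix \<phi> assume \<phi>: "\<phi> \<in> tests c d"
    note t = tests_test_function[OF \<phi>]
    obtain l r where lr: "c < l" "l \<le> r" "r < d" and out: "\<And>x. x \<notin> {l<..<r} \<Longrightarrow> \<phi> x = 0 \<and> deriv \<phi> x = 0"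
      using test_functionD(4)[OF t cd] by blast
    have "set_integrable lborel {l..r} (\<lambda>x. deriv \<phi> x * f x)"
      using f[OF lr] test_functionD(3)[OF t] by (intro set_integrable_mult_continuous)
    moreover have "(\<lambda>x. indicator {l..r} x *\<^sub>R (deriv \<phi> x * f x)) = (\<lambda>x. f x * deriv \<phi> x)"
    proof
      show "indicator {l..r} x *\<^sub>R (deriv \<phi> x * f x) = f x * deriv \<phi> x" for x
        using out[of x] by (cases "x \<in> {l..r}") auto
    qed
    ultimately have "integrable lborel (\<lambda>x. f x * deriv \<phi> x)" by (simp only: set_integrable_def)
    then have "(LINT x|lborel. f x * deriv \<phi> x - F x * deriv \<phi> x) = 0"
      by (subst Bochner_Integration.integral_diff[OF _ primitive_on_test_function(1)[OF F t cd]])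
        (simp_all only: primitive_on_test_function(3)[OF F t cd] w[OF \<phi>] diff_self)
    then show "(LINT x|lborel. (f x - F x) * deriv \<phi> x) = 0" unfolding left_diff_distrib .
  qed
  then obtain k where k: "AE x in lborel. x \<in> {c<..<d} \<longrightarrow> f x - F x = k" by blast
  have "primitive_on {c<..<d} (\<lambda>x. F x + k) g" using F by (simp add: primitive_on_def)
  moreover have "AE x in lborel. x \<in> {c<..<d} \<longrightarrow> F x + k = f x" using k by eventually_elim auto
  ultimately show ?thesis by blast
qed

lemma primitive_on_unique_AE:
  assumes F: "primitive_on {c<..<d} F f" and G: "primitive_on {c<..<d} G g"
    and FG: "AE x in lborel. x \<in> {c<..<d} \<longrightarrow> F x = G x"
  shows "AE x in lborel. x \<in> {c<..<d} \<longrightarrow> f x = g x"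
proof -
  have eq: "F x = G x" if "x \<in> {c<..<d}" for x
    using AE_eq_continuous_Ioo[OF primitive_on_continuous_Ioo[OF F] primitive_on_continuous_Ioo[OF G] FG] that by auto
  have "AE x in lborel. x \<in> {c<..<d} \<longrightarrow> f x - g x = 0"
  proof (rule AE_zero_of_interval_integrals_on)
    fix x y assume xy: "c < x" "x \<le> y" "y < d"
    then have sub: "{x..y} \<subseteq> {c<..<d}" by auto
    note f = primitive_onD[OF F xy(2) sub] and g = primitive_onD[OF G xy(2) sub]
    show "set_integrable lborel {x..y} (\<lambda>x. f x - g x)" using f(1) g(1) by (rule set_integral_diff)
    show "(LINT z:{x..y}|lborel. f z - g z) = 0"
      using f(2) g(2) eq[of x] eq[of y] xy by (subst set_integral_diff(2)[OF f(1) g(1)]) simp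
  qed
  then show ?thesis by eventually_elim auto
qed

text \<open>Integrability of f up to the ends gives F limits there. The constant k makes the
  extension agree with F at the interior point m, hence throughout.\<close>

lemma primitive_on_extend:
  assumes F: "primitive_on {c<..<d} F f" and f: "set_integrable lborel {c..d} f" and cd: "c < d"
  shows "\<exists>G. primitive_on {c..d} G f \<and> (\<forall>x\<in>{c<..<d}. G x = F x)"
proof -
  obtain m where m: "c < m" "m < d" using dense[OF cd] by auto
  define k where "k = F m - (LINT z:{c..m}|lborel. f z)"
  let ?G = "\<lambda>x. k + (LINT z:{c..x}|lborel. f z)"
  have G: "primitive_on {c..d} ?G f" by (rule primitive_on_integral[OF f])
  have Gm: "?G m = F m" unfolding k_def by linarith
  have "?G x = F x" if x: "x \<in> {c<..<d}" for x
  proof (cases "x \<le> m")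
    case True
    have s: "{x..m} \<subseteq> {c<..<d}" "{x..m} \<subseteq> {c..d}" using x m by auto
    have "?G m - ?G x = F m - F x" by (rule trans[OF primitive_onD(2)[OF G True s(2)] primitive_onD(2)[OF F True s(1), symmetric]])
    then show ?thesis using Gm by linarith
  next
    case False
    have s: "m \<le> x" "{m..x} \<subseteq> {c<..<d}" "{m..x} \<subseteq> {c..d}" using x m False by auto
    have "?G x - ?G m = F x - F m" by (rule trans[OF primitive_onD(2)[OF G s(1,3)] primitive_onD(2)[OF F s(1,2), symmetric]])
    then show ?thesis using Gm by linarith
  qed
  then show ?thesis using G by blast
qed

subsection \<open>Translations and completeness in L2\<close>

lemma lborel_translate:
  fixes f :: "'a::euclidean_space \<Rightarrow> real"
  assumes m: "f \<in> borel_measurable borel"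
  shows "integrable lborel (\<lambda>z. f (v + z)) \<longleftrightarrow> integrable lborel f"
    and "(LINT z|lborel. f (v + z)) = (LINT z|lborel. f z)"
proof -
  have "integrable (distr lborel borel ((+) v)) f \<longleftrightarrow> integrable lborel (\<lambda>z. f (v + z))"
    using m by (intro integrable_distr_eq) auto
  then show "integrable lborel (\<lambda>z. f (v + z)) \<longleftrightarrow> integrable lborel f" by (simp add: lborel_distr_plus)
  have "integral\<^sup>L (distr lborel borel ((+) v)) f = (LINT z|lborel. f (v + z))"
    using m by (intro integral_distr) auto
  then show "(LINT z|lborel. f (v + z)) = (LINT z|lborel. f z)" by (simp add: lborel_distr_plus)
qed

text \<open>Openness makes \<open>v n + z\<close> stay in U eventually for each z in U, so the
  positive part of the difference tends to 0, dominated by the indicator of U. The indicator and its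
  translate have equal integrals, hence the L1 norm of their difference is twice the integral of
  that positive part.\<close>

lemma translate_open_tendsto:
  fixes U :: "'a::euclidean_space set"
  assumes U: "open U" "emeasure lborel U < \<infinity>" and v: "v \<longlonglongrightarrow> 0"
  shows "(\<lambda>n::nat. LINT z|lborel. \<bar>indicator U (v n + z) - indicator U z :: real\<bar>) \<longlonglongrightarrow> 0"
proof -
  let ?I = "indicator U :: 'a \<Rightarrow> real"
  have Um: "U \<in> sets borel" using U by auto
  have Im: "?I \<in> borel_measurable borel" using Um by auto
  have Ii: "integrable lborel ?I" using U Um by (intro integrable_real_indicator) auto
  have Ii': "integrable lborel (\<lambda>z. ?I (w + z))" and Ie: "(LINT z|lborel. ?I (w + z)) = (LINT z|lborel. ?I z)" for w
    using lborel_translate[OF Im] Ii by auto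
  have mI: "integrable lborel (\<lambda>z. max 0 (?I z - ?I (w + z)))" for w
    by (intro integrable_max Bochner_Integration.integrable_diff Ii Ii') auto
  have e: "(LINT z|lborel. \<bar>?I (w + z) - ?I z\<bar>) = 2 * (LINT z|lborel. max 0 (?I z - ?I (w + z)))" for w
  proof -
    have "(LINT z|lborel. \<bar>?I (w + z) - ?I z\<bar>) = (LINT z|lborel. 2 * max 0 (?I z - ?I (w + z)) - (?I z - ?I (w + z)))"
      by (rule Bochner_Integration.integral_cong) (auto simp: max_def)
    also have "\<dots> = 2 * (LINT z|lborel. max 0 (?I z - ?I (w + z))) - ((LINT z|lborel. ?I z) - (LINT z|lborel. ?I (w + z)))"
      using Ii Ii' mI by simp
    finally show ?thesis by (simp add: Ie)
  qed
  have "(\<lambda>n. LINT z|lborel. max 0 (?I z - ?I (v n + z))) \<longlonglongrightarrow> (LINT z|(lborel::'a measure). 0)"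
  proof (rule integral_dominated_convergence[where w="?I"])
    show "AE z in lborel. (\<lambda>n. max 0 (?I z - ?I (v n + z))) \<longlonglongrightarrow> 0"
    proof (rule AE_I2)
      fix z
      show "(\<lambda>n. max 0 (?I z - ?I (v n + z))) \<longlonglongrightarrow> 0"
      proof (cases "z \<in> U")
        case True
        have "(\<lambda>n. v n + z) \<longlonglongrightarrow> 0 + z" by (intro tendsto_intros v)
        then have "\<forall>\<^sub>F n in sequentially. v n + z \<in> U" using U True by (auto dest: topological_tendstoD)
        then have "\<forall>\<^sub>F n in sequentially. max 0 (?I z - ?I (v n + z)) = 0" by eventually_elim (use True in auto)
        then show ?thesis by (rule tendsto_eventually)
      qed auto
    qed
    show "AE z in lborel. norm (max 0 (?I z - ?I (v n + z))) \<le> ?I z" for n by (auto simp: indicator_def)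
    show "(\<lambda>z. max 0 (?I z - ?I (v n + z))) \<in> borel_measurable lborel" for n using mI by (rule borel_measurable_integrable)
  qed (use Ii in auto)
  then show ?thesis unfolding e by (auto intro!: tendsto_mult_right_zero)
qed

text \<open>A density argument: the functions with this property are closed under L1 limits
  (\<open>approx\<close>). They include indicators of open sets, by outer regularity those of Borel
  sets of finite measure, and thus all integrable functions.\<close>

lemma translate_L1_tendsto:
  fixes f :: "'a::euclidean_space \<Rightarrow> real"
  assumes f: "integrable lborel f" and v: "v \<longlonglongrightarrow> 0"
  shows "(\<lambda>n::nat. LINT z|lborel. \<bar>f (v n + z) - f z\<bar>) \<longlonglongrightarrow> 0"
proof -
  define \<Delta> where "\<Delta> f n = (LINT z|lborel. \<bar>f (v n + z) - f z\<bar>)" for f :: "'a \<Rightarrow> real" and n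
  have ti: "integrable lborel (\<lambda>z. f (w + z))" if "integrable lborel f" for f :: "'a \<Rightarrow> real" and w
    using that lborel_translate(1)[of f w] by auto
  have \<Delta>i: "integrable lborel (\<lambda>z. \<bar>f (v n + z) - f z\<bar>)" if "integrable lborel f" for f :: "'a \<Rightarrow> real" and n
    using ti[OF that] that by auto
  have tri: "\<Delta> f n \<le> \<Delta> g n + 2 * (LINT z|lborel. \<bar>f z - g z\<bar>)"
    if f: "integrable lborel f" and g: "integrable lborel g" for f g :: "'a \<Rightarrow> real" and n
  proof -
    have d: "integrable lborel (\<lambda>z. \<bar>f z - g z\<bar>)" using f g by auto
    have d': "integrable lborel (\<lambda>z. \<bar>f (v n + z) - g (v n + z)\<bar>)" by (rule ti[OF d])
    have "\<Delta> f n \<le> (LINT z|lborel. \<bar>g (v n + z) - g z\<bar> + \<bar>f (v n + z) - g (v n + z)\<bar> + \<bar>f z - g z\<bar>)"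
      unfolding \<Delta>_def using \<Delta>i[OF f] \<Delta>i[OF g] d d'
      by (intro Bochner_Integration.integral_mono Bochner_Integration.integrable_add) auto
    also have "\<dots> = \<Delta> g n + (LINT z|lborel. \<bar>f (v n + z) - g (v n + z)\<bar>) + (LINT z|lborel. \<bar>f z - g z\<bar>)"
      using \<Delta>i[OF g] d d' by (simp add: \<Delta>_def)
    also have "(LINT z|lborel. \<bar>f (v n + z) - g (v n + z)\<bar>) = (LINT z|lborel. \<bar>f z - g z\<bar>)"
      by (rule lborel_translate(2)[of "\<lambda>z. \<bar>f z - g z\<bar>"]) (use d in auto)
    finally show ?thesis by simp
  qed
  have \<Delta>0: "\<Delta> f n \<ge> 0" for f n by (simp add: \<Delta>_def)
  \<comment> \<open>Translation invariance of the integral lets an approximation error count exactly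
    twice, once at the shifted and once at the original point.\<close>
  have approx: "\<Delta> f \<longlonglongrightarrow> 0"
    if f: "integrable lborel f" and ap: "\<And>e. e > 0 \<Longrightarrow> \<exists>g. integrable lborel g \<and> \<Delta> g \<longlonglongrightarrow> 0 \<and> (LINT z|lborel. \<bar>f z - g z\<bar>) < e" for f :: "'a \<Rightarrow> real"
  proof (rule LIMSEQ_I)
    fix e :: real assume e: "e > 0"
    obtain g where g: "integrable lborel g" "\<Delta> g \<longlonglongrightarrow> 0" "(LINT z|lborel. \<bar>f z - g z\<bar>) < e / 4" using ap[of "e / 4"] e by auto
    obtain N where N: "\<And>n. n \<ge> N \<Longrightarrow> \<Delta> g n < e / 2"
      using LIMSEQ_D[OF g(2), of "e / 2"] e \<Delta>0 by auto
    show "\<exists>N. \<forall>n\<ge>N. norm (\<Delta> f n - 0) < e"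
    proof (rule exI[of _ N], intro allI impI)
      fix n assume "n \<ge> N"
      then show "norm (\<Delta> f n - 0) < e" using tri[OF f g(1), of n] N[of n] g(3) \<Delta>0[of f n] by simp
    qed
  qed
  have "\<Delta> f \<longlonglongrightarrow> 0" using f
  proof (induction rule: integrable_induct)
    case (base A c)
    have A: "A \<in> sets borel" "emeasure lborel A < \<infinity>" using base by auto
    have ind: "\<Delta> (indicator A) \<longlonglongrightarrow> 0"
    proof (rule approx)
      show Ai: "integrable lborel (indicator A :: 'a \<Rightarrow> real)" using A by (intro integrable_real_indicator) auto
      fix e :: real assume e: "e > 0"
      obtain U where U: "open U" "A \<subseteq> U" "U - A \<in> lmeasurable" "emeasure lebesgue (U - A) < ennreal e"
        using sets_lebesgue_outer_open[of A e] e A by auto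
      have UA: "U - A \<in> sets borel" using A U by auto
      have eUA: "emeasure lborel (U - A) < ennreal e" using U UA by simp
      have "emeasure lborel U \<le> emeasure lborel A + emeasure lborel (U - A)"
        using emeasure_subadditive[of A lborel "U - A"] A UA U(2) by (simp add: Un_absorb1)
      also have "\<dots> < \<infinity>" using A eUA by (auto simp: ennreal_add_less_top intro: order.strict_trans[OF _ ennreal_less_top])
      finally have Uf: "emeasure lborel U < \<infinity>" .
      have "(LINT z|lborel. \<bar>indicator A z - indicator U z :: real\<bar>) = (LINT z|lborel. indicator (U - A) z)"
        by (rule Bochner_Integration.integral_cong) (use U(2) in \<open>auto simp: indicator_def\<close>)
      also have "\<dots> = measure lborel (U - A)" using UA by simp
      also have "\<dots> < e" using eUA e by (metis enn2real_ennreal enn2real_mono ennreal_less_top less_eq_real_def measure_def emeasure_eq_ennreal_measure ennreal_less_iff measure_nonneg not_less_iff_gr_or_eq order_less_irrefl top.not_eq_extremum order.strict_trans)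
      finally show "\<exists>g. integrable lborel g \<and> \<Delta> g \<longlonglongrightarrow> 0 \<and> (LINT z|lborel. \<bar>indicator A z - g z\<bar>) < e"
        using translate_open_tendsto[OF U(1) Uf v] U(1) Uf unfolding \<Delta>_def
        by (intro exI[of _ "indicator U"] conjI integrable_real_indicator) auto
    qed
    have "\<Delta> (\<lambda>x. indicator A x *\<^sub>R c) n = \<bar>c\<bar> * \<Delta> (indicator A) n" for n
    proof -
      have "\<bar>indicator A (v n + z) *\<^sub>R c - indicator A z *\<^sub>R c\<bar> = \<bar>c\<bar> * \<bar>indicator A (v n + z) - indicator A z\<bar>" for z
        by (auto simp: indicator_def)
      then show ?thesis by (simp add: \<Delta>_def)
    qed
    then show ?case using ind by (auto intro!: tendsto_mult_right_zero)
  next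
    case (add f g)
    have "(\<lambda>n. \<Delta> f n + \<Delta> g n) \<longlonglongrightarrow> 0" using tendsto_add[OF add.IH] by simp
    then show ?case
    proof (rule Lim_null_comparison[rotated])
      show "\<forall>\<^sub>F n in sequentially. norm (\<Delta> (\<lambda>x. f x + g x) n) \<le> \<Delta> f n + \<Delta> g n"
      proof (rule always_eventually, rule allI)
        fix n
        have "\<Delta> (\<lambda>x. f x + g x) n \<le> (LINT z|lborel. \<bar>f (v n + z) - f z\<bar> + \<bar>g (v n + z) - g z\<bar>)"
          unfolding \<Delta>_def using \<Delta>i[OF add.hyps(1)] \<Delta>i[OF add.hyps(2)] \<Delta>i[of "\<lambda>x. f x + g x" n] add.hyps
          by (intro Bochner_Integration.integral_mono) auto
        also have "\<dots> = \<Delta> f n + \<Delta> g n" using \<Delta>i[OF add.hyps(1)] \<Delta>i[OF add.hyps(2)] by (simp add: \<Delta>_def)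
        finally show "norm (\<Delta> (\<lambda>x. f x + g x) n) \<le> \<Delta> f n + \<Delta> g n" using \<Delta>0 by simp
      qed
    qed
  next
    case (lim f s)
    show ?case
    proof (rule approx[OF lim.hyps(4)])
      fix e :: real assume e: "e > 0"
      have "(\<lambda>i. LINT z|lborel. \<bar>f z - s i z\<bar>) \<longlonglongrightarrow> (LINT z|(lborel::'a measure). 0)"
      proof (rule integral_dominated_convergence[where w="\<lambda>z. 3 * \<bar>f z\<bar>"])
        show "AE z in lborel. (\<lambda>i. \<bar>f z - s i z\<bar>) \<longlonglongrightarrow> 0"
        proof (rule AE_I2)
          fix z
          have "(\<lambda>i. \<bar>f z - s i z\<bar>) \<longlonglongrightarrow> \<bar>f z - f z\<bar>" by (intro tendsto_intros lim.hyps(2)) auto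
          then show "(\<lambda>i. \<bar>f z - s i z\<bar>) \<longlonglongrightarrow> 0" by simp
        qed
        show "AE z in lborel. norm \<bar>f z - s i z\<bar> \<le> 3 * \<bar>f z\<bar>" for i
        proof (rule AE_I2)
          fix z
          show "norm \<bar>f z - s i z\<bar> \<le> 3 * \<bar>f z\<bar>" using lim.hyps(3)[of z i] by simp
        qed
        show "(\<lambda>z. \<bar>f z - s i z\<bar>) \<in> borel_measurable lborel" for i using lim.hyps(1)[of i] lim.hyps(4) by auto
      qed (use lim.hyps(4) in auto)
      then have "\<forall>\<^sub>F i in sequentially. (LINT z|lborel. \<bar>f z - s i z\<bar>) < e"
        using e by (intro order_tendstoD(2)) auto
      then obtain i where "(LINT z|lborel. \<bar>f z - s i z\<bar>) < e" using eventually_happens'[OF sequentially_bot] by blast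
      then show "\<exists>g. integrable lborel g \<and> \<Delta> g \<longlonglongrightarrow> 0 \<and> (LINT z|lborel. \<bar>f z - g z\<bar>) < e"
        using lim.hyps(1) lim.IH by blast
    qed
  qed
  then have "(\<lambda>n. \<Delta> f n) \<longlonglongrightarrow> 0" .
  then show ?thesis unfolding \<Delta>_def .
qed

text \<open>The signed square f |f| of an L2 function is in L1, and by this inequality its L1
  translation error controls the L2 translation error of f. The factor 2 is for arguments of
  opposite sign.\<close>

lemma diff_sq_le_signed_sq: "(a - b)^2 \<le> 2 * \<bar>a * \<bar>a\<bar> - b * \<bar>b\<bar>\<bar>" for a b :: real
proof -
  have *: "(a - b)^2 \<le> 2 * \<bar>a * \<bar>a\<bar> - b * \<bar>b\<bar>\<bar>" if "a \<ge> 0" for a b :: real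
  proof (cases "b \<ge> 0")
    case True
    have "(a - b)^2 = \<bar>a - b\<bar> * \<bar>a - b\<bar>" by (simp add: power2_eq_square)
    also have "\<dots> \<le> \<bar>a - b\<bar> * (a + b)" using True that by (intro mult_left_mono) auto
    also have "\<dots> = \<bar>a * \<bar>a\<bar> - b * \<bar>b\<bar>\<bar>" using True that by (simp add: abs_mult[symmetric] square_diff_square_factored mult.commute flip: abs_mult_pos)
    finally have "(a - b)^2 \<le> \<bar>a * \<bar>a\<bar> - b * \<bar>b\<bar>\<bar>" .
    then show ?thesis by (rule order_trans) simp
  next
    case False
    have "0 \<le> (a + b)^2" by simp
    then have "(a - b)^2 \<le> 2 * (a * a + b * b)" by (simp add: power2_eq_square algebra_simps)
    then show ?thesis using False that by (auto simp: abs_if)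
  qed
  show ?thesis
  proof (cases "a \<ge> 0")
    case False
    then show ?thesis using *[of "- a" "- b"] by (simp add: power2_commute abs_minus_commute add.commute)
  qed (rule *)
qed

lemma translate_L2_tendsto:
  fixes f :: "'a::euclidean_space \<Rightarrow> real"
  assumes f: "integrable lborel (\<lambda>z. (f z)^2)" "f \<in> borel_measurable borel" and v: "v \<longlonglongrightarrow> 0"
  shows "(\<lambda>n::nat. LINT z|lborel. (f (v n + z) - f z)^2) \<longlonglongrightarrow> 0"
proof -
  define F where "F = (\<lambda>z. f z * \<bar>f z\<bar>)"
  have F: "integrable lborel F" unfolding F_def
    by (rule Bochner_Integration.integrable_bound[OF f(1)]) (use f(2) in \<open>auto simp: abs_mult power2_eq_square\<close>)
  have "(\<lambda>n. 2 * (LINT z|lborel. \<bar>F (v n + z) - F z\<bar>)) \<longlonglongrightarrow> 0"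
    by (intro tendsto_mult_right_zero translate_L1_tendsto F v)
  then show ?thesis
  proof (rule Lim_null_comparison[rotated], intro always_eventually allI)
    fix n
    have "integrable lborel (\<lambda>z. F (v n + z))" using lborel_translate(1)[of F] F by auto
    then have i: "integrable lborel (\<lambda>z. 2 * \<bar>F (v n + z) - F z\<bar>)" using F by auto
    have "(LINT z|lborel. (f (v n + z) - f z)^2) \<le> (LINT z|lborel. 2 * \<bar>F (v n + z) - F z\<bar>)"
      by (rule Bochner_Integration.integral_mono'[OF i]) (auto simp: F_def diff_sq_le_signed_sq)
    then show "norm (LINT z|lborel. (f (v n + z) - f z)^2) \<le> 2 * (LINT z|lborel. \<bar>F (v n + z) - F z\<bar>)" by simp
  qed
qed

text \<open>The form uniform in v: a difference quotient with step h averages over all shifts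
  between 0 and h at once.\<close>

lemma translate_L2_small:
  fixes f :: "'a::euclidean_space \<Rightarrow> real"
  assumes f: "integrable lborel (\<lambda>z. (f z)^2)" "f \<in> borel_measurable borel" and e: "e > 0"
  shows "\<exists>\<delta>>0. \<forall>v. norm v < \<delta> \<longrightarrow> (LINT z|lborel. (f (v + z) - f z)^2) < e"
proof (rule ccontr)
  assume "\<not> ?thesis"
  then have "\<forall>\<delta>>0. \<exists>v. norm v < \<delta> \<and> \<not> (LINT z|lborel. (f (v + z) - f z)^2) < e" by auto
  then have "\<forall>n::nat. \<exists>v. norm v < 1 / real (Suc n) \<and> \<not> (LINT z|lborel. (f (v + z) - f z)^2) < e" by simp
  then obtain v where "\<forall>n::nat. norm (v n) < 1 / real (Suc n) \<and> \<not> (LINT z|lborel. (f (v n + z) - f z)^2) < e"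
    by (rule choice[THEN exE])
  then have v: "\<And>n::nat. norm (v n) < 1 / real (Suc n)" "\<And>n. \<not> (LINT z|lborel. (f (v n + z) - f z)^2) < e" by auto
  have "v \<longlonglongrightarrow> 0"
    by (rule Lim_null_comparison[OF _ LIMSEQ_Suc[OF lim_1_over_n]]) (use v(1) in \<open>auto intro!: always_eventually less_imp_le\<close>)
  from translate_L2_tendsto[OF f this] have "\<forall>\<^sub>F n in sequentially. (LINT z|lborel. (f (v n + z) - f z)^2) < e"
    using e by (intro order_tendstoD(2))
  then show False using v(2) eventually_happens' by (metis (mono_tags, lifting) eventually_sequentially order_refl)
qed

text \<open>Riesz-Fischer. Along \<open>r\<close> the squared gaps are below 8^-j. Multiplied by 2^j
  they are still summable, which forces |f (r (j+1)) - f (r j)| \<le> 2^(-j/2) eventually at almost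
  every point and so pointwise convergence. Fatou's lemma then bounds the norm distance of the whole
  sequence to the limit.\<close>

lemma L2_complete:
  fixes f :: "nat \<Rightarrow> 'a \<Rightarrow> real"
  assumes f: "\<And>n. f n \<in> borel_measurable M" "\<And>n. integrable M (\<lambda>x. (f n x)^2)"
    and C: "\<And>e. e > 0 \<Longrightarrow> \<exists>N. \<forall>n\<ge>N. \<forall>k\<ge>n. (LINT x|M. (f n x - f k x)^2) < e"
  shows "\<exists>g. g \<in> borel_measurable M \<and> (\<forall>n. integrable M (\<lambda>x. (f n x - g x)^2)) \<and> (\<lambda>n. LINT x|M. (f n x - g x)^2) \<longlonglongrightarrow> 0"
proof -
  have di: "integrable M (\<lambda>x. (f n x - f k x)^2)" for n k
  proof (rule Bochner_Integration.integrable_bound)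
    show "integrable M (\<lambda>x. 2 * (f n x)^2 + 2 * (f k x)^2)" using f by auto
    have "(u - v)^2 \<le> 2 * u^2 + 2 * v^2" for u v :: real
      using zero_le_power2[of "u + v"] by (simp add: power2_sum power2_diff)
    then show "AE x in M. norm ((f n x - f k x)^2) \<le> norm (2 * (f n x)^2 + 2 * (f k x)^2)" by auto
  qed (use f in auto)
  define N where "N e = (SOME N. \<forall>n\<ge>N. \<forall>k\<ge>n. (LINT x|M. (f n x - f k x)^2) < e)" for e
  have N: "(LINT x|M. (f n x - f k x)^2) < e" if "e > 0" "n \<ge> N e" "k \<ge> n" for e n k
    using someI_ex[OF C[OF that(1)]] that unfolding N_def by auto
  define r where "r = rec_nat (N 1) (\<lambda>j m. max (Suc m) (N ((1/8) ^ Suc j)))"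
  have r0: "r 0 = N 1" and rS: "r (Suc j) = max (Suc (r j)) (N ((1/8) ^ Suc j))" for j by (auto simp: r_def)
  have rN: "r j \<ge> N ((1/8) ^ j)" for j by (cases j) (auto simp: r0 rS)
  have rmono: "strict_mono r" by (rule strict_monoI_Suc) (simp add: rS)
  have step: "(LINT x|M. (f (r j) x - f (r i) x)^2) < (1/8) ^ j" if "i \<ge> j" for i j
    using N[of "(1/8) ^ j" "r j" "r i"] rN rmono that by (auto simp: strict_mono_less_eq)
  have "summable (\<lambda>j. LINT x|M. norm (2 ^ j * (f (r (Suc j)) x - f (r j) x)^2))"
  proof (rule summable_comparison_test)
    show "summable (\<lambda>j. (1/4 :: real) ^ j)" by (rule summable_geometric) auto
    have "(LINT x|M. 2 ^ j * (f (r (Suc j)) x - f (r j) x)^2) \<le> (1/4) ^ j" for j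
    proof -
      have "(LINT x|M. 2 ^ j * (f (r (Suc j)) x - f (r j) x)^2) = 2 ^ j * (LINT x|M. (f (r j) x - f (r (Suc j)) x)^2)"
        by (simp add: power2_commute)
      also have "\<dots> \<le> 2 ^ j * (1/8) ^ j" using step[of j "Suc j"] by (intro mult_left_mono) auto
      also have "\<dots> = (1/4) ^ j" by (simp flip: power_mult_distrib)
      finally show ?thesis .
    qed
    then show "\<exists>N. \<forall>n\<ge>N. norm (LINT x|M. norm (2 ^ n * (f (r (Suc n)) x - f (r n) x)^2)) \<le> (1/4) ^ n" by auto
  qed
  note sum = this
  have wi: "integrable M (\<lambda>x. 2 ^ j * (f (r (Suc j)) x - f (r j) x)^2)" for j using di by auto
  have "(\<integral>\<^sup>+x. (\<Sum>j. ennreal (2 ^ j * (f (r (Suc j)) x - f (r j) x)^2)) \<partial>M) \<noteq> \<infinity>"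
  proof -
    have "(\<integral>\<^sup>+x. (\<Sum>j. ennreal (2 ^ j * (f (r (Suc j)) x - f (r j) x)^2)) \<partial>M) = (\<Sum>j. \<integral>\<^sup>+x. ennreal (2 ^ j * (f (r (Suc j)) x - f (r j) x)^2) \<partial>M)"
      using wi by (intro nn_integral_suminf) auto
    also have "\<dots> = (\<Sum>j. ennreal (LINT x|M. norm (2 ^ j * (f (r (Suc j)) x - f (r j) x)^2)))"
    proof (rule suminf_cong)
      fix j
      show "(\<integral>\<^sup>+x. ennreal (2 ^ j * (f (r (Suc j)) x - f (r j) x)^2) \<partial>M) = ennreal (LINT x|M. norm (2 ^ j * (f (r (Suc j)) x - f (r j) x)^2))"
        using nn_integral_eq_integral[OF wi[of j]] by simp
    qed
    also have "\<dots> = ennreal (\<Sum>j. LINT x|M. norm (2 ^ j * (f (r (Suc j)) x - f (r j) x)^2))"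
      using sum by (intro suminf_ennreal2) auto
    finally show ?thesis by simp
  qed
  then have "AE x in M. (\<Sum>j. ennreal (2 ^ j * (f (r (Suc j)) x - f (r j) x)^2)) \<noteq> \<infinity>"
    using wi by (intro nn_integral_PInf_AE) auto
  then have conv: "AE x in M. convergent (\<lambda>j. f (r j) x)"
  proof eventually_elim
    case (elim x)
    have "summable (\<lambda>j. 2 ^ j * (f (r (Suc j)) x - f (r j) x)^2)"
      using elim by (intro summable_suminf_not_top) auto
    then have "(\<lambda>j. 2 ^ j * (f (r (Suc j)) x - f (r j) x)^2) \<longlonglongrightarrow> 0" by (rule summable_LIMSEQ_zero)
    then have ev: "\<forall>\<^sub>F j in sequentially. 2 ^ j * (f (r (Suc j)) x - f (r j) x)^2 < 1" by (rule order_tendstoD) auto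
    have "summable (\<lambda>j. f (r (Suc j)) x - f (r j) x)"
    proof (rule summable_comparison_test_ev)
      show "summable (\<lambda>j. (1 / sqrt 2) ^ j)" by (rule summable_geometric) auto
      show "\<forall>\<^sub>F j in sequentially. norm (f (r (Suc j)) x - f (r j) x) \<le> (1 / sqrt 2) ^ j"
        using ev
      proof eventually_elim
        case (elim j)
        have "(f (r (Suc j)) x - f (r j) x)^2 \<le> 1 / 2 ^ j" using elim by (simp add: field_simps)
        also have "1 / 2 ^ j = ((1 / sqrt 2) ^ j)^2"
        proof -
          have "((1 / sqrt 2) ^ j)^2 = ((1 / sqrt 2 :: real)^2) ^ j" by (simp only: power_mult[symmetric] mult.commute)
          also have "(1 / sqrt 2 :: real)^2 = 1 / 2" by (simp add: power_divide)
          finally show ?thesis by (simp add: power_one_over)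
        qed
        finally have "\<bar>f (r (Suc j)) x - f (r j) x\<bar> \<le> \<bar>(1 / sqrt 2) ^ j\<bar>" unfolding abs_le_square_iff .
        then show ?case by simp
      qed
    qed
    then have "convergent (\<lambda>n. \<Sum>j<n. f (r (Suc j)) x - f (r j) x)" by (rule summable_iff_convergent[THEN iffD1])
    then have "convergent (\<lambda>n. f (r n) x - f (r 0) x)" unfolding sum_lessThan_telescope[of "\<lambda>j. f (r j) x"] .
    then have "convergent (\<lambda>n. (f (r n) x - f (r 0) x) + f (r 0) x)" by (intro convergent_add convergent_const)
    then show ?case by simp
  qed
  define g where "g x = lim (\<lambda>j. f (r j) x)" for x
  have gm: "g \<in> borel_measurable M" unfolding g_def using f by (intro borel_measurable_lim_metric)
  have glim: "AE x in M. (\<lambda>j. f (r j) x) \<longlonglongrightarrow> g x" using conv by eventually_elim (simp add: g_def convergent_LIMSEQ_iff)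
  have bound: "(\<integral>\<^sup>+x. ennreal ((f n x - g x)^2) \<partial>M) \<le> ennreal e" if e: "e > 0" and n: "n \<ge> N e" for n e
  proof -
    have "(\<integral>\<^sup>+x. ennreal ((f n x - g x)^2) \<partial>M) = (\<integral>\<^sup>+x. liminf (\<lambda>j. ennreal ((f n x - f (r j) x)^2)) \<partial>M)"
    proof (rule nn_integral_cong_AE, use glim in eventually_elim)
      case (elim x)
      have "(\<lambda>j. ennreal ((f n x - f (r j) x)^2)) \<longlonglongrightarrow> ennreal ((f n x - g x)^2)"
        by (intro tendsto_intros elim)
      then have "liminf (\<lambda>j. ennreal ((f n x - f (r j) x)^2)) = ennreal ((f n x - g x)^2)"
        by (intro lim_imp_Liminf) auto
      then show ?case by (rule sym)
    qed
    also have "\<dots> \<le> liminf (\<lambda>j. \<integral>\<^sup>+x. ennreal ((f n x - f (r j) x)^2) \<partial>M)"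
      using f by (intro nn_integral_liminf) auto
    also have "\<dots> = liminf (\<lambda>j. ennreal (LINT x|M. (f n x - f (r j) x)^2))"
      using di by (subst nn_integral_eq_integral) auto
    also have "\<dots> \<le> ennreal e"
    proof (rule Liminf_le)
      have "\<forall>\<^sub>F j in sequentially. n \<le> r j"
        using rmono by (meson eventually_sequentiallyI order_trans seq_suble)
      then show "\<forall>\<^sub>F j in sequentially. ennreal (LINT x|M. (f n x - f (r j) x)^2) \<le> ennreal e"
        by eventually_elim (rule ennreal_leI[OF less_imp_le[OF N[OF e n]]])
    qed auto
    finally show ?thesis .
  qed
  have fgi: "integrable M (\<lambda>x. (f n x - g x)^2)" if "n \<ge> N 1" for n
    using bound[of 1 n] that f gm by (auto simp: integrable_iff_bounded intro: order.strict_trans1)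
  have fgi': "integrable M (\<lambda>x. (f n x - g x)^2)" for n
  proof (rule Bochner_Integration.integrable_bound)
    show "integrable M (\<lambda>x. 2 * (f n x - f (N 1) x)^2 + 2 * (f (N 1) x - g x)^2)" using di fgi by auto
    have "(u + v)^2 \<le> 2 * u^2 + 2 * v^2" for u v :: real
      using zero_le_power2[of "u - v"] by (simp add: power2_sum power2_diff)
    from this[of "f n x - f (N 1) x" "f (N 1) x - g x" for x]
    have "(f n x - g x)^2 \<le> 2 * (f n x - f (N 1) x)^2 + 2 * (f (N 1) x - g x)^2" for x by simp
    then show "AE x in M. norm ((f n x - g x)^2) \<le> norm (2 * (f n x - f (N 1) x)^2 + 2 * (f (N 1) x - g x)^2)" by auto
  qed (use f gm in auto)
  moreover have "(\<lambda>n. LINT x|M. (f n x - g x)^2) \<longlonglongrightarrow> 0"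
  proof (rule LIMSEQ_I)
    fix e :: real assume e: "e > 0"
    have "(LINT x|M. (f n x - g x)^2) < e" if "n \<ge> N (e / 2)" for n
    proof -
      have "ennreal (LINT x|M. (f n x - g x)^2) \<le> ennreal (e / 2)"
        using bound[of "e / 2" n] e that fgi'[of n] by (subst nn_integral_eq_integral[symmetric]) auto
      then show ?thesis using e by (simp add: ennreal_le_iff)
    qed
    then show "\<exists>no. \<forall>n\<ge>no. norm ((LINT x|M. (f n x - g x)^2) - 0) < e" by auto
  qed
  ultimately show ?thesis using gm by blast
qed

lemma L2_product_tendsto:
  fixes F G :: "'a \<Rightarrow> real"
  assumes Fn: "\<And>n. Fn n \<in> borel_measurable M" "\<And>n. integrable M (\<lambda>x. (Fn n x - F x)^2)" "(\<lambda>n. LINT x|M. (Fn n x - F x)^2) \<longlonglongrightarrow> 0"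
    and Gn: "\<And>n. Gn n \<in> borel_measurable M" "\<And>n. integrable M (\<lambda>x. (Gn n x - G x)^2)" "(\<lambda>n. LINT x|M. (Gn n x - G x)^2) \<longlonglongrightarrow> 0"
    and F: "F \<in> borel_measurable M" "integrable M (\<lambda>x. (F x)^2)"
    and G: "G \<in> borel_measurable M" "integrable M (\<lambda>x. (G x)^2)"
  shows "(\<lambda>n::nat. LINT x|M. Fn n x * Gn n x) \<longlonglongrightarrow> (LINT x|M. F x * G x)"
proof -
  have m1: "(\<lambda>x. Fn n x - F x) \<in> borel_measurable M" "(\<lambda>x. Gn n x - G x) \<in> borel_measurable M" for n
    using Fn(1) Gn(1) F(1) G(1) by auto
  have sq: "(\<lambda>n. LINT x|M. f n x * g n x) \<longlonglongrightarrow> 0"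
    if f: "\<And>n. f n \<in> borel_measurable M" "\<And>n. integrable M (\<lambda>x. (f n x)^2)"
      and g: "\<And>n. g n \<in> borel_measurable M" "\<And>n. integrable M (\<lambda>x. (g n x)^2)"
      and l: "(\<lambda>n. (LINT x|M. (f n x)^2) * (LINT x|M. (g n x)^2)) \<longlonglongrightarrow> 0" for f g :: "nat \<Rightarrow> 'a \<Rightarrow> real"
  proof -
    have "(\<lambda>n. (LINT x|M. f n x * g n x)^2) \<longlonglongrightarrow> 0"
      by (rule Lim_null_comparison[OF _ l])
        (use integral_Cauchy_Schwarz(2)[OF f(2) g(2) f(1) g(1)] in \<open>auto intro!: always_eventually\<close>)
    then have "(\<lambda>n. sqrt ((LINT x|M. f n x * g n x)^2)) \<longlonglongrightarrow> sqrt 0" by (rule tendsto_real_sqrt)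
    then show ?thesis by (simp add: tendsto_rabs_zero_iff)
  qed
  have l1: "(\<lambda>n. LINT x|M. (Fn n x - F x) * (Gn n x - G x)) \<longlonglongrightarrow> 0"
    by (rule sq) (use m1 Fn(2) Gn(2) tendsto_mult[OF Fn(3) Gn(3)] in auto)
  have l2: "(\<lambda>n. LINT x|M. (Fn n x - F x) * G x) \<longlonglongrightarrow> 0"
    by (rule sq) (use m1 Fn(2) G tendsto_mult_left_zero[OF Fn(3)] in auto)
  have l3: "(\<lambda>n. LINT x|M. F x * (Gn n x - G x)) \<longlonglongrightarrow> 0"
    by (rule sq) (use m1 F Gn(2) tendsto_mult_right_zero[OF Gn(3)] in auto)
  have e: "(LINT x|M. Fn n x * Gn n x) = (LINT x|M. (Fn n x - F x) * (Gn n x - G x)) + (LINT x|M. (Fn n x - F x) * G x)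
      + (LINT x|M. F x * (Gn n x - G x)) + (LINT x|M. F x * G x)" for n
  proof -
    have i: "integrable M (\<lambda>x. (Fn n x - F x) * (Gn n x - G x))" "integrable M (\<lambda>x. (Fn n x - F x) * G x)"
      "integrable M (\<lambda>x. F x * (Gn n x - G x))" "integrable M (\<lambda>x. F x * G x)"
      by (rule integral_Cauchy_Schwarz; use m1 Fn(2) Gn(2) F G in auto)+
    have "(LINT x|M. Fn n x * Gn n x) = (LINT x|M. ((Fn n x - F x) * (Gn n x - G x) + (Fn n x - F x) * G x)
      + (F x * (Gn n x - G x) + F x * G x))"
      by (rule Bochner_Integration.integral_cong) (auto simp: algebra_simps)
    also have "\<dots> = (LINT x|M. (Fn n x - F x) * (Gn n x - G x)) + (LINT x|M. (Fn n x - F x) * G x)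
      + ((LINT x|M. F x * (Gn n x - G x)) + (LINT x|M. F x * G x))"
      using i by (subst Bochner_Integration.integral_add) auto
    finally show ?thesis by simp
  qed
  show ?thesis unfolding e
    using tendsto_add[OF tendsto_add[OF tendsto_add[OF l1 l2] l3] tendsto_const] by simp
qed

subsection \<open>Energy identities for the degenerate evolution\<close>

lemma lborel_Fubini_fst:
  fixes f :: "real \<times> real \<Rightarrow> real"
  assumes "integrable lborel f"
  shows "AE x in lborel. integrable lborel (\<lambda>t. f (x, t))"
    and "integrable lborel (\<lambda>x. LINT t|lborel. f (x, t))"
    and "(LINT x|lborel. LINT t|lborel. f (x, t)) = (LINT z|lborel. f z)"
  using lborel_pair.AE_integrable_fst'[of f] lborel_pair.integrable_fst'[of f] lborel_pair.integral_fst'[of f] assms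
  by (simp_all add: lborel_prod)

lemma lborel_Fubini_snd:
  fixes f :: "real \<times> real \<Rightarrow> real"
  assumes "integrable lborel f"
  shows "AE t in lborel. integrable lborel (\<lambda>x. f (x, t))"
    and "integrable lborel (\<lambda>t. LINT x|lborel. f (x, t))"
    and "(LINT t|lborel. LINT x|lborel. f (x, t)) = (LINT z|lborel. f z)"
  using lborel_pair.AE_integrable_snd[of "\<lambda>x t. f (x, t)"] lborel_pair.integrable_snd[of "\<lambda>x t. f (x, t)"]
    lborel_pair.integral_snd[of "\<lambda>x t. f (x, t)"] assms
  by (simp_all add: lborel_prod)

lemma integrable_weighted_mult:
  fixes u f g :: "'a \<Rightarrow> real"
  assumes "integrable M (\<lambda>z. u z * (f z)^2)" "integrable M (\<lambda>z. u z * (g z)^2)"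
    and m: "u \<in> borel_measurable M" "f \<in> borel_measurable M" "g \<in> borel_measurable M" and u: "\<And>z. u z \<ge> 0"
  shows "integrable M (\<lambda>z. u z * f z * g z)"
proof -
  have "integrable M (\<lambda>z. (sqrt (u z) * f z) * (sqrt (u z) * g z))"
    by (rule integral_Cauchy_Schwarz) (use assms in \<open>auto simp: power_mult_distrib\<close>)
  moreover have "(sqrt (u z) * f z) * (sqrt (u z) * g z) = u z * f z * g z" for z
  proof -
    have "(sqrt (u z) * f z) * (sqrt (u z) * g z) = (sqrt (u z) * sqrt (u z)) * f z * g z" by (simp only: mult_ac)
    then show ?thesis using u[of z] by simp
  qed
  ultimately show ?thesis by simp
qed

lemma integrable_bounded_mult:
  fixes f k :: "'a \<Rightarrow> real"
  assumes f: "integrable M f" and k: "k \<in> borel_measurable M" and b: "\<And>z. f z \<noteq> 0 \<Longrightarrow> \<bar>k z\<bar> \<le> B"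
  shows "integrable M (\<lambda>z. k z * f z)"
proof (rule Bochner_Integration.integrable_bound)
  show "integrable M (\<lambda>z. B * f z)" using f by simp
  show "AE z in M. norm (k z * f z) \<le> norm (B * f z)"
  proof (rule AE_I2)
    fix z show "norm (k z * f z) \<le> norm (B * f z)"
    proof (cases "f z = 0")
      case False
      then have "\<bar>k z\<bar> \<le> \<bar>B\<bar>" using b[of z] by linarith
      then show ?thesis by (simp add: abs_mult mult_right_mono)
    qed simp
  qed
qed (use f k in auto)

lemma continuous_bounded_Icc:
  fixes f :: "real \<Rightarrow> real"
  assumes "continuous_on UNIV f"
  shows "\<exists>B. \<forall>t\<in>{a..b}. \<bar>f t\<bar> \<le> B"
proof -
  have "compact (f ` {a..b})" using assms by (intro compact_continuous_image) (auto intro: continuous_on_subset)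
  then show ?thesis by (auto dest!: compact_imp_bounded simp: bounded_iff)
qed

text \<open>w is the coefficient a extended by 0, and v, p, A stand for m_t, (am)_x, (am)_xx. In
  \<open>space\<close>, W and P are the continuous representatives of a m and of (am)_x at a fixed
  time; W reaches the ends of the interval and vanishes there, P lives inside only. In
  \<open>time\<close>, c is the initial value, and the formula is imposed at every point of
  \<open>Q T\<close>; this is a choice of representative.\<close>

locale degenerate_evolution =
  fixes w :: "real \<Rightarrow> real" and T :: real and m v p A :: "real \<times> real \<Rightarrow> real" and c :: "real \<Rightarrow> real"
  assumes T: "T > 0"
    and w_meas [measurable]: "w \<in> borel_measurable borel"
    and w_pos: "\<And>x. x \<in> {0<..<1} \<Longrightarrow> w x > 0" and w_out: "\<And>x. x \<notin> {0<..<1} \<Longrightarrow> w x = 0"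
    and m_meas [measurable]: "m \<in> borel_measurable borel" and v_meas [measurable]: "v \<in> borel_measurable borel"
    and p_meas [measurable]: "p \<in> borel_measurable borel" and A_meas [measurable]: "A \<in> borel_measurable borel"
    and c_meas [measurable]: "c \<in> borel_measurable borel"
    and out: "\<And>z. z \<notin> Q T \<Longrightarrow> m z = 0" "\<And>z. z \<notin> Q T \<Longrightarrow> v z = 0" "\<And>z. z \<notin> Q T \<Longrightarrow> p z = 0" "\<And>z. z \<notin> Q T \<Longrightarrow> A z = 0"
    and int_m: "integrable lborel (\<lambda>z. w (fst z) * (m z)^2)" and int_v: "integrable lborel (\<lambda>z. w (fst z) * (v z)^2)"
    and int_A: "integrable lborel (\<lambda>z. w (fst z) * (A z)^2)" and int_p: "integrable lborel (\<lambda>z. (p z)^2)"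
    and space: "AE t in lborel. t \<in> {0<..<T} \<longrightarrow> (\<exists>W P. primitive_on {0..1} W (\<lambda>x. p (x, t)) \<and> W 0 = 0 \<and> W 1 = 0 \<and>
        (AE x in lborel. x \<in> {0<..<1} \<longrightarrow> W x = w x * m (x, t)) \<and>
        primitive_on {0<..<1} P (\<lambda>x. A (x, t)) \<and> (AE x in lborel. x \<in> {0<..<1} \<longrightarrow> P x = p (x, t)))"
    and time: "\<And>x t. x \<in> {0<..<1} \<Longrightarrow> t \<in> {0<..<T} \<Longrightarrow> m (x, t) = c x + (LINT \<tau>:{0..t}|lborel. v (x, \<tau>))"
begin

lemma w_nonneg: "w x \<ge> 0"
  using w_pos[of x] w_out[of x] by (cases "x \<in> {0<..<1}") (auto intro: less_imp_le)

lemma wf_meas [measurable]: "(\<lambda>z. w (fst z)) \<in> borel_measurable (borel :: (real \<times> real) measure)"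
  by (rule measurable_compose[OF _ w_meas]) (intro borel_measurable_continuous_onI continuous_intros)

lemma snd_meas: "(\<psi> :: real \<Rightarrow> real) \<in> borel_measurable borel \<Longrightarrow> (\<lambda>z. \<psi> (snd z)) \<in> borel_measurable (borel :: (real \<times> real) measure)"
  by (rule measurable_compose[of snd _ borel]) (intro borel_measurable_continuous_onI continuous_intros)

lemma integrable_time_weight:
  fixes \<psi> :: "real \<Rightarrow> real" and f :: "real \<times> real \<Rightarrow> real"
  assumes f: "integrable lborel f" "\<And>z. z \<notin> Q T \<Longrightarrow> f z = 0" and \<psi>: "continuous_on UNIV \<psi>"
  shows "integrable lborel (\<lambda>z. \<psi> (snd z) * f z)"
proof -
  obtain B where B: "\<And>t. t \<in> {0..T} \<Longrightarrow> \<bar>\<psi> t\<bar> \<le> B" using continuous_bounded_Icc[OF \<psi>] by blast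
  show ?thesis
  proof (rule integrable_bounded_mult[OF f(1)])
    show "(\<lambda>z :: real \<times> real. \<psi> (snd z)) \<in> borel_measurable lborel"
      unfolding measurable_lborel2 by (rule snd_meas[OF borel_measurable_continuous_onI[OF \<psi>]])
    fix z assume "f z \<noteq> 0"
    then have "z \<in> Q T" using f(2) by blast
    then have "snd z \<in> {0..T}" by (auto simp: Q_def)
    then show "\<bar>\<psi> (snd z)\<bar> \<le> B" by (rule B)
  qed
qed

text \<open>A time at which every almost-everywhere hypothesis holds simultaneously and all slices
  have finite norms.\<close>

definition good :: "real \<Rightarrow> bool"
  where "good t \<longleftrightarrow> t \<in> {0<..<T} \<and> (\<exists>W P. primitive_on {0..1} W (\<lambda>x. p (x, t)) \<and> W 0 = 0 \<and> W 1 = 0 \<and>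
        (AE x in lborel. x \<in> {0<..<1} \<longrightarrow> W x = w x * m (x, t)) \<and>
        primitive_on {0<..<1} P (\<lambda>x. A (x, t)) \<and> (AE x in lborel. x \<in> {0<..<1} \<longrightarrow> P x = p (x, t))) \<and>
      integrable lborel (\<lambda>x. w x * (m (x, t))^2) \<and> integrable lborel (\<lambda>x. w x * (v (x, t))^2) \<and>
      integrable lborel (\<lambda>x. w x * (A (x, t))^2) \<and> integrable lborel (\<lambda>x. (p (x, t))^2)"

lemma AE_good: "AE t in lborel. t \<in> {0<..<T} \<longrightarrow> good t"
  using space lborel_Fubini_snd(1)[OF int_m] lborel_Fubini_snd(1)[OF int_v]
    lborel_Fubini_snd(1)[OF int_A] lborel_Fubini_snd(1)[OF int_p]
  by eventually_elim (auto simp: good_def)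

lemma slice_meas [measurable]:
  "(\<lambda>x. m (x, t)) \<in> borel_measurable borel" "(\<lambda>x. v (x, t)) \<in> borel_measurable borel"
  "(\<lambda>x. p (x, t)) \<in> borel_measurable borel" "(\<lambda>x. A (x, t)) \<in> borel_measurable borel"
  "(\<lambda>t. m (x, t)) \<in> borel_measurable borel" "(\<lambda>t. v (x, t)) \<in> borel_measurable borel"
  by measurable

lemma integral_eq_01:
  fixes f :: "real \<Rightarrow> real"
  assumes "\<And>x. x \<notin> {0<..<1} \<Longrightarrow> f x = 0"
  shows "(LINT x:{0..1}|lborel. f x) = (LINT x|lborel. f x)" "set_integrable lborel {0..1} f \<longleftrightarrow> integrable lborel f"
proof -
  have "indicator {0..1} x *\<^sub>R f x = f x" for x
    using assms[of x] by (cases "x \<in> {0<..<1}") auto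
  then have "(\<lambda>x. indicator {0..1} x *\<^sub>R f x) = f" by (rule ext)
  then show "(LINT x:{0..1}|lborel. f x) = (LINT x|lborel. f x)" "set_integrable lborel {0..1} f \<longleftrightarrow> integrable lborel f"
    by (simp_all add: set_lebesgue_integral_def set_integrable_def)
qed

text \<open>Integration by parts in x with m and A taken at two different times. The mixed version
  is what makes increments of the gradient norm computable, because the right-hand side is symmetric
  in t and s.\<close>

lemma good_by_parts:
  assumes t: "good t" and s: "good s"
  shows "(LINT x|lborel. w x * m (x, t) * A (x, s)) = - (LINT x|lborel. p (x, t) * p (x, s))"
    and "integrable lborel (\<lambda>x. w x * m (x, t) * A (x, s))" "integrable lborel (\<lambda>x. p (x, t) * p (x, s))"
proof -
  obtain W where W: "primitive_on {0..1} W (\<lambda>x. p (x, t))" "W 0 = 0" "W 1 = 0"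
    and Wm: "AE x in lborel. x \<in> {0<..<1} \<longrightarrow> W x = w x * m (x, t)" using t unfolding good_def by blast
  obtain P where P: "primitive_on {0<..<1} P (\<lambda>x. A (x, s))" "AE x in lborel. x \<in> {0<..<1} \<longrightarrow> P x = p (x, s)"
    using s unfolding good_def by blast
  show iA: "integrable lborel (\<lambda>x. w x * m (x, t) * A (x, s))"
    by (rule integrable_weighted_mult) (use t s w_nonneg in \<open>auto simp: good_def\<close>)
  show ip: "integrable lborel (\<lambda>x. p (x, t) * p (x, s))"
    by (rule integral_Cauchy_Schwarz) (use t s in \<open>auto simp: good_def\<close>)
  have p0: "p (x, r) = 0" if "x \<notin> {0<..<1}" for x r using out(3) that by (auto simp: Q_def)
  have p2: "set_integrable lborel {0..1} (\<lambda>x. (p (x, r))^2)" if "good r" for r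
    using integral_eq_01(2)[of "\<lambda>x. (p (x, r))^2"] p0 that by (auto simp: good_def)
  have "continuous_on {0..1} W" by (rule primitive_on_continuous_Icc[OF W(1)])
  then have Wc: "(\<lambda>x. indicator {0..1} x *\<^sub>R W x) \<in> borel_measurable borel"
    by (intro borel_measurable_continuous_on_indicator) auto
  have ae: "AE x in lborel. indicator {0..1} x *\<^sub>R (W x * A (x, s)) = w x * m (x, t) * A (x, s)"
    using Wm
  proof eventually_elim
    case (elim x)
    show ?case
    proof (cases "x \<in> {0<..<1}")
      case False
      then show ?thesis using W w_out out(4)[of "(x, s)"] by (auto simp: Q_def indicator_def)
    qed (use elim in auto)
  qed
  have me: "(\<lambda>x. indicator {0..1} x *\<^sub>R (W x * A (x, s))) \<in> borel_measurable lborel"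
  proof -
    have "(\<lambda>x. (indicator {0..1} x *\<^sub>R W x) * A (x, s)) \<in> borel_measurable borel" using Wc by measurable
    then show ?thesis by (simp add: mult.assoc)
  qed
  have WA: "set_integrable lborel {0..1} (\<lambda>x. W x * A (x, s))" unfolding set_integrable_def
    by (rule integrable_cong_AE_imp[OF iA me], use ae in eventually_elim, rule sym)
  have "(LINT x:{0..1}|lborel. W x * A (x, s)) = - (LINT x:{0..1}|lborel. p (x, t) * p (x, s))"
    by (rule integral_by_parts_zero_boundary[OF W p2[OF t] _ p2[OF s] _ P WA]) measurable
  also have "(LINT x:{0..1}|lborel. p (x, t) * p (x, s)) = (LINT x|lborel. p (x, t) * p (x, s))"
    by (rule integral_eq_01(1)) (simp add: p0)
  also have "(LINT x:{0..1}|lborel. W x * A (x, s)) = (LINT x|lborel. w x * m (x, t) * A (x, s))"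
    unfolding set_lebesgue_integral_def by (rule integral_cong_AE[OF me borel_measurable_integrable[OF iA] ae])
  finally show "(LINT x|lborel. w x * m (x, t) * A (x, s)) = - (LINT x|lborel. p (x, t) * p (x, s))" .
qed

text \<open>The representative of m that is continuous in time; it is meaningful at t = 0 and t = T
  as well, where m itself has been set to 0.\<close>

definition M :: "real \<Rightarrow> real \<Rightarrow> real"
  where "M x t = c x + (LINT \<tau>:{0..t}|lborel. v (x, \<tau>))"

lemma M_0: "M x 0 = c x"
  by (simp add: M_def set_integral_singleton)

lemma M_eq: "x \<in> {0<..<1} \<Longrightarrow> t \<in> {0<..<T} \<Longrightarrow> m (x, t) = M x t"
  using time by (simp add: M_def)

lemma M_meas [measurable]: "(\<lambda>x. M x t) \<in> borel_measurable borel"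
  unfolding M_def set_lebesgue_integral_def by measurable

definition vgood :: "real \<Rightarrow> bool"
  where "vgood x \<longleftrightarrow> x \<in> {0<..<1} \<and> set_integrable lborel {0..T} (\<lambda>t. (v (x, t))^2)"

lemma AE_vgood: "AE x in lborel. x \<in> {0<..<1} \<longrightarrow> vgood x"
  using lborel_Fubini_fst(1)[OF int_v]
proof eventually_elim
  case (elim x)
  show ?case
  proof
    assume x: "x \<in> {0<..<1}"
    then have "integrable lborel (\<lambda>t. (v (x, t))^2)" using elim w_pos[OF x] by simp
    then have "integrable lborel (\<lambda>t. indicator {0..T} t *\<^sub>R (v (x, t))^2)" by (rule integrable_mult_indicator[rotated]) auto
    then show "vgood x" using x by (simp add: vgood_def set_integrable_def)
  qed
qed

lemma vgood_primitive:
  assumes "vgood x"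
  shows "primitive_on {0..T} (M x) (\<lambda>t. v (x, t))" "set_integrable lborel {0..T} (\<lambda>t. v (x, t))"
proof -
  show i: "set_integrable lborel {0..T} (\<lambda>t. v (x, t))"
    by (rule set_integrable_L2_L1) (use assms in \<open>auto simp: vgood_def\<close>)
  have "M x = (\<lambda>t. c x + (LINT \<tau>:{0..t}|lborel. v (x, \<tau>)))" by (simp add: M_def fun_eq_iff)
  then show "primitive_on {0..T} (M x) (\<lambda>t. v (x, t))" using primitive_on_integral[OF i] by simp
qed

lemma set_integral_Q:
  fixes f :: "real \<Rightarrow> real"
  assumes "\<And>t. t \<notin> {0<..<T} \<Longrightarrow> f t = 0"
  shows "(LINT t:{0..T}|lborel. f t) = (LINT t|lborel. f t)"
proof -
  have "indicator {0..T} t *\<^sub>R f t = f t" for t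
    using assms[of t] by (cases "t \<in> {0<..<T}") auto
  then have "(\<lambda>t. indicator {0..T} t *\<^sub>R f t) = f" by (rule ext)
  then show ?thesis by (simp add: set_lebesgue_integral_def)
qed

text \<open>For almost every x the product rule for \<psi> M^2 on the time interval, then Fubini.
  Only the combination of the two end terms is obtained here, because it arises as the inner
  integral of an integrable function; \<open>integrable_trace\<close> separates them.\<close>

lemma energy_identity_aux:
  assumes \<psi>: "\<And>t. (\<psi> has_real_derivative \<psi>' t) (at t)" and \<psi>': "continuous_on UNIV \<psi>'"
  shows "integrable lborel (\<lambda>z. w (fst z) * (2 * \<psi> (snd z) * m z * v z + \<psi>' (snd z) * (m z)^2))"
    and "integrable lborel (\<lambda>x. w x * (\<psi> T * (M x T)^2 - \<psi> 0 * (c x)^2))"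
    and "(LINT z|lborel. w (fst z) * (2 * \<psi> (snd z) * m z * v z + \<psi>' (snd z) * (m z)^2))
       = (LINT x|lborel. w x * (\<psi> T * (M x T)^2 - \<psi> 0 * (c x)^2))"
proof -
  let ?F = "\<lambda>z. w (fst z) * (2 * \<psi> (snd z) * m z * v z + \<psi>' (snd z) * (m z)^2)"
  have \<psi>c: "continuous_on UNIV \<psi>" using \<psi> by (meson DERIV_isCont continuous_at_imp_continuous_on)
  have [measurable]: "\<psi> \<in> borel_measurable borel" "\<psi>' \<in> borel_measurable borel"
    using \<psi>c \<psi>' by (auto intro: borel_measurable_continuous_onI)
  have wmv: "integrable lborel (\<lambda>z. w (fst z) * m z * v z)"
    by (rule integrable_weighted_mult) (use int_m int_v w_nonneg in auto)
  have "integrable lborel (\<lambda>z. 2 * (\<psi> (snd z) * (w (fst z) * m z * v z)) + \<psi>' (snd z) * (w (fst z) * (m z)^2))"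
  proof (intro Bochner_Integration.integrable_add integrable_mult_right)
    show "integrable lborel (\<lambda>z. \<psi> (snd z) * (w (fst z) * m z * v z))"
      by (rule integrable_time_weight[OF wmv _ \<psi>c]) (simp add: out(1))
    show "integrable lborel (\<lambda>z. \<psi>' (snd z) * (w (fst z) * (m z)^2))"
      by (rule integrable_time_weight[OF int_m _ \<psi>']) (simp add: out(1))
  qed
  then show F: "integrable lborel ?F" by (simp add: algebra_simps)
  have inner: "AE x in lborel. (LINT t|lborel. ?F (x, t)) = w x * (\<psi> T * (M x T)^2 - \<psi> 0 * (c x)^2)"
    using AE_vgood
  proof eventually_elim
    case (elim x)
    show ?case
    proof (cases "x \<in> {0<..<1}")
      case True
      then have Mp: "primitive_on {0..T} (M x) (\<lambda>t. v (x, t))" using vgood_primitive elim by auto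
      have \<psi>p: "primitive_on {0..T} \<psi> \<psi>'" by (rule primitive_on_C1) (use \<psi> \<psi>' in \<open>auto intro: has_field_derivative_at_within continuous_on_subset\<close>)
      have "(LINT t|lborel. 2 * \<psi> t * m (x, t) * v (x, t) + \<psi>' t * (m (x, t))^2) =
        (LINT t:{0..T}|lborel. 2 * \<psi> t * m (x, t) * v (x, t) + \<psi>' t * (m (x, t))^2)"
        by (rule set_integral_Q[symmetric]) (use out(1) in \<open>auto simp: Q_def\<close>)
      also have "\<dots> = (LINT t:{0..T}|lborel. \<psi> t * (M x t * v (x, t) + M x t * v (x, t)) + M x t * M x t * \<psi>' t)"
      proof -
        have "AE t in lborel. t \<noteq> 0" "AE t in lborel. t \<noteq> T" by (rule AE_lborel_singleton)+
        then have ae: "AE t in lborel. indicator {0..T} t *\<^sub>R (2 * \<psi> t * m (x, t) * v (x, t) + \<psi>' t * (m (x, t))^2) =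
            indicator {0..T} t *\<^sub>R (\<psi> t * (M x t * v (x, t) + M x t * v (x, t)) + M x t * M x t * \<psi>' t)"
        proof eventually_elim
          case (elim t)
          then show ?case using M_eq[OF True, of t]
            by (cases "t \<in> {0<..<T}") (auto simp: power2_eq_square algebra_simps indicator_def)
        qed
        have "set_integrable lborel {0..T} (\<lambda>t. \<psi> t * (M x t * v (x, t) + M x t * v (x, t)) + M x t * M x t * \<psi>' t)"
          using primitive_onD(1)[OF primitive_on_mult[OF \<psi>p primitive_on_mult[OF Mp Mp]], of 0 T] T by auto
        then show ?thesis unfolding set_lebesgue_integral_def set_integrable_def
          by (intro integral_cong_AE ae) auto
      qed
      also have "\<dots> = \<psi> T * (M x T * M x T) - \<psi> 0 * (M x 0 * M x 0)"
        using primitive_onD(2)[OF primitive_on_mult[OF \<psi>p primitive_on_mult[OF Mp Mp]], of 0 T] T by simp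
      finally show ?thesis by (simp add: M_0 power2_eq_square)
    qed (simp add: w_out)
  qed
  note fub = lborel_Fubini_fst(2,3)[OF F]
  show "integrable lborel (\<lambda>x. w x * (\<psi> T * (M x T)^2 - \<psi> 0 * (c x)^2))"
    by (rule integrable_cong_AE_imp[OF fub(1) _ inner]) measurable
  show "(LINT z|lborel. ?F z) = (LINT x|lborel. w x * (\<psi> T * (M x T)^2 - \<psi> 0 * (c x)^2))"
    unfolding fub(2)[symmetric] by (rule integral_cong_AE[OF borel_measurable_integrable[OF fub(1)] _ inner]) measurable
qed

text \<open>The weight \<psi>(t) = t removes the contribution of time 0, and \<psi>(t) = T - t that
  of time T.\<close>

lemma integrable_trace: "integrable lborel (\<lambda>x. w x * (M x T)^2)" "integrable lborel (\<lambda>x. w x * (c x)^2)"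
proof -
  have "integrable lborel (\<lambda>x. w x * (T * (M x T)^2 - 0 * (c x)^2))"
    by (rule energy_identity_aux(2)[of "\<lambda>t. t" "\<lambda>_. 1"]) (auto intro!: derivative_eq_intros)
  then show "integrable lborel (\<lambda>x. w x * (M x T)^2)" using T by (simp add: mult.left_commute)
  have "integrable lborel (\<lambda>x. w x * ((T - T) * (M x T)^2 - (T - 0) * (c x)^2))"
    by (rule energy_identity_aux(2)[of "\<lambda>t. T - t" "\<lambda>_. -1"]) (auto intro!: derivative_eq_intros)
  then show "integrable lborel (\<lambda>x. w x * (c x)^2)" using T by (simp add: mult.left_commute)
qed

lemma energy_identity:
  assumes \<psi>: "\<And>t. (\<psi> has_real_derivative \<psi>' t) (at t)" and \<psi>': "continuous_on UNIV \<psi>'"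
  shows "(LINT z|lborel. w (fst z) * (2 * \<psi> (snd z) * m z * v z + \<psi>' (snd z) * (m z)^2))
       = \<psi> T * (LINT x|lborel. w x * (M x T)^2) - \<psi> 0 * (LINT x|lborel. w x * (c x)^2)"
proof -
  have "w x * (\<psi> T * (M x T)^2 - \<psi> 0 * (c x)^2) = \<psi> T * (w x * (M x T)^2) - \<psi> 0 * (w x * (c x)^2)" for x
    by (simp add: algebra_simps)
  then show ?thesis using energy_identity_aux(3)[OF assms] integrable_trace by simp
qed

text \<open>Cauchy-Schwarz in time on the integral of v from r to t: m is Hoelder continuous of
  order 1/2 with values in the weighted L2 space. The behaviour near both end times rests on
  this.\<close>

lemma M_diff_bound:
  assumes rt: "0 \<le> r" "r \<le> t" "t \<le> T"
  shows "integrable lborel (\<lambda>x. w x * (M x t - M x r)^2)"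
    and "(LINT x|lborel. w x * (M x t - M x r)^2) \<le> (t - r) * (LINT z|lborel. w (fst z) * (v z)^2)"
proof -
  note fub = lborel_Fubini_fst(2,3)[OF int_v]
  have i: "integrable lborel (\<lambda>x. (t - r) * (LINT \<tau>|lborel. w x * (v (x, \<tau>))^2))" using fub(1) by simp
  have ae: "AE x in lborel. w x * (M x t - M x r)^2 \<le> (t - r) * (LINT \<tau>|lborel. w x * (v (x, \<tau>))^2)"
    using AE_vgood
  proof eventually_elim
    case (elim x)
    show ?case
    proof (cases "x \<in> {0<..<1}")
      case True
      then have g: "vgood x" using elim by simp
      then have v2: "set_integrable lborel {0..T} (\<lambda>t. (v (x, t))^2)" by (simp add: vgood_def)
      have v2': "set_integrable lborel {r..t} (\<lambda>t. (v (x, t))^2)" by (rule set_integrable_subset[OF v2]) (use rt in auto)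
      have "M x t - M x r = (LINT \<tau>:{r..t}|lborel. v (x, \<tau>))"
        using primitive_onD(2)[OF vgood_primitive(1)[OF g], of r t] rt by auto
      then have "(M x t - M x r)^2 \<le> (t - r) * (LINT \<tau>:{r..t}|lborel. (v (x, \<tau>))^2)"
        using set_integral_sq_le[OF v2' _ rt(2)] by simp
      also have "(LINT \<tau>:{r..t}|lborel. (v (x, \<tau>))^2) \<le> (LINT \<tau>:{0..T}|lborel. (v (x, \<tau>))^2)"
        unfolding set_lebesgue_integral_def
        by (rule Bochner_Integration.integral_mono) (use v2 v2' rt in \<open>auto simp: set_integrable_def indicator_def\<close>)
      also have "(LINT \<tau>:{0..T}|lborel. (v (x, \<tau>))^2) = (LINT \<tau>|lborel. (v (x, \<tau>))^2)"
        by (rule set_integral_Q) (use out(2) in \<open>auto simp: Q_def\<close>)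
      finally have "(M x t - M x r)^2 \<le> (t - r) * (LINT \<tau>|lborel. (v (x, \<tau>))^2)"
        using rt by (simp add: mult_left_mono)
      then have "w x * (M x t - M x r)^2 \<le> w x * ((t - r) * (LINT \<tau>|lborel. (v (x, \<tau>))^2))"
        using w_nonneg by (rule mult_left_mono)
      then show ?thesis by (simp add: mult.left_commute)
    qed (simp add: w_out)
  qed
  show i2: "integrable lborel (\<lambda>x. w x * (M x t - M x r)^2)"
    by (rule Bochner_Integration.integrable_bound[OF i]) (use ae w_nonneg in \<open>auto elim!: eventually_mono intro: order_trans[OF _ abs_ge_self]\<close>)
  have "(LINT x|lborel. w x * (M x t - M x r)^2) \<le> (LINT x|lborel. (t - r) * (LINT \<tau>|lborel. w x * (v (x, \<tau>))^2))"
    by (rule integral_mono_AE[OF i2 i ae])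
  also have "\<dots> = (t - r) * (LINT z|lborel. w (fst z) * (v z)^2)" using fub(2) by simp
  finally show "(LINT x|lborel. w x * (M x t - M x r)^2) \<le> (t - r) * (LINT z|lborel. w (fst z) * (v z)^2)" .
qed

lemma gradient_identity:
  assumes \<psi>': "continuous_on UNIV \<psi>"
  shows "(LINT z|lborel. \<psi> (snd z) * (w (fst z) * m z * A z)) = - (LINT z|lborel. \<psi> (snd z) * (p z)^2)"
    and "integrable lborel (\<lambda>z. \<psi> (snd z) * (w (fst z) * m z * A z))" "integrable lborel (\<lambda>z. \<psi> (snd z) * (p z)^2)"
proof -
  have [measurable]: "\<psi> \<in> borel_measurable borel" using \<psi>' by (auto intro: borel_measurable_continuous_onI)
  have wmA: "integrable lborel (\<lambda>z. w (fst z) * m z * A z)"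
    by (rule integrable_weighted_mult) (use int_m int_A w_nonneg in auto)
  show i1: "integrable lborel (\<lambda>z. \<psi> (snd z) * (w (fst z) * m z * A z))"
    by (rule integrable_time_weight[OF wmA _ \<psi>']) (simp add: out(1))
  show i2: "integrable lborel (\<lambda>z. \<psi> (snd z) * (p z)^2)"
    by (rule integrable_time_weight[OF int_p _ \<psi>']) (simp add: out(3))
  have "(LINT t|lborel. LINT x|lborel. \<psi> t * (w x * m (x, t) * A (x, t))) = (LINT t|lborel. - (LINT x|lborel. \<psi> t * (p (x, t))^2))"
  proof (rule integral_cong_AE)
    show "AE t in lborel. (LINT x|lborel. \<psi> t * (w x * m (x, t) * A (x, t))) = - (LINT x|lborel. \<psi> t * (p (x, t))^2)"
      using AE_good
    proof eventually_elim
      case (elim t)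
      show ?case
      proof (cases "t \<in> {0<..<T}")
        case True
        then show ?thesis using good_by_parts(1)[of t t] elim by (simp add: power2_eq_square)
      next
        case False
        then have "(x, t) \<notin> Q T" for x by (auto simp: Q_def)
        then show ?thesis using out by simp
      qed
    qed
  qed measurable
  then show "(LINT z|lborel. \<psi> (snd z) * (w (fst z) * m z * A z)) = - (LINT z|lborel. \<psi> (snd z) * (p z)^2)"
    using lborel_Fubini_snd(3)[OF i1] lborel_Fubini_snd(3)[OF i2] by simp
qed

end

subsection \<open>The time derivative of the squared gradient norm\<close>

context degenerate_evolution
begin

definition D :: "real \<Rightarrow> real" where "D t = (LINT x|lborel. (p (x, t))^2)"
definition d :: "real \<Rightarrow> real" where "d t = - 2 * (LINT x|lborel. w x * v (x, t) * A (x, t))"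

lemma int_wvA: "integrable lborel (\<lambda>z. w (fst z) * v z * A z)"
  by (rule integrable_weighted_mult) (use int_v int_A w_nonneg in auto)

lemma integrable_D: "integrable lborel D"
  using lborel_Fubini_snd(2)[OF int_p] by (simp add: D_def[abs_def])

lemma integrable_d: "integrable lborel d"
  using lborel_Fubini_snd(2)[OF int_wvA] by (simp add: d_def[abs_def])

lemma slice_zero: "t \<notin> {0<..<T} \<Longrightarrow> m (x, t) = 0" "t \<notin> {0<..<T} \<Longrightarrow> v (x, t) = 0"
    "t \<notin> {0<..<T} \<Longrightarrow> p (x, t) = 0" "t \<notin> {0<..<T} \<Longrightarrow> A (x, t) = 0"
  by (rule out, auto simp: Q_def)+

lemma slice_zero': "x \<notin> {0<..<1} \<Longrightarrow> m (x, t) = 0" "x \<notin> {0<..<1} \<Longrightarrow> v (x, t) = 0"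
    "x \<notin> {0<..<1} \<Longrightarrow> p (x, t) = 0" "x \<notin> {0<..<1} \<Longrightarrow> A (x, t) = 0"
  by (rule out, auto simp: Q_def)+

text \<open>By \<open>good_by_parts\<close> the integral of p(t) p(s) equals both mixed products,
  m(t) with A(s) and m(s) with A(t). After multiplying out, the mixed terms therefore
  cancel.\<close>

lemma D_diff:
  assumes t: "good t" and s: "good s"
  shows "D s - D t = - (LINT x|lborel. w x * (m (x, s) - m (x, t)) * (A (x, s) + A (x, t)))"
proof -
  note bp = good_by_parts
  have "(LINT x|lborel. w x * (m (x, s) - m (x, t)) * (A (x, s) + A (x, t)))
    = (LINT x|lborel. (w x * m (x, s) * A (x, s) + w x * m (x, s) * A (x, t)) - (w x * m (x, t) * A (x, s) + w x * m (x, t) * A (x, t)))"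
    by (rule Bochner_Integration.integral_cong) (auto simp: algebra_simps)
  also have "\<dots> = ((LINT x|lborel. w x * m (x, s) * A (x, s)) + (LINT x|lborel. w x * m (x, s) * A (x, t)))
      - ((LINT x|lborel. w x * m (x, t) * A (x, s)) + (LINT x|lborel. w x * m (x, t) * A (x, t)))"
    using bp(2)[OF s s] bp(2)[OF s t] bp(2)[OF t s] bp(2)[OF t t] by simp
  also have "\<dots> = - D s + D t"
    using bp(1)[OF s s] bp(1)[OF s t] bp(1)[OF t s] bp(1)[OF t t] by (simp add: D_def power2_eq_square mult.commute)
  finally show ?thesis by simp
qed

text \<open>Absorbing the square root of the weight gives plain L2 functions on the plane. Since w
  depends on x only, a shift in time commutes with this, so continuity of translations applies to
  them.\<close>

definition wv :: "real \<times> real \<Rightarrow> real" where "wv z = sqrt (w (fst z)) * v z"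
definition wA :: "real \<times> real \<Rightarrow> real" where "wA z = sqrt (w (fst z)) * A z"

lemma wv_wA_meas [measurable]: "wv \<in> borel_measurable borel" "wA \<in> borel_measurable borel"
  unfolding wv_def wA_def by measurable

lemma wv_wA_int: "integrable lborel (\<lambda>z. (wv z)^2)" "integrable lborel (\<lambda>z. (wA z)^2)"
  using int_v int_A w_nonneg by (simp_all add: wv_def wA_def power_mult_distrib)

lemma M_increment:
  assumes x: "vgood x" and t: "0 < t" "t + h < T" and h: "h > 0"
  shows "m (x, t + h) - m (x, t) = (LINT \<sigma>:{0..h}|lborel. v (x, t + \<sigma>))"
proof -
  have x1: "x \<in> {0<..<1}" using x by (simp add: vgood_def)
  have "m (x, t + h) - m (x, t) = M x (t + h) - M x t" using M_eq[OF x1] t h by simp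
  also have "\<dots> = (LINT \<tau>:{t..t+h}|lborel. v (x, \<tau>))"
    by (rule primitive_onD(2)[OF vgood_primitive(1)[OF x]]) (use t h in auto)
  also have "\<dots> = (LINT \<sigma>:{0..h}|lborel. v (x, t + \<sigma>))"
  proof -
    have "indicator {t..t+h} (t + \<sigma>) = (indicator {0..h} \<sigma> :: real)" for \<sigma> by (auto simp: indicator_def)
    then show ?thesis
      using lborel_integral_real_affine[of 1 "\<lambda>\<tau>. indicator {t..t+h} \<tau> *\<^sub>R v (x, \<tau>)" t]
      by (simp add: set_lebesgue_integral_def)
  qed
  finally show ?thesis .
qed

text \<open>The difference quotient of m minus v is the average of v(t + \<sigma>) - v(t) over
  \<sigma> in the interval from 0 to h, so its square is at most the average of the squares.
  Extended nonnegative integrals are used so that Tonelli applies afterwards.\<close>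

lemma increment_sq_le:
  assumes x: "vgood x" and t: "0 < t" "t + h < T" and h: "h > 0"
  shows "ennreal ((sqrt (w x) * ((m (x, t + h) - m (x, t)) / h) - wv (x, t))^2)
    \<le> ennreal (1 / h) * (\<integral>\<^sup>+\<sigma>. indicator {0..h} \<sigma> * ennreal ((wv (x, t + \<sigma>) - wv (x, t))^2) \<partial>lborel)"
proof -
  let ?k = "\<lambda>\<sigma>. wv (x, t + \<sigma>) - wv (x, t)"
  have "set_integrable lborel {0..T} (\<lambda>t. (v (x, t))^2)" using x by (simp add: vgood_def)
  then have "integrable lborel (\<lambda>\<sigma>. indicator {0..T} (t + 1 * \<sigma>) *\<^sub>R (v (x, t + 1 * \<sigma>))^2)"
    unfolding set_integrable_def by (rule lborel_integrable_real_affine) simp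
  then have "integrable lborel (\<lambda>\<sigma>. indicator {0..h} \<sigma> *\<^sub>R (indicator {0..T} (t + 1 * \<sigma>) *\<^sub>R (v (x, t + 1 * \<sigma>))^2))"
    by (rule integrable_mult_indicator[rotated]) auto
  moreover have "indicator {0..h} \<sigma> *\<^sub>R (indicator {0..T} (t + 1 * \<sigma>) *\<^sub>R (v (x, t + 1 * \<sigma>))^2) = indicator {0..h} \<sigma> *\<^sub>R (v (x, t + \<sigma>))^2" for \<sigma>
    using t by (auto simp: indicator_def)
  ultimately have v2: "set_integrable lborel {0..h} (\<lambda>\<sigma>. (v (x, t + \<sigma>))^2)" by (simp only: set_integrable_def)
  have v1: "set_integrable lborel {0..h} (\<lambda>\<sigma>. v (x, t + \<sigma>))" by (rule set_integrable_L2_L1[OF v2]) measurable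
  have cst: "set_integrable lborel {0..h} (\<lambda>_. q)" for q :: real by (rule borel_integrable_atLeastAtMost') auto
  have k2: "set_integrable lborel {0..h} (\<lambda>\<sigma>. (?k \<sigma>)^2)"
  proof -
    have "set_integrable lborel {0..h} (\<lambda>\<sigma>. w x * ((v (x, t + \<sigma>))^2 - (2 * v (x, t)) * v (x, t + \<sigma>) + (v (x, t))^2))"
      by (intro set_integrable_mult_right set_integral_add(1) set_integral_diff(1) v2 v1 cst)
    moreover have "w x * ((v (x, t + \<sigma>))^2 - (2 * v (x, t)) * v (x, t + \<sigma>) + (v (x, t))^2) = (?k \<sigma>)^2" for \<sigma>
    proof -
      have "(?k \<sigma>)^2 = (sqrt (w x))^2 * (v (x, t + \<sigma>) - v (x, t))^2"
        by (simp add: wv_def power_mult_distrib[symmetric] right_diff_distrib)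
      then show ?thesis using w_nonneg[of x] by (simp add: power2_diff algebra_simps)
    qed
    ultimately show ?thesis by simp
  qed
  have "sqrt (w x) * ((m (x, t + h) - m (x, t)) / h) - wv (x, t) = (1 / h) * (LINT \<sigma>:{0..h}|lborel. ?k \<sigma>)"
  proof -
    have "(LINT \<sigma>:{0..h}|lborel. ?k \<sigma>) = (LINT \<sigma>:{0..h}|lborel. sqrt (w x) * v (x, t + \<sigma>)) - (LINT \<sigma>:{0..h}|lborel. wv (x, t))"
      unfolding wv_def fst_conv by (intro set_integral_diff(2) set_integrable_mult_right v1 cst)
    also have "(LINT \<sigma>:{0..h}|lborel. wv (x, t)) = h * wv (x, t)" using h by (simp add: set_lebesgue_integral_def)
    also have "(LINT \<sigma>:{0..h}|lborel. sqrt (w x) * v (x, t + \<sigma>)) = sqrt (w x) * (m (x, t + h) - m (x, t))"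
      using M_increment[OF assms] by simp
    finally show ?thesis using h by (simp add: field_simps)
  qed
  then have "(sqrt (w x) * ((m (x, t + h) - m (x, t)) / h) - wv (x, t))^2 = (1 / h)^2 * (LINT \<sigma>:{0..h}|lborel. ?k \<sigma>)^2"
    by (simp only: power_mult_distrib)
  also have "\<dots> \<le> (1 / h)^2 * ((h - 0) * (LINT \<sigma>:{0..h}|lborel. (?k \<sigma>)^2))"
    using h by (intro mult_left_mono set_integral_sq_le k2) auto
  also have "\<dots> = (1 / h) * (LINT \<sigma>:{0..h}|lborel. (?k \<sigma>)^2)" using h by (simp add: power2_eq_square)
  finally have "ennreal ((sqrt (w x) * ((m (x, t + h) - m (x, t)) / h) - wv (x, t))^2)
     \<le> ennreal ((1 / h) * (LINT \<sigma>:{0..h}|lborel. (?k \<sigma>)^2))" by (rule ennreal_leI)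
  also have "\<dots> = ennreal (1 / h) * ennreal (LINT \<sigma>:{0..h}|lborel. (?k \<sigma>)^2)"
    using h by (intro ennreal_mult) (auto simp: set_lebesgue_integral_def)
  also have "ennreal (LINT \<sigma>:{0..h}|lborel. (?k \<sigma>)^2) = (\<integral>\<^sup>+\<sigma>. indicator {0..h} \<sigma> * ennreal ((?k \<sigma>)^2) \<partial>lborel)"
  proof -
    have "(\<integral>\<^sup>+\<sigma>. ennreal (indicator {0..h} \<sigma> *\<^sub>R (?k \<sigma>)^2) \<partial>lborel) = ennreal (LINT \<sigma>:{0..h}|lborel. (?k \<sigma>)^2)"
      unfolding set_lebesgue_integral_def using k2[unfolded set_integrable_def] by (rule nn_integral_eq_integral) auto
    moreover have "ennreal (indicator {0..h} \<sigma> *\<^sub>R (?k \<sigma>)^2) = indicator {0..h} \<sigma> * ennreal ((?k \<sigma>)^2)" for \<sigma>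
      by (auto simp: indicator_def)
    ultimately show ?thesis by simp
  qed
  finally show ?thesis .
qed

text \<open>Integrate \<open>increment_sq_le\<close> over the plane and exchange the integrals: the
  result is the average over the shifts \<sigma> of squared L2 translation errors of
  \<open>wv\<close>, each at most e. The cutoff k keeps t and t + h inside the time
  interval.\<close>

lemma difference_quotient_L2:
  assumes k [measurable]: "k \<in> borel_measurable borel" and kB: "\<And>t. \<bar>k t\<bar> \<le> B" and k0: "\<And>t. t \<notin> {l..r} \<Longrightarrow> k t = 0"
    and lr: "0 < l" "r + h < T" and h: "h > 0" and e: "e \<ge> 0"
    and small: "\<And>\<sigma>. \<sigma> \<in> {0..h} \<Longrightarrow> (LINT z|lborel. (wv ((0, \<sigma>) + z) - wv z)^2) \<le> e"
  defines "F \<equiv> \<lambda>z. k (snd z) * (sqrt (w (fst z)) * ((m (fst z, snd z + h) - m z) / h) - wv z)"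
  shows "F \<in> borel_measurable borel" "integrable lborel (\<lambda>z. (F z)^2)" "(LINT z|lborel. (F z)^2) \<le> B^2 * e"
proof -
  have [measurable]: "(\<lambda>z. k (snd z)) \<in> borel_measurable (borel :: (real \<times> real) measure)" by (rule snd_meas[OF k])
  have [measurable]: "(\<lambda>z. m (fst z, snd z + h)) \<in> borel_measurable (borel :: (real \<times> real) measure)"
    by (rule measurable_compose[OF _ m_meas]) (intro borel_measurable_continuous_onI continuous_intros)
  show Fm [measurable]: "F \<in> borel_measurable borel" unfolding F_def by measurable
  have B0: "B \<ge> 0" using kB[of 0] by linarith
  have gs [measurable]: "(\<lambda>q. wv (fst q, snd q + \<sigma>)) \<in> borel_measurable (borel :: (real \<times> real) measure)" for \<sigma>
    by (rule measurable_compose[OF _ wv_wA_meas(1)]) (intro borel_measurable_continuous_onI continuous_intros)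
  have G3: "(\<lambda>q. wv (fst (fst q), snd (fst q) + snd q)) \<in> borel_measurable (borel :: ((real \<times> real) \<times> real) measure)"
    "(\<lambda>q. wv (fst q)) \<in> borel_measurable (borel :: ((real \<times> real) \<times> real) measure)"
    by (rule measurable_compose[OF _ wv_wA_meas(1)], intro borel_measurable_continuous_onI continuous_intros)+
  let ?K = "\<lambda>(z::real\<times>real) \<sigma>. indicator {0..h} \<sigma> * ennreal ((wv (fst z, snd z + \<sigma>) - wv z)^2)"
  have K: "(\<lambda>(z, \<sigma>). ?K z \<sigma>) \<in> borel_measurable (lborel \<Otimes>\<^sub>M lborel)"
  proof -
    have "(\<lambda>q. indicator {0..h} (snd q) * ennreal ((wv (fst (fst q), snd (fst q) + snd q) - wv (fst q))^2)) \<in> borel_measurable (borel :: ((real \<times> real) \<times> real) measure)"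
    proof (rule borel_measurable_times_ennreal)
      have "{q :: (real \<times> real) \<times> real. snd q \<in> {0..h}} \<in> sets borel"
      proof -
        have "closed {q :: (real \<times> real) \<times> real. 0 \<le> snd q \<and> snd q \<le> h}"
          by (intro closed_Collect_conj closed_Collect_le continuous_intros)
        then show ?thesis by (auto intro: borel_closed)
      qed
      then have "indicator {q :: (real \<times> real) \<times> real. snd q \<in> {0..h}} \<in> borel_measurable (borel :: ((real \<times> real) \<times> real) measure)"
        by (rule borel_measurable_indicator)
      moreover have "(\<lambda>q. indicator {0..h} (snd q)) = (indicator {q :: (real \<times> real) \<times> real. snd q \<in> {0..h}} :: _ \<Rightarrow> ennreal)"
        by (auto simp: indicator_def fun_eq_iff)
      ultimately show "(\<lambda>q :: (real \<times> real) \<times> real. indicator {0..h} (snd q) :: ennreal) \<in> borel_measurable borel" by simp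
      show "(\<lambda>q :: (real \<times> real) \<times> real. ennreal ((wv (fst (fst q), snd (fst q) + snd q) - wv (fst q))^2)) \<in> borel_measurable borel"
        by (intro measurable_compose[OF _ measurable_ennreal] borel_measurable_power borel_measurable_diff G3)
    qed
    then show ?thesis by (simp add: lborel_prod case_prod_beta)
  qed
  have m1: "(\<lambda>z. \<integral>\<^sup>+\<sigma>. ?K z \<sigma> \<partial>lborel) \<in> borel_measurable (lborel \<Otimes>\<^sub>M lborel)"
    using lborel.borel_measurable_nn_integral_fst[OF K] by (simp add: lborel_prod)
  have le: "(\<integral>\<^sup>+z. ennreal ((F z)^2) \<partial>lborel) \<le> ennreal (B^2 * e)"
  proof -
    have "(\<integral>\<^sup>+z. ennreal ((F z)^2) \<partial>lborel) = (\<integral>\<^sup>+x. \<integral>\<^sup>+t. ennreal ((F (x, t))^2) \<partial>lborel \<partial>lborel)"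
      using lborel.nn_integral_fst[of "\<lambda>z. ennreal ((F z)^2)" lborel] by (simp add: lborel_prod)
    also have "\<dots> \<le> (\<integral>\<^sup>+x. \<integral>\<^sup>+t. ennreal (B^2) * (ennreal (1 / h) * (\<integral>\<^sup>+\<sigma>. ?K (x, t) \<sigma> \<partial>lborel)) \<partial>lborel \<partial>lborel)"
    proof (rule nn_integral_mono_AE, use AE_vgood in eventually_elim)
      case (elim x)
      show ?case
      proof (rule nn_integral_mono)
        fix t
        show "ennreal ((F (x, t))^2) \<le> ennreal (B^2) * (ennreal (1 / h) * (\<integral>\<^sup>+\<sigma>. ?K (x, t) \<sigma> \<partial>lborel))"
        proof (cases "x \<in> {0<..<1} \<and> t \<in> {l..r}")
          case True
          then have x: "vgood x" and t: "0 < t" "t + h < T" using elim lr by auto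
          let ?X = "sqrt (w x) * ((m (x, t + h) - m (x, t)) / h) - wv (x, t)"
          have "(F (x, t))^2 = (k t)^2 * ?X^2" by (simp add: F_def power_mult_distrib)
          also have "\<dots> \<le> B^2 * ?X^2"
            using kB[of t] by (intro mult_right_mono) (auto simp: abs_le_square_iff[symmetric])
          finally have "ennreal ((F (x, t))^2) \<le> ennreal (B^2) * ennreal (?X^2)"
            by (simp add: ennreal_mult[symmetric] ennreal_leI)
          also have "\<dots> \<le> ennreal (B^2) * (ennreal (1 / h) * (\<integral>\<^sup>+\<sigma>. ?K (x, t) \<sigma> \<partial>lborel))"
            using increment_sq_le[OF x t h] by (intro mult_left_mono) auto
          finally show ?thesis .
        next
          case False
          then have "F (x, t) = 0" using k0[of t] w_out[of x] by (auto simp: F_def wv_def)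
          then show ?thesis by simp
        qed
      qed
    qed
    also have "\<dots> = (\<integral>\<^sup>+z. ennreal (B^2) * (ennreal (1 / h) * (\<integral>\<^sup>+\<sigma>. ?K z \<sigma> \<partial>lborel)) \<partial>(lborel \<Otimes>\<^sub>M lborel))"
      by (rule lborel.nn_integral_fst) (use m1 in measurable)
    also have "\<dots> = ennreal (B^2) * (ennreal (1 / h) * (\<integral>\<^sup>+z. \<integral>\<^sup>+\<sigma>. ?K z \<sigma> \<partial>lborel \<partial>(lborel \<Otimes>\<^sub>M lborel)))"
      using m1 by (simp add: nn_integral_cmult)
    \<comment> \<open>After the exchange the inner integral is the squared L2 translation error for
      one fixed shift.\<close>
    also have "(\<integral>\<^sup>+z. \<integral>\<^sup>+\<sigma>. ?K z \<sigma> \<partial>lborel \<partial>(lborel \<Otimes>\<^sub>M lborel)) = (\<integral>\<^sup>+\<sigma>. \<integral>\<^sup>+z. ?K z \<sigma> \<partial>lborel \<partial>lborel)"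
      unfolding lborel_prod by (rule lborel_pair.Fubini'[OF K, symmetric])
    finally have le1: "(\<integral>\<^sup>+z. ennreal ((F z)^2) \<partial>lborel)
      \<le> ennreal (B^2) * (ennreal (1 / h) * (\<integral>\<^sup>+\<sigma>. \<integral>\<^sup>+z. ?K z \<sigma> \<partial>lborel \<partial>lborel))" .
    have "(\<integral>\<^sup>+\<sigma>. \<integral>\<^sup>+z. ?K z \<sigma> \<partial>lborel \<partial>lborel) \<le> (\<integral>\<^sup>+\<sigma>. ennreal e * indicator {0..h} \<sigma> \<partial>lborel)"
    proof (rule nn_integral_mono)
      fix \<sigma> :: real
      show "(\<integral>\<^sup>+z. ?K z \<sigma> \<partial>lborel) \<le> ennreal e * indicator {0..h} \<sigma>"
      proof (cases "\<sigma> \<in> {0..h}")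
        case True
        have eq: "wv (fst z, snd z + \<sigma>) = wv ((0, \<sigma>) + z)" for z :: "real \<times> real"
          by (cases z) (simp add: add.commute)
        have tg: "integrable lborel (\<lambda>z. (wv ((0, \<sigma>) + z))^2)"
          using lborel_translate(1)[of "\<lambda>z. (wv z)^2" "(0, \<sigma>)"] wv_wA_int(1) by simp
        have i: "integrable lborel (\<lambda>z. (wv ((0, \<sigma>) + z) - wv z)^2)"
        proof (rule Bochner_Integration.integrable_bound)
          show "integrable lborel (\<lambda>z. 2 * (wv ((0, \<sigma>) + z))^2 + 2 * (wv z)^2)" using tg wv_wA_int(1) by simp
          have "(a - b)^2 \<le> 2 * a^2 + 2 * b^2" for a b :: real
            using zero_le_power2[of "a + b"] by (simp add: power2_sum power2_diff)
          then show "AE z in lborel. norm ((wv ((0, \<sigma>) + z) - wv z)^2) \<le> norm (2 * (wv ((0, \<sigma>) + z))^2 + 2 * (wv z)^2)" by auto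
          show "(\<lambda>z. (wv ((0, \<sigma>) + z) - wv z)^2) \<in> borel_measurable lborel"
            unfolding eq[symmetric] by measurable
        qed
        have "(\<integral>\<^sup>+z. ?K z \<sigma> \<partial>lborel) = (\<integral>\<^sup>+z. ennreal ((wv ((0, \<sigma>) + z) - wv z)^2) \<partial>lborel)"
          using True by (simp add: eq)
        also have "\<dots> = ennreal (LINT z|lborel. (wv ((0, \<sigma>) + z) - wv z)^2)" by (rule nn_integral_eq_integral[OF i]) auto
        also have "\<dots> \<le> ennreal e" by (rule ennreal_leI[OF small[OF True]])
        finally show ?thesis using True by simp
      qed simp
    qed
    also have "(\<integral>\<^sup>+\<sigma>. ennreal e * indicator {0..h} \<sigma> \<partial>lborel) = ennreal e * ennreal h"
      using h by (subst nn_integral_cmult_indicator) auto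
    finally have "ennreal (B^2) * (ennreal (1 / h) * (\<integral>\<^sup>+\<sigma>. \<integral>\<^sup>+z. ?K z \<sigma> \<partial>lborel \<partial>lborel))
      \<le> ennreal (B^2) * (ennreal (1 / h) * (ennreal e * ennreal h))"
      by (intro mult_left_mono) auto
    note order_trans[OF le1 this]
    also have "\<dots> = ennreal (B^2 * ((1 / h) * (e * h)))"
      using h e by (simp add: ennreal_mult[symmetric])
    also have "B^2 * ((1 / h) * (e * h)) = B^2 * e" using h by simp
    finally show ?thesis .
  qed
  show i: "integrable lborel (\<lambda>z. (F z)^2)"
    using le by (intro integrableI_bounded) (auto intro: order.strict_trans1)
  have "ennreal (LINT z|lborel. (F z)^2) \<le> ennreal (B^2 * e)"
    using le nn_integral_eq_integral[OF i] by simp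
  then show "(LINT z|lborel. (F z)^2) \<le> B^2 * e" using e by (simp add: ennreal_le_iff)
qed


lemma int_mult_bounded_D:
  assumes k [measurable]: "k \<in> borel_measurable borel" and B: "\<And>t. \<bar>k t\<bar> \<le> B"
  shows "integrable lborel (\<lambda>t. k t * D t)"
  by (rule integrable_bounded_mult[OF integrable_D, of _ B]) (use B in auto)

text \<open>Replace the derivative of \<psi> by a backward difference quotient, move the shift onto
  D, and insert \<open>D_diff\<close>. This gives the integral of \<open>Fn n * Gn n\<close>, where
  \<open>Fn n\<close> tends to \<psi> times \<open>wv\<close> and \<open>Gn n\<close> to twice
  \<open>wA\<close>. Both convergences are strong in L2, so the product passes to the limit.\<close>

lemma D_weak_deriv:
  assumes \<psi>: "test_function 0 T \<psi>"
  shows "(LINT t|lborel. D t * deriv \<psi> t) = - (LINT t|lborel. d t * \<psi> t)"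
proof -
  obtain l r where lr: "0 < l" "l \<le> r" "r < T" and out\<psi>: "\<And>x. x \<notin> {l<..<r} \<Longrightarrow> \<psi> x = 0 \<and> deriv \<psi> x = 0"
    using test_functionD(4)[OF \<psi> T] by blast
  have bounded: "\<exists>B. \<forall>t. \<bar>k t\<bar> \<le> B" if cont: "continuous_on UNIV k" and zero: "\<And>x. x \<notin> {l<..<r} \<Longrightarrow> k x = 0" for k :: "real \<Rightarrow> real"
  proof -
    obtain B where B: "\<And>t. t \<in> {l..r} \<Longrightarrow> \<bar>k t\<bar> \<le> B" using continuous_bounded_Icc[OF cont] by blast
    have "\<bar>k t\<bar> \<le> \<bar>B\<bar>" for t using B[of t] zero[of t] by (cases "t \<in> {l..r}") auto
    then show ?thesis by blast
  qed
  obtain B where B: "\<And>t. \<bar>\<psi> t\<bar> \<le> B" using bounded[OF test_functionD(2)[OF \<psi>]] out\<psi> by blast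
  obtain B' where B': "\<And>t. \<bar>deriv \<psi> t\<bar> \<le> B'" using bounded[OF test_functionD(3)[OF \<psi>]] out\<psi> by blast
  have [measurable]: "\<psi> \<in> borel_measurable borel" "deriv \<psi> \<in> borel_measurable borel"
    using test_functionD(2,3)[OF \<psi>] by (auto intro: borel_measurable_continuous_onI)
  note \<psi>m = snd_meas[OF \<open>\<psi> \<in> borel_measurable borel\<close>]
  \<comment> \<open>Half the distance from the support of \<psi> to T, so that t + h stays inside
    the time interval for every step h used.\<close>
  define h0 where "h0 = (T - r) / 2"
  have h0: "h0 > 0" "r + h0 < T" using lr by (auto simp: h0_def field_simps)
  define h where "h n = h0 / real (Suc n)" for n
  have h: "h n > 0" "h n \<le> h0" for n using h0 by (auto simp: h_def divide_le_eq)
  have hlim: "h \<longlonglongrightarrow> 0" unfolding h_def by (rule LIMSEQ_Suc[OF lim_const_over_n])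
  define F where "F z = \<psi> (snd z) * wv z" for z
  define Fn where "Fn n z = \<psi> (snd z) * (sqrt (w (fst z)) * ((m (fst z, snd z + h n) - m z) / h n))" for n z
  define G where "G z = 2 * wA z" for z
  define Gn where "Gn n z = wA ((0, h n) + z) + wA z" for n z
  have eq: "Fn n z - F z = \<psi> (snd z) * (sqrt (w (fst z)) * ((m (fst z, snd z + h n) - m z) / h n) - wv z)" for n z
    by (simp add: Fn_def F_def right_diff_distrib)
  have quot: "(\<lambda>z. Fn n z - F z) \<in> borel_measurable borel" "integrable lborel (\<lambda>z. (Fn n z - F z)^2)"
     "(LINT z|lborel. (Fn n z - F z)^2) \<le> B^2 * e"
    if "e \<ge> 0" "\<And>\<sigma>. \<sigma> \<in> {0..h n} \<Longrightarrow> (LINT z|lborel. (wv ((0, \<sigma>) + z) - wv z)^2) \<le> e" for n e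
    unfolding eq
    by (rule difference_quotient_L2[where k=\<psi> and l=l and r=r and e=e]; use B out\<psi> lr h[of n] h0 that in force)+
  have Fm: "F \<in> borel_measurable lborel" unfolding F_def using \<psi>m wv_wA_meas(1) by simp
  have F2: "integrable lborel (\<lambda>z. (F z)^2)"
  proof -
    have "\<bar>(\<psi> t)^2\<bar> \<le> B^2" for t using power_mono[OF B[of t] abs_ge_zero, of 2] by simp
    then have "integrable lborel (\<lambda>z. (\<psi> (snd z))^2 * (wv z)^2)"
      by (intro integrable_bounded_mult[OF wv_wA_int(1), of _ "B^2"]) (use \<psi>m in auto)
    then show ?thesis by (simp add: F_def power_mult_distrib)
  qed
  have tf: "(\<lambda>z. wA (v + z)) \<in> borel_measurable borel" for v
    by (rule measurable_compose[OF _ wv_wA_meas(2)]) (intro borel_measurable_continuous_onI continuous_intros)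
  have sq2: "(a - b)^2 \<le> 2 * a^2 + 2 * b^2" for a b :: real
    using zero_le_power2[of "a + b"] by (simp add: power2_sum power2_diff)
  have shift2: "integrable lborel (\<lambda>z. (k (v + z) - k z)^2)"
    if k: "k \<in> borel_measurable borel" "integrable lborel (\<lambda>z. (k z)^2)" for k :: "real \<times> real \<Rightarrow> real" and v
  proof (rule Bochner_Integration.integrable_bound)
    have "integrable lborel (\<lambda>z. (k (v + z))^2)" using lborel_translate(1)[of "\<lambda>z. (k z)^2" v] k by simp
    then show "integrable lborel (\<lambda>z. 2 * (k (v + z))^2 + 2 * (k z)^2)" using k by simp
    have "(\<lambda>z. k (v + z)) \<in> borel_measurable borel"
      by (rule measurable_compose[OF _ k(1)]) (intro borel_measurable_continuous_onI continuous_intros)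
    then show "(\<lambda>z. (k (v + z) - k z)^2) \<in> borel_measurable lborel" using k by simp
    show "AE z in lborel. norm ((k (v + z) - k z)^2) \<le> norm (2 * (k (v + z))^2 + 2 * (k z)^2)"
      using sq2 by (intro AE_I2) simp
  qed
  have Fm': "Fn n \<in> borel_measurable lborel" and F2': "integrable lborel (\<lambda>z. (Fn n z - F z)^2)" for n
  proof -
    \<comment> \<open>A crude bound for the translation error, valid for every shift; it serves only
      to obtain measurability and integrability for all n, while \<open>Flim\<close> uses a small
      e.\<close>
    define e where "e = 2 * (LINT z|lborel. (wv z)^2) + 2 * (LINT z|lborel. (wv z)^2)"
    have e0: "e \<ge> 0" by (simp add: e_def)
    have ge: "(LINT z|lborel. (wv ((0, \<sigma>) + z) - wv z)^2) \<le> e" for \<sigma>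
    proof -
      have t: "integrable lborel (\<lambda>z. (wv ((0, \<sigma>) + z))^2)" "(LINT z|lborel. (wv ((0, \<sigma>) + z))^2) = (LINT z|lborel. (wv z)^2)"
        using lborel_translate[of "\<lambda>z. (wv z)^2" "(0, \<sigma>)"] wv_wA_int(1) by simp_all
      have "(LINT z|lborel. (wv ((0, \<sigma>) + z) - wv z)^2) \<le> (LINT z|lborel. 2 * (wv ((0, \<sigma>) + z))^2 + 2 * (wv z)^2)"
        by (rule Bochner_Integration.integral_mono[OF shift2[OF wv_wA_meas(1) wv_wA_int(1)]]) (use t wv_wA_int(1) sq2 in auto)
      also have "\<dots> = e" using t wv_wA_int(1) by (simp add: e_def)
      finally show ?thesis .
    qed
    show "integrable lborel (\<lambda>z. (Fn n z - F z)^2)" by (rule quot(2)[OF e0 ge])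
    have "(\<lambda>z. (Fn n z - F z) + F z) \<in> borel_measurable lborel"
      by (rule borel_measurable_add[OF _ Fm]) (simp add: quot(1)[OF e0 ge])
    then show "Fn n \<in> borel_measurable lborel" by simp
  qed
  have Flim: "(\<lambda>n. LINT z|lborel. (Fn n z - F z)^2) \<longlonglongrightarrow> 0"
  proof (rule LIMSEQ_I)
    fix \<epsilon> :: real assume \<epsilon>: "\<epsilon> > 0"
    define e where "e = \<epsilon> / (B^2 + 1)"
    have BB: "B^2 + 1 > 0" by (simp add: add_nonneg_pos)
    have e: "e > 0" using \<epsilon> BB by (simp add: e_def)
    obtain \<delta> where \<delta>: "\<delta> > 0" "\<And>v. norm v < \<delta> \<Longrightarrow> (LINT z|lborel. (wv (v + z) - wv z)^2) < e"
      using translate_L2_small[OF wv_wA_int(1) wv_wA_meas(1) e] by blast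
    obtain N where N: "\<And>n. n \<ge> N \<Longrightarrow> h n < \<delta>" using LIMSEQ_D[OF hlim \<delta>(1)] h(1) by fastforce
    have "(LINT z|lborel. (Fn n z - F z)^2) < \<epsilon>" if "n \<ge> N" for n
    proof -
      have "(LINT z|lborel. (Fn n z - F z)^2) \<le> B^2 * e"
      proof (rule quot(3))
        fix \<sigma> assume "\<sigma> \<in> {0..h n}"
        then have "norm ((0, \<sigma>) :: real \<times> real) < \<delta>" using N[OF that] by (simp add: norm_Pair)
        then show "(LINT z|lborel. (wv ((0, \<sigma>) + z) - wv z)^2) \<le> e" using \<delta>(2) less_imp_le by blast
      qed (use e in auto)
      also have "\<dots> < (B^2 + 1) * e" using e by simp
      also have "\<dots> = \<epsilon>" using BB by (simp add: e_def)
      finally show ?thesis .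
    qed
    then show "\<exists>N. \<forall>n\<ge>N. norm ((LINT z|lborel. (Fn n z - F z)^2) - 0) < \<epsilon>" by auto
  qed
  have Geq: "Gn n z - G z = wA ((0, h n) + z) - wA z" for n z by (simp add: Gn_def G_def)
  have vlim: "(\<lambda>n. (0 :: real, h n)) \<longlonglongrightarrow> 0"
    using tendsto_Pair[OF tendsto_const[of "0::real"] hlim] by (simp add: zero_prod_def)
  have Glim: "(\<lambda>n. LINT z|lborel. (Gn n z - G z)^2) \<longlonglongrightarrow> 0"
    unfolding Geq by (rule translate_L2_tendsto[OF wv_wA_int(2) wv_wA_meas(2) vlim])
  have Gm: "G \<in> borel_measurable lborel" "integrable lborel (\<lambda>z. (G z)^2)"
    unfolding G_def using wv_wA_int(2) wv_wA_meas(2) by (auto simp: power_mult_distrib)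
  have Gm': "Gn n \<in> borel_measurable lborel" for n unfolding Gn_def using tf[of "(0, h n)"] wv_wA_meas(2) by simp
  have G2': "integrable lborel (\<lambda>z. (Gn n z - G z)^2)" for n unfolding Geq by (rule shift2[OF wv_wA_meas(2) wv_wA_int(2)])
  have lim1: "(\<lambda>n. LINT z|lborel. Fn n z * Gn n z) \<longlonglongrightarrow> (LINT z|lborel. F z * G z)"
    by (rule L2_product_tendsto[OF Fm' F2' Flim Gm' G2' Glim Fm F2 Gm])
  have FG: "(LINT z|lborel. F z * G z) = - (LINT t|lborel. d t * \<psi> t)"
  proof -
    have i: "integrable lborel (\<lambda>z. F z * G z)" by (rule integral_Cauchy_Schwarz(1)[OF F2 Gm(2) Fm Gm(1)])
    have "(LINT x|lborel. F (x, t) * G (x, t)) = - (d t * \<psi> t)" for t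
    proof -
      have "F (x, t) * G (x, t) = 2 * \<psi> t * (w x * v (x, t) * A (x, t))" for x
      proof -
        have "F (x, t) * G (x, t) = 2 * \<psi> t * ((sqrt (w x) * sqrt (w x)) * v (x, t) * A (x, t))"
          by (simp only: F_def G_def wv_def wA_def fst_conv snd_conv mult_ac)
        then show ?thesis using w_nonneg[of x] by simp
      qed
      then show ?thesis by (simp add: d_def)
    qed
    then show ?thesis using lborel_Fubini_snd(3)[OF i] by simp
  qed
  have lhs: "(LINT z|lborel. Fn n z * Gn n z) = (LINT t|lborel. D t * ((\<psi> t - \<psi> (t - h n)) / h n))" for n
  proof -
    have Fn2: "integrable lborel (\<lambda>z. (Fn n z)^2)"
    proof (rule Bochner_Integration.integrable_bound)
      show "integrable lborel (\<lambda>z. 2 * (Fn n z - F z)^2 + 2 * (F z)^2)" using F2' F2 by simp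
      show "AE z in lborel. norm ((Fn n z)^2) \<le> norm (2 * (Fn n z - F z)^2 + 2 * (F z)^2)"
      proof (rule AE_I2)
        fix z show "norm ((Fn n z)^2) \<le> norm (2 * (Fn n z - F z)^2 + 2 * (F z)^2)"
          using sq2[of "Fn n z - F z" "- F z"] by simp
      qed
    qed (use Fm' in auto)
    have Gn2: "integrable lborel (\<lambda>z. (Gn n z)^2)"
    proof (rule Bochner_Integration.integrable_bound)
      show "integrable lborel (\<lambda>z. 2 * (Gn n z - G z)^2 + 2 * (G z)^2)" using G2' Gm by simp
      show "AE z in lborel. norm ((Gn n z)^2) \<le> norm (2 * (Gn n z - G z)^2 + 2 * (G z)^2)"
      proof (rule AE_I2)
        fix z show "norm ((Gn n z)^2) \<le> norm (2 * (Gn n z - G z)^2 + 2 * (G z)^2)"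
          using sq2[of "Gn n z - G z" "- G z"] by simp
      qed
    qed (use Gm' in auto)
    have i: "integrable lborel (\<lambda>z. Fn n z * Gn n z)" by (rule integral_Cauchy_Schwarz(1)[OF Fn2 Gn2 Fm' Gm'])
    \<comment> \<open>Translation invariance of Lebesgue measure makes t and t + h good times
      simultaneously, for almost every t.\<close>
    have "AE t in distr lborel borel ((+) (h n)). t \<in> {0<..<T} \<longrightarrow> good t"
      unfolding lborel_distr_plus by (rule AE_good)
    then have shift: "AE t in lborel. h n + t \<in> {0<..<T} \<longrightarrow> good (h n + t)" by (rule AE_distrD[rotated]) auto
    have Dm: "D \<in> borel_measurable borel" using integrable_D by auto
    have ae: "AE t in lborel. (LINT x|lborel. Fn n (x, t) * Gn n (x, t)) = (\<psi> t * (D t - D (h n + t))) / h n"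
      using AE_good shift
    proof eventually_elim
      case (elim t)
      show ?case
      proof (cases "t \<in> {l<..<r}")
        case True
        then have t: "good t" "good (h n + t)" using elim lr h[of n] h0 by auto
        have "Fn n (x, t) * Gn n (x, t) = (\<psi> t / h n) * (w x * (m (x, h n + t) - m (x, t)) * (A (x, h n + t) + A (x, t)))" for x
        proof -
          have "Fn n (x, t) * Gn n (x, t) = (\<psi> t / h n) * ((sqrt (w x) * sqrt (w x)) * (m (x, h n + t) - m (x, t)) * (A (x, h n + t) + A (x, t)))"
          proof -
            have gen: "a * (s * (X / k)) * (s * y + s * z) = a / k * (s * s * X * (y + z))" for a s X k y z :: real
              by (simp add: algebra_simps add_divide_distrib)
            show ?thesis
              unfolding Fn_def Gn_def wA_def add_Pair fst_conv snd_conv add_0_left add.commute[of t] by (rule gen)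
          qed
          then show ?thesis using w_nonneg[of x] by simp
        qed
        then have "(LINT x|lborel. Fn n (x, t) * Gn n (x, t)) = (\<psi> t / h n) * (LINT x|lborel. w x * (m (x, h n + t) - m (x, t)) * (A (x, h n + t) + A (x, t)))"
          by simp
        also have "\<dots> = (\<psi> t / h n) * (D t - D (h n + t))" using D_diff[OF t] by simp
        finally show ?thesis by simp
      next
        case False
        then have "\<psi> t = 0" using out\<psi> by blast
        then show ?thesis by (simp add: Fn_def)
      qed
    qed
    have bm: "(\<lambda>t. \<psi> (t - h n)) \<in> borel_measurable borel" by measurable
    have i1: "integrable lborel (\<lambda>t. \<psi> t * D t)" by (rule int_mult_bounded_D[of \<psi> B]) (use B in auto)
    have i2: "integrable lborel (\<lambda>t. \<psi> (t - h n) * D t)" by (rule int_mult_bounded_D[OF bm]) (rule B)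
    have i3: "integrable lborel (\<lambda>t. \<psi> t * D (h n + t))"
      and e3: "(LINT t|lborel. \<psi> t * D (h n + t)) = (LINT t|lborel. \<psi> (t - h n) * D t)"
      using lborel_translate[of "\<lambda>t. \<psi> (t - h n) * D t" "h n"] i2 Dm by simp_all
    have "(LINT z|lborel. Fn n z * Gn n z) = (LINT t|lborel. (\<psi> t * (D t - D (h n + t))) / h n)"
      unfolding lborel_Fubini_snd(3)[OF i, symmetric]
      by (rule integral_cong_AE[OF borel_measurable_integrable[OF lborel_Fubini_snd(2)[OF i]] _ ae]) (use Dm in measurable)
    also have "\<dots> = (LINT t|lborel. (\<psi> t * D t - \<psi> t * D (h n + t)) / h n)" by (simp add: right_diff_distrib)
    also have "\<dots> = ((LINT t|lborel. \<psi> t * D t) - (LINT t|lborel. \<psi> (t - h n) * D t)) / h n"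
      using i1 i3 e3 by simp
    also have "\<dots> = (LINT t|lborel. (\<psi> t * D t - \<psi> (t - h n) * D t) / h n)" using i1 i2 by simp
    also have "\<dots> = (LINT t|lborel. D t * ((\<psi> t - \<psi> (t - h n)) / h n))"
      by (rule Bochner_Integration.integral_cong) (auto simp: algebra_simps diff_divide_distrib)
    finally show ?thesis .
  qed
  have Dm: "D \<in> borel_measurable borel" using integrable_D by auto
  have lim2: "(\<lambda>n. LINT t|lborel. D t * ((\<psi> t - \<psi> (t - h n)) / h n)) \<longlonglongrightarrow> (LINT t|lborel. D t * deriv \<psi> t)"
  proof (rule integral_dominated_convergence[where w="\<lambda>t. B' * \<bar>D t\<bar>"])
    show "AE t in lborel. (\<lambda>n. D t * ((\<psi> t - \<psi> (t - h n)) / h n)) \<longlonglongrightarrow> D t * deriv \<psi> t"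
    proof (rule AE_I2)
      fix t
      have "((\<lambda>k. (\<psi> (t + k) - \<psi> t) / k) \<longlongrightarrow> deriv \<psi> t) (at 0)"
        using test_functionD(1)[OF \<psi>, of t] by (simp add: DERIV_def)
      moreover have "filterlim (\<lambda>n. - h n) (at 0) sequentially"
        using tendsto_minus[OF hlim] by (auto simp: filterlim_at less_imp_neq[OF h(1), symmetric] intro!: always_eventually)
      ultimately have "(\<lambda>n. (\<psi> (t + - h n) - \<psi> t) / (- h n)) \<longlonglongrightarrow> deriv \<psi> t" by (rule filterlim_compose)
      moreover have "(\<psi> (t + - h n) - \<psi> t) / (- h n) = (\<psi> t - \<psi> (t - h n)) / h n" for n by (simp add: diff_divide_distrib)
      ultimately have "(\<lambda>n. (\<psi> t - \<psi> (t - h n)) / h n) \<longlonglongrightarrow> deriv \<psi> t" by simp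
      then show "(\<lambda>n. D t * ((\<psi> t - \<psi> (t - h n)) / h n)) \<longlonglongrightarrow> D t * deriv \<psi> t" by (rule tendsto_mult_left)
    qed
    show "AE t in lborel. norm (D t * ((\<psi> t - \<psi> (t - h n)) / h n)) \<le> B' * \<bar>D t\<bar>" for n
    proof (rule AE_I2)
      fix t
      have "norm (\<psi> t - \<psi> (t - h n)) \<le> B' * norm (t - (t - h n))"
        by (rule field_differentiable_bound[where S=UNIV and f'="deriv \<psi>"]) (use test_functionD(1)[OF \<psi>] B' in auto)
      then have "\<bar>(\<psi> t - \<psi> (t - h n)) / h n\<bar> \<le> B'" using h(1)[of n] by (simp add: divide_le_eq)
      then have "\<bar>D t\<bar> * \<bar>(\<psi> t - \<psi> (t - h n)) / h n\<bar> \<le> \<bar>D t\<bar> * B'" by (rule mult_left_mono) simp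
      then show "norm (D t * ((\<psi> t - \<psi> (t - h n)) / h n)) \<le> B' * \<bar>D t\<bar>" by (simp add: abs_mult mult.commute)
    qed
    show "integrable lborel (\<lambda>t. B' * \<bar>D t\<bar>)" using integrable_D by simp
  qed (use Dm in measurable)
  have "(LINT t|lborel. D t * deriv \<psi> t) = (LINT z|lborel. F z * G z)"
    by (rule LIMSEQ_unique[OF lim2 lim1[unfolded lhs]])
  then show ?thesis unfolding FG .
qed


lemma D_primitive: "\<exists>E. primitive_on {0..T} E d \<and> (AE t in lborel. t \<in> {0<..<T} \<longrightarrow> E t = D t)"
proof -
  have si: "set_integrable lborel S k" if "integrable lborel k" "S \<in> sets borel" for S and k :: "real \<Rightarrow> real"
    unfolding set_integrable_def using that by (intro integrable_mult_indicator) auto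
  have "\<exists>F. primitive_on {0<..<T} F d \<and> (AE t in lborel. t \<in> {0<..<T} \<longrightarrow> F t = D t)"
  proof (rule primitive_of_tests[OF T])
    show "set_integrable lborel {x..y} D" "set_integrable lborel {x..y} d" for x y
      using si integrable_D integrable_d by auto
    show "(LINT t|lborel. D t * deriv \<phi> t) = - (LINT t|lborel. d t * \<phi> t)" if "\<phi> \<in> tests 0 T" for \<phi>
      by (rule D_weak_deriv[OF tests_test_function[OF that]])
  qed
  then obtain F where F: "primitive_on {0<..<T} F d" "AE t in lborel. t \<in> {0<..<T} \<longrightarrow> F t = D t" by blast
  obtain E where E: "primitive_on {0..T} E d" "\<And>t. t \<in> {0<..<T} \<Longrightarrow> E t = F t"
    using primitive_on_extend[OF F(1) si[OF integrable_d] T] by auto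
  have "AE t in lborel. t \<in> {0<..<T} \<longrightarrow> E t = D t" using F(2) by eventually_elim (use E(2) in auto)
  then show ?thesis using E(1) by blast
qed

text \<open>In the expansion of the square, both products containing p(r) are integrated by parts
  with A taken at the later time r. Thus s may tend to 0 without any control of A(s), and m(s) -
  m(r) costs only the square root of the elapsed time by \<open>M_diff_bound\<close>.\<close>

lemma gradient_difference:
  assumes r: "good r" and s: "good s" and sr: "s \<le> r"
  shows "(LINT x|lborel. (p (x, r) - p (x, s))^2)
    \<le> \<bar>D s - D r\<bar> + 2 * sqrt (r * (LINT z|lborel. w (fst z) * (v z)^2) * (LINT x|lborel. w x * (A (x, r))^2))"
proof -
  note bp = good_by_parts
  let ?V = "LINT z|lborel. w (fst z) * (v z)^2" and ?a = "LINT x|lborel. w x * (A (x, r))^2"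
  have rT: "0 < s" "r < T" "0 < r" "s < T" using r s by (auto simp: good_def)
  have pi: "integrable lborel (\<lambda>x. (p (x, r))^2)" "integrable lborel (\<lambda>x. (p (x, s))^2)" using r s by (auto simp: good_def)
  have "(LINT x|lborel. (p (x, r) - p (x, s))^2) = (LINT x|lborel. (p (x, r))^2 + (p (x, s))^2 - 2 * (p (x, s) * p (x, r)))"
    by (rule Bochner_Integration.integral_cong) (auto simp: power2_diff)
  also have "\<dots> = D r + D s - 2 * (LINT x|lborel. p (x, s) * p (x, r))"
    using pi bp(3)[OF s r] by (simp add: D_def)
  also have "D r = - (LINT x|lborel. w x * m (x, r) * A (x, r))" using bp(1)[OF r r] by (simp add: D_def power2_eq_square)
  finally have "(LINT x|lborel. (p (x, r) - p (x, s))^2) = (D s - D r) + 2 * (LINT x|lborel. w x * m (x, s) * A (x, r)) - 2 * (LINT x|lborel. w x * m (x, r) * A (x, r))"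
    using bp(1)[OF s r] bp(1)[OF r r] by (simp add: D_def power2_eq_square)
  also have "\<dots> = (D s - D r) + 2 * (LINT x|lborel. w x * m (x, s) * A (x, r) - w x * m (x, r) * A (x, r))"
    using bp(2)[OF s r] bp(2)[OF r r] by simp
  also have "(LINT x|lborel. w x * m (x, s) * A (x, r) - w x * m (x, r) * A (x, r)) = (LINT x|lborel. (sqrt (w x) * (M x s - M x r)) * (sqrt (w x) * A (x, r)))"
  proof (rule Bochner_Integration.integral_cong)
    fix x
    have "(sqrt (w x) * (M x s - M x r)) * (sqrt (w x) * A (x, r)) = (sqrt (w x) * sqrt (w x)) * (M x s - M x r) * A (x, r)" by (simp only: mult_ac)
    then show "w x * m (x, s) * A (x, r) - w x * m (x, r) * A (x, r) = (sqrt (w x) * (M x s - M x r)) * (sqrt (w x) * A (x, r))"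
      using w_nonneg[of x] M_eq[of x s] M_eq[of x r] w_out[of x] rT by (cases "x \<in> {0<..<1}") (auto simp: algebra_simps)
  qed simp
  finally have eq: "(LINT x|lborel. (p (x, r) - p (x, s))^2)
    = (D s - D r) + 2 * (LINT x|lborel. (sqrt (w x) * (M x s - M x r)) * (sqrt (w x) * A (x, r)))" .
  have le: "(LINT x|lborel. (sqrt (w x) * (M x s - M x r)) * (sqrt (w x) * A (x, r))) \<le> sqrt (r * ?V * ?a)"
  proof -
    let ?I = "LINT x|lborel. (sqrt (w x) * (M x s - M x r)) * (sqrt (w x) * A (x, r))"
    have M2: "integrable lborel (\<lambda>x. w x * (M x r - M x s)^2)" "(LINT x|lborel. w x * (M x r - M x s)^2) \<le> (r - s) * ?V"
      using M_diff_bound[of s r] rT sr by auto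
    have e: "(sqrt (w x) * (M x s - M x r))^2 = w x * (M x r - M x s)^2" "(sqrt (w x) * A (x, r))^2 = w x * (A (x, r))^2" for x
      using w_nonneg[of x] by (simp_all add: power_mult_distrib power2_commute)
    have V0: "?V \<ge> 0" "?a \<ge> 0" using w_nonneg by simp_all
    have "?I^2 \<le> (LINT x|lborel. (sqrt (w x) * (M x s - M x r))^2) * (LINT x|lborel. (sqrt (w x) * A (x, r))^2)"
      by (rule integral_Cauchy_Schwarz(2)) (use r M2 in \<open>auto simp: e good_def\<close>)
    also have "\<dots> \<le> (r * ?V) * ?a"
      unfolding e using M2(2) V0 rT sr
      by (intro mult_right_mono order_trans[OF M2(2)]) auto
    finally show ?thesis by (rule real_le_rsqrt)
  qed
  show ?thesis unfolding eq by (rule add_mono[OF abs_ge_self mult_left_mono[OF le]]) simp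
qed

text \<open>Chebyshev on the windows from \<eta> to 2 \<eta> yields \<eta> a(r) \<le>
  \<open>J (2 * \<eta> n)\<close> + \<eta>, which tends to 0 because the integral of a over a
  shrinking interval does; and r < 2 \<eta>.\<close>

lemma exists_good_sequence:
  assumes P: "AE t in lborel. t \<in> {0<..<T} \<longrightarrow> P t"
  shows "\<exists>r. (\<forall>n. good (r n) \<and> P (r n)) \<and> decseq r \<and> r \<longlonglongrightarrow> 0 \<and> (\<lambda>n. r n * (LINT x|lborel. w x * (A (x, r n))^2)) \<longlonglongrightarrow> 0"
proof -
  define a where "a t = (LINT x|lborel. w x * (A (x, t))^2)" for t
  have a0: "a t \<ge> 0" for t unfolding a_def using w_nonneg by simp
  have ai: "integrable lborel a" unfolding a_def using lborel_Fubini_snd(2)[OF int_A] by simp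
  have asi: "set_integrable lborel {c..d} a" for c d
    unfolding set_integrable_def using ai by (intro integrable_mult_indicator) auto
  \<comment> \<open>The dyadic choice makes successive windows adjacent, so that r is decreasing;
    the exponent n + 2 keeps the first window below T.\<close>
  define \<eta> where "\<eta> n = T / 2 ^ (n + 2)" for n :: nat
  have \<eta>: "\<eta> n > 0" "2 * \<eta> (Suc n) = \<eta> n" "2 * \<eta> n < T" for n
  proof -
    show "\<eta> n > 0" "2 * \<eta> (Suc n) = \<eta> n" using T by (simp_all add: \<eta>_def)
    have "(1::real) < 2 ^ (n + 1)" using one_less_power[of "2::real" "n + 1"] by simp
    then have "T / 2 ^ (n + 1) < T" using T by (simp add: divide_less_eq)
    then show "2 * \<eta> n < T" by (simp add: \<eta>_def)
  qed
  have \<eta>lim: "\<eta> \<longlonglongrightarrow> 0"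
  proof -
    have "(\<lambda>n. (T / 4) * (1/2) ^ n) \<longlonglongrightarrow> (T / 4) * 0"
      by (intro tendsto_intros LIMSEQ_power_zero) auto
    moreover have "\<eta> = (\<lambda>n. (T / 4) * (1/2) ^ n)" by (auto simp: \<eta>_def power_add power_one_over)
    ultimately show ?thesis by simp
  qed
  define J where "J x = 0 + (LINT t:{0..x}|lborel. a t)" for x
  have "\<exists>r. r \<in> {\<eta> n<..<2 * \<eta> n} \<and> (good r \<and> P r) \<and> \<eta> n * a r \<le> J (2 * \<eta> n) + \<eta> n" for n
  proof -
    have "AE t in lborel. t \<in> {\<eta> n<..<2 * \<eta> n} \<longrightarrow> good t \<and> P t"
      using AE_good P by eventually_elim (use \<eta>(1,3)[of n] in auto)
    then obtain r where r: "r \<in> {\<eta> n<..<2 * \<eta> n}" "good r \<and> P r"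
      "(2 * \<eta> n - \<eta> n) * a r \<le> (LINT x:{\<eta> n..2 * \<eta> n}|lborel. a x) + (2 * \<eta> n - \<eta> n)"
      using exists_le_average[OF _ asi, of "\<eta> n" "2 * \<eta> n" "\<lambda>t. good t \<and> P t"] \<eta>(1)[of n] by auto
    have "(LINT x:{\<eta> n..2 * \<eta> n}|lborel. a x) \<le> (LINT x:{0..2 * \<eta> n}|lborel. a x)"
      unfolding set_lebesgue_integral_def
      by (rule Bochner_Integration.integral_mono) (use asi a0 \<eta>(1)[of n] in \<open>auto simp: set_integrable_def indicator_def\<close>)
    then show ?thesis using r by (intro exI[of _ r]) (auto simp: J_def)
  qed
  then obtain r where r: "\<And>n. r n \<in> {\<eta> n<..<2 * \<eta> n}" "\<And>n. good (r n) \<and> P (r n)" "\<And>n. \<eta> n * a (r n) \<le> J (2 * \<eta> n) + \<eta> n"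
    by metis
  have "decseq r"
  proof (rule decseq_SucI)
    fix n show "r (Suc n) \<le> r n" using r(1)[of n] r(1)[of "Suc n"] \<eta>(2)[of n] by auto
  qed
  moreover have "r \<longlonglongrightarrow> 0"
  proof (rule tendsto_sandwich[where f="\<lambda>_. 0" and h="\<lambda>n. 2 * \<eta> n"])
    show "\<forall>\<^sub>F n in sequentially. 0 \<le> r n" using r(1) \<eta>(1) by (intro always_eventually allI) (meson greaterThanLessThan_iff less_imp_le order.strict_trans)
    show "\<forall>\<^sub>F n in sequentially. r n \<le> 2 * \<eta> n" using r(1) by (intro always_eventually allI) (meson greaterThanLessThan_iff less_imp_le)
    show "(\<lambda>n. 2 * \<eta> n) \<longlonglongrightarrow> 0" using tendsto_mult_right_zero[OF \<eta>lim] by simp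
  qed simp
  moreover have "(\<lambda>n. r n * a (r n)) \<longlonglongrightarrow> 0"
  proof (rule tendsto_sandwich[where f="\<lambda>_. 0" and h="\<lambda>n. 2 * (J (2 * \<eta> n) + \<eta> n)"])
    show "\<forall>\<^sub>F n in sequentially. 0 \<le> r n * a (r n)"
    proof (intro always_eventually allI mult_nonneg_nonneg a0)
      fix n show "0 \<le> r n" using r(1)[of n] \<eta>(1)[of n] by auto
    qed
    show "\<forall>\<^sub>F n in sequentially. r n * a (r n) \<le> 2 * (J (2 * \<eta> n) + \<eta> n)"
    proof (intro always_eventually allI)
      fix n
      have "r n * a (r n) \<le> (2 * \<eta> n) * a (r n)" using r(1)[of n] a0 by (intro mult_right_mono) auto
      then have "r n * a (r n) \<le> 2 * (\<eta> n * a (r n))" by (simp only: mult.assoc)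
      also have "\<dots> \<le> 2 * (J (2 * \<eta> n) + \<eta> n)" by (rule mult_left_mono[OF r(3)]) simp
      finally show "r n * a (r n) \<le> 2 * (J (2 * \<eta> n) + \<eta> n)" .
    qed
    have Jc: "continuous_on {0..T} J" unfolding J_def[abs_def]
      by (rule primitive_on_continuous_Icc[OF primitive_on_integral[OF asi]])
    have "(\<lambda>n. J (2 * \<eta> n)) \<longlonglongrightarrow> J 0"
    proof (rule continuous_on_tendsto_compose[OF Jc])
      show "(\<lambda>n. 2 * \<eta> n) \<longlonglongrightarrow> 0" using tendsto_mult_right_zero[OF \<eta>lim] by simp
      show "\<forall>\<^sub>F n in sequentially. 2 * \<eta> n \<in> {0..T}" using \<eta>(1,3) by (intro always_eventually allI) (auto intro: less_imp_le)
    qed (use T in auto)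
    moreover have "J 0 = 0" by (simp add: J_def set_integral_singleton)
    ultimately have "(\<lambda>n. 2 * (J (2 * \<eta> n) + \<eta> n)) \<longlonglongrightarrow> 2 * (0 + 0)" by (intro tendsto_intros \<eta>lim) simp
    then show "(\<lambda>n. 2 * (J (2 * \<eta> n) + \<eta> n)) \<longlonglongrightarrow> 0" by simp
  qed simp
  ultimately show ?thesis using r(2) unfolding a_def by blast
qed

text \<open>G is the trace of (am)_x at time 0, obtained as an L2 limit along \<open>r\<close>. The
  last conjunct is the product rule for \<theta> E on the time interval, with E the continuous
  version of D: E(0) is the squared norm of G, and the term \<theta>(T) E(T) \<ge> 0 has been
  dropped.\<close>

lemma trace_gradient:
  "\<exists>r G. (\<forall>n. good (r n)) \<and> r \<longlonglongrightarrow> 0 \<and> G \<in> borel_measurable borel \<and> (\<forall>x. x \<notin> {0<..<1} \<longrightarrow> G x = 0) \<and> integrable lborel (\<lambda>x. (G x)^2) \<and>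
     (\<forall>n. integrable lborel (\<lambda>x. (p (x, r n) - G x)^2)) \<and> (\<lambda>n. LINT x|lborel. (p (x, r n) - G x)^2) \<longlonglongrightarrow> 0 \<and>
     (\<forall>\<theta> \<theta>'. (\<forall>t. (\<theta> has_real_derivative \<theta>' t) (at t)) \<longrightarrow> continuous_on UNIV \<theta>' \<longrightarrow> (\<forall>t. \<theta> t \<ge> 0) \<longrightarrow>
       (LINT z|lborel. \<theta>' (snd z) * (p z)^2) - 2 * (LINT z|lborel. \<theta> (snd z) * (w (fst z) * v z * A z))
         \<ge> - \<theta> 0 * (LINT x|lborel. (G x)^2))"
proof -
  obtain E where E: "primitive_on {0..T} E d" and ED: "AE t in lborel. t \<in> {0<..<T} \<longrightarrow> E t = D t"
    using D_primitive by blast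
  obtain r where good: "\<And>n. good (r n)" and rD: "\<And>n. E (r n) = D (r n)" and dec: "decseq r" and r0: "r \<longlonglongrightarrow> 0"
    and ra: "(\<lambda>n. r n * (LINT x|lborel. w x * (A (x, r n))^2)) \<longlonglongrightarrow> 0"
    using exists_good_sequence[OF ED] by blast
  let ?V = "LINT z|lborel. w (fst z) * (v z)^2"
  have Ec: "continuous_on {0..T} E" by (rule primitive_on_continuous_Icc[OF E])
  have Elim: "(\<lambda>n. E (r n)) \<longlonglongrightarrow> E 0"
    by (rule continuous_on_tendsto_compose[OF Ec r0])
      (use T good in \<open>auto simp: good_def intro!: always_eventually less_imp_le\<close>)
  have blim: "(\<lambda>n. sqrt (r n * ?V * (LINT x|lborel. w x * (A (x, r n))^2))) \<longlonglongrightarrow> 0"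
  proof -
    have "(\<lambda>n. sqrt (?V * (r n * (LINT x|lborel. w x * (A (x, r n))^2)))) \<longlonglongrightarrow> sqrt (?V * 0)"
      by (intro tendsto_intros ra)
    then show ?thesis by (simp add: mult_ac)
  qed
  have pm: "(\<lambda>x. p (x, r n)) \<in> borel_measurable lborel" for n by simp
  have p2: "integrable lborel (\<lambda>x. (p (x, r n))^2)" for n using good[of n] by (simp add: good_def)
  have "\<exists>N. \<forall>n\<ge>N. \<forall>k\<ge>n. (LINT x|lborel. (p (x, r n) - p (x, r k))^2) < e" if e: "e > 0" for e
  proof -
    obtain N1 where N1: "\<And>n. n \<ge> N1 \<Longrightarrow> \<bar>E (r n) - E 0\<bar> < e / 4" using LIMSEQ_D[OF Elim, of "e / 4"] e by auto
    obtain N2 where N2: "\<And>n. n \<ge> N2 \<Longrightarrow> sqrt (r n * ?V * (LINT x|lborel. w x * (A (x, r n))^2)) < e / 4"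
      using order_tendstoD(2)[OF blim, of "e / 4"] e by (auto simp: eventually_sequentially)
    have "(LINT x|lborel. (p (x, r n) - p (x, r k))^2) < e" if "n \<ge> max N1 N2" "k \<ge> n" for n k
    proof -
      have "r k \<le> r n" using dec that by (simp add: decseq_def)
      from gradient_difference[OF good good this]
      have "(LINT x|lborel. (p (x, r n) - p (x, r k))^2) \<le> \<bar>E (r k) - E (r n)\<bar> + 2 * sqrt (r n * ?V * (LINT x|lborel. w x * (A (x, r n))^2))"
        by (simp add: rD)
      moreover have "\<bar>E (r k) - E (r n)\<bar> < e / 2" 
      proof -
        have "\<bar>E (r n) - E 0\<bar> < e / 4" "\<bar>E (r k) - E 0\<bar> < e / 4" using N1[of n] N1[of k] that by auto
        then show ?thesis by linarith
      qed
      ultimately show ?thesis using N2[of n] that by auto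
    qed
    then show ?thesis by blast
  qed
  then obtain H where H: "H \<in> borel_measurable lborel" "\<And>n. integrable lborel (\<lambda>x. (p (x, r n) - H x)^2)"
    "(\<lambda>n. LINT x|lborel. (p (x, r n) - H x)^2) \<longlonglongrightarrow> 0"
    using L2_complete[of "\<lambda>n x. p (x, r n)" lborel, OF pm p2] by blast
  \<comment> \<open>The limit is cut off to (0,1), so that integrals of G over (0,1) and over the
    line agree; the distance to p, which vanishes outside, does not increase.\<close>
  define G where "G x = indicator {0<..<1} x * H x" for x
  have le: "(p (x, r n) - G x)^2 \<le> (p (x, r n) - H x)^2" for x n
    by (cases "x \<in> {0<..<1}") (simp_all add: G_def slice_zero')
  have G: "G \<in> borel_measurable lborel" "\<And>n. integrable lborel (\<lambda>x. (p (x, r n) - G x)^2)"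
    "(\<lambda>n. LINT x|lborel. (p (x, r n) - G x)^2) \<longlonglongrightarrow> 0"
  proof -
    show Gm: "G \<in> borel_measurable lborel" unfolding G_def[abs_def] using H(1) by simp
    show i: "integrable lborel (\<lambda>x. (p (x, r n) - G x)^2)" for n
      by (rule Bochner_Integration.integrable_bound[OF H(2)[of n]]) (use Gm pm[of n] le in auto)
    show "(\<lambda>n. LINT x|lborel. (p (x, r n) - G x)^2) \<longlonglongrightarrow> 0"
      by (rule Lim_null_comparison[OF _ H(3)], rule always_eventually)
        (use Bochner_Integration.integral_mono[OF i H(2) le] in simp)
  qed
  have G2: "integrable lborel (\<lambda>x. (G x)^2)"
  proof (rule Bochner_Integration.integrable_bound)
    show "integrable lborel (\<lambda>x. 2 * (p (x, r 0))^2 + 2 * (p (x, r 0) - G x)^2)" using p2 G(2) by simp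
    have "b^2 \<le> 2 * a^2 + 2 * (a - b)^2" for a b :: real
      using zero_le_power2[of "2 * a - b"] by (simp add: power2_diff power_mult_distrib)
    then show "AE x in lborel. norm ((G x)^2) \<le> norm (2 * (p (x, r 0))^2 + 2 * (p (x, r 0) - G x)^2)" by auto
  qed (use G(1) in auto)
  have "(\<lambda>n. LINT x|lborel. p (x, r n) * p (x, r n)) \<longlonglongrightarrow> (LINT x|lborel. G x * G x)"
    by (rule L2_product_tendsto[OF pm G(2,3) pm G(2,3) G(1) G2 G(1) G2])
  then have "(\<lambda>n. E (r n)) \<longlonglongrightarrow> (LINT x|lborel. (G x)^2)" by (simp add: rD D_def power2_eq_square)
  then have E0: "E 0 = (LINT x|lborel. (G x)^2)" using LIMSEQ_unique[OF Elim] by blast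
  \<comment> \<open>E agrees with D \<ge> 0 only almost everywhere, so a negative value at T would,
    by continuity, be refuted on a whole interval ending at T.\<close>
  have ET: "E T \<ge> 0"
  proof (rule ccontr)
    assume n: "\<not> E T \<ge> 0"
    then obtain \<delta> where \<delta>: "\<delta> > 0" "\<And>t. t \<in> {0..T} \<Longrightarrow> dist t T < \<delta> \<Longrightarrow> dist (E t) (E T) < - E T"
      using Ec T unfolding continuous_on_iff by (metis atLeastAtMost_iff less_imp_le neg_0_less_iff_less not_le order_refl)
    define l where "l = max 0 (T - \<delta>)"
    have l: "l < T" "l \<ge> 0" "l \<ge> T - \<delta>" using T \<delta> by (auto simp: l_def)
    have "AE t in lborel. t \<in> {l<..<T} \<longrightarrow> False"
      using ED
    proof eventually_elim
      case (elim t)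
      show ?case
      proof
        assume t: "t \<in> {l<..<T}"
        then have "E t < 0" using \<delta>(2)[of t] l by (auto simp: dist_real_def)
        moreover have "E t = D t" using elim t l by auto
        moreover have "D t \<ge> 0" by (simp add: D_def)
        ultimately show False by simp
      qed
    qed
    \<comment> \<open>A property that fails everywhere on an open interval but holds almost
      everywhere: \<open>AE_eq_continuous_Ioo\<close> for two different constants converts this into
      a contradiction.\<close>
    then have "\<forall>t\<in>{l<..<T}. (0::real) = 1" by (intro AE_eq_continuous_Ioo continuous_on_const) simp
    then show False using dense[OF l(1)] by auto
  qed
  have fin: "(LINT z|lborel. \<theta>' (snd z) * (p z)^2) - 2 * (LINT z|lborel. \<theta> (snd z) * (w (fst z) * v z * A z))
         \<ge> - \<theta> 0 * (LINT x|lborel. (G x)^2)"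
    if \<theta>: "\<And>t. (\<theta> has_real_derivative \<theta>' t) (at t)" and \<theta>': "continuous_on UNIV \<theta>'" and \<theta>0: "\<And>t. \<theta> t \<ge> 0" for \<theta> \<theta>'
  proof -
    have \<theta>c: "continuous_on UNIV \<theta>" using \<theta> by (meson DERIV_isCont continuous_at_imp_continuous_on)
    have [measurable]: "\<theta> \<in> borel_measurable borel" "\<theta>' \<in> borel_measurable borel"
      using \<theta>c \<theta>' by (auto intro: borel_measurable_continuous_onI)
    have i1: "integrable lborel (\<lambda>z. \<theta>' (snd z) * (p z)^2)" by (rule integrable_time_weight[OF int_p _ \<theta>']) (simp add: out)
    have i2: "integrable lborel (\<lambda>z. \<theta> (snd z) * (w (fst z) * v z * A z))" by (rule integrable_time_weight[OF int_wvA _ \<theta>c]) (simp add: out)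
    have f1: "(LINT z|lborel. \<theta>' (snd z) * (p z)^2) = (LINT t|lborel. \<theta>' t * D t)"
      "integrable lborel (\<lambda>t. \<theta>' t * D t)"
      using lborel_Fubini_snd(2,3)[OF i1] by (simp_all add: D_def)
    have f2: "2 * (LINT z|lborel. \<theta> (snd z) * (w (fst z) * v z * A z)) = - (LINT t|lborel. \<theta> t * d t)"
      "integrable lborel (\<lambda>t. \<theta> t * d t)"
    proof -
      have "\<theta> t * d t = - 2 * (LINT x|lborel. \<theta> t * (w x * v (x, t) * A (x, t)))" for t by (simp add: d_def)
      then show "2 * (LINT z|lborel. \<theta> (snd z) * (w (fst z) * v z * A z)) = - (LINT t|lborel. \<theta> t * d t)"
        "integrable lborel (\<lambda>t. \<theta> t * d t)"
        using lborel_Fubini_snd(2,3)[OF i2] by simp_all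
    qed
    have D0: "D t = 0" "d t = 0" if "t \<notin> {0<..<T}" for t using that by (simp_all add: D_def d_def slice_zero)
    have \<theta>p: "primitive_on {0..T} \<theta> \<theta>'" by (rule primitive_on_C1) (use \<theta> \<theta>' in \<open>auto intro: has_field_derivative_at_within continuous_on_subset\<close>)
    note pr = primitive_onD[OF primitive_on_mult[OF \<theta>p E], of 0 T]
    have "(LINT t|lborel. \<theta>' t * D t) + (LINT t|lborel. \<theta> t * d t) = (LINT t|lborel. \<theta> t * d t + D t * \<theta>' t)"
      using f1(2) f2(2) by (simp add: mult.commute add.commute)
    also have "\<dots> = (LINT t:{0..T}|lborel. \<theta> t * d t + D t * \<theta>' t)" by (rule set_integral_Q[symmetric]) (simp add: D0)
    also have "\<dots> = (LINT t:{0..T}|lborel. \<theta> t * d t + E t * \<theta>' t)"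
    proof -
      have "AE t in lborel. t \<noteq> 0" "AE t in lborel. t \<noteq> T" by (rule AE_lborel_singleton)+
      with ED have ae: "AE t in lborel. indicator {0..T} t *\<^sub>R (\<theta> t * d t + D t * \<theta>' t) = indicator {0..T} t *\<^sub>R (\<theta> t * d t + E t * \<theta>' t)"
        by eventually_elim (auto simp: indicator_def)
      have "D \<in> borel_measurable borel" "d \<in> borel_measurable borel" using integrable_D integrable_d by auto
      then have "(\<lambda>t. indicator {0..T} t *\<^sub>R (\<theta> t * d t + D t * \<theta>' t)) \<in> borel_measurable lborel" by measurable
      then show ?thesis unfolding set_lebesgue_integral_def
        by (rule integral_cong_AE[OF _ _ ae]) (use pr(1) T in \<open>auto simp: set_integrable_def\<close>)
    qed
    also have "\<dots> = \<theta> T * E T - \<theta> 0 * E 0" using pr(2) T by auto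
    finally show ?thesis using f1(1) f2(1) E0 mult_nonneg_nonneg[OF \<theta>0[of T] ET] by simp
  qed
  show ?thesis
    by (rule exI[of _ r], rule exI[of _ G]) (use good r0 G G2 fin in \<open>auto simp: G_def[of x for x]\<close>)
qed

lemma good_trace_L2:
  assumes "good r"
  shows "integrable lborel (\<lambda>x. w x * (m (x, r) - c x)^2)"
    "(LINT x|lborel. w x * (m (x, r) - c x)^2) \<le> r * (LINT z|lborel. w (fst z) * (v z)^2)"
proof -
  have r: "0 < r" "r < T" using assms by (auto simp: good_def)
  have e: "w x * (M x r - M x 0)^2 = w x * (m (x, r) - c x)^2" for x
    using M_eq[of x r] r w_out[of x] by (cases "x \<in> {0<..<1}") (auto simp: M_0)
  show "integrable lborel (\<lambda>x. w x * (m (x, r) - c x)^2)"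
    "(LINT x|lborel. w x * (m (x, r) - c x)^2) \<le> r * (LINT z|lborel. w (fst z) * (v z)^2)"
    using M_diff_bound[of 0 r, unfolded e] r by simp_all
qed

end

subsection \<open>The Carleman inequality\<close>

context degenerate_evolution
begin

text \<open>Together with \<open>wprod\<close>, names for the integrals in which the estimate is
  bilinear, so that the final argument is linear arithmetic in them.\<close>

definition wint :: "(real \<Rightarrow> real) \<Rightarrow> (real \<times> real \<Rightarrow> real) \<Rightarrow> real"
  where "wint \<psi> u = (LINT z|lborel. \<psi> (snd z) * u z)"

definition wprod :: "(real \<times> real \<Rightarrow> real) \<Rightarrow> (real \<times> real \<Rightarrow> real) \<Rightarrow> real \<times> real \<Rightarrow> real"
  where "wprod u h z = w (fst z) * u z * h z"

lemma wprod_integrable: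
  assumes "continuous_on UNIV \<psi>"
  shows "integrable lborel (\<lambda>z. \<psi> (snd z) * wprod m m z)" "integrable lborel (\<lambda>z. \<psi> (snd z) * wprod v v z)"
    "integrable lborel (\<lambda>z. \<psi> (snd z) * wprod A A z)" "integrable lborel (\<lambda>z. \<psi> (snd z) * wprod m v z)"
    "integrable lborel (\<lambda>z. \<psi> (snd z) * wprod m A z)" "integrable lborel (\<lambda>z. \<psi> (snd z) * wprod v A z)"
    "integrable lborel (\<lambda>z. \<psi> (snd z) * (p z)^2)"
proof -
  have i: "integrable lborel (wprod u h)"
    if "integrable lborel (\<lambda>z. w (fst z) * (u z)^2)" "integrable lborel (\<lambda>z. w (fst z) * (h z)^2)"
      "u \<in> borel_measurable borel" "h \<in> borel_measurable borel" for u h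
    unfolding wprod_def[abs_def] by (rule integrable_weighted_mult) (use that w_nonneg in auto)
  have tw: "integrable lborel (\<lambda>z. \<psi> (snd z) * wprod u h z)"
    if "integrable lborel (\<lambda>z. w (fst z) * (u z)^2)" "integrable lborel (\<lambda>z. w (fst z) * (h z)^2)"
      "u \<in> borel_measurable borel" "h \<in> borel_measurable borel" "\<And>z. z \<notin> Q T \<Longrightarrow> u z = 0" for u h
    by (rule integrable_time_weight[OF i[OF that(1-4)] _ assms]) (simp add: wprod_def that(5))
  show "integrable lborel (\<lambda>z. \<psi> (snd z) * wprod m m z)" "integrable lborel (\<lambda>z. \<psi> (snd z) * wprod v v z)"
    "integrable lborel (\<lambda>z. \<psi> (snd z) * wprod A A z)" "integrable lborel (\<lambda>z. \<psi> (snd z) * wprod m v z)"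
    "integrable lborel (\<lambda>z. \<psi> (snd z) * wprod m A z)" "integrable lborel (\<lambda>z. \<psi> (snd z) * wprod v A z)"
    "integrable lborel (\<lambda>z. \<psi> (snd z) * (p z)^2)"
    by (intro tw int_m int_v int_A m_meas v_meas A_meas out integrable_time_weight[OF int_p _ assms]; simp add: out)+
qed

text \<open>The abstract estimate: \<open>gG\<close> stands for the weighted norm of G,
  \<open>D0\<close> for the squared norm of the initial gradient, \<open>grad\<close> for the
  identity of \<open>trace_gradient\<close>, and \<open>eqn\<close> for the equation once the first
  order term has been estimated. The constants depend on K alone.\<close>

lemma carleman:
  fixes lam s K gG D0 :: real
  assumes lam: "lam \<ge> 32 * K^2 + 1" and s: "s \<ge> 1"
  defines "\<phi> \<equiv> \<lambda>t. exp (lam * t)" and "\<theta> \<equiv> \<lambda>t. exp (2 * s * exp (lam * t))"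
  assumes grad: "\<And>\<psi> \<psi>'. (\<And>t. (\<psi> has_real_derivative \<psi>' t) (at t)) \<Longrightarrow> continuous_on UNIV \<psi>' \<Longrightarrow> (\<And>t. \<psi> t \<ge> 0) \<Longrightarrow>
       (LINT z|lborel. \<psi>' (snd z) * (p z)^2) - 2 * (LINT z|lborel. \<psi> (snd z) * (w (fst z) * v z * A z)) \<ge> - \<psi> 0 * D0"
    and D0: "D0 \<ge> 0"
    and eqn: "(LINT z|lborel. \<theta> (snd z) * (w (fst z) * (v z - A z)^2))
       \<le> 2 * gG + 4 * K^2 * (LINT z|lborel. \<theta> (snd z) * (p z)^2) + 4 * K^4 * (LINT z|lborel. \<theta> (snd z) * (w (fst z) * (m z)^2))"
    and gG: "gG \<ge> 0"
  shows "(LINT z|lborel. 1 / (s * \<phi> (snd z)) * (w (fst z) * (A z)^2 + w (fst z) * (v z)^2) * \<theta> (snd z))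
      + (LINT z|lborel. lam * (p z)^2 * \<theta> (snd z))
      + (LINT z|lborel. s * lam^2 * \<phi> (snd z) * w (fst z) * (m z)^2 * \<theta> (snd z))
    \<le> 100 * gG + 100 * s * lam * (\<phi> T * (LINT x|lborel. w x * (M x T)^2)) * \<theta> T
      + 100 * (s * lam * (LINT x|lborel. w x * (c x)^2) + D0) * exp (2 * s)"
proof -
  define P where "P t = s * lam * \<phi> t" for t
  have lam1: "lam \<ge> 1" using lam by (smt (verit) zero_le_power2)
  have \<phi>0: "\<phi> t > 0" for t by (simp add: \<phi>_def)
  have \<theta>0: "\<theta> t > 0" for t by (simp add: \<theta>_def)
  have c\<phi>: "continuous_on UNIV \<phi>" unfolding \<phi>_def by (intro continuous_intros)
  have cP: "continuous_on UNIV P" unfolding P_def \<phi>_def by (intro continuous_intros)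
  have c\<theta>: "continuous_on UNIV \<theta>" unfolding \<theta>_def by (intro continuous_intros)
  have d\<theta>: "(\<theta> has_real_derivative 2 * P t * \<theta> t) (at t)" for t
    unfolding \<theta>_def P_def \<phi>_def by (auto intro!: derivative_eq_intros simp: algebra_simps)
  have dP: "(P has_real_derivative lam * P t) (at t)" for t
    unfolding P_def \<phi>_def by (auto intro!: derivative_eq_intros simp: algebra_simps)
  let ?\<theta>P = "\<lambda>t. \<theta> t * P t" and ?\<theta>PP = "\<lambda>t. \<theta> t * (P t)^2"
  have c1: "continuous_on UNIV ?\<theta>P" "continuous_on UNIV ?\<theta>PP" using c\<theta> cP by (auto intro!: continuous_intros)
  note i\<theta> = wprod_integrable[OF c\<theta>] and iP = wprod_integrable[OF c1(1)] and iPP = wprod_integrable[OF c1(2)]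
  define N where "N = (LINT z|lborel. \<theta> (snd z) * (w (fst z) * (v z - A z)^2))"
  \<comment> \<open>X and Y are the last two integrals of the left-hand side; N, Z, R and S are
    squared weighted norms of v - A, v + P m, P m + A and (v - A) - \<lambda> m.\<close>
  define X where "X = lam * wint ?\<theta>P (wprod m m)"
  define Y where "Y = lam * wint \<theta> (\<lambda>z. (p z)^2)"
  define Z where "Z = (LINT z|lborel. \<theta> (snd z) * (w (fst z) * (v z + P (snd z) * m z)^2))"
  define R where "R = (LINT z|lborel. \<theta> (snd z) * (w (fst z) * (P (snd z) * m z + A z)^2))"
  define S where "S = (LINT z|lborel. \<theta> (snd z) * (w (fst z) * ((v z - A z) - lam * m z)^2))"
  have RS0: "R \<ge> 0" "S \<ge> 0" "Z \<ge> 0" "N \<ge> 0" unfolding R_def S_def Z_def N_def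
    using w_nonneg less_imp_le[OF \<theta>0] by simp_all
  have Ni: "integrable lborel (\<lambda>z. \<theta> (snd z) * (w (fst z) * (v z - A z)^2))"
    and N: "N = wint \<theta> (wprod v v) - 2 * wint \<theta> (wprod v A) + wint \<theta> (wprod A A)"
  proof -
    have e: "\<theta> (snd z) * (w (fst z) * (v z - A z)^2) = \<theta> (snd z) * wprod v v z - 2 * (\<theta> (snd z) * wprod v A z) + \<theta> (snd z) * wprod A A z" for z
      by (simp add: wprod_def power2_eq_square algebra_simps)
    show "integrable lborel (\<lambda>z. \<theta> (snd z) * (w (fst z) * (v z - A z)^2))"
      "N = wint \<theta> (wprod v v) - 2 * wint \<theta> (wprod v A) + wint \<theta> (wprod A A)"
      unfolding N_def e wint_def using i\<theta> by simp_all
  qed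
  have Zi: "integrable lborel (\<lambda>z. \<theta> (snd z) * (w (fst z) * (v z + P (snd z) * m z)^2))"
    and Z: "Z = wint \<theta> (wprod v v) + 2 * wint ?\<theta>P (wprod m v) + wint ?\<theta>PP (wprod m m)"
  proof -
    have e: "\<theta> (snd z) * (w (fst z) * (v z + P (snd z) * m z)^2) = \<theta> (snd z) * wprod v v z + 2 * (\<theta> (snd z) * P (snd z) * wprod m v z) + \<theta> (snd z) * (P (snd z))^2 * wprod m m z" for z
      by (simp add: wprod_def power2_eq_square algebra_simps)
    show "integrable lborel (\<lambda>z. \<theta> (snd z) * (w (fst z) * (v z + P (snd z) * m z)^2))"
      "Z = wint \<theta> (wprod v v) + 2 * wint ?\<theta>P (wprod m v) + wint ?\<theta>PP (wprod m m)"
      unfolding Z_def e wint_def using i\<theta> iP iPP by simp_all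
  qed
  have R: "R = wint ?\<theta>PP (wprod m m) + 2 * wint ?\<theta>P (wprod m A) + wint \<theta> (wprod A A)"
  proof -
    have e: "\<theta> (snd z) * (w (fst z) * (P (snd z) * m z + A z)^2) = \<theta> (snd z) * (P (snd z))^2 * wprod m m z + 2 * (\<theta> (snd z) * P (snd z) * wprod m A z) + \<theta> (snd z) * wprod A A z" for z
      by (simp add: wprod_def power2_eq_square algebra_simps)
    show ?thesis unfolding R_def e wint_def using i\<theta> iP iPP by simp
  qed
  have S: "S = N - 2 * lam * (wint \<theta> (wprod m v) - wint \<theta> (wprod m A)) + lam^2 * wint \<theta> (wprod m m)"
  proof -
    have e: "\<theta> (snd z) * (w (fst z) * ((v z - A z) - lam * m z)^2) = \<theta> (snd z) * (w (fst z) * (v z - A z)^2)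
      - 2 * lam * (\<theta> (snd z) * wprod m v z - \<theta> (snd z) * wprod m A z) + lam^2 * (\<theta> (snd z) * wprod m m z)" for z
      by (simp add: wprod_def power2_eq_square algebra_simps)
    show ?thesis unfolding S_def e wint_def N_def using Ni i\<theta> by simp
  qed
  define ET where "ET = (LINT x|lborel. w x * (M x T)^2)"
  define E0 where "E0 = (LINT x|lborel. w x * (c x)^2)"
  have E: "ET \<ge> 0" "E0 \<ge> 0" unfolding ET_def E0_def using w_nonneg by simp_all
  have d\<theta>P: "(?\<theta>P has_real_derivative 2 * (\<theta> t * (P t)^2) + lam * (\<theta> t * P t)) (at t)" for t
    by (rule DERIV_cong[OF DERIV_mult[OF d\<theta> dP]]) (simp add: power2_eq_square algebra_simps)
  \<comment> \<open>The derivative of \<theta> P is 2 \<theta> P^2 + \<lambda> \<theta> P. The first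
    part is matched by the P^2 terms of Z and R, the second is X.\<close>
  have en1: "2 * wint ?\<theta>P (wprod m v) + (2 * wint ?\<theta>PP (wprod m m) + X) = \<theta> T * P T * ET - \<theta> 0 * P 0 * E0"
  proof -
    have "(LINT z|lborel. w (fst z) * (2 * (\<theta> (snd z) * P (snd z)) * m z * v z + (2 * (\<theta> (snd z) * (P (snd z))^2) + lam * (\<theta> (snd z) * P (snd z))) * (m z)^2))
       = \<theta> T * P T * ET - \<theta> 0 * P 0 * E0"
      unfolding ET_def E0_def
      by (rule energy_identity[OF d\<theta>P]) (use c\<theta> cP in \<open>auto intro!: continuous_intros\<close>)
    moreover have "w (fst z) * (2 * (\<theta> (snd z) * P (snd z)) * m z * v z + (2 * (\<theta> (snd z) * (P (snd z))^2) + lam * (\<theta> (snd z) * P (snd z))) * (m z)^2)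
      = 2 * (\<theta> (snd z) * P (snd z) * wprod m v z) + (2 * (\<theta> (snd z) * (P (snd z))^2 * wprod m m z) + lam * (\<theta> (snd z) * P (snd z) * wprod m m z))" for z
      by (simp add: wprod_def power2_eq_square algebra_simps)
    ultimately show ?thesis unfolding wint_def X_def using iP iPP by simp
  qed
  have en2: "2 * wint \<theta> (wprod m v) + 2 * wint ?\<theta>P (wprod m m) = \<theta> T * ET - \<theta> 0 * E0"
  proof -
    have "(LINT z|lborel. w (fst z) * (2 * \<theta> (snd z) * m z * v z + 2 * P (snd z) * \<theta> (snd z) * (m z)^2)) = \<theta> T * ET - \<theta> 0 * E0"
      unfolding ET_def E0_def
      by (rule energy_identity[OF d\<theta>]) (use c\<theta> cP in \<open>auto intro!: continuous_intros\<close>)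
    moreover have "w (fst z) * (2 * \<theta> (snd z) * m z * v z + 2 * P (snd z) * \<theta> (snd z) * (m z)^2)
      = 2 * (\<theta> (snd z) * wprod m v z) + 2 * (\<theta> (snd z) * P (snd z) * wprod m m z)" for z
      by (simp add: wprod_def power2_eq_square algebra_simps)
    ultimately show ?thesis unfolding wint_def using iP i\<theta> by simp
  qed
  have gr1: "wint ?\<theta>P (wprod m A) = - wint ?\<theta>P (\<lambda>z. (p z)^2)" "wint \<theta> (wprod m A) = - wint \<theta> (\<lambda>z. (p z)^2)"
    using gradient_identity(1)[OF c1(1)] gradient_identity(1)[OF c\<theta>] by (simp_all add: wint_def wprod_def)
  \<comment> \<open>\<open>grad\<close> with \<psi> = \<theta>, whose derivative is 2 P \<theta>:
    exactly the gradient term that \<open>gr1\<close> produces from the cross term of P m and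
    A.\<close>
  have gr2: "2 * wint ?\<theta>P (\<lambda>z. (p z)^2) - 2 * wint \<theta> (wprod v A) \<ge> - \<theta> 0 * D0"
  proof -
    have "(LINT z|lborel. 2 * P (snd z) * \<theta> (snd z) * (p z)^2) - 2 * (LINT z|lborel. \<theta> (snd z) * (w (fst z) * v z * A z)) \<ge> - \<theta> 0 * D0"
      by (rule grad[OF d\<theta>]) (use c\<theta> cP less_imp_le[OF \<theta>0] in \<open>auto intro!: continuous_intros\<close>)
    moreover have "2 * P (snd z) * \<theta> (snd z) * (p z)^2 = 2 * (\<theta> (snd z) * P (snd z) * (p z)^2)" for z by simp
    ultimately show ?thesis by (simp add: wint_def wprod_def)
  qed
  define bT where "bT = \<theta> T * P T * ET"
  define b0 where "b0 = \<theta> 0 * P 0 * E0"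
  define bD where "bD = \<theta> 0 * D0"
  have P_ge: "t \<ge> 0 \<Longrightarrow> P t \<ge> lam" for t
  proof -
    assume "t \<ge> 0"
    then have "1 \<le> \<phi> t" using lam1 by (simp add: \<phi>_def)
    then have "1 * 1 \<le> s * \<phi> t" using s by (intro mult_mono) auto
    then have "lam * 1 \<le> lam * (s * \<phi> t)" using lam1 by (intro mult_left_mono) auto
    then show "P t \<ge> lam" by (simp add: P_def mult_ac)
  qed
  have b: "bT \<ge> 0" "b0 \<ge> 0" "bD \<ge> 0"
    using E D0 P_ge[of T] P_ge[of 0] T lam1 less_imp_le[OF \<theta>0] by (auto simp: bT_def b0_def bD_def intro!: mult_nonneg_nonneg)
  \<comment> \<open>N = Z + R - 2 (v + P m, P m + A). By \<open>en1\<close> the part of the cross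
    term containing m v and P^2 m^2 contributes X up to boundary terms; by \<open>gr1\<close> and
    \<open>gr2\<close> the part containing A costs at most bD. The square R is dropped.\<close>
  have star: "X + Z \<le> N + bT + bD"
    using N Z R en1 gr1 gr2 RS0 b by (simp add: bT_def b0_def bD_def)
  \<comment> \<open>On \<open>Q T\<close> one has P \<ge> \<lambda>, because s and \<phi> are at
    least 1 there. So zero order terms with the factor \<lambda>^2 are dominated by X.\<close>
  have mm: "lam^2 * wint \<theta> (wprod m m) \<le> X"
  proof -
    have "lam * wint \<theta> (wprod m m) \<le> wint ?\<theta>P (wprod m m)"
    proof -
      have "(LINT z|lborel. lam * (\<theta> (snd z) * wprod m m z)) \<le> (LINT z|lborel. \<theta> (snd z) * P (snd z) * wprod m m z)"
      proof (rule Bochner_Integration.integral_mono)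
        fix z
        show "lam * (\<theta> (snd z) * wprod m m z) \<le> \<theta> (snd z) * P (snd z) * wprod m m z"
        proof (cases "z \<in> Q T")
          case True
          then have "snd z \<ge> 0" by (auto simp: Q_def)
          then have "lam * (\<theta> (snd z) * wprod m m z) \<le> P (snd z) * (\<theta> (snd z) * wprod m m z)"
            using less_imp_le[OF \<theta>0] w_nonneg by (intro mult_right_mono P_ge) (auto simp: wprod_def mult.assoc)
          then show ?thesis by (simp add: mult_ac)
        next
          case False
          then show ?thesis by (simp add: wprod_def out)
        qed
      qed (use i\<theta> iP in auto)
      then show ?thesis by (simp add: wint_def)
    qed
    then have "lam * (lam * wint \<theta> (wprod m m)) \<le> lam * wint ?\<theta>P (wprod m m)" using lam1 by (intro mult_left_mono) auto
    then show ?thesis by (simp add: X_def power2_eq_square)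
  qed
  \<comment> \<open>Testing with \<lambda> m: Y = - \<lambda> (m, A) = - \<lambda> (m, v) +
    \<lambda> (m, v - A). The first product is evaluated by \<open>en2\<close>; the second is at
    most N/2 plus half of \<lambda>^2 (m, m), which is what S \<ge> 0 says.\<close>
  have YX: "Y \<le> X + X / 2 + N / 2 + b0 / 2"
  proof -
    have "Y = - lam * wint \<theta> (wprod m A)" using gr1 by (simp add: Y_def)
    moreover have "2 * (lam * wint \<theta> (wprod m v)) = lam * (\<theta> T * ET) - lam * (\<theta> 0 * E0) - 2 * X"
    proof -
      have "lam * (2 * wint \<theta> (wprod m v) + 2 * wint ?\<theta>P (wprod m m)) = lam * (\<theta> T * ET - \<theta> 0 * E0)" using en2 by simp
      then show ?thesis by (simp add: X_def algebra_simps)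
    qed
    moreover have "lam * (\<theta> T * ET) \<ge> 0" using lam1 E less_imp_le[OF \<theta>0] by simp
    moreover have "lam * (\<theta> 0 * E0) \<le> b0"
    proof -
      have "lam * (\<theta> 0 * E0) \<le> P 0 * (\<theta> 0 * E0)" using P_ge[of 0] E less_imp_le[OF \<theta>0] by (intro mult_right_mono) auto
      then show ?thesis by (simp add: b0_def mult_ac)
    qed
    moreover have "0 \<le> N - 2 * (lam * wint \<theta> (wprod m v)) + 2 * (lam * wint \<theta> (wprod m A)) + lam^2 * wint \<theta> (wprod m m)"
      using RS0(2) unfolding S by (simp add: algebra_simps)
    ultimately show ?thesis using mm by linarith
  qed
  have I0: "wint \<theta> (\<lambda>z. (p z)^2) \<ge> 0" "wint \<theta> (wprod m m) \<ge> 0" "X \<ge> 0"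
  proof -
    show "wint \<theta> (\<lambda>z. (p z)^2) \<ge> 0" using less_imp_le[OF \<theta>0] by (simp add: wint_def)
    show a: "wint \<theta> (wprod m m) \<ge> 0" unfolding wint_def
      using less_imp_le[OF \<theta>0] w_nonneg by (intro Bochner_Integration.integral_nonneg mult_nonneg_nonneg) (auto simp: wprod_def mult.assoc)
    then have "0 \<le> lam^2 * wint \<theta> (wprod m m)" by simp
    then show "X \<ge> 0" using mm by linarith
  qed
  have Nle: "N \<le> 2 * gG + Y / 8 + X / 8"
  proof -
    have "N \<le> 2 * gG + 4 * K^2 * wint \<theta> (\<lambda>z. (p z)^2) + 4 * K^4 * wint \<theta> (wprod m m)"
      using eqn by (simp add: N_def wint_def wprod_def power2_eq_square mult_ac)
    \<comment> \<open>Here the threshold for \<lambda> originates: \<lambda> \<ge> 32 K^2 gives 4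
      K^2 \<le> \<lambda>/8, and squared it gives 4 K^4 \<le> \<lambda>^2/8 with room to
      spare.\<close>
    moreover have "4 * K^2 * wint \<theta> (\<lambda>z. (p z)^2) \<le> Y / 8"
    proof -
      have "(4 * K^2) * wint \<theta> (\<lambda>z. (p z)^2) \<le> (lam / 8) * wint \<theta> (\<lambda>z. (p z)^2)"
        using lam I0 by (intro mult_right_mono) auto
      then show ?thesis by (simp add: Y_def)
    qed
    moreover have "4 * K^4 * wint \<theta> (wprod m m) \<le> X / 8"
    proof -
      have "(32 * K^2)^2 \<le> lam^2" using lam by (intro power_mono) auto
      then have "1024 * K^4 \<le> lam^2" by (simp add: power_mult_distrib flip: power_mult)
      moreover have "0 \<le> K^4" by simp
      ultimately have "4 * K^4 \<le> lam^2 / 8" by linarith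
      then have "(4 * K^4) * wint \<theta> (wprod m m) \<le> (lam^2 / 8) * wint \<theta> (wprod m m)" using I0 by (intro mult_right_mono) auto
      then show ?thesis using mm by simp
    qed
    ultimately show ?thesis by linarith
  qed
  have L2: "(LINT z|lborel. lam * (p z)^2 * \<theta> (snd z)) = Y" by (simp add: Y_def wint_def mult_ac)
  have L3: "(LINT z|lborel. s * lam^2 * \<phi> (snd z) * w (fst z) * (m z)^2 * \<theta> (snd z)) = X"
  proof -
    have "s * lam^2 * \<phi> (snd z) * w (fst z) * (m z)^2 * \<theta> (snd z) = lam * (\<theta> (snd z) * P (snd z) * wprod m m z)" for z
      by (simp add: P_def wprod_def power2_eq_square mult_ac)
    then show ?thesis by (simp only: X_def wint_def integral_mult_right_zero)
  qed
  \<comment> \<open>The derivatives are recovered from the squares: v = (v + P m) - P m and A = v -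
    (v - A). The weight k = 1/(s \<phi>) is at most 1 and satisfies k P^2 = \<lambda> P, so the
    contribution of P m is X.\<close>
  have L1: "(LINT z|lborel. 1 / (s * \<phi> (snd z)) * (w (fst z) * (A z)^2 + w (fst z) * (v z)^2) * \<theta> (snd z)) \<le> 2 * N + 6 * Z + 6 * X"
  proof -
    let ?U = "\<lambda>z. 2 * (\<theta> (snd z) * (w (fst z) * (v z - A z)^2)) + 6 * (\<theta> (snd z) * (w (fst z) * (v z + P (snd z) * m z)^2)) + 6 * (lam * (\<theta> (snd z) * P (snd z) * wprod m m z))"
    have "(LINT z|lborel. 1 / (s * \<phi> (snd z)) * (w (fst z) * (A z)^2 + w (fst z) * (v z)^2) * \<theta> (snd z)) \<le> (LINT z|lborel. ?U z)"
    proof (rule Bochner_Integration.integral_mono')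
      show "integrable lborel ?U" using Ni Zi iP by simp
      fix z
      have wt: "w (fst z) * \<theta> (snd z) \<ge> 0" using w_nonneg less_imp_le[OF \<theta>0] by simp
      show "1 / (s * \<phi> (snd z)) * (w (fst z) * (A z)^2 + w (fst z) * (v z)^2) * \<theta> (snd z) \<le> ?U z"
      proof (cases "z \<in> Q T")
        case True
        then have "snd z \<ge> 0" by (auto simp: Q_def)
        then have "1 \<le> \<phi> (snd z)" using lam1 by (simp add: \<phi>_def)
        then have "1 * 1 \<le> s * \<phi> (snd z)" using s by (intro mult_mono) auto
        then have q: "s * \<phi> (snd z) \<ge> 1" by simp
        define k where "k = 1 / (s * \<phi> (snd z))"
        have k: "0 < k" "k \<le> 1" using q by (simp_all add: k_def)
        have kP: "k * (P (snd z))^2 = lam * P (snd z)"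
          using q by (simp add: k_def P_def power2_eq_square)
        have "(A z)^2 + (v z)^2 \<le> 2 * (v z - A z)^2 + 6 * (v z + P (snd z) * m z)^2 + 6 * (P (snd z))^2 * (m z)^2"
        proof -
          have "(A z)^2 \<le> 2 * (v z)^2 + 2 * (v z - A z)^2"
            using zero_le_power2[of "2 * v z - A z"] by (simp add: power2_diff power_mult_distrib)
          moreover have "x^2 \<le> 2 * (x + y)^2 + 2 * y^2" for x y :: real
            using zero_le_power2[of "x + 2 * y"] by (simp add: power2_sum power_mult_distrib)
          from this[of "v z" "P (snd z) * m z"]
          have "(v z)^2 \<le> 2 * (v z + P (snd z) * m z)^2 + 2 * (P (snd z) * m z)^2" .
          moreover have "(P (snd z) * m z)^2 = (P (snd z))^2 * (m z)^2" by (rule power_mult_distrib)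
          ultimately show ?thesis by linarith
        qed
        then have "k * ((A z)^2 + (v z)^2) \<le> k * (2 * (v z - A z)^2 + 6 * (v z + P (snd z) * m z)^2 + 6 * (P (snd z))^2 * (m z)^2)"
          using k by (intro mult_left_mono) auto
        also have "\<dots> = k * (2 * (v z - A z)^2) + k * (6 * (v z + P (snd z) * m z)^2) + 6 * (k * (P (snd z))^2) * (m z)^2"
          by (simp add: algebra_simps)
        also have "\<dots> \<le> 2 * (v z - A z)^2 + 6 * (v z + P (snd z) * m z)^2 + 6 * (lam * P (snd z)) * (m z)^2"
          unfolding kP using k by (intro add_mono mult_left_le_one_le) auto
        finally have "(w (fst z) * \<theta> (snd z)) * (k * ((A z)^2 + (v z)^2))
          \<le> (w (fst z) * \<theta> (snd z)) * (2 * (v z - A z)^2 + 6 * (v z + P (snd z) * m z)^2 + 6 * (lam * P (snd z)) * (m z)^2)"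
          using wt by (rule mult_left_mono)
        then show ?thesis unfolding k_def[symmetric] by (simp add: wprod_def power2_eq_square[of "m z"] algebra_simps)
      next
        case False
        then show ?thesis by (simp add: out wprod_def)
      qed
      show "0 \<le> ?U z"
      proof (cases "z \<in> Q T")
        case True
        then have "snd z \<ge> 0" by (auto simp: Q_def)
        then have "P (snd z) \<ge> 0" using P_ge[of "snd z"] lam1 by linarith
        then show ?thesis using w_nonneg less_imp_le[OF \<theta>0] lam1
          by (auto simp: wprod_def mult.assoc intro!: add_nonneg_nonneg mult_nonneg_nonneg)
      qed (simp add: out wprod_def)
    qed
    also have "\<dots> = 2 * N + 6 * Z + 6 * X"
      unfolding N_def Z_def X_def wint_def using Ni Zi iP by simp
    finally show ?thesis .
  qed
  have rhs: "100 * s * lam * (\<phi> T * ET) * \<theta> T = 100 * bT"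
    "100 * (s * lam * E0 + D0) * exp (2 * s) = 100 * b0 + 100 * bD"
    by (simp_all add: bT_def b0_def bD_def P_def \<theta>_def \<phi>_def algebra_simps)
  \<comment> \<open>Eliminating Y from \<open>Nle\<close> by \<open>YX\<close> bounds N by X/3 plus
    multiples of gG and b0, so \<open>star\<close> absorbs X. The value 100 is a generous round
    constant.\<close>
  have "2 * N + 6 * Z + 6 * X + Y + X \<le> 100 * gG + 100 * bT + (100 * b0 + 100 * bD)"
    using star YX Nle I0 RS0 b gG by linarith
  then show ?thesis unfolding L2 L3 using L1 rhs unfolding ET_def E0_def by linarith
qed

end

subsection \<open>Borel representatives and weak derivatives\<close>

lemma Q_borel [measurable]: "Q T \<in> sets borel"
  unfolding Q_def by (intro borel_open open_Times) auto

lemma AE_lebesgue_on_iff: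
  fixes S :: "'a::euclidean_space set"
  assumes "S \<in> sets borel"
  shows "(AE z in lebesgue_on S. P z) \<longleftrightarrow> (AE z in lborel. z \<in> S \<longrightarrow> P z)"
  using assms by (subst AE_restrict_space_iff) (auto simp: AE_completion_iff)

text \<open>Slices of a Lebesgue measurable function on the plane may fail to be measurable. Passing
  to a Borel function that vanishes outside S makes slices, shifts and Fubini available.\<close>

lemma lebesgue_on_borel_version:
  fixes f :: "'a::euclidean_space \<Rightarrow> real"
  assumes S: "S \<in> sets borel" and f: "f \<in> borel_measurable (lebesgue_on S)"
  shows "\<exists>h. h \<in> borel_measurable borel \<and> (\<forall>z. z \<notin> S \<longrightarrow> h z = 0) \<and> (AE z in lborel. z \<in> S \<longrightarrow> f z = h z)"
proof -
  have "(\<lambda>z. indicator S z *\<^sub>R f z) \<in> borel_measurable lebesgue"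
    using f S borel_measurable_restrict_space_iff[of S lebesgue f] by auto
  then obtain h where h: "h \<in> borel_measurable lborel" "AE z in lborel. indicator S z *\<^sub>R f z = h z"
    using completion_ex_borel_measurable_real by blast
  let ?h = "\<lambda>z. indicator S z * h z"
  have "?h \<in> borel_measurable borel" using h(1) S by simp
  moreover have "AE z in lborel. z \<in> S \<longrightarrow> f z = ?h z" using h(2) by eventually_elim auto
  ultimately show ?thesis by (intro exI[of _ ?h]) auto
qed

text \<open>Transfers integrals of the given functions over S to Borel versions. Measurability of f
  is a conclusion: completeness of Lebesgue measure lets it be inherited from h.\<close>

lemma lebesgue_on_eq_lborel:
  fixes f h :: "'a::euclidean_space \<Rightarrow> real"
  assumes S: "S \<in> sets borel" and h: "h \<in> borel_measurable borel" and ae: "AE z in lborel. z \<in> S \<longrightarrow> f z = h z"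
  shows "f \<in> borel_measurable (lebesgue_on S)"
    "integrable (lebesgue_on S) f \<longleftrightarrow> set_integrable lborel S h"
    "(LINT z|lebesgue_on S. f z) = (LINT z:S|lborel. h z)"
proof -
  have hm: "(\<lambda>z. indicator S z *\<^sub>R h z) \<in> borel_measurable lborel" using h S by simp
  then have hm': "(\<lambda>z. indicator S z *\<^sub>R h z) \<in> borel_measurable lebesgue" by (rule measurable_completion)
  have ae1: "AE z in lborel. indicator S z *\<^sub>R h z = indicator S z *\<^sub>R f z" using ae by eventually_elim auto
  then have ae2: "AE z in lebesgue. indicator S z *\<^sub>R h z = indicator S z *\<^sub>R f z" by (simp only: AE_completion_iff)
  have fm: "(\<lambda>z. indicator S z *\<^sub>R f z) \<in> borel_measurable lebesgue"
    by (rule borel_measurable_AE[OF hm' ae2])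
  show "f \<in> borel_measurable (lebesgue_on S)"
    using fm S borel_measurable_restrict_space_iff[of S lebesgue f] by auto
  show "integrable (lebesgue_on S) f \<longleftrightarrow> set_integrable lborel S h"
  proof -
    have "integrable (lebesgue_on S) f \<longleftrightarrow> integrable lebesgue (\<lambda>z. indicator S z *\<^sub>R f z)"
      using S by (intro integrable_restrict_space) auto
    also have "\<dots> \<longleftrightarrow> integrable lebesgue (\<lambda>z. indicator S z *\<^sub>R h z)"
      using fm hm' ae2 by (intro integrable_cong_AE) (auto elim: eventually_mono)
    also have "\<dots> \<longleftrightarrow> set_integrable lborel S h"
      unfolding set_integrable_def by (rule integrable_completion[OF hm])
    finally show ?thesis .
  qed
  have "(LINT z|lebesgue_on S. f z) = (LINT z|lebesgue. indicator S z *\<^sub>R f z)"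
    using S by (intro integral_restrict_space) auto
  also have "\<dots> = (LINT z|lebesgue. indicator S z *\<^sub>R h z)"
    by (rule integral_cong_AE[OF fm hm']) (use ae2 in \<open>auto elim: eventually_mono\<close>)
  also have "\<dots> = (LINT z:S|lborel. h z)"
    unfolding set_lebesgue_integral_def by (rule integral_completion[OF hm])
  finally show "(LINT z|lebesgue_on S. f z) = (LINT z:S|lborel. h z)" .
qed

text \<open>The exceptional set is first enlarged to a Borel null set, for which Fubini gives null
  slices in both directions.\<close>

lemma AE_lborel_slices:
  fixes P :: "real \<times> real \<Rightarrow> bool"
  assumes "AE z in lborel. P z"
  shows "AE x in lborel. AE t in lborel. P (x, t)" "AE t in lborel. AE x in lborel. P (x, t)"
proof -
  obtain N where N: "{z. \<not> P z} \<subseteq> N" "emeasure lborel N = 0" "N \<in> sets lborel"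
    using assms by (auto elim!: AE_E)
  have m: "{z \<in> Sigma_Algebra.space (lborel \<Otimes>\<^sub>M lborel). z \<notin> N} \<in> sets (lborel \<Otimes>\<^sub>M lborel :: (real \<times> real) measure)"
  proof -
    have "{z \<in> Sigma_Algebra.space (lborel :: (real \<times> real) measure). z \<notin> N} = - N" by auto
    then show ?thesis unfolding lborel_prod using N(3) by simp
  qed
  have "AE z in lborel \<Otimes>\<^sub>M lborel. z \<notin> N" unfolding lborel_prod
    by (rule AE_not_in) (use N in \<open>auto simp: null_sets_def\<close>)
  then have 1: "AE x in lborel. AE t in lborel. (x, t) \<notin> N" by (rule lborel_pair.AE_pair)
  then have 2: "AE t in lborel. AE x in lborel. (x, t) \<notin> N"
    by (subst (asm) lborel_pair.AE_commute) (use m in auto)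
  have P: "z \<notin> N \<Longrightarrow> P z" for z using N(1) by blast
  show "AE x in lborel. AE t in lborel. P (x, t)"
    by (rule eventually_mono[OF 1], erule eventually_mono, rule P)
  show "AE t in lborel. AE x in lborel. P (x, t)"
    by (rule eventually_mono[OF 2], erule eventually_mono, rule P)
qed

lemma integrable_of_slices:
  fixes u :: "real \<times> real \<Rightarrow> real"
  assumes u: "u \<in> borel_measurable borel" "\<And>z. u z \<ge> 0"
    and ae: "AE t in lborel. integrable lborel (\<lambda>x. u (x, t)) \<and> (LINT x|lborel. u (x, t)) \<le> k t" and k: "integrable lborel k"
  shows "integrable lborel u"
proof -
  have um: "u \<in> borel_measurable (lborel \<Otimes>\<^sub>M lborel)" using u(1) by (simp add: lborel_prod)
  have "(\<integral>\<^sup>+z. ennreal (u z) \<partial>lborel) = (\<integral>\<^sup>+t. \<integral>\<^sup>+x. ennreal (u (x, t)) \<partial>lborel \<partial>lborel)"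
    using lborel_pair.nn_integral_snd[of "\<lambda>z. ennreal (u z)"] um by (simp add: lborel_prod)
  also have "\<dots> \<le> (\<integral>\<^sup>+t. ennreal \<bar>k t\<bar> \<partial>lborel)"
  proof (rule nn_integral_mono_AE, use ae in eventually_elim)
    case (elim t)
    have "(\<integral>\<^sup>+x. ennreal (u (x, t)) \<partial>lborel) = ennreal (LINT x|lborel. u (x, t))"
      using elim u(2) by (intro nn_integral_eq_integral) auto
    also have "\<dots> \<le> ennreal \<bar>k t\<bar>" using elim by (intro ennreal_leI) auto
    finally show ?case .
  qed
  also have "\<dots> < \<infinity>" using k by (simp add: integrable_iff_bounded)
  finally have "(\<integral>\<^sup>+z. ennreal (u z) \<partial>lborel) < \<infinity>" .
  then show ?thesis using u by (intro integrableI_bounded) auto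
qed

section \<open>Weak derivatives as primitives\<close>

lemma locally_integrable_Icc:
  assumes "locally_integrable f" "0 < x" "x \<le> y" "y < 1"
  shows "integrable (lebesgue_on {x..y}) f"
  using assms(1)[unfolded locally_integrable_def, rule_format, of "{x..y}"] assms(2-)
  by (simp add: subset_eq)

text \<open>Local integrability gives measurability only on compact sets, so the open interval is
  exhausted by compact ones and f is a pointwise limit. The summand 2 keeps all of them
  nonempty.\<close>

lemma locally_integrable_borel_version:
  assumes "locally_integrable f"
  shows "\<exists>h. h \<in> borel_measurable borel \<and> (\<forall>x. x \<notin> {0<..<1} \<longrightarrow> h x = 0) \<and> (AE x in lborel. x \<in> {0<..<1} \<longrightarrow> f x = h x)"
proof (rule lebesgue_on_borel_version)
  let ?K = "\<lambda>n::nat. {1 / real (n + 2)..1 - 1 / real (n + 2)}"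
  have "(\<lambda>x. indicator {0<..<1} x *\<^sub>R f x) \<in> borel_measurable lebesgue"
  proof (rule borel_measurable_LIMSEQ_real)
    fix n
    have "1 / real (n + 2) \<le> 1 / 2" by (simp add: field_simps)
    then have "integrable (lebesgue_on (?K n)) f" by (intro locally_integrable_Icc[OF assms]) (auto simp: field_simps)
    then have "f \<in> borel_measurable (lebesgue_on (?K n))" by (rule borel_measurable_integrable)
    then show "(\<lambda>x. indicator (?K n) x *\<^sub>R f x) \<in> borel_measurable lebesgue"
      by (subst (asm) borel_measurable_restrict_space_iff) auto
  next
    fix x :: real
    show "(\<lambda>n. indicator (?K n) x *\<^sub>R f x) \<longlonglongrightarrow> indicator {0<..<1} x *\<^sub>R f x"
    proof (cases "x \<in> {0<..<1}")
      case True
      have "(\<lambda>n. 1 / real (n + 2)) \<longlonglongrightarrow> 0" using LIMSEQ_ignore_initial_segment[OF lim_1_over_n, of 2] by simp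
      then have "\<forall>\<^sub>F n in sequentially. 1 / real (n + 2) < min x (1 - x)" using True by (intro order_tendstoD(2)) auto
      then have "\<forall>\<^sub>F n in sequentially. indicator (?K n) x *\<^sub>R f x = indicator {0<..<1} x *\<^sub>R f x"
        by eventually_elim (use True in auto)
      then show ?thesis by (rule tendsto_eventually)
    next
      case False
      have "x \<notin> ?K n" for n
      proof
        assume "x \<in> ?K n"
        moreover have "1 / real (n + 2) > 0" by simp
        moreover have "x \<le> 0 \<or> 1 \<le> x" using False by auto
        ultimately show False by (metis atLeastAtMost_iff diff_gt_0_iff_gt less_le_not_le order.trans diff_less_eq less_add_same_cancel1)
      qed
      then show ?thesis using False by simp
    qed
  qed
  then show "f \<in> borel_measurable (lebesgue_on {0<..<1})"
    by (subst borel_measurable_restrict_space_iff) auto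
qed auto

text \<open>The passage from test functions to an absolutely continuous representative: the defining
  identity is used for the countable set \<open>tests\<close> and fed to
  \<open>primitive_of_tests\<close>.\<close>

lemma has_weak_deriv_primitive:
  assumes fh: "has_weak_deriv f h" and f': "f' \<in> borel_measurable borel" "AE x in lborel. x \<in> {0<..<1} \<longrightarrow> f x = f' x"
    and h': "h' \<in> borel_measurable borel" "AE x in lborel. x \<in> {0<..<1} \<longrightarrow> h x = h' x"
  shows "\<exists>F. primitive_on {0<..<1} F h' \<and> (AE x in lborel. x \<in> {0<..<1} \<longrightarrow> F x = f x)"
proof -
  have si: "set_integrable lborel {x..y} k'"
    if "locally_integrable k" "k' \<in> borel_measurable borel" "AE x in lborel. x \<in> {0<..<1} \<longrightarrow> k x = k' x" "0 < x" "x \<le> y" "y < 1" for k k' x y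
  proof -
    have "AE z in lborel. z \<in> {x..y} \<longrightarrow> k z = k' z" using that(3) by eventually_elim (use that in auto)
    then show ?thesis using locally_integrable_Icc[OF that(1,4-6)] lebesgue_on_eq_lborel(2)[OF _ that(2)] by auto
  qed
  have "\<exists>F. primitive_on {0<..<1} F h' \<and> (AE x in lborel. x \<in> {0<..<1} \<longrightarrow> F x = f' x)"
  proof (rule primitive_of_tests)
    show "set_integrable lborel {x..y} f'" "set_integrable lborel {x..y} h'" if "0 < x" "x \<le> y" "y < 1" for x y
      using fh that by (auto simp: has_weak_deriv_def intro: si[OF _ f'] si[OF _ h'])
    fix \<phi> assume \<phi>: "\<phi> \<in> tests 0 1"
    note t = tests_test_function[OF \<phi>]
    obtain l r where lr: "0 < l" "l \<le> r" "r < 1" and out: "\<And>x. x \<notin> {l<..<r} \<Longrightarrow> \<phi> x = 0 \<and> deriv \<phi> x = 0"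
      using test_functionD(4)[OF t] by auto
    have m: "\<phi> \<in> borel_measurable borel" "deriv \<phi> \<in> borel_measurable borel"
      using test_functionD(2,3)[OF t] by (auto intro: borel_measurable_continuous_onI)
    have "(LINT x|lebesgue_on {0<..<1}. f x * deriv \<phi> x) = - (LINT x|lebesgue_on {0<..<1}. h x * \<phi> x)"
      using fh t by (auto simp: has_weak_deriv_def)
    moreover have "(LINT x|lebesgue_on {0<..<1}. f x * deriv \<phi> x) = (LINT x:{0<..<1}|lborel. f' x * deriv \<phi> x)"
      using f' m by (intro lebesgue_on_eq_lborel(3)) (auto elim!: eventually_mono)
    moreover have "(LINT x|lebesgue_on {0<..<1}. h x * \<phi> x) = (LINT x:{0<..<1}|lborel. h' x * \<phi> x)"
      using h' m by (intro lebesgue_on_eq_lborel(3)) (auto elim!: eventually_mono)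
    moreover have "(LINT x:{0<..<1}|lborel. k x) = (LINT x|lborel. k x)" if "\<And>x. x \<notin> {l<..<r} \<Longrightarrow> k x = 0" for k :: "real \<Rightarrow> real"
    proof -
      have "indicator {0<..<1} x *\<^sub>R k x = k x" for x using that[of x] lr by (cases "x \<in> {l<..<r}") auto
      then have "(\<lambda>x. indicator {0<..<1} x *\<^sub>R k x) = k" by (rule ext)
      then show ?thesis by (simp add: set_lebesgue_integral_def)
    qed
    ultimately show "(LINT x|lborel. f' x * deriv \<phi> x) = - (LINT x|lborel. h' x * \<phi> x)" using out by simp
  qed simp
  then obtain F where F: "primitive_on {0<..<1} F h'" "AE x in lborel. x \<in> {0<..<1} \<longrightarrow> F x = f' x" by blast
  have "AE x in lborel. x \<in> {0<..<1} \<longrightarrow> F x = f x" using F(2) f'(2) by eventually_elim auto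
  then show ?thesis using F(1) by blast
qed

lemma has_weak_deriv_primitive':
  assumes fh: "has_weak_deriv f h" and h': "h' \<in> borel_measurable borel" "AE x in lborel. x \<in> {0<..<1} \<longrightarrow> h x = h' x"
  shows "\<exists>F. primitive_on {0<..<1} F h' \<and> (AE x in lborel. x \<in> {0<..<1} \<longrightarrow> F x = f x)"
proof -
  have "locally_integrable f" using fh by (simp add: has_weak_deriv_def)
  from locally_integrable_borel_version[OF this] show ?thesis
    using has_weak_deriv_primitive[OF fh _ _ h'] by blast
qed

text \<open>Allows the arbitrary version chosen by \<open>wderiv\<close> in the norms to be
  exchanged for the jointly measurable derivatives given in the theorem.\<close>

lemma has_weak_deriv_unique:
  assumes 1: "has_weak_deriv f h" and 2: "has_weak_deriv f' k" and ff': "AE x in lborel. x \<in> {0<..<1} \<longrightarrow> f x = f' x"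
  shows "AE x in lborel. x \<in> {0<..<1} \<longrightarrow> h x = k x"
proof -
  have "locally_integrable h" "locally_integrable k" using 1 2 by (simp_all add: has_weak_deriv_def)
  then obtain h' k' where h': "h' \<in> borel_measurable borel" "AE x in lborel. x \<in> {0<..<1} \<longrightarrow> h x = h' x"
    and k': "k' \<in> borel_measurable borel" "AE x in lborel. x \<in> {0<..<1} \<longrightarrow> k x = k' x"
    using locally_integrable_borel_version by meson
  obtain F where F: "primitive_on {0<..<1} F h'" "AE x in lborel. x \<in> {0<..<1} \<longrightarrow> F x = f x"
    using has_weak_deriv_primitive'[OF 1 h'] by blast
  obtain F' where F': "primitive_on {0<..<1} F' k'" "AE x in lborel. x \<in> {0<..<1} \<longrightarrow> F' x = f' x"
    using has_weak_deriv_primitive'[OF 2 k'] by blast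
  have "AE x in lborel. x \<in> {0<..<1} \<longrightarrow> F x = F' x" using F(2) F'(2) ff' by eventually_elim auto
  from primitive_on_unique_AE[OF F(1) F'(1) this] h'(2) k'(2) show ?thesis by eventually_elim auto
qed

lemma wderiv_has_weak_deriv: "weakly_differentiable f \<Longrightarrow> has_weak_deriv f (wderiv f)"
  using someI_ex[of "\<lambda>h. has_weak_deriv f h"] unfolding weakly_differentiable_def wderiv_def by blast

section \<open>From the Bochner spaces to Borel functions on the plane\<close>

lemma integrable_of_time_slices:
  fixes u :: "real \<times> real \<Rightarrow> real"
  assumes u: "u \<in> borel_measurable borel" "\<And>z. u z \<ge> 0" "\<And>z. z \<notin> Q T \<Longrightarrow> u z = 0"
    and N: "integrable (lebesgue_on {0<..<T}) N"
    and ae: "AE t in lborel. t \<in> {0<..<T} \<longrightarrow> integrable lborel (\<lambda>x. u (x, t)) \<and> (LINT x|lborel. u (x, t)) \<le> N t"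
  shows "integrable lborel u"
proof -
  obtain k where k: "k \<in> borel_measurable borel" "\<And>t. t \<notin> {0<..<T} \<Longrightarrow> k t = 0" "AE t in lborel. t \<in> {0<..<T} \<longrightarrow> N t = k t"
    using lebesgue_on_borel_version[OF _ borel_measurable_integrable[OF N]] by auto
  have "set_integrable lborel {0<..<T} k" using lebesgue_on_eq_lborel(2)[OF _ k(1,3)] N by auto
  moreover have "(\<lambda>t. indicator {0<..<T} t *\<^sub>R k t) = k"
  proof
    fix t show "indicator {0<..<T} t *\<^sub>R k t = k t" using k(2)[of t] by (cases "t \<in> {0<..<T}") auto
  qed
  ultimately have ki: "integrable lborel k" by (simp only: set_integrable_def)
  show ?thesis
  proof (rule integrable_of_slices[OF u(1,2) _ ki])
    show "AE t in lborel. integrable lborel (\<lambda>x. u (x, t)) \<and> (LINT x|lborel. u (x, t)) \<le> k t"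
      using ae k(3)
    proof eventually_elim
      case (elim t)
      show ?case
      proof (cases "t \<in> {0<..<T}")
        case False
        then have "u (x, t) = 0" for x by (intro u(3)) (auto simp: Q_def)
        then show ?thesis using k(2)[OF False] by simp
      qed (use elim in auto)
    qed
  qed
qed

lemma weighted_slice:
  fixes a :: "real \<Rightarrow> real"
  assumes w: "w \<in> borel_measurable borel" "\<And>x. x \<in> {0<..<1} \<Longrightarrow> w x = a x"
    and h: "h \<in> borel_measurable borel" "\<And>x. x \<notin> {0<..<1} \<Longrightarrow> h x = 0" "AE x in lborel. x \<in> {0<..<1} \<longrightarrow> u x = h x"
  shows "integrable (lebesgue_on {0<..<1}) (\<lambda>x. a x * (u x)^2) \<longleftrightarrow> integrable lborel (\<lambda>x. w x * (h x)^2)"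
    "(LINT x|lebesgue_on {0<..<1}. a x * (u x)^2) = (LINT x|lborel. w x * (h x)^2)"
proof -
  have m: "(\<lambda>x. w x * (h x)^2) \<in> borel_measurable borel" using w(1) h(1) by measurable
  have ae: "AE x in lborel. x \<in> {0<..<1} \<longrightarrow> a x * (u x)^2 = w x * (h x)^2"
    using h(3) by eventually_elim (use w(2) in auto)
  have "(\<lambda>x. indicator {0<..<1} x *\<^sub>R (w x * (h x)^2)) = (\<lambda>x. w x * (h x)^2)"
  proof
    fix x show "indicator {0<..<1} x *\<^sub>R (w x * (h x)^2) = w x * (h x)^2"
      using h(2)[of x] by (cases "x \<in> {0<..<1}") auto
  qed
  then show "integrable (lebesgue_on {0<..<1}) (\<lambda>x. a x * (u x)^2) \<longleftrightarrow> integrable lborel (\<lambda>x. w x * (h x)^2)"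
    "(LINT x|lebesgue_on {0<..<1}. a x * (u x)^2) = (LINT x|lborel. w x * (h x)^2)"
    using lebesgue_on_eq_lborel(2,3)[OF _ m ae] by (simp_all add: set_integrable_def set_lebesgue_integral_def)
qed

lemma AE_Q_slices:
  assumes "AE z in lborel. z \<in> Q T \<longrightarrow> P z"
  shows "AE t in lborel. t \<in> {0<..<T} \<longrightarrow> (AE x in lborel. x \<in> {0<..<1} \<longrightarrow> P (x, t))"
    "AE x in lborel. x \<in> {0<..<1} \<longrightarrow> (AE t in lborel. t \<in> {0<..<T} \<longrightarrow> P (x, t))"
proof -
  show "AE t in lborel. t \<in> {0<..<T} \<longrightarrow> (AE x in lborel. x \<in> {0<..<1} \<longrightarrow> P (x, t))"
    using AE_lborel_slices(2)[OF assms]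
  proof eventually_elim
    case (elim t)
    show ?case
    proof
      assume "t \<in> {0<..<T}"
      with elim show "AE x in lborel. x \<in> {0<..<1} \<longrightarrow> P (x, t)" by (auto elim!: eventually_mono simp: Q_def)
    qed
  qed
  show "AE x in lborel. x \<in> {0<..<1} \<longrightarrow> (AE t in lborel. t \<in> {0<..<T} \<longrightarrow> P (x, t))"
    using AE_lborel_slices(1)[OF assms]
  proof eventually_elim
    case (elim x)
    show ?case
    proof
      assume "x \<in> {0<..<1}"
      with elim show "AE t in lborel. t \<in> {0<..<T} \<longrightarrow> P (x, t)" by (auto elim!: eventually_mono simp: Q_def)
    qed
  qed
qed

lemma slice_borel: "h \<in> borel_measurable borel \<Longrightarrow> (\<lambda>x. h (x, t)) \<in> borel_measurable borel"
    "h \<in> borel_measurable borel \<Longrightarrow> (\<lambda>t. h (x, t)) \<in> borel_measurable borel" for h :: "real \<times> real \<Rightarrow> real"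
  by (rule measurable_compose[of _ borel borel]; (assumption | intro borel_measurable_continuous_onI continuous_intros))+

lemma L2_time_weighted_integrable:
  assumes w: "w \<in> borel_measurable borel" "\<And>x. x \<in> {0<..<1} \<Longrightarrow> w x = a x" "\<And>x. w x \<ge> 0"
    and u: "u \<in> L2_time T (L2a a) (norm_a a)"
    and h: "h \<in> borel_measurable borel" "\<And>z. z \<notin> Q T \<Longrightarrow> h z = 0" "AE z in lborel. z \<in> Q T \<longrightarrow> u z = h z"
  shows "integrable lborel (\<lambda>z. w (fst z) * (h z)^2)"
proof (rule integrable_of_time_slices)
  show "integrable (lebesgue_on {0<..<T}) (\<lambda>t. (norm_a a (\<lambda>x. u (x, t)))^2)" using u by (simp add: L2_time_def)
  have wf: "(\<lambda>z. w (fst z)) \<in> borel_measurable (borel :: (real \<times> real) measure)"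
    by (rule measurable_compose[OF _ w(1)]) (intro borel_measurable_continuous_onI continuous_intros)
  show "(\<lambda>z. w (fst z) * (h z)^2) \<in> borel_measurable borel" using wf h(1) by measurable
  have "AE t in lborel. t \<in> {0<..<T} \<longrightarrow> (\<lambda>x. u (x, t)) \<in> L2a a"
    using u AE_lebesgue_on_iff[of "{0<..<T}"] by (auto simp: L2_time_def)
  then show "AE t in lborel. t \<in> {0<..<T} \<longrightarrow> integrable lborel (\<lambda>x. w (fst (x, t)) * (h (x, t))^2) \<and>
     (LINT x|lborel. w (fst (x, t)) * (h (x, t))^2) \<le> (norm_a a (\<lambda>x. u (x, t)))^2"
    using AE_Q_slices(1)[OF h(3)]
  proof eventually_elim
    case (elim t)
    show ?case
    proof
      assume t: "t \<in> {0<..<T}"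
      have h0: "h (x, t) = 0" if "x \<notin> {0<..<1}" for x using h(2) that by (auto simp: Q_def)
      have ae: "AE x in lborel. x \<in> {0<..<1} \<longrightarrow> u (x, t) = h (x, t)" using elim t by auto
      have ws: "integrable (lebesgue_on {0<..<1}) (\<lambda>x. a x * (u (x, t))^2) \<longleftrightarrow> integrable lborel (\<lambda>x. w x * (h (x, t))^2)"
          "(LINT x|lebesgue_on {0<..<1}. a x * (u (x, t))^2) = (LINT x|lborel. w x * (h (x, t))^2)"
        by (rule weighted_slice[where w=w and a=a and u="\<lambda>x. u (x, t)" and h="\<lambda>x. h (x, t)", OF w(1) _ slice_borel(1)[OF h(1)] _ ae];
          simp add: w(2) h0)+
      have "integrable lborel (\<lambda>x. w x * (h (x, t))^2)" using elim t ws(1) by (simp add: L2a_def)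
      moreover have "(norm_a a (\<lambda>x. u (x, t)))^2 = (LINT x|lborel. w x * (h (x, t))^2)"
      proof -
        have "norm_a a (\<lambda>x. u (x, t)) = sqrt (LINT x|lborel. w x * (h (x, t))^2)" by (simp add: norm_a_def ws(2))
        then show ?thesis using w(3) by simp
      qed
      ultimately show "integrable lborel (\<lambda>x. w (fst (x, t)) * (h (x, t))^2) \<and>
         (LINT x|lborel. w (fst (x, t)) * (h (x, t))^2) \<le> (norm_a a (\<lambda>x. u (x, t)))^2" by simp
    qed
  qed
qed (use w h in auto)

text \<open>For almost every x all identities for \<open>tests\<close> hold at once, so u(x,.) has
  an absolutely continuous version with density u_t(x,.). The function m is then defined by the
  integral formula itself. The formula therefore holds at every point of \<open>Q T\<close>,
  including exceptional x, and m still agrees with u almost everywhere.\<close>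

lemma time_representation:
  assumes T: "T > 0"
    and w: "w \<in> borel_measurable borel" "\<And>x. x \<in> {0<..<1} \<Longrightarrow> w x = a x" "\<And>x. w x \<ge> 0" "\<And>x. x \<in> {0<..<1} \<Longrightarrow> w x > 0"
    and u: "has_time_deriv a T u u_t"
  shows "\<exists>m v c. m \<in> borel_measurable borel \<and> v \<in> borel_measurable borel \<and> c \<in> borel_measurable borel \<and>
    (\<forall>z. z \<notin> Q T \<longrightarrow> m z = 0) \<and> (\<forall>z. z \<notin> Q T \<longrightarrow> v z = 0) \<and>
    (AE z in lborel. z \<in> Q T \<longrightarrow> u z = m z) \<and> (AE z in lborel. z \<in> Q T \<longrightarrow> u_t z = v z) \<and>
    integrable lborel (\<lambda>z. w (fst z) * (m z)^2) \<and> integrable lborel (\<lambda>z. w (fst z) * (v z)^2) \<and>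
    (\<forall>x\<in>{0<..<1}. \<forall>t\<in>{0<..<T}. m (x, t) = c x + (LINT \<tau>:{0..t}|lborel. v (x, \<tau>)))"
proof -
  have uL: "u \<in> L2_time T (L2a a) (norm_a a)" and uL': "u_t \<in> L2_time T (L2a a) (norm_a a)"
    and ut: "\<And>\<phi>. test_function 0 T \<phi> \<Longrightarrow> AE x in lebesgue_on {0<..<1}.
                 (LINT t|lebesgue_on {0<..<T}. deriv \<phi> t * u (x, t)) = - (LINT t|lebesgue_on {0<..<T}. \<phi> t * u_t (x, t))"
    using u by (auto simp: has_time_deriv_def)
  obtain n where n: "n \<in> borel_measurable borel" "\<And>z. z \<notin> Q T \<Longrightarrow> n z = 0" "AE z in lborel. z \<in> Q T \<longrightarrow> u z = n z"
    using lebesgue_on_borel_version[OF Q_borel, of u T] uL by (auto simp: L2_time_def)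
  obtain v where v: "v \<in> borel_measurable borel" "\<And>z. z \<notin> Q T \<Longrightarrow> v z = 0" "AE z in lborel. z \<in> Q T \<longrightarrow> u_t z = v z"
    using lebesgue_on_borel_version[OF Q_borel, of u_t T] uL' by (auto simp: L2_time_def)
  have ni: "integrable lborel (\<lambda>z. w (fst z) * (n z)^2)"
    by (rule L2_time_weighted_integrable[OF w(1) _ w(3) uL n(1) _ n(3)]; simp add: w(2) n(2))
  have vi: "integrable lborel (\<lambda>z. w (fst z) * (v z)^2)"
    by (rule L2_time_weighted_integrable[OF w(1) _ w(3) uL' v(1) _ v(3)]; simp add: w(2) v(2))
  have [measurable]: "n \<in> borel_measurable (borel \<Otimes>\<^sub>M borel)" "v \<in> borel_measurable (borel \<Otimes>\<^sub>M borel)" "w \<in> borel_measurable borel"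
    using n(1) v(1) w(1) by (simp_all add: borel_prod)
  define V where "V x t = (LINT \<tau>:{0..t}|lborel. v (x, \<tau>))" for x t
  have Vm [measurable]: "(\<lambda>z. V (fst z) (snd z)) \<in> borel_measurable (borel \<Otimes>\<^sub>M borel)"
  proof -
    have "(\<lambda>z. LINT \<tau>|lborel. (if 0 \<le> \<tau> \<and> \<tau> \<le> snd z then 1 else 0) * v (fst z, \<tau>)) \<in> borel_measurable (borel \<Otimes>\<^sub>M borel)"
      by measurable
    moreover have "V x t = (LINT \<tau>|lborel. (if 0 \<le> \<tau> \<and> \<tau> \<le> t then 1 else 0) * v (x, \<tau>))" for x t
      unfolding V_def set_lebesgue_integral_def by (rule Bochner_Integration.integral_cong) (auto simp: indicator_def)
    ultimately show ?thesis by simp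
  qed
  \<comment> \<open>The initial value has to depend measurably on x. For almost every x the
    difference n(x,t) - V(x,t) is constant in t, so its average over the time interval is that value
    and is measurable by construction.\<close>
  define c where "c x = (LINT t|lborel. indicator {0..T} t * (n (x, t) - V x t)) / T" for x
  have Vm2: "(\<lambda>(x, t). V x t) \<in> borel_measurable (borel \<Otimes>\<^sub>M borel)" using Vm by (simp add: case_prod_beta)
  have cm: "c \<in> borel_measurable borel"
  proof -
    have "(\<lambda>(x, t). indicator {0..T} t * (n (x, t) - V x t)) \<in> borel_measurable (borel \<Otimes>\<^sub>M lborel)"
      using Vm by (simp add: case_prod_beta)
    then have "(\<lambda>x. LINT t|lborel. indicator {0..T} t * (n (x, t) - V x t)) \<in> borel_measurable borel"
      by (rule lborel.borel_measurable_lebesgue_integral)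
    then show ?thesis unfolding c_def[abs_def] by measurable
  qed
  define m where "m z = indicator (Q T) z * (c (fst z) + V (fst z) (snd z))" for z
  have mm: "m \<in> borel_measurable borel"
  proof -
    have "(\<lambda>z. V (fst z) (snd z)) \<in> borel_measurable borel" using Vm by (simp add: borel_prod)
    moreover have "(\<lambda>z. c (fst z)) \<in> borel_measurable (borel :: (real \<times> real) measure)"
      by (rule measurable_compose[OF _ cm]) (intro borel_measurable_continuous_onI continuous_intros)
    ultimately show ?thesis unfolding m_def[abs_def] by simp
  qed
  \<comment> \<open>The exceptional null set in the definition of the time derivative depends on the
    test function; countability of \<open>tests\<close> allows a common one.\<close>
  have tests: "AE x in lborel. x \<in> {0<..<1} \<longrightarrow> (\<forall>\<phi>\<in>tests 0 T.
      (LINT t|lebesgue_on {0<..<T}. deriv \<phi> t * u (x, t)) = - (LINT t|lebesgue_on {0<..<T}. \<phi> t * u_t (x, t)))"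
  proof -
    have "AE x in lborel. \<forall>\<phi>\<in>tests 0 T. x \<in> {0<..<1} \<longrightarrow>
        (LINT t|lebesgue_on {0<..<T}. deriv \<phi> t * u (x, t)) = - (LINT t|lebesgue_on {0<..<T}. \<phi> t * u_t (x, t))"
    proof (subst AE_ball_countable[OF countable_tests], rule ballI)
      fix \<phi> assume "\<phi> \<in> tests 0 T"
      from ut[OF tests_test_function[OF this]]
      show "AE x in lborel. x \<in> {0<..<1} \<longrightarrow>
        (LINT t|lebesgue_on {0<..<T}. deriv \<phi> t * u (x, t)) = - (LINT t|lebesgue_on {0<..<T}. \<phi> t * u_t (x, t))"
        by (rule AE_lebesgue_on_iff[THEN iffD1, rotated]) simp
    qed
    then show ?thesis by eventually_elim auto
  qed
  have rep: "AE x in lborel. AE t in lborel. (x, t) \<in> Q T \<longrightarrow> n (x, t) = m (x, t)"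
    using tests AE_Q_slices(2)[OF n(3)] AE_Q_slices(2)[OF v(3)] lborel_Fubini_fst(1)[OF ni] lborel_Fubini_fst(1)[OF vi]
  proof eventually_elim
    case (elim x)
    show ?case
    proof (cases "x \<in> {0<..<1}")
      case x: True
      have si: "set_integrable lborel {y..z} (\<lambda>t. h (x, t))"
        if "integrable lborel (\<lambda>t. w (fst (x, t)) * (h (x, t))^2)" "h \<in> borel_measurable borel" for h :: "real \<times> real \<Rightarrow> real" and y z
      proof (rule set_integrable_L2_L1)
        have "integrable lborel (\<lambda>t. (h (x, t))^2)" using that(1) w(4)[OF x] by simp
        then show "set_integrable lborel {y..z} (\<lambda>t. (h (x, t))^2)"
          unfolding set_integrable_def by (rule integrable_mult_indicator[rotated]) auto
      qed (rule slice_borel(2)[OF that(2)])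
      note nsi = si[OF elim(4) n(1)] and vsi = si[OF elim(5) v(1)]
      have h0: "n (x, t) = 0" "v (x, t) = 0" if "t \<notin> {0<..<T}" for t using n(2) v(2) that by (auto simp: Q_def)
      have "\<exists>F. primitive_on {0<..<T} F (\<lambda>t. v (x, t)) \<and> (AE t in lborel. t \<in> {0<..<T} \<longrightarrow> F t = n (x, t))"
      proof (rule primitive_of_tests[OF T])
        fix \<phi> assume \<phi>: "\<phi> \<in> tests 0 T"
        note t = tests_test_function[OF \<phi>]
        have \<phi>m: "\<phi> \<in> borel_measurable borel" "deriv \<phi> \<in> borel_measurable borel"
          using test_functionD(2,3)[OF t] by (auto intro: borel_measurable_continuous_onI)
        have e: "(LINT t:{0<..<T}|lborel. k t) = (LINT t|lborel. k t)" if "\<And>t. t \<notin> {0<..<T} \<Longrightarrow> k t = 0" for k :: "real \<Rightarrow> real"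
        proof -
          have "indicator {0<..<T} t *\<^sub>R k t = k t" for t using that[of t] by (cases "t \<in> {0<..<T}") auto
          then have "(\<lambda>t. indicator {0<..<T} t *\<^sub>R k t) = k" by (rule ext)
          then show ?thesis by (simp add: set_lebesgue_integral_def)
        qed
        have "(LINT t|lebesgue_on {0<..<T}. deriv \<phi> t * u (x, t)) = (LINT t:{0<..<T}|lborel. n (x, t) * deriv \<phi> t)"
        proof (rule lebesgue_on_eq_lborel(3))
          show "AE t in lborel. t \<in> {0<..<T} \<longrightarrow> deriv \<phi> t * u (x, t) = n (x, t) * deriv \<phi> t"
            using elim(2)[rule_format, OF x] by eventually_elim auto
        qed (use \<phi>m slice_borel(2)[OF n(1)] in auto)
        also have "\<dots> = (LINT t|lborel. n (x, t) * deriv \<phi> t)" by (rule e) (simp add: h0)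
        finally have 1: "(LINT t|lebesgue_on {0<..<T}. deriv \<phi> t * u (x, t)) = (LINT t|lborel. n (x, t) * deriv \<phi> t)" .
        have "(LINT t|lebesgue_on {0<..<T}. \<phi> t * u_t (x, t)) = (LINT t:{0<..<T}|lborel. v (x, t) * \<phi> t)"
        proof (rule lebesgue_on_eq_lborel(3))
          show "AE t in lborel. t \<in> {0<..<T} \<longrightarrow> \<phi> t * u_t (x, t) = v (x, t) * \<phi> t"
            using elim(3)[rule_format, OF x] by eventually_elim auto
        qed (use \<phi>m slice_borel(2)[OF v(1)] in auto)
        also have "\<dots> = (LINT t|lborel. v (x, t) * \<phi> t)" by (rule e) (simp add: h0)
        finally show "(LINT t|lborel. n (x, t) * deriv \<phi> t) = - (LINT t|lborel. v (x, t) * \<phi> t)"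
          using elim(1)[rule_format, OF x \<phi>] unfolding 1 by simp
      qed (use nsi vsi in auto)
      then obtain F where F: "primitive_on {0<..<T} F (\<lambda>t. v (x, t))" "AE t in lborel. t \<in> {0<..<T} \<longrightarrow> F t = n (x, t)" by blast
      obtain G where G: "primitive_on {0..T} G (\<lambda>t. v (x, t))" "\<And>t. t \<in> {0<..<T} \<Longrightarrow> G t = F t"
        using primitive_on_extend[OF F(1) vsi T] by auto
      have GV: "G t = G 0 + V x t" if "t \<in> {0..T}" for t
        using primitive_onD(2)[OF G(1), of 0 t] that by (auto simp: V_def)
      have ae: "AE t in lborel. indicator {0..T} t * (n (x, t) - V x t) = indicator {0..T} t * G 0"
      proof -
        have "AE t in lborel. t \<noteq> 0" "AE t in lborel. t \<noteq> T" by (rule AE_lborel_singleton)+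
        with F(2) show ?thesis
        proof eventually_elim
          case (elim t)
          show ?case
          proof (cases "t \<in> {0<..<T}")
            case True
            then have "n (x, t) - V x t = G 0" using elim G(2)[OF True] GV[of t] by auto
            then show ?thesis by simp
          qed (use elim in auto)
        qed
      qed
      have Vx: "(\<lambda>t. V x t) \<in> borel_measurable borel" by (rule measurable_Pair2[OF Vm2, of x, simplified])
      have "(LINT t|lborel. indicator {0..T} t * (n (x, t) - V x t)) = (LINT t|lborel. indicator {0..T} t * G 0)"
        by (rule integral_cong_AE[OF _ _ ae]) (use Vx slice_borel(2)[OF n(1), of x] in auto)
      also have "\<dots> = T * G 0" using T by simp
      finally have c: "c x = G 0" using T by (simp add: c_def)
      show ?thesis
        using F(2)
      proof eventually_elim
        case (elim t)
        show ?case
        proof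
          assume "(x, t) \<in> Q T"
          then have t: "t \<in> {0<..<T}" by (auto simp: Q_def)
          then have "n (x, t) = G t" using elim G(2) by auto
          also have "\<dots> = m (x, t)" using GV[of t] t \<open>(x, t) \<in> Q T\<close> by (auto simp: m_def c)
          finally show "n (x, t) = m (x, t)" .
        qed
      qed
    next
      case False
      then show ?thesis by (auto simp: Q_def)
    qed
  qed
  \<comment> \<open>Agreement on almost all slices gives agreement almost everywhere on the plane
    because both functions are Borel, which makes the set in question measurable.\<close>
  have nm: "AE z in lborel. z \<in> Q T \<longrightarrow> n z = m z"
  proof -
    have "{z. z \<in> Q T \<longrightarrow> n z = m z} \<in> sets borel"
      by (rule pred_Collect_borel) (use n(1) mm in measurable)
    then have "AE z in (lborel \<Otimes>\<^sub>M lborel). z \<in> Q T \<longrightarrow> n z = m z"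
      by (intro lborel_pair.AE_pair_measure rep) (unfold lborel_prod, simp)
    then show ?thesis unfolding lborel_prod .
  qed
  have um: "AE z in lborel. z \<in> Q T \<longrightarrow> u z = m z" using nm n(3) by eventually_elim auto
  have m0: "\<And>z. z \<notin> Q T \<Longrightarrow> m z = 0" by (simp add: m_def)
  have mi: "integrable lborel (\<lambda>z. w (fst z) * (m z)^2)"
    by (rule L2_time_weighted_integrable[OF w(1) _ w(3) uL mm _ um]; simp add: w(2) m0)
  have "\<forall>x\<in>{0<..<1}. \<forall>t\<in>{0<..<T}. m (x, t) = c x + (LINT \<tau>:{0..t}|lborel. v (x, \<tau>))"
    by (auto simp: m_def V_def Q_def)
  then show ?thesis using mm v cm m0 um mi vi by blast
qed

text \<open>An integrable density extends the primitive continuously to the closed interval. It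
  agrees with the continuous representative g on the open interval, hence also at the ends, where g
  is 0.\<close>

lemma zero_at_ends_primitive:
  assumes W0: "primitive_on {0<..<1} F q" and q: "set_integrable lborel {0..1} q"
    and Ff: "AE x in lborel. x \<in> {0<..<1} \<longrightarrow> F x = f x" and z: "zero_at_ends f"
  shows "\<exists>W. primitive_on {0..1} W q \<and> W 0 = 0 \<and> W 1 = 0 \<and> (AE x in lborel. x \<in> {0<..<1} \<longrightarrow> W x = f x)"
proof -
  obtain W where W: "primitive_on {0..1} W q" "\<And>x. x \<in> {0<..<1} \<Longrightarrow> W x = F x"
    using primitive_on_extend[OF W0 q] by auto
  obtain g where g: "continuous_on {0..1} g" "AE x in lebesgue_on {0<..<1}. f x = g x" "g 0 = 0" "g 1 = 0"
    using z unfolding zero_at_ends_def by blast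
  have g2: "AE x in lborel. x \<in> {0<..<1} \<longrightarrow> f x = g x" using g(2) by (subst (asm) AE_lebesgue_on_iff) auto
  have Wc: "continuous_on {0..1} W" by (rule primitive_on_continuous_Icc[OF W(1)])
  have Wf: "AE x in lborel. x \<in> {0<..<1} \<longrightarrow> W x = f x" using Ff by eventually_elim (use W(2) in auto)
  have Wg: "AE x in lborel. x \<in> {0<..<1} \<longrightarrow> W x = g x" using Wf g2 by eventually_elim auto
  have sub: "{0<..<1} \<subseteq> {0..1::real}" by auto
  have eq: "\<And>x. x \<in> {0<..<1} \<Longrightarrow> W x = g x"
    using AE_eq_continuous_Ioo[OF continuous_on_subset[OF Wc sub] continuous_on_subset[OF g(1) sub] Wg] by blast
  have cl: "{0..1::real} = closure {0<..<1}" by simp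
  have "\<forall>x\<in>{0..1}. W x - g x = 0"
  proof
    fix x :: real assume x: "x \<in> {0..1}"
    show "W x - g x = 0"
    proof (rule continuous_constant_on_closure[of "{0<..<1}" "\<lambda>x. W x - g x" 0 x])
      show "continuous_on (closure {0<..<1}) (\<lambda>x. W x - g x)"
        unfolding cl[symmetric] using Wc g(1) by (intro continuous_intros)
    qed (use eq x in simp_all)
  qed
  then have "W 0 = 0" "W 1 = 0" using g(3,4) by auto
  then show ?thesis using W(1) Wf by blast
qed

text \<open>By uniqueness of weak derivatives \<open>norm_2a\<close>, which is built on
  \<open>wderiv\<close>, dominates the norms of the given derivatives. These slice bounds are what
  makes p and A square integrable over \<open>Q T\<close>.\<close>

lemma H2a_slice:
  assumes w: "w \<in> borel_measurable borel" "\<And>x. x \<in> {0<..<1} \<Longrightarrow> w x = a x" "\<And>x. w x \<ge> 0"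
    and u: "u \<in> H2a a" and q: "has_weak_deriv (\<lambda>x. a x * u x) q" and r: "has_weak_deriv q r"
    and z: "zero_at_ends (\<lambda>x. a x * u x)"
    and q': "q' \<in> borel_measurable borel" "\<And>x. x \<notin> {0<..<1} \<Longrightarrow> q' x = 0" "AE x in lborel. x \<in> {0<..<1} \<longrightarrow> q x = q' x"
    and r': "r' \<in> borel_measurable borel" "\<And>x. x \<notin> {0<..<1} \<Longrightarrow> r' x = 0" "AE x in lborel. x \<in> {0<..<1} \<longrightarrow> r x = r' x"
  shows "\<exists>W P. primitive_on {0..1} W q' \<and> W 0 = 0 \<and> W 1 = 0 \<and> (AE x in lborel. x \<in> {0<..<1} \<longrightarrow> W x = a x * u x) \<and>
        primitive_on {0<..<1} P r' \<and> (AE x in lborel. x \<in> {0<..<1} \<longrightarrow> P x = q' x)"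
    "integrable lborel (\<lambda>x. (q' x)^2)" "(LINT x|lborel. (q' x)^2) \<le> (norm_2a a u)^2"
    "integrable lborel (\<lambda>x. w x * (r' x)^2)" "(LINT x|lborel. w x * (r' x)^2) \<le> (norm_2a a u)^2"
proof -
  let ?f = "\<lambda>x. a x * u x"
  have wd1: "has_weak_deriv ?f (wderiv ?f)" and wd2: "has_weak_deriv (wderiv ?f) (wderiv (wderiv ?f))"
    using u by (auto simp: H2a_def H1a_def intro: wderiv_has_weak_deriv)
  have ae1: "AE x in lborel. x \<in> {0<..<1} \<longrightarrow> wderiv ?f x = q x" by (rule has_weak_deriv_unique[OF wd1 q]) simp
  have ae2: "AE x in lborel. x \<in> {0<..<1} \<longrightarrow> wderiv (wderiv ?f) x = r x" by (rule has_weak_deriv_unique[OF wd2 r ae1])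
  have ae1': "AE x in lborel. x \<in> {0<..<1} \<longrightarrow> wderiv ?f x = q' x" using ae1 q'(3) by eventually_elim auto
  have ae2': "AE x in lborel. x \<in> {0<..<1} \<longrightarrow> wderiv (wderiv ?f) x = r' x" using ae2 r'(3) by eventually_elim auto
  have ws1: "integrable (lebesgue_on {0<..<1}) (\<lambda>x. 1 * (wderiv ?f x)^2) \<longleftrightarrow> integrable lborel (\<lambda>x. 1 * (q' x)^2)"
      "(LINT x|lebesgue_on {0<..<1}. 1 * (wderiv ?f x)^2) = (LINT x|lborel. 1 * (q' x)^2)"
    by (rule weighted_slice[where w="\<lambda>_. 1" and a="\<lambda>_. 1" and u="wderiv ?f" and h=q', OF _ _ q'(1) _ ae1']; simp add: q'(2))+
  have ws2: "integrable (lebesgue_on {0<..<1}) (\<lambda>x. a x * (wderiv (wderiv ?f) x)^2) \<longleftrightarrow> integrable lborel (\<lambda>x. w x * (r' x)^2)"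
      "(LINT x|lebesgue_on {0<..<1}. a x * (wderiv (wderiv ?f) x)^2) = (LINT x|lborel. w x * (r' x)^2)"
    by (rule weighted_slice[where w=w and a=a and u="wderiv (wderiv ?f)" and h=r', OF w(1) _ r'(1) _ ae2']; simp add: w(2) r'(2))+
  show qi: "integrable lborel (\<lambda>x. (q' x)^2)" using u ws1(1) by (simp add: H2a_def H1a_def)
  show "integrable lborel (\<lambda>x. w x * (r' x)^2)" using u ws2(1) by (simp add: H2a_def L2a_def)
  have n1: "(norm_L2 (wderiv ?f))^2 = (LINT x|lborel. (q' x)^2)"
  proof -
    have "norm_L2 (wderiv ?f) = sqrt (LINT x|lborel. (q' x)^2)" using ws1(2) by (simp add: norm_L2_def)
    then show ?thesis by simp
  qed
  have n2: "(norm_a a (wderiv (wderiv ?f)))^2 = (LINT x|lborel. w x * (r' x)^2)"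
  proof -
    have "norm_a a (wderiv (wderiv ?f)) = sqrt (LINT x|lborel. w x * (r' x)^2)" by (simp add: norm_a_def ws2(2))
    then show ?thesis using w(3) by simp
  qed
  have "(norm_2a a u)^2 = (norm_1a a u)^2 + (norm_a a (wderiv (wderiv ?f)))^2"
    unfolding norm_2a_def by (intro real_sqrt_pow2) simp
  also have "(norm_1a a u)^2 = (norm_a a u)^2 + (norm_L2 (wderiv ?f))^2"
    unfolding norm_1a_def by (intro real_sqrt_pow2) simp
  finally have n: "(norm_2a a u)^2 = (norm_a a u)^2 + (LINT x|lborel. (q' x)^2) + (LINT x|lborel. w x * (r' x)^2)"
    by (simp only: n1 n2)
  have "0 \<le> (LINT x|lborel. (q' x)^2)" "0 \<le> (LINT x|lborel. w x * (r' x)^2)" using w(3) by simp_all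
  then show "(LINT x|lborel. (q' x)^2) \<le> (norm_2a a u)^2" "(LINT x|lborel. w x * (r' x)^2) \<le> (norm_2a a u)^2"
    unfolding n using zero_le_power2[of "norm_a a u"] by linarith+
  obtain F where F: "primitive_on {0<..<1} F q'" "AE x in lborel. x \<in> {0<..<1} \<longrightarrow> F x = ?f x"
    using has_weak_deriv_primitive'[OF q q'(1,3)] by blast
  have q1: "set_integrable lborel {0..1} q'"
    by (rule set_integrable_L2_L1[OF _ q'(1)]) (use integrable_mult_indicator[OF _ qi, of "{0..1}"] in \<open>simp add: set_integrable_def\<close>)
  obtain W where W: "primitive_on {0..1} W q'" "W 0 = 0" "W 1 = 0" "AE x in lborel. x \<in> {0<..<1} \<longrightarrow> W x = ?f x"
    using zero_at_ends_primitive[OF F(1) q1 F(2) z] by blast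
  obtain P where P: "primitive_on {0<..<1} P r'" "AE x in lborel. x \<in> {0<..<1} \<longrightarrow> P x = q x"
    using has_weak_deriv_primitive'[OF r r'(1,3)] by blast
  have "AE x in lborel. x \<in> {0<..<1} \<longrightarrow> P x = q' x" using P(2) q'(3) by eventually_elim auto
  then show "\<exists>W P. primitive_on {0..1} W q' \<and> W 0 = 0 \<and> W 1 = 0 \<and> (AE x in lborel. x \<in> {0<..<1} \<longrightarrow> W x = a x * u x) \<and>
        primitive_on {0<..<1} P r' \<and> (AE x in lborel. x \<in> {0<..<1} \<longrightarrow> P x = q' x)"
    using W P(1) by blast
qed

lemma C1_deriv:
  fixes a :: "real \<Rightarrow> real"
  assumes "a C1_differentiable_on {0<..<1}"
  shows "x \<in> {0<..<1} \<Longrightarrow> (a has_real_derivative deriv a x) (at x)" "continuous_on {0<..<1} (deriv a)"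
proof -
  obtain D where D: "\<And>x. x \<in> {0<..<1} \<Longrightarrow> (a has_vector_derivative D x) (at x)" "continuous_on {0<..<1} D"
    using assms unfolding C1_differentiable_on_def by blast
  have d: "deriv a x = D x" "(a has_real_derivative D x) (at x)" if "x \<in> {0<..<1}" for x
    using D(1)[OF that] by (auto simp: has_real_derivative_iff_has_vector_derivative intro: DERIV_imp_deriv)
  show "x \<in> {0<..<1} \<Longrightarrow> (a has_real_derivative deriv a x) (at x)" using d by simp
  show "continuous_on {0<..<1} (deriv a)" using D(2) by (rule continuous_on_eq) (simp add: d)
qed

text \<open>Multiply the primitive of the weak derivative of u by the C1 function a; by uniqueness
  of densities the product rule must reproduce q.\<close>

lemma weak_deriv_product_rule:
  assumes a: "a C1_differentiable_on {0<..<1}" and u: "has_weak_deriv u u'" and q: "has_weak_deriv (\<lambda>x. a x * u x) q"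
  shows "AE x in lborel. x \<in> {0<..<1} \<longrightarrow> a x * u' x = q x - deriv a x * u x"
proof -
  have "locally_integrable u'" "locally_integrable q" using u q by (simp_all add: has_weak_deriv_def)
  then obtain h k where h: "h \<in> borel_measurable borel" "AE x in lborel. x \<in> {0<..<1} \<longrightarrow> u' x = h x"
    and k: "k \<in> borel_measurable borel" "AE x in lborel. x \<in> {0<..<1} \<longrightarrow> q x = k x"
    using locally_integrable_borel_version by meson
  obtain F where F: "primitive_on {0<..<1} F h" "AE x in lborel. x \<in> {0<..<1} \<longrightarrow> F x = u x"
    using has_weak_deriv_primitive'[OF u h] by blast
  obtain G where G: "primitive_on {0<..<1} G k" "AE x in lborel. x \<in> {0<..<1} \<longrightarrow> G x = a x * u x"
    using has_weak_deriv_primitive'[OF q k] by blast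
  have ap: "primitive_on {0<..<1} a (deriv a)"
    using C1_deriv[OF a] by (intro primitive_on_C1) (auto intro: has_field_derivative_at_within)
  have "AE x in lborel. x \<in> {0<..<1} \<longrightarrow> a x * F x = G x" using F(2) G(2) by eventually_elim auto
  from primitive_on_unique_AE[OF primitive_on_mult[OF ap F(1)] G(1) this] F(2) h(2) k(2)
  show ?thesis by eventually_elim (auto simp: algebra_simps)
qed

subsection \<open>Traces and conclusion\<close>

lemma weighted_diff_integrable:
  fixes w h k :: "'a \<Rightarrow> real"
  assumes "integrable M (\<lambda>x. w x * (h x)^2)" "integrable M (\<lambda>x. w x * (k x)^2)" "\<And>x. w x \<ge> 0"
    and m: "w \<in> borel_measurable M" "h \<in> borel_measurable M" "k \<in> borel_measurable M"
  shows "integrable M (\<lambda>x. w x * (h x - k x)^2)"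
proof (rule Bochner_Integration.integrable_bound)
  show "integrable M (\<lambda>x. 2 * (w x * (h x)^2) + 2 * (w x * (k x)^2))" using assms by simp
  show "AE x in M. norm (w x * (h x - k x)^2) \<le> norm (2 * (w x * (h x)^2) + 2 * (w x * (k x)^2))"
  proof (rule AE_I2)
    fix x
    have "(h x - k x)^2 \<le> 2 * (h x)^2 + 2 * (k x)^2"
      using zero_le_power2[of "h x + k x"] by (simp add: power2_sum power2_diff)
    then have "w x * (h x - k x)^2 \<le> w x * (2 * (h x)^2 + 2 * (k x)^2)" using assms(3) by (rule mult_left_mono)
    then show "norm (w x * (h x - k x)^2) \<le> norm (2 * (w x * (h x)^2) + 2 * (w x * (k x)^2))"
      using assms(3)[of x] by (simp add: algebra_simps)
  qed
qed (use m in measurable)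

lemma AE_Ioo_exists:
  fixes c d :: real
  assumes "c < d" "AE x in lborel. x \<in> {c<..<d} \<longrightarrow> P x"
  shows "\<exists>x\<in>{c<..<d}. P x"
  using exists_le_average[OF assms(1) borel_integrable_atLeastAtMost'[of c d "\<lambda>_. 0"] assms(2)] by auto

context degenerate_evolution
begin

lemma M_diff_bound_abs:
  assumes "r \<in> {0..T}" "t \<in> {0..T}"
  shows "integrable lborel (\<lambda>x. w x * (M x t - M x r)^2)"
    and "(LINT x|lborel. w x * (M x t - M x r)^2) \<le> \<bar>t - r\<bar> * (LINT z|lborel. w (fst z) * (v z)^2)"
proof -
  consider "r \<le> t" | "t \<le> r" by linarith
  then have "integrable lborel (\<lambda>x. w x * (M x t - M x r)^2) \<and>
    (LINT x|lborel. w x * (M x t - M x r)^2) \<le> \<bar>t - r\<bar> * (LINT z|lborel. w (fst z) * (v z)^2)"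
  proof cases
    case 1
    then show ?thesis using M_diff_bound[of r t] assms by simp
  next
    case 2
    then show ?thesis using M_diff_bound[of t r] assms by (simp add: power2_commute[of "M _ r"])
  qed
  then show "integrable lborel (\<lambda>x. w x * (M x t - M x r)^2)"
    "(LINT x|lborel. w x * (M x t - M x r)^2) \<le> \<bar>t - r\<bar> * (LINT z|lborel. w (fst z) * (v z)^2)" by auto
qed

text \<open>\<open>U\<close> and the slices of \<open>M\<close> are both continuous in the weighted
  norm and agree at almost every time. Choosing such a time r close to t0 bounds the distance of the
  two candidates at t0 by two increments, both small. The end times are those for which
  \<open>integrable_trace\<close> provides square integrability.\<close>

lemma time_trace_eq:
  assumes wa: "\<And>x. x \<in> {0<..<1} \<Longrightarrow> w x = a x" and um: "AE z in lborel. z \<in> Q T \<longrightarrow> u z = m z"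
    and tr: "has_time_trace a T u t0 u0" and t0: "t0 = 0 \<or> t0 = T"
  shows "AE x in lborel. x \<in> {0<..<1} \<longrightarrow> u0 x = M x t0"
    "(norm_a a u0)^2 = (LINT x|lborel. w x * (M x t0)^2)"
proof -
  obtain U where UL: "\<And>t. t \<in> {0..T} \<Longrightarrow> U t \<in> L2a a"
    and Uc: "\<And>t. t \<in> {0..T} \<Longrightarrow> ((\<lambda>r. norm_a a (\<lambda>x. U r x - U t x)) \<longlongrightarrow> 0) (at t within {0..T})"
    and Uu: "AE t in lebesgue_on {0<..<T}. AE x in lebesgue_on {0<..<1}. u (x, t) = U t x"
    and u0: "u0 = U t0" using tr unfolding has_time_trace_def by blast
  have t0T: "t0 \<in> {0..T}" using t0 T by auto
  have Uu': "AE t in lborel. t \<in> {0<..<T} \<longrightarrow> (AE x in lborel. x \<in> {0<..<1} \<longrightarrow> u (x, t) = U t x)"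
  proof -
    have "AE t in lborel. t \<in> {0<..<T} \<longrightarrow> (AE x in lebesgue_on {0<..<1}. u (x, t) = U t x)"
      using Uu by (subst (asm) AE_lebesgue_on_iff) auto
    then show ?thesis by eventually_elim (subst (asm) AE_lebesgue_on_iff, auto)
  qed
  obtain h where h: "h \<in> borel_measurable borel" "\<And>x. x \<notin> {0<..<1} \<Longrightarrow> h x = 0" "AE x in lborel. x \<in> {0<..<1} \<longrightarrow> u0 x = h x"
    using lebesgue_on_borel_version[of "{0<..<1}" u0] UL[OF t0T] unfolding u0 by (auto simp: L2a_def)
  have ws0: "integrable (lebesgue_on {0<..<1}) (\<lambda>x. a x * (u0 x)^2) \<longleftrightarrow> integrable lborel (\<lambda>x. w x * (h x)^2)"
      "(LINT x|lebesgue_on {0<..<1}. a x * (u0 x)^2) = (LINT x|lborel. w x * (h x)^2)"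
    by (rule weighted_slice[where w=w and a=a and u=u0 and h=h, OF w_meas _ h(1) _ h(3)]; simp add: wa h(2))+
  have hi: "integrable lborel (\<lambda>x. w x * (h x)^2)" using ws0(1) UL[OF t0T] unfolding u0 by (simp add: L2a_def)
  have Mi: "integrable lborel (\<lambda>x. w x * (M x t0)^2)" using t0 integrable_trace by (auto simp: M_0)
  have [measurable]: "h \<in> borel_measurable borel" by (rule h(1))
  have di: "integrable lborel (\<lambda>x. w x * (h x - M x t0)^2)"
    by (rule weighted_diff_integrable[OF hi Mi w_nonneg]) measurable
  let ?V = "LINT z|lborel. w (fst z) * (v z)^2"
  have V0: "?V \<ge> 0" using w_nonneg by simp
  have le: "(LINT x|lborel. w x * (h x - M x t0)^2) \<le> \<epsilon>" if \<epsilon>: "\<epsilon> > 0" for \<epsilon>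
  proof -
    have "\<forall>\<^sub>F r in at t0 within {0..T}. norm_a a (\<lambda>x. U r x - U t0 x) < sqrt (\<epsilon> / 4)"
      using Uc[OF t0T] \<epsilon> by (intro order_tendstoD(2)) auto
    then obtain \<delta> where \<delta>: "\<delta> > 0" "\<And>r. r \<in> {0..T} \<Longrightarrow> r \<noteq> t0 \<Longrightarrow> dist r t0 < \<delta> \<Longrightarrow> norm_a a (\<lambda>x. U r x - U t0 x) < sqrt (\<epsilon> / 4)"
      unfolding eventually_at by blast
    \<comment> \<open>The last entry makes the increment of \<open>M\<close> cost at most
      \<epsilon>/4 by the bound |r - t0| \<open>?V\<close>; the summand 1 covers \<open>?V\<close> =
      0.\<close>
    define \<eta> where "\<eta> = min T (min \<delta> (\<epsilon> / (4 * (?V + 1))))"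
    have \<eta>: "\<eta> > 0" "\<eta> \<le> T" "\<eta> \<le> \<delta>" "\<eta> \<le> \<epsilon> / (4 * (?V + 1))" using T \<delta> \<epsilon> V0 by (auto simp: \<eta>_def)
    \<comment> \<open>Start of a window of length \<eta> that lies inside the time interval and
      touches t0, to the right of 0 or to the left of T.\<close>
    define l where "l = (if t0 = 0 then 0 else T - \<eta>)"
    have l: "l \<ge> 0" "l + \<eta> \<le> T" "\<And>r. r \<in> {l<..<l + \<eta>} \<Longrightarrow> \<bar>r - t0\<bar> < \<eta> \<and> r \<noteq> t0"
    proof -
      have "l \<ge> 0 \<and> l + \<eta> \<le> T \<and> (\<forall>r\<in>{l<..<l + \<eta>}. \<bar>r - t0\<bar> < \<eta> \<and> r \<noteq> t0)"
      proof (cases "t0 = 0")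
        case True
        then show ?thesis using \<eta>(1,2) by (auto simp: l_def)
      next
        case False
        then have "t0 = T" "l = T - \<eta>" using t0 by (auto simp: l_def)
        then show ?thesis using \<eta>(1,2) by auto
      qed
      then show "l \<ge> 0" "l + \<eta> \<le> T" "\<And>r. r \<in> {l<..<l + \<eta>} \<Longrightarrow> \<bar>r - t0\<bar> < \<eta> \<and> r \<noteq> t0" by auto
    qed
    have ex: "AE t in lborel. t \<in> {l<..<l + \<eta>} \<longrightarrow> good t \<and> (AE x in lborel. x \<in> {0<..<1} \<longrightarrow> u (x, t) = U t x) \<and>
        (AE x in lborel. x \<in> {0<..<1} \<longrightarrow> u (x, t) = m (x, t))"
      using AE_good Uu' AE_Q_slices(1)[OF um] by eventually_elim (use l in auto)
    obtain r where r: "r \<in> {l<..<l + \<eta>}" "good r" "AE x in lborel. x \<in> {0<..<1} \<longrightarrow> u (x, r) = U r x"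
      "AE x in lborel. x \<in> {0<..<1} \<longrightarrow> u (x, r) = m (x, r)"
      using AE_Ioo_exists[OF _ ex] \<eta>(1) by fastforce
    have rT: "r \<in> {0<..<T}" using r(2) by (simp add: good_def)
    have rt: "\<bar>r - t0\<bar> < \<eta>" "r \<noteq> t0" using l(3)[OF r(1)] by auto
    have mi: "integrable lborel (\<lambda>x. w x * (m (x, r))^2)" using r(2) by (simp add: good_def)
    have ki: "integrable lborel (\<lambda>x. w x * (m (x, r) - h x)^2)"
      by (rule weighted_diff_integrable[OF mi hi w_nonneg]) measurable
    have ae: "AE x in lborel. x \<in> {0<..<1} \<longrightarrow> U r x - U t0 x = m (x, r) - h x"
      using r(3,4) h(3) by eventually_elim (auto simp: u0)
    have "(LINT x|lebesgue_on {0<..<1}. a x * (U r x - U t0 x)^2) = (LINT x|lborel. w x * (m (x, r) - h x)^2)"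
      by (rule weighted_slice(2)[where w=w and a=a and u="\<lambda>x. U r x - U t0 x" and h="\<lambda>x. m (x, r) - h x", OF w_meas _ _ _ ae])
        (simp_all add: wa h slice_zero')
    then have "norm_a a (\<lambda>x. U r x - U t0 x) = sqrt (LINT x|lborel. w x * (m (x, r) - h x)^2)" by (simp add: norm_a_def)
    moreover have "norm_a a (\<lambda>x. U r x - U t0 x) < sqrt (\<epsilon> / 4)"
      by (rule \<delta>(2)) (use rT rt \<eta> in \<open>auto simp: dist_real_def\<close>)
    ultimately have k: "(LINT x|lborel. w x * (m (x, r) - h x)^2) < \<epsilon> / 4" by simp
    have rT': "r \<in> {0..T}" using rT by auto
    note Mb = M_diff_bound_abs[OF t0T rT']
    have "(LINT x|lborel. w x * (h x - M x t0)^2) \<le> (LINT x|lborel. 2 * (w x * (m (x, r) - h x)^2) + 2 * (w x * (M x r - M x t0)^2))"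
    proof (rule Bochner_Integration.integral_mono[OF di])
      show "integrable lborel (\<lambda>x. 2 * (w x * (m (x, r) - h x)^2) + 2 * (w x * (M x r - M x t0)^2))" using ki Mb(1) by simp
      fix x
      show "w x * (h x - M x t0)^2 \<le> 2 * (w x * (m (x, r) - h x)^2) + 2 * (w x * (M x r - M x t0)^2)"
      proof (cases "x \<in> {0<..<1}")
        case True
        have "(h x - M x t0)^2 \<le> 2 * (M x r - h x)^2 + 2 * (M x r - M x t0)^2"
          using zero_le_power2[of "(M x r - h x) + (M x r - M x t0)"] by (simp add: power2_eq_square algebra_simps)
        then have "w x * (h x - M x t0)^2 \<le> w x * (2 * (M x r - h x)^2 + 2 * (M x r - M x t0)^2)"
          using w_nonneg by (rule mult_left_mono)
        then show ?thesis using M_eq[OF True rT] by (simp add: algebra_simps)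
      qed (simp add: w_out)
    qed
    also have "\<dots> = 2 * (LINT x|lborel. w x * (m (x, r) - h x)^2) + 2 * (LINT x|lborel. w x * (M x r - M x t0)^2)"
      using ki Mb(1) by simp
    finally have fin: "(LINT x|lborel. w x * (h x - M x t0)^2)
      \<le> 2 * (LINT x|lborel. w x * (m (x, r) - h x)^2) + 2 * (LINT x|lborel. w x * (M x r - M x t0)^2)" .
    have Mle: "(LINT x|lborel. w x * (M x r - M x t0)^2) \<le> \<epsilon> / 4"
    proof -
      have "\<bar>r - t0\<bar> * ?V \<le> \<epsilon> / (4 * (?V + 1)) * (?V + 1)"
        using rt \<eta> V0 \<epsilon> by (intro mult_mono) auto
      also have "\<dots> = \<epsilon> / 4" using V0 by (simp add: field_simps)
      finally show ?thesis using Mb(2) by linarith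
    qed
    show ?thesis using fin Mle k by linarith
  qed
  have "(LINT x|lborel. w x * (h x - M x t0)^2) \<le> 0" by (rule field_le_epsilon) (use le in auto)
  then have "(LINT x|lborel. w x * (h x - M x t0)^2) = 0" using w_nonneg by (intro antisym) auto
  then have "AE x in lborel. w x * (h x - M x t0)^2 = 0"
    using integral_nonneg_eq_0_iff_AE[OF di] w_nonneg by auto
  then have hM: "AE x in lborel. x \<in> {0<..<1} \<longrightarrow> h x = M x t0"
    by eventually_elim (use w_pos in force)
  then show "AE x in lborel. x \<in> {0<..<1} \<longrightarrow> u0 x = M x t0" using h(3) by eventually_elim auto
  have "(LINT x|lborel. w x * (h x)^2) = (LINT x|lborel. w x * (M x t0)^2)"
  proof (rule integral_cong_AE)
    show "AE x in lborel. w x * (h x)^2 = w x * (M x t0)^2"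
      using hM by eventually_elim (use w_out in force)
  qed measurable
  then have "norm_a a u0 = sqrt (LINT x|lborel. w x * (M x t0)^2)" by (simp add: norm_a_def ws0(2))
  then show "(norm_a a u0)^2 = (LINT x|lborel. w x * (M x t0)^2)" using w_nonneg by simp
qed

text \<open>At the good times \<open>r n\<close>, p is the weak derivative of a m. Both sides of the
  test function identity pass to the limit: m(r n) tends to c in the weighted norm by
  \<open>good_trace_L2\<close>, and p(r n) tends to G. So G is the weak derivative of a m(0), and by
  uniqueness it is the one chosen by \<open>wderiv\<close>.\<close>

lemma initial_gradient:
  assumes wa: "\<And>x. x \<in> {0<..<1} \<Longrightarrow> w x = a x" and wB: "\<And>x. w x \<le> B"
    and u0: "AE x in lborel. x \<in> {0<..<1} \<longrightarrow> u0 x = c x"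
    and r: "\<And>n. good (r n)" "r \<longlonglongrightarrow> 0"
    and G: "G \<in> borel_measurable borel" "\<And>x. x \<notin> {0<..<1} \<Longrightarrow> G x = 0" "integrable lborel (\<lambda>x. (G x)^2)"
    and pG: "\<And>n. integrable lborel (\<lambda>x. (p (x, r n) - G x)^2)" "(\<lambda>n. LINT x|lborel. (p (x, r n) - G x)^2) \<longlonglongrightarrow> 0"
  shows "(norm_L2 (wderiv (\<lambda>x. a x * u0 x)))^2 = (LINT x|lborel. (G x)^2)"
proof -
  have [measurable]: "G \<in> borel_measurable borel" by (rule G(1))
  \<comment> \<open>w is bounded and vanishes outside (0,1). Its integrability makes w c integrable
    by Cauchy-Schwarz against the constant 1, although c alone may not be integrable near the
    ends.\<close>
  have Iw: "integrable lborel w"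
  proof -
    have "integrable lborel (indicator {0..1} :: real \<Rightarrow> real)" by (rule integrable_real_indicator) (auto simp: emeasure_lborel_Icc_eq)
    then have "integrable lborel (\<lambda>x. w x * indicator {0..1} x)"
      by (rule integrable_bounded_mult[where B=B]) (use w_nonneg wB in auto)
    moreover have "w x * indicator {0..1} x = w x" for x using w_out[of x] by (cases "x \<in> {0<..<1}") auto
    ultimately show ?thesis by (simp only:)
  qed
  have wc: "integrable lborel (\<lambda>x. w x * c x)"
    using integrable_weighted_mult[of lborel w "\<lambda>_. 1" c] Iw integrable_trace(2) w_nonneg by simp
  have Gi: "integrable lborel G"
  proof -
    have "integrable lborel (\<lambda>x. indicator {0..1} x *\<^sub>R (G x)^2)" by (rule integrable_mult_indicator[OF _ G(3)]) auto
    then have "set_integrable lborel {0..1} G" 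
      unfolding set_integrable_def by (rule set_integrable_L2_L1[unfolded set_integrable_def, OF _ G(1)])
    moreover have "indicator {0..1} x *\<^sub>R G x = G x" for x using G(2)[of x] by (cases "x \<in> {0<..<1}") auto
    ultimately show ?thesis by (simp only: set_integrable_def)
  qed
  have au: "AE x in lborel. x \<in> {0<..<1} \<longrightarrow> a x * u0 x = w x * c x" using u0 by eventually_elim (use wa in auto)
  have li: "locally_integrable h" if "integrable lborel k" "AE x in lborel. x \<in> {0<..<1} \<longrightarrow> h x = k x" for h k
    unfolding locally_integrable_def
  proof (intro allI impI, elim conjE)
    fix S :: "real set" assume S: "compact S" "S \<subseteq> {0<..<1}"
    have Sb: "S \<in> sets borel" using S(1) by (simp add: borel_compact)
    have ae: "AE x in lborel. x \<in> S \<longrightarrow> h x = k x" using that(2) by eventually_elim (use S in auto)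
    have "set_integrable lborel S k" unfolding set_integrable_def using that(1) Sb by (intro integrable_mult_indicator) auto
    then show "integrable (lebesgue_on S) h" using lebesgue_on_eq_lborel(2)[OF Sb _ ae] that(1) by auto
  qed
  have key: "(LINT x|lborel. w x * c x * deriv \<phi> x) = - (LINT x|lborel. G x * \<phi> x)" if \<phi>: "test_function 0 1 \<phi>" for \<phi>
  proof -
    obtain l q where lq: "0 < l" "l \<le> q" "q < 1" and out\<phi>: "\<And>x. x \<notin> {l<..<q} \<Longrightarrow> \<phi> x = 0 \<and> deriv \<phi> x = 0"
      using test_functionD(4)[OF \<phi>] by auto
    have \<phi>m [measurable]: "\<phi> \<in> borel_measurable borel" "deriv \<phi> \<in> borel_measurable borel"
      using test_functionD(2,3)[OF \<phi>] by (auto intro: borel_measurable_continuous_onI)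
    have sq: "integrable lborel (\<lambda>x. (k x)^2)" if "continuous_on UNIV k" "\<And>x. x \<notin> {l<..<q} \<Longrightarrow> k x = 0" for k :: "real \<Rightarrow> real"
    proof -
      have "set_integrable lborel {l..q} (\<lambda>x. (k x)^2)"
        by (rule borel_integrable_atLeastAtMost') (use that(1) in \<open>auto intro!: continuous_intros intro: continuous_on_subset\<close>)
      moreover have "indicator {l..q} x *\<^sub>R (k x)^2 = (k x)^2" for x using that(2)[of x] by (cases "x \<in> {l<..<q}") auto
      ultimately show ?thesis by (simp only: set_integrable_def)
    qed
    have \<phi>2: "integrable lborel (\<lambda>x. (\<phi> x)^2)" and \<phi>2': "integrable lborel (\<lambda>x. (deriv \<phi> x)^2)"
      using sq[of \<phi>] sq[of "deriv \<phi>"] test_functionD(2,3)[OF \<phi>] out\<phi> by auto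
    have w\<phi>: "integrable lborel (\<lambda>x. (sqrt (w x) * deriv \<phi> x)^2)"
    proof -
      have "integrable lborel (\<lambda>x. w x * (deriv \<phi> x)^2)"
        by (rule integrable_bounded_mult[OF \<phi>2', where B=B]) (use w_nonneg wB in auto)
      then show ?thesis using w_nonneg by (simp add: power_mult_distrib)
    qed
    have id: "(LINT x|lborel. (sqrt (w x) * m (x, r n)) * (sqrt (w x) * deriv \<phi> x)) = - (LINT x|lborel. p (x, r n) * \<phi> x)" for n
    proof -
      obtain W where W: "primitive_on {0..1} W (\<lambda>x. p (x, r n))" "AE x in lborel. x \<in> {0<..<1} \<longrightarrow> W x = w x * m (x, r n)"
        using r(1)[of n] unfolding good_def by blast
      have W': "primitive_on {0<..<1} W (\<lambda>x. p (x, r n))" by (rule primitive_on_subset[OF W(1)]) auto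
      note tf = primitive_on_test_function[OF W' \<phi>]
      have "(LINT x|lborel. (sqrt (w x) * m (x, r n)) * (sqrt (w x) * deriv \<phi> x)) = (LINT x|lborel. W x * deriv \<phi> x)"
      proof (rule integral_cong_AE)
        show "(\<lambda>x. W x * deriv \<phi> x) \<in> borel_measurable lborel" using tf(1) by auto
        show "AE x in lborel. (sqrt (w x) * m (x, r n)) * (sqrt (w x) * deriv \<phi> x) = W x * deriv \<phi> x"
          using W(2)
        proof eventually_elim
          case (elim x)
          show ?case
          proof (cases "x \<in> {l<..<q}")
            case True
            then have "W x = w x * m (x, r n)" using elim lq by auto
            moreover have "(sqrt (w x) * m (x, r n)) * (sqrt (w x) * deriv \<phi> x) = (sqrt (w x) * sqrt (w x)) * m (x, r n) * deriv \<phi> x" by (simp only: mult_ac)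
            ultimately show ?thesis using w_nonneg[of x] by simp
          next
            case False
            then show ?thesis using out\<phi> by simp
          qed
        qed
      qed measurable
      also have "\<dots> = - (LINT x|lborel. p (x, r n) * \<phi> x)" using tf(3) by simp
      finally show ?thesis .
    qed
    have sqd: "(sqrt (w x) * m (x, t) - sqrt (w x) * c x)^2 = w x * (m (x, t) - c x)^2" for x t
      using w_nonneg[of x] by (simp add: right_diff_distrib[symmetric] power_mult_distrib)
    have lim1: "(\<lambda>n. LINT x|lborel. (sqrt (w x) * m (x, r n)) * (sqrt (w x) * deriv \<phi> x)) \<longlonglongrightarrow> (LINT x|lborel. (sqrt (w x) * c x) * (sqrt (w x) * deriv \<phi> x))"
    proof (rule L2_product_tendsto)
      show "integrable lborel (\<lambda>x. (sqrt (w x) * m (x, r n) - sqrt (w x) * c x)^2)" for n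
        unfolding sqd by (rule good_trace_L2(1)[OF r(1)])
      show "(\<lambda>n. LINT x|lborel. (sqrt (w x) * m (x, r n) - sqrt (w x) * c x)^2) \<longlonglongrightarrow> 0"
        unfolding sqd
      proof (rule Lim_null_comparison)
        show "\<forall>\<^sub>F n in sequentially. norm (LINT x|lborel. w x * (m (x, r n) - c x)^2) \<le> r n * (LINT z|lborel. w (fst z) * (v z)^2)"
          using good_trace_L2(2)[OF r(1)] w_nonneg by simp
        show "(\<lambda>n. r n * (LINT z|lborel. w (fst z) * (v z)^2)) \<longlonglongrightarrow> 0" by (rule tendsto_mult_left_zero[OF r(2)])
      qed
      show "integrable lborel (\<lambda>x. (sqrt (w x) * c x)^2)" using integrable_trace(2) w_nonneg by (simp add: power_mult_distrib)
    qed (use w\<phi> in auto)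
    have lim2: "(\<lambda>n. LINT x|lborel. p (x, r n) * \<phi> x) \<longlonglongrightarrow> (LINT x|lborel. G x * \<phi> x)"
      by (rule L2_product_tendsto) (use pG G(3) \<phi>2 in auto)
    have "(LINT x|lborel. (sqrt (w x) * c x) * (sqrt (w x) * deriv \<phi> x)) = - (LINT x|lborel. G x * \<phi> x)"
      using lim1 tendsto_minus[OF lim2] unfolding id by (rule LIMSEQ_unique)
    moreover have "(sqrt (w x) * c x) * (sqrt (w x) * deriv \<phi> x) = w x * c x * deriv \<phi> x" for x
    proof -
      have "(sqrt (w x) * c x) * (sqrt (w x) * deriv \<phi> x) = (sqrt (w x) * sqrt (w x)) * c x * deriv \<phi> x" by (simp only: mult_ac)
      then show ?thesis using w_nonneg[of x] by simp
    qed
    ultimately show ?thesis by simp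
  qed
  have full: "(LINT x:{0<..<1}|lborel. k x) = (LINT x|lborel. k x)" if "\<And>x. x \<notin> {0<..<1} \<Longrightarrow> k x = 0" for k :: "real \<Rightarrow> real"
  proof -
    have "indicator {0<..<1} x *\<^sub>R k x = k x" for x using that[of x] by (cases "x \<in> {0<..<1}") auto
    then show ?thesis by (simp only: set_lebesgue_integral_def)
  qed
  have wd: "has_weak_deriv (\<lambda>x. a x * u0 x) G"
    unfolding has_weak_deriv_def
  proof (intro conjI allI impI)
    show "locally_integrable (\<lambda>x. a x * u0 x)" by (rule li[OF wc au])
    show "locally_integrable G" by (rule li[OF Gi]) simp
    fix \<phi> assume \<phi>: "test_function 0 1 \<phi>"
    have \<phi>m [measurable]: "\<phi> \<in> borel_measurable borel" "deriv \<phi> \<in> borel_measurable borel"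
      using test_functionD(2,3)[OF \<phi>] by (auto intro: borel_measurable_continuous_onI)
    have "(LINT x|lebesgue_on {0<..<1}. a x * u0 x * deriv \<phi> x) = (LINT x:{0<..<1}|lborel. w x * c x * deriv \<phi> x)"
      by (rule lebesgue_on_eq_lborel(3)) (use au in \<open>auto elim!: eventually_mono\<close>)
    also have "\<dots> = (LINT x|lborel. w x * c x * deriv \<phi> x)" by (rule full) (simp add: w_out)
    also have "\<dots> = - (LINT x|lborel. G x * \<phi> x)" by (rule key[OF \<phi>])
    also have "(LINT x|lborel. G x * \<phi> x) = (LINT x:{0<..<1}|lborel. G x * \<phi> x)" by (rule full[symmetric]) (simp add: G(2))
    also have "\<dots> = (LINT x|lebesgue_on {0<..<1}. G x * \<phi> x)" by (rule lebesgue_on_eq_lborel(3)[symmetric]) auto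
    finally show "(LINT x|lebesgue_on {0<..<1}. a x * u0 x * deriv \<phi> x) = - (LINT x|lebesgue_on {0<..<1}. G x * \<phi> x)" .
  qed
  then have "has_weak_deriv (\<lambda>x. a x * u0 x) (wderiv (\<lambda>x. a x * u0 x))"
    by (intro wderiv_has_weak_deriv) (auto simp: weakly_differentiable_def)
  from has_weak_deriv_unique[OF this wd] have ae: "AE x in lborel. x \<in> {0<..<1} \<longrightarrow> wderiv (\<lambda>x. a x * u0 x) x = G x" by simp
  have "(LINT x|lebesgue_on {0<..<1}. (wderiv (\<lambda>x. a x * u0 x) x)^2) = (LINT x:{0<..<1}|lborel. (G x)^2)"
    by (rule lebesgue_on_eq_lborel(3)) (use ae in \<open>auto elim!: eventually_mono\<close>)
  also have "\<dots> = (LINT x|lborel. (G x)^2)" by (rule full) (simp add: G(2))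
  finally show ?thesis by (simp add: norm_L2_def)
qed

end

lemma AE_lborel_of_slices:
  fixes X :: "real \<times> real \<Rightarrow> bool"
  assumes S: "{z. X z} \<in> sets borel" and ae: "AE t in lborel. AE x in lborel. X (x, t)"
  shows "AE z in lborel. X z"
proof -
  have m: "{z \<in> Sigma_Algebra.space (lborel \<Otimes>\<^sub>M lborel). X (fst z, snd z)} \<in> sets (lborel \<Otimes>\<^sub>M lborel)"
    "{z \<in> Sigma_Algebra.space (lborel \<Otimes>\<^sub>M lborel). X z} \<in> sets (lborel \<Otimes>\<^sub>M lborel)"
    unfolding lborel_prod using S by simp_all
  have "AE x in lborel. AE t in lborel. X (x, t)"
    using lborel_pair.AE_commute[where P="\<lambda>x t. X (x, t)", OF m(1)] ae by blast
  then have "AE z in (lborel \<Otimes>\<^sub>M lborel). X z" by (rule lborel_pair.AE_pair_measure[OF m(2)])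
  then show ?thesis unfolding lborel_prod .
qed

lemma integral_lebesgue_on_Q:
  fixes f h :: "real \<times> real \<Rightarrow> real"
  assumes h: "h \<in> borel_measurable borel" "\<And>z. z \<notin> Q T \<Longrightarrow> h z = 0" and ae: "AE z in lborel. z \<in> Q T \<longrightarrow> f z = h z"
  shows "(LINT z|lebesgue_on (Q T). f z) = (LINT z|lborel. h z)"
proof -
  have "indicator (Q T) z *\<^sub>R h z = h z" for z using h(2)[of z] by (cases "z \<in> Q T") auto
  then show ?thesis using lebesgue_on_eq_lborel(3)[OF Q_borel h(1) ae] by (simp only: set_lebesgue_integral_def)
qed

text \<open>The bound on b supplies the second factor \<alpha> that turns \<alpha> q^2 into
  (\<alpha> q)^2 / \<alpha>, and \<alpha> q is a combination of p and a' m. The bound on a' then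
  returns a factor \<alpha> to m^2, so no negative power of the degenerate coefficient
  remains.\<close>

lemma equation_remainder_bound:
  fixes \<alpha> K m v p A b q a' :: real
  assumes \<alpha>: "\<alpha> \<ge> 0" and b: "b^2 \<le> K^2 * \<alpha>" and a': "a'^2 \<le> K^2 * \<alpha>" and q: "\<alpha> * q = p - a' * m"
  shows "\<alpha> * (b * q)^2 \<le> 2 * K^2 * p^2 + 2 * K^4 * (\<alpha> * m^2)"
proof -
  have "\<alpha> * (b * q)^2 = b^2 * (\<alpha> * q^2)" by (simp add: power_mult_distrib)
  also have "\<dots> \<le> K^2 * \<alpha> * (\<alpha> * q^2)" using b \<alpha> by (intro mult_right_mono) auto
  also have "\<dots> = K^2 * (\<alpha> * q)^2" by (simp add: power2_eq_square)
  also have "\<dots> \<le> K^2 * (2 * p^2 + 2 * (a' * m)^2)"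
    unfolding q using zero_le_power2[of "p + a' * m"]
    by (intro mult_left_mono) (simp_all add: power2_sum power2_diff)
  also have "(a' * m)^2 = a'^2 * m^2" by (rule power_mult_distrib)
  also have "K^2 * (2 * p^2 + 2 * (a'^2 * m^2)) \<le> K^2 * (2 * p^2 + 2 * (K^2 * \<alpha> * m^2))"
    using a' by (intro mult_left_mono add_left_mono mult_right_mono) auto
  also have "\<dots> = 2 * K^2 * p^2 + 2 * K^4 * (\<alpha> * m^2)"
    by (simp add: algebra_simps power2_eq_square power4_eq_xxxx)
  finally show ?thesis .
qed

text \<open>The theorem with its constants made explicit. Borel versions of all functions are
  chosen, \<open>carleman\<close> is applied to them, and the integrals and traces are translated
  back.\<close>

lemma carleman_estimate:
  fixes a :: "real \<Rightarrow> real" and b :: "real \<times> real \<Rightarrow> real" and T K lam s :: real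
  assumes T: "T > 0"
    and a_cont: "continuous_on {0..1} a"
    and a_C1: "a C1_differentiable_on {0<..<1}"
    and a_pos: "\<forall>x\<in>{0<..<1}. a x > 0"
    and b_Linfty: "b \<in> Linfty (Q T)"
    and b_bound: "AE (x, t) in lebesgue_on (Q T). \<bar>b (x, t)\<bar> \<le> K * sqrt (a x)"
    and a_deriv_bound: "\<forall>x\<in>{0<..<1}. \<bar>deriv a x\<bar> \<le> K * sqrt (a x)"
    and lam: "lam > 32 * K^2 + 1" and s: "s \<ge> 1"
    and mH2: "m \<in> L2_time T (H2a a) (norm_2a a)"
    and mt: "has_time_deriv a T m m_t"
    and am_x: "has_space_deriv T (\<lambda>(x, t). a x * m (x, t)) am_x"
    and am_xx: "has_space_deriv T am_x am_xx"
    and m_x: "has_space_deriv T m m_x"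
    and m0: "has_time_trace a T m 0 m0"
    and mT: "has_time_trace a T m T mT"
    and eq: "AE (x, t) in lebesgue_on (Q T). m_t (x, t) - am_xx (x, t) + b (x, t) * m_x (x, t) = G (x, t)"
    and bc: "AE t in lebesgue_on {0<..<T}. zero_at_ends (\<lambda>x. a x * m (x, t))"
  defines "\<phi> \<equiv> \<lambda>t. exp (lam * t)"
  shows "(LINT (x, t)|lebesgue_on (Q T).
           1 / (s * \<phi> t) * (a x * (am_xx (x, t))\<^sup>2 + a x * (m_t (x, t))\<^sup>2) * exp (2 * s * \<phi> t))
        + (LINT (x, t)|lebesgue_on (Q T). lam * (am_x (x, t))\<^sup>2 * exp (2 * s * \<phi> t))
        + (LINT (x, t)|lebesgue_on (Q T). s * lam\<^sup>2 * \<phi> t * a x * (m (x, t))\<^sup>2 * exp (2 * s * \<phi> t))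
        \<le> 100 * (LINT (x, t)|lebesgue_on (Q T). a x * (G (x, t))\<^sup>2 * exp (2 * s * \<phi> t))
          + 100 * s * lam * (\<phi> T * (norm_a a mT)\<^sup>2
                           + (norm_L2 (wderiv (\<lambda>x. a x * mT x)))\<^sup>2) * exp (2 * s * \<phi> T)
          + 100 * (s * lam * (norm_a a m0)\<^sup>2
                 + (norm_L2 (wderiv (\<lambda>x. a x * m0 x)))\<^sup>2) * exp (2 * s)"
proof -
  define w where "w x = indicator {0<..<1} x * a x" for x
  have wa: "\<And>x. x \<in> {0<..<1} \<Longrightarrow> w x = a x" and w_out: "\<And>x. x \<notin> {0<..<1} \<Longrightarrow> w x = 0" by (auto simp: w_def)
  have w_pos: "\<And>x. x \<in> {0<..<1} \<Longrightarrow> w x > 0" using a_pos wa by auto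
  have w_nonneg: "w x \<ge> 0" for x using w_pos[of x] w_out[of x] by (cases "x \<in> {0<..<1}") (auto intro: less_imp_le)
  have a_cont': "continuous_on {0<..<1} a" by (rule continuous_on_subset[OF a_cont]) auto
  have w_meas [measurable]: "w \<in> borel_measurable borel"
    using borel_measurable_continuous_on_indicator[OF _ a_cont'] by (simp add: w_def[abs_def])
  obtain B where wB: "\<And>x. w x \<le> B"
  proof -
    have "compact (a ` {0..1})" by (intro compact_continuous_image a_cont) auto
    then obtain B where B: "\<And>x. x \<in> {0..1} \<Longrightarrow> \<bar>a x\<bar> \<le> B" by (fastforce dest!: compact_imp_bounded simp: bounded_iff)
    have "w x \<le> \<bar>B\<bar>" for x using B[of x] by (cases "x \<in> {0<..<1}") (auto simp: w_def)
    then show ?thesis by (rule that)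
  qed
  obtain M V c where M: "M \<in> borel_measurable borel" and V: "V \<in> borel_measurable borel" and c: "c \<in> borel_measurable borel"
    and M0: "\<And>z. z \<notin> Q T \<Longrightarrow> M z = 0" and V0: "\<And>z. z \<notin> Q T \<Longrightarrow> V z = 0"
    and mM: "AE z in lborel. z \<in> Q T \<longrightarrow> m z = M z" and mV: "AE z in lborel. z \<in> Q T \<longrightarrow> m_t z = V z"
    and Mi: "integrable lborel (\<lambda>z. w (fst z) * (M z)^2)" and Vi: "integrable lborel (\<lambda>z. w (fst z) * (V z)^2)"
    and rep: "\<And>x t. x \<in> {0<..<1} \<Longrightarrow> t \<in> {0<..<T} \<Longrightarrow> M (x, t) = c x + (LINT \<tau>:{0..t}|lborel. V (x, \<tau>))"
    using time_representation[OF T w_meas wa w_nonneg w_pos mt] by blast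
  obtain P where P: "P \<in> borel_measurable borel" "\<And>z. z \<notin> Q T \<Longrightarrow> P z = 0" "AE z in lborel. z \<in> Q T \<longrightarrow> am_x z = P z"
    using lebesgue_on_borel_version[OF Q_borel, of am_x T] am_x by (auto simp: has_space_deriv_def)
  obtain A where A: "A \<in> borel_measurable borel" "\<And>z. z \<notin> Q T \<Longrightarrow> A z = 0" "AE z in lborel. z \<in> Q T \<longrightarrow> am_xx z = A z"
    using lebesgue_on_borel_version[OF Q_borel, of am_xx T] am_xx by (auto simp: has_space_deriv_def)
  obtain R where R: "R \<in> borel_measurable borel" "\<And>z. z \<notin> Q T \<Longrightarrow> R z = 0" "AE z in lborel. z \<in> Q T \<longrightarrow> m_x z = R z"
    using lebesgue_on_borel_version[OF Q_borel, of m_x T] m_x by (auto simp: has_space_deriv_def)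
  obtain \<beta> where \<beta>: "\<beta> \<in> borel_measurable borel" "\<And>z. z \<notin> Q T \<Longrightarrow> \<beta> z = 0" "AE z in lborel. z \<in> Q T \<longrightarrow> b z = \<beta> z"
    using lebesgue_on_borel_version[OF Q_borel, of b T] b_Linfty by (auto simp: Linfty_def)
  \<comment> \<open>A Borel version of G, read off from the left-hand side of the equation.\<close>
  define \<gamma> where "\<gamma> z = V z - A z + \<beta> z * R z" for z
  have ae_time: "AE t in lborel. t \<in> {0<..<T} \<longrightarrow> X t" if "AE t in lebesgue_on {0<..<T}. X t" for X
    using that by (subst (asm) AE_lebesgue_on_iff) auto
  have slices: "AE t in lborel. t \<in> {0<..<T} \<longrightarrow> (\<lambda>x. m (x, t)) \<in> H2a a"
    "AE t in lborel. t \<in> {0<..<T} \<longrightarrow> has_weak_deriv (\<lambda>x. a x * m (x, t)) (\<lambda>x. am_x (x, t))"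
    "AE t in lborel. t \<in> {0<..<T} \<longrightarrow> has_weak_deriv (\<lambda>x. am_x (x, t)) (\<lambda>x. am_xx (x, t))"
    "AE t in lborel. t \<in> {0<..<T} \<longrightarrow> has_weak_deriv (\<lambda>x. m (x, t)) (\<lambda>x. m_x (x, t))"
    "AE t in lborel. t \<in> {0<..<T} \<longrightarrow> zero_at_ends (\<lambda>x. a x * m (x, t))"
    by (rule ae_time, use mH2 am_x am_xx m_x bc in \<open>simp add: L2_time_def has_space_deriv_def\<close>)+
  have out1: "P (x, t) = 0" "A (x, t) = 0" if "x \<notin> {0<..<1}" for x t using P(2) A(2) that by (auto simp: Q_def)
  have sl: "AE t in lborel. t \<in> {0<..<T} \<longrightarrow>
      (\<exists>W F. primitive_on {0..1} W (\<lambda>x. P (x, t)) \<and> W 0 = 0 \<and> W 1 = 0 \<and> (AE x in lborel. x \<in> {0<..<1} \<longrightarrow> W x = a x * m (x, t)) \<and>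
        primitive_on {0<..<1} F (\<lambda>x. A (x, t)) \<and> (AE x in lborel. x \<in> {0<..<1} \<longrightarrow> F x = P (x, t))) \<and>
      (integrable lborel (\<lambda>x. (P (x, t))^2) \<and> (LINT x|lborel. (P (x, t))^2) \<le> (norm_2a a (\<lambda>x. m (x, t)))^2) \<and>
      (integrable lborel (\<lambda>x. w x * (A (x, t))^2) \<and> (LINT x|lborel. w x * (A (x, t))^2) \<le> (norm_2a a (\<lambda>x. m (x, t)))^2)"
    using slices(1,2,3,5) AE_Q_slices(1)[OF P(3)] AE_Q_slices(1)[OF A(3)]
  proof eventually_elim
    case (elim t)
    show ?case
    proof
      assume t: "t \<in> {0<..<T}"
      have e1: "AE x in lborel. x \<in> {0<..<1} \<longrightarrow> am_x (x, t) = P (x, t)" using elim(5) t by blast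
      have e2: "AE x in lborel. x \<in> {0<..<1} \<longrightarrow> am_xx (x, t) = A (x, t)" using elim(6) t by blast
      have u: "(\<lambda>x. m (x, t)) \<in> H2a a" and wd: "has_weak_deriv (\<lambda>x. a x * m (x, t)) (\<lambda>x. am_x (x, t))"
        "has_weak_deriv (\<lambda>x. am_x (x, t)) (\<lambda>x. am_xx (x, t))" and z: "zero_at_ends (\<lambda>x. a x * m (x, t))"
        using elim(1-4) t by blast+
      note H = H2a_slice[where w=w and q'="\<lambda>x. P (x, t)" and r'="\<lambda>x. A (x, t)",
          OF w_meas _ w_nonneg u wd z slice_borel(1)[OF P(1)] _ e1 slice_borel(1)[OF A(1)] _ e2]
      show "(\<exists>W F. primitive_on {0..1} W (\<lambda>x. P (x, t)) \<and> W 0 = 0 \<and> W 1 = 0 \<and> (AE x in lborel. x \<in> {0<..<1} \<longrightarrow> W x = a x * m (x, t)) \<and>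
        primitive_on {0<..<1} F (\<lambda>x. A (x, t)) \<and> (AE x in lborel. x \<in> {0<..<1} \<longrightarrow> F x = P (x, t))) \<and>
      (integrable lborel (\<lambda>x. (P (x, t))^2) \<and> (LINT x|lborel. (P (x, t))^2) \<le> (norm_2a a (\<lambda>x. m (x, t)))^2) \<and>
      (integrable lborel (\<lambda>x. w x * (A (x, t))^2) \<and> (LINT x|lborel. w x * (A (x, t))^2) \<le> (norm_2a a (\<lambda>x. m (x, t)))^2)"
        by (intro conjI H) (simp_all add: wa out1)
    qed
  qed
  have wf [measurable]: "(\<lambda>z. w (fst z)) \<in> borel_measurable (borel :: (real \<times> real) measure)"
    by (rule measurable_compose[OF _ w_meas]) (intro borel_measurable_continuous_onI continuous_intros)
  have [measurable]: "M \<in> borel_measurable borel" "V \<in> borel_measurable borel" "P \<in> borel_measurable borel"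
    "A \<in> borel_measurable borel" "R \<in> borel_measurable borel" "\<beta> \<in> borel_measurable borel" by fact+
  have N2: "integrable (lebesgue_on {0<..<T}) (\<lambda>t. (norm_2a a (\<lambda>x. m (x, t)))^2)" using mH2 by (simp add: L2_time_def)
  have Pi: "integrable lborel (\<lambda>z. (P z)^2)"
    by (rule integrable_of_time_slices[OF _ _ _ N2]) (use P(2) sl in \<open>auto elim!: eventually_mono\<close>)
  have Ai: "integrable lborel (\<lambda>z. w (fst z) * (A z)^2)"
    by (rule integrable_of_time_slices[OF _ _ _ N2]) (use A(2) sl w_nonneg in \<open>auto elim!: eventually_mono\<close>)
  have space: "AE t in lborel. t \<in> {0<..<T} \<longrightarrow> (\<exists>W F. primitive_on {0..1} W (\<lambda>x. P (x, t)) \<and> W 0 = 0 \<and> W 1 = 0 \<and>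
        (AE x in lborel. x \<in> {0<..<1} \<longrightarrow> W x = w x * M (x, t)) \<and>
        primitive_on {0<..<1} F (\<lambda>x. A (x, t)) \<and> (AE x in lborel. x \<in> {0<..<1} \<longrightarrow> F x = P (x, t)))"
    using sl AE_Q_slices(1)[OF mM]
  proof eventually_elim
    case (elim t)
    show ?case
    proof
      assume t: "t \<in> {0<..<T}"
      obtain W F where W: "primitive_on {0..1} W (\<lambda>x. P (x, t))" "W 0 = 0" "W 1 = 0" "AE x in lborel. x \<in> {0<..<1} \<longrightarrow> W x = a x * m (x, t)"
        and F: "primitive_on {0<..<1} F (\<lambda>x. A (x, t))" "AE x in lborel. x \<in> {0<..<1} \<longrightarrow> F x = P (x, t)"
        using elim(1) t by blast
      have "AE x in lborel. x \<in> {0<..<1} \<longrightarrow> m (x, t) = M (x, t)" using elim(2) t by blast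
      with W(4) have "AE x in lborel. x \<in> {0<..<1} \<longrightarrow> W x = w x * M (x, t)" by eventually_elim (use wa in auto)
      with W F show "\<exists>W F. primitive_on {0..1} W (\<lambda>x. P (x, t)) \<and> W 0 = 0 \<and> W 1 = 0 \<and>
        (AE x in lborel. x \<in> {0<..<1} \<longrightarrow> W x = w x * M (x, t)) \<and>
        primitive_on {0<..<1} F (\<lambda>x. A (x, t)) \<and> (AE x in lborel. x \<in> {0<..<1} \<longrightarrow> F x = P (x, t))" by blast
    qed
  qed
  interpret E: degenerate_evolution w T M V P A c
    by unfold_locales (fact T w_meas w_pos w_out M V P(1) A(1) c M0 V0 P(2) A(2) Mi Vi Ai Pi space rep)+
  define \<theta> where "\<theta> t = exp (2 * s * exp (lam * t))" for t
  have \<theta>c: "continuous_on UNIV \<theta>" unfolding \<theta>_def[abs_def] by (intro continuous_intros)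
  have \<phi>c: "continuous_on UNIV \<phi>" unfolding \<phi>_def by (intro continuous_intros)
  have \<theta>0: "\<theta> t \<ge> 0" for t by (simp add: \<theta>_def)
  have \<theta>m [measurable]: "(\<lambda>z. \<theta> (snd z)) \<in> borel_measurable (borel :: (real \<times> real) measure)"
    by (rule E.snd_meas) (rule borel_measurable_continuous_onI[OF \<theta>c])
  have \<phi>m [measurable]: "(\<lambda>z. \<phi> (snd z)) \<in> borel_measurable (borel :: (real \<times> real) measure)"
    by (rule E.snd_meas) (rule borel_measurable_continuous_onI[OF \<phi>c])
  define a' where "a' x = indicator {0<..<1} x * deriv a x" for x
  have a'm: "a' \<in> borel_measurable borel"
    using borel_measurable_continuous_on_indicator[OF _ C1_deriv(2)[OF a_C1]] by (simp add: a'_def[abs_def])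
  have [measurable]: "(\<lambda>z. a' (fst z)) \<in> borel_measurable (borel :: (real \<times> real) measure)"
    by (rule measurable_compose[OF _ a'm]) (intro borel_measurable_continuous_onI continuous_intros)
  \<comment> \<open>The identity a m_x = (am)_x - a_x m for the Borel versions, first on time slices
    and then on the plane.\<close>
  have prod_rule: "AE z in lborel. z \<in> Q T \<longrightarrow> w (fst z) * R z = P z - a' (fst z) * M z"
  proof -
    have "AE t in lborel. AE x in lborel. (x, t) \<in> Q T \<longrightarrow> w x * R (x, t) = P (x, t) - a' x * M (x, t)"
      using slices(2,4) AE_Q_slices(1)[OF P(3)] AE_Q_slices(1)[OF R(3)] AE_Q_slices(1)[OF mM]
    proof eventually_elim
      case (elim t)
      show ?case
      proof (cases "t \<in> {0<..<T}")
        case True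
        have wd: "has_weak_deriv (\<lambda>x. m (x, t)) (\<lambda>x. m_x (x, t))" "has_weak_deriv (\<lambda>x. a x * m (x, t)) (\<lambda>x. am_x (x, t))"
          using elim(1,2) True by blast+
        have e: "AE x in lborel. x \<in> {0<..<1} \<longrightarrow> am_x (x, t) = P (x, t)" "AE x in lborel. x \<in> {0<..<1} \<longrightarrow> m_x (x, t) = R (x, t)"
          "AE x in lborel. x \<in> {0<..<1} \<longrightarrow> m (x, t) = M (x, t)" using elim(3,4,5) True by blast+
        show ?thesis using weak_deriv_product_rule[OF a_C1 wd] e
          by eventually_elim (auto simp: wa a'_def Q_def)
      qed (auto simp: Q_def)
    qed
    moreover have "{z. z \<in> Q T \<longrightarrow> w (fst z) * R z = P z - a' (fst z) * M z} \<in> sets borel"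
      by (rule pred_Collect_borel) measurable
    ultimately show ?thesis by (intro AE_lborel_of_slices) simp_all
  qed
  have b_ae: "AE z in lborel. z \<in> Q T \<longrightarrow> (\<beta> z)^2 \<le> K^2 * w (fst z)"
  proof -
    have "AE z in lborel. z \<in> Q T \<longrightarrow> \<bar>b z\<bar> \<le> K * sqrt (a (fst z))"
      using b_bound by (subst (asm) AE_lebesgue_on_iff) (auto simp: case_prod_beta)
    with \<beta>(3) show ?thesis
    proof eventually_elim
      case (elim z)
      show ?case
      proof
        assume z: "z \<in> Q T"
        then have x: "fst z \<in> {0<..<1}" by (auto simp: Q_def)
        have "\<bar>\<beta> z\<bar> \<le> K * sqrt (a (fst z))" using elim z by simp
        then have "\<bar>\<beta> z\<bar>^2 \<le> (K * sqrt (a (fst z)))^2" by (intro power_mono) auto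
        then show "(\<beta> z)^2 \<le> K^2 * w (fst z)" using w_pos[OF x] wa[OF x] by (simp add: power_mult_distrib)
      qed
    qed
  qed
  have a'_bd: "(a' x)^2 \<le> K^2 * w x" for x
  proof (cases "x \<in> {0<..<1}")
    case True
    then have "\<bar>deriv a x\<bar>^2 \<le> (K * sqrt (a x))^2" using a_deriv_bound by (intro power_mono) auto
    then show ?thesis using True w_pos[OF True] wa[OF True] by (simp add: power_mult_distrib a'_def)
  qed (simp add: a'_def w_out)
  have rem: "AE z in lborel. w (fst z) * (\<beta> z * R z)^2 \<le> 2 * K^2 * (P z)^2 + 2 * K^4 * (w (fst z) * (M z)^2)"
    using prod_rule b_ae
  proof eventually_elim
    case (elim z)
    show ?case
    proof (cases "z \<in> Q T")
      case True
      then show ?thesis using elim by (intro equation_remainder_bound[OF w_nonneg _ a'_bd]) auto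
    next
      case False
      then show ?thesis by (simp add: \<beta>(2) P(2) M0)
    qed
  qed
  have two: "(x + y)^2 \<le> 2 * x^2 + 2 * y^2" "(x - y)^2 \<le> 2 * x^2 + 2 * y^2" for x y :: real
    using zero_le_power2[of "x - y"] zero_le_power2[of "x + y"] by (simp_all add: power2_sum power2_diff)
  have [measurable]: "\<gamma> \<in> borel_measurable borel" unfolding \<gamma>_def[abs_def] by measurable
  have VAi: "integrable lborel (\<lambda>z. w (fst z) * (V z - A z)^2)"
    by (rule weighted_diff_integrable[OF Vi Ai w_nonneg]) measurable
  have \<gamma>i: "integrable lborel (\<lambda>z. w (fst z) * (\<gamma> z)^2)"
  proof (rule Bochner_Integration.integrable_bound)
    show "integrable lborel (\<lambda>z. 2 * (w (fst z) * (V z - A z)^2) + (4 * K^2 * (P z)^2 + 4 * K^4 * (w (fst z) * (M z)^2)))"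
      using VAi Pi Mi by simp
    show "AE z in lborel. norm (w (fst z) * (\<gamma> z)^2) \<le> norm (2 * (w (fst z) * (V z - A z)^2) + (4 * K^2 * (P z)^2 + 4 * K^4 * (w (fst z) * (M z)^2)))"
      using rem
    proof eventually_elim
      case (elim z)
      have "w (fst z) * (\<gamma> z)^2 \<le> w (fst z) * (2 * (V z - A z)^2 + 2 * (\<beta> z * R z)^2)"
        unfolding \<gamma>_def by (intro mult_left_mono two w_nonneg)
      also have "\<dots> = 2 * (w (fst z) * (V z - A z)^2) + 2 * (w (fst z) * (\<beta> z * R z)^2)" by (simp add: algebra_simps)
      finally have "w (fst z) * (\<gamma> z)^2 \<le> 2 * (w (fst z) * (V z - A z)^2) + (4 * K^2 * (P z)^2 + 4 * K^4 * (w (fst z) * (M z)^2))"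
        using elim by linarith
      then show ?case using w_nonneg by simp
    qed
  qed measurable
  have tw: "integrable lborel (\<lambda>z. \<theta> (snd z) * h z)" if "integrable lborel h" "\<And>z. z \<notin> Q T \<Longrightarrow> h z = 0" for h
    by (rule E.integrable_time_weight[OF that \<theta>c])
  have i1: "integrable lborel (\<lambda>z. \<theta> (snd z) * (w (fst z) * (V z - A z)^2))" by (rule tw[OF VAi]) (simp add: V0 A(2))
  have i2: "integrable lborel (\<lambda>z. \<theta> (snd z) * (w (fst z) * (\<gamma> z)^2))" by (rule tw[OF \<gamma>i]) (simp add: \<gamma>_def V0 A(2) R(2))
  have i3: "integrable lborel (\<lambda>z. \<theta> (snd z) * (P z)^2)" by (rule tw[OF Pi]) (simp add: P(2))
  have i4: "integrable lborel (\<lambda>z. \<theta> (snd z) * (w (fst z) * (M z)^2))" by (rule tw[OF Mi]) (simp add: M0)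
  define gG where "gG = (LINT z|lborel. \<theta> (snd z) * (w (fst z) * (\<gamma> z)^2))"
  \<comment> \<open>V - A = \<gamma> - \<beta> R, and (x - y)^2 \<le> 2 x^2 + 2 y^2; the factor 2
    doubles the constants of the remainder bound \<open>rem\<close>.\<close>
  have eqn: "(LINT z|lborel. \<theta> (snd z) * (w (fst z) * (V z - A z)^2))
       \<le> 2 * gG + 4 * K^2 * (LINT z|lborel. \<theta> (snd z) * (P z)^2) + 4 * K^4 * (LINT z|lborel. \<theta> (snd z) * (w (fst z) * (M z)^2))"
  proof -
    have "(LINT z|lborel. \<theta> (snd z) * (w (fst z) * (V z - A z)^2))
      \<le> (LINT z|lborel. 2 * (\<theta> (snd z) * (w (fst z) * (\<gamma> z)^2)) + 4 * K^2 * (\<theta> (snd z) * (P z)^2) + 4 * K^4 * (\<theta> (snd z) * (w (fst z) * (M z)^2)))"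
    proof (rule integral_mono_AE[OF i1])
      show "AE z in lborel. \<theta> (snd z) * (w (fst z) * (V z - A z)^2) \<le> 2 * (\<theta> (snd z) * (w (fst z) * (\<gamma> z)^2)) + 4 * K^2 * (\<theta> (snd z) * (P z)^2) + 4 * K^4 * (\<theta> (snd z) * (w (fst z) * (M z)^2))"
        using rem
      proof eventually_elim
        case (elim z)
        have "V z - A z = \<gamma> z - \<beta> z * R z" by (simp add: \<gamma>_def)
        then have "w (fst z) * (V z - A z)^2 \<le> w (fst z) * (2 * (\<gamma> z)^2 + 2 * (\<beta> z * R z)^2)"
          using two(2) w_nonneg by (simp add: mult_left_mono)
        also have "\<dots> = 2 * (w (fst z) * (\<gamma> z)^2) + 2 * (w (fst z) * (\<beta> z * R z)^2)" by (simp add: algebra_simps)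
        finally have "w (fst z) * (V z - A z)^2 \<le> 2 * (w (fst z) * (\<gamma> z)^2) + 4 * K^2 * (P z)^2 + 4 * K^4 * (w (fst z) * (M z)^2)"
          using elim by linarith
        then have "\<theta> (snd z) * (w (fst z) * (V z - A z)^2) \<le> \<theta> (snd z) * (2 * (w (fst z) * (\<gamma> z)^2) + 4 * K^2 * (P z)^2 + 4 * K^4 * (w (fst z) * (M z)^2))"
          using \<theta>0 by (rule mult_left_mono)
        then show ?case by (simp add: algebra_simps)
      qed
    qed (use i2 i3 i4 in simp)
    also have "\<dots> = 2 * gG + 4 * K^2 * (LINT z|lborel. \<theta> (snd z) * (P z)^2) + 4 * K^4 * (LINT z|lborel. \<theta> (snd z) * (w (fst z) * (M z)^2))"
      using i2 i3 i4 by (simp add: gG_def)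
    finally show ?thesis .
  qed
  have gG0: "gG \<ge> 0" unfolding gG_def using \<theta>0 w_nonneg by simp
  obtain r H where r: "\<And>n. E.good (r n)" "r \<longlonglongrightarrow> 0" and H: "H \<in> borel_measurable borel" "\<And>x. x \<notin> {0<..<1} \<Longrightarrow> H x = 0"
    "integrable lborel (\<lambda>x. (H x)^2)" and PH: "\<And>n. integrable lborel (\<lambda>x. (P (x, r n) - H x)^2)"
      "(\<lambda>n. LINT x|lborel. (P (x, r n) - H x)^2) \<longlonglongrightarrow> 0"
    and grad: "\<And>\<psi> \<psi>'. (\<And>t. (\<psi> has_real_derivative \<psi>' t) (at t)) \<Longrightarrow> continuous_on UNIV \<psi>' \<Longrightarrow> (\<And>t. \<psi> t \<ge> 0) \<Longrightarrow>
       (LINT z|lborel. \<psi>' (snd z) * (P z)^2) - 2 * (LINT z|lborel. \<psi> (snd z) * (w (fst z) * V z * A z)) \<ge> - \<psi> 0 * (LINT x|lborel. (H x)^2)"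
    using E.trace_gradient by blast
  have D0: "(LINT x|lborel. (H x)^2) \<ge> 0" by simp
  have main: "(LINT z|lborel. 1 / (s * \<phi> (snd z)) * (w (fst z) * (A z)^2 + w (fst z) * (V z)^2) * \<theta> (snd z))
      + (LINT z|lborel. lam * (P z)^2 * \<theta> (snd z))
      + (LINT z|lborel. s * lam^2 * \<phi> (snd z) * w (fst z) * (M z)^2 * \<theta> (snd z))
    \<le> 100 * gG + 100 * s * lam * (\<phi> T * (LINT x|lborel. w x * (E.M x T)^2)) * \<theta> T
      + 100 * (s * lam * (LINT x|lborel. w x * (c x)^2) + (LINT x|lborel. (H x)^2)) * exp (2 * s)"
    unfolding \<theta>_def \<phi>_def by (rule E.carleman[OF less_imp_le[OF lam] s _ D0 eqn[unfolded \<theta>_def] gG0]) (rule grad)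
  have t0: "AE x in lborel. x \<in> {0<..<1} \<longrightarrow> m0 x = c x" "(norm_a a m0)^2 = (LINT x|lborel. w x * (c x)^2)"
    using E.time_trace_eq[where a=a, OF wa mM m0] by (simp_all add: E.M_0)
  have tT: "(norm_a a mT)^2 = (LINT x|lborel. w x * (E.M x T)^2)"
    using E.time_trace_eq(2)[where a=a, OF wa mM mT] by simp
  have D: "(norm_L2 (wderiv (\<lambda>x. a x * m0 x)))^2 = (LINT x|lborel. (H x)^2)"
    by (rule E.initial_gradient[where B=B, OF wa wB t0(1) r H PH])
  have \<theta>\<phi>: "\<theta> t = exp (2 * s * \<phi> t)" for t by (simp add: \<theta>_def \<phi>_def)
  have L1: "(LINT (x, t)|lebesgue_on (Q T). 1 / (s * \<phi> t) * (a x * (am_xx (x, t))\<^sup>2 + a x * (m_t (x, t))\<^sup>2) * exp (2 * s * \<phi> t))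
    = (LINT z|lborel. 1 / (s * \<phi> (snd z)) * (w (fst z) * (A z)^2 + w (fst z) * (V z)^2) * \<theta> (snd z))"
  proof (rule integral_lebesgue_on_Q)
    show "AE z in lborel. z \<in> Q T \<longrightarrow> (case z of (x, t) \<Rightarrow> 1 / (s * \<phi> t) * (a x * (am_xx (x, t))\<^sup>2 + a x * (m_t (x, t))\<^sup>2) * exp (2 * s * \<phi> t))
      = 1 / (s * \<phi> (snd z)) * (w (fst z) * (A z)^2 + w (fst z) * (V z)^2) * \<theta> (snd z)"
      using A(3) mV by eventually_elim (auto simp: Q_def wa \<theta>\<phi>)
  qed (measurable, simp add: A(2) V0)
  have L2: "(LINT (x, t)|lebesgue_on (Q T). lam * (am_x (x, t))\<^sup>2 * exp (2 * s * \<phi> t)) = (LINT z|lborel. lam * (P z)^2 * \<theta> (snd z))"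
  proof (rule integral_lebesgue_on_Q)
    show "AE z in lborel. z \<in> Q T \<longrightarrow> (case z of (x, t) \<Rightarrow> lam * (am_x (x, t))\<^sup>2 * exp (2 * s * \<phi> t)) = lam * (P z)^2 * \<theta> (snd z)"
      using P(3) by eventually_elim (auto simp: Q_def \<theta>\<phi>)
  qed (measurable, simp add: P(2))
  have L3: "(LINT (x, t)|lebesgue_on (Q T). s * lam\<^sup>2 * \<phi> t * a x * (m (x, t))\<^sup>2 * exp (2 * s * \<phi> t))
    = (LINT z|lborel. s * lam^2 * \<phi> (snd z) * w (fst z) * (M z)^2 * \<theta> (snd z))"
  proof (rule integral_lebesgue_on_Q)
    show "AE z in lborel. z \<in> Q T \<longrightarrow> (case z of (x, t) \<Rightarrow> s * lam\<^sup>2 * \<phi> t * a x * (m (x, t))\<^sup>2 * exp (2 * s * \<phi> t))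
      = s * lam^2 * \<phi> (snd z) * w (fst z) * (M z)^2 * \<theta> (snd z)"
      using mM by eventually_elim (auto simp: Q_def wa \<theta>\<phi>)
  qed (measurable, simp add: M0)
  have L4: "(LINT (x, t)|lebesgue_on (Q T). a x * (G (x, t))\<^sup>2 * exp (2 * s * \<phi> t)) = gG"
    unfolding gG_def
  proof (rule integral_lebesgue_on_Q)
    have "AE z in lborel. z \<in> Q T \<longrightarrow> m_t z - am_xx z + b z * m_x z = G z"
      using eq by (subst (asm) AE_lebesgue_on_iff) (auto simp: case_prod_beta)
    then show "AE z in lborel. z \<in> Q T \<longrightarrow> (case z of (x, t) \<Rightarrow> a x * (G (x, t))\<^sup>2 * exp (2 * s * \<phi> t)) = \<theta> (snd z) * (w (fst z) * (\<gamma> z)^2)"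
      using A(3) mV R(3) \<beta>(3)
    proof eventually_elim
      case (elim z)
      show ?case
      proof
        assume z: "z \<in> Q T"
        then have "G z = \<gamma> z" using elim by (simp add: \<gamma>_def)
        then show "(case z of (x, t) \<Rightarrow> a x * (G (x, t))\<^sup>2 * exp (2 * s * \<phi> t)) = \<theta> (snd z) * (w (fst z) * (\<gamma> z)^2)"
          using z by (auto simp: Q_def wa \<theta>\<phi>)
      qed
    qed
  qed (measurable, simp add: \<gamma>_def A(2) V0 R(2))
  \<comment> \<open>\<open>main\<close> has no gradient term at time T; here the nonnegative one of
    the statement is added to the right-hand side.\<close>
  have T_term: "100 * s * lam * (\<phi> T * (norm_a a mT)^2) * exp (2 * s * \<phi> T)
      \<le> 100 * s * lam * (\<phi> T * (norm_a a mT)^2 + (norm_L2 (wderiv (\<lambda>x. a x * mT x)))^2) * exp (2 * s * \<phi> T)"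
  proof -
    have "lam \<ge> 0" using lam by (smt (verit) zero_le_power2)
    then show ?thesis using s by (intro mult_right_mono mult_left_mono) auto
  qed
  show ?thesis
    using main T_term unfolding L1 L2 L3 L4 D t0(2) tT \<theta>\<phi> by linarith
qed

theorem lemma2p6:
  fixes a :: "real \<Rightarrow> real" and b :: "real \<times> real \<Rightarrow> real" and T K :: real
  assumes T: "T > 0"
    and a_cont: "continuous_on {0..1} a"
    and a_C1: "a C1_differentiable_on {0<..<1}"
    and a_pos: "\<forall>x\<in>{0<..<1}. a x > 0"
    and a_zero: "a 0 = 0" "a 1 = 0"
    and b_Linfty: "b \<in> Linfty (Q T)"
    and K: "K > 0"
    and b_bound: "AE (x, t) in lebesgue_on (Q T). \<bar>b (x, t)\<bar> \<le> K * sqrt (a x)"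
    and a_deriv_bound: "\<forall>x\<in>{0<..<1}. \<bar>deriv a x\<bar> \<le> K * sqrt (a x)"
  shows "\<exists>lam0>0. \<forall>lam>lam0. \<exists>s0>0. \<exists>C>0. \<forall>s\<ge>s0.
    \<forall>m m_t am_x am_xx m_x G m0 mT.
      m \<in> H1_time_L2a a T \<inter> L2_time T (H2a a) (norm_2a a) \<and>
      has_time_deriv a T m m_t \<and>
      has_space_deriv T (\<lambda>(x, t). a x * m (x, t)) am_x \<and>
      has_space_deriv T am_x am_xx \<and>
      has_space_deriv T m m_x \<and>
      has_time_trace a T m 0 m0 \<and>
      has_time_trace a T m T mT \<and>
      (AE (x, t) in lebesgue_on (Q T).
         m_t (x, t) - am_xx (x, t) + b (x, t) * m_x (x, t) = G (x, t)) \<and>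
      (AE t in lebesgue_on {0<..<T}. zero_at_ends (\<lambda>x. a x * m (x, t)))
      \<longrightarrow>
      (let \<phi> = (\<lambda>t. exp (lam * t)) in
        (LINT (x, t)|lebesgue_on (Q T).
           1 / (s * \<phi> t) * (a x * (am_xx (x, t))\<^sup>2 + a x * (m_t (x, t))\<^sup>2) * exp (2 * s * \<phi> t))
        + (LINT (x, t)|lebesgue_on (Q T). lam * (am_x (x, t))\<^sup>2 * exp (2 * s * \<phi> t))
        + (LINT (x, t)|lebesgue_on (Q T). s * lam\<^sup>2 * \<phi> t * a x * (m (x, t))\<^sup>2 * exp (2 * s * \<phi> t))
        \<le> C * (LINT (x, t)|lebesgue_on (Q T). a x * (G (x, t))\<^sup>2 * exp (2 * s * \<phi> t))
          + C * s * lam * (\<phi> T * (norm_a a mT)\<^sup>2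
                           + (norm_L2 (wderiv (\<lambda>x. a x * mT x)))\<^sup>2) * exp (2 * s * \<phi> T)
          + C * (s * lam * (norm_a a m0)\<^sup>2
                 + (norm_L2 (wderiv (\<lambda>x. a x * m0 x)))\<^sup>2) * exp (2 * s))"
  \<comment> \<open>The witnesses are \<lambda>_0 = 32 K^2 + 1, s_0 = 1 and C = 100; s_0 and C are
    the same for every \<lambda>.\<close>
  by (rule exI[of _ "32 * K^2 + 1"], rule conjI, simp add: add_nonneg_pos, intro allI impI,
      rule exI[of _ 1], rule conjI, simp, rule exI[of _ 100], rule conjI, simp,
      intro allI impI, elim conjE IntE, unfold Let_def,
      rule carleman_estimate[OF T a_cont a_C1 a_pos b_Linfty b_bound a_deriv_bound]; assumption)

end
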